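(* Let $A$ be a complex abelian variety such that $\operatorname{Aut}_0(A)$ is finite. Let $A_1,\dots,A_h$ be the (uniquely determined, pairwise non-isogenous) simple abelian subvarieties of $A$ such that the sum map $\sigma : A_1\times\cdots\times A_h\to A$, $\sigma(a_1,\dots,a_h)=a_1+\cdots+a_h$, is an isogeny, and let $N$ be the order of $\ker\sigma$. Let $p\geq 7$ be a prime number such that for every $i=1,\dots,h$, every subgroup $H$ of $A_i$ contained in $A[N]$, and every nontrivial $\varphi\in\operatorname{Aut}_0(A_i/H)$, $p$ is larger than the order of $(A_i/H)^\varphi=\{x\in A_i/H : \varphi(x)=x\}$. Let $S$ be a smooth hypersurface of degree $p$ in $\mathbb{P}^3_{\mathbb{C}}$ such that $G:=\operatorname{Aut}(S)$ is isomorphic to $\mathbb{Z}/p\mathbb{Z}$ and every nontrivial element of $G$ acts on $S$ without fixed points. Fix an isomorphism $\chi : G\to\mathbb{Z}/p\mathbb{Z}$ and a $p$-torsion point $P$ of $A$ which is not contained in any proper abelian subvariety of $A$. Let $Y=(S\times A)/G$, where $G$ acts on $S\times A$ by $g\cdot(s,a)=(g\cdot s,\ a+\chi(g)P)$. Then the automorphism group of $Y$ is isomorphic to $A$.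
   Context: All varieties are over $\mathbb{C}$. For a projective variety $Z$, $\operatorname{Aut}(Z)$ is the group of automorphisms of $Z$ as an algebraic variety; for an abelian variety $B$, $\operatorname{Aut}_0(B)$ is the group of automorphisms of $B$ as an algebraic group, and $B[N]$ is the subgroup of $N$-torsion points of $B$. The notation $\chi(g)P$ means $nP$ for any integer $n$ whose class modulo $p$ is $\chi(g)$ (well defined since $pP=0$). The quotient $Y$ is a smooth projective variety. *)

theory Defs
  imports
    "HOL-Library.Poly_Mapping"
    "HOL-Computational_Algebra.Primes"
    "HOL-Analysis.Function_Topology"
    "HOL-Algebra.Bij"
    "HOL-Algebra.FiniteProduct"
    "HOL-Algebra.Product_Groups"
    "HOL-Algebra.Group_Action"
begin

text \<open>
  Varieties over the complex numbers are treated classically, as spaces with functions (Kempf,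
  \<^emph>\<open>Algebraic Varieties\<close>): a set of closed points with its Zariski topology and, for every open
  set, the complex-valued regular functions on it. Functions in HOL are total; membership in
  \<open>regular X U\<close> depends only on the values on \<open>U\<close>, and \<open>regular X U\<close> is meaningful
  only for open \<open>U\<close>.
\<close>

record 'a fspace =
  zariski :: "'a topology"
  regular :: "'a set \<Rightarrow> ('a \<Rightarrow> complex) set"

abbreviation points :: "'a fspace \<Rightarrow> 'a set"
  where "points X \<equiv> topspace (zariski X)"

definition fspace :: "'a fspace \<Rightarrow> bool" where
  "fspace X \<longleftrightarrow>
    (\<forall>U f g. openin (zariski X) U \<longrightarrow> f \<in> regular X U \<longrightarrow> (\<forall>x\<in>U. g x = f x) \<longrightarrow> g \<in> regular X U) \<and>
    (\<forall>U V f. openin (zariski X) U \<longrightarrow> openin (zariski X) V \<longrightarrow> V \<subseteq> U \<longrightarrow>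
        f \<in> regular X U \<longrightarrow> f \<in> regular X V) \<and>
    (\<forall>\<U> f. (\<forall>U\<in>\<U>. openin (zariski X) U \<and> f \<in> regular X U) \<longrightarrow> f \<in> regular X (\<Union>\<U>)) \<and>
    (\<forall>U c. openin (zariski X) U \<longrightarrow> (\<lambda>_. c) \<in> regular X U) \<and>
    (\<forall>U f g. openin (zariski X) U \<longrightarrow> f \<in> regular X U \<longrightarrow> g \<in> regular X U \<longrightarrow>
        (\<lambda>x. f x + g x) \<in> regular X U \<and> (\<lambda>x. f x * g x) \<in> regular X U) \<and>
    (\<forall>U f. openin (zariski X) U \<longrightarrow> f \<in> regular X U \<longrightarrow>
        openin (zariski X) {x\<in>U. f x \<noteq> 0} \<and> (\<lambda>x. 1 / f x) \<in> regular X {x\<in>U. f x \<noteq> 0})"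

definition morphism :: "'a fspace \<Rightarrow> 'b fspace \<Rightarrow> ('a \<Rightarrow> 'b) \<Rightarrow> bool" where
  "morphism X Y f \<longleftrightarrow>
    continuous_map (zariski X) (zariski Y) f \<and>
    (\<forall>V g. openin (zariski Y) V \<longrightarrow> g \<in> regular Y V \<longrightarrow> g \<circ> f \<in> regular X {x \<in> points X. f x \<in> V})"

definition isomorphism :: "'a fspace \<Rightarrow> 'b fspace \<Rightarrow> ('a \<Rightarrow> 'b) \<Rightarrow> bool" where
  "isomorphism X Y f \<longleftrightarrow>
    bij_betw f (points X) (points Y) \<and> morphism X Y f \<and> morphism Y X (inv_into (points X) f)"

definition Aut :: "'a fspace \<Rightarrow> ('a \<Rightarrow> 'a) monoid" where
  "Aut X = BijGroup (points X)\<lparr>carrier := {f \<in> Bij (points X). isomorphism X X f}\<rparr>"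

definition subspace_of :: "'a fspace \<Rightarrow> 'a set \<Rightarrow> 'a fspace" where
  "subspace_of X Z =
    \<lparr>zariski = subtopology (zariski X) Z,
     regular = (\<lambda>U. {f. \<forall>x\<in>U. \<exists>W g. openin (zariski X) W \<and> x \<in> W \<and> g \<in> regular X W \<and>
                          (\<forall>y\<in>U \<inter> W. f y = g y)})\<rparr>"

text \<open>
  The quotient by a partition \<open>Q\<close> of the points: \<open>V \<subseteq> Q\<close> is open iff its preimage \<open>\<Union>V\<close> is
  (these sets already form a topology), and regular functions are those with regular pullback.
\<close>

definition quotient_fspace :: "'a fspace \<Rightarrow> 'a set set \<Rightarrow> 'a set fspace" where
  "quotient_fspace X Q =
    \<lparr>zariski = topology_generated_by {V. V \<subseteq> Q \<and> openin (zariski X) (\<Union>V)},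
     regular = (\<lambda>V. {f. \<exists>g\<in>regular X (\<Union>V). \<forall>B\<in>V. \<forall>x\<in>B. g x = f B})\<rparr>"

text \<open>
  The space with functions generated by pairs \<open>(W, h)\<close> of a domain and a function on it: the sets
  \<open>{x \<in> W. h x \<noteq> 0}\<close> form a basis of the topology (for the families used below), and regular functions are locally quotients of
  functions with common domain.
\<close>

definition generated_fspace :: "('a set \<times> ('a \<Rightarrow> complex)) set \<Rightarrow> 'a fspace" where
  "generated_fspace \<F> =
    \<lparr>zariski = topology_generated_by {{x\<in>W. h x \<noteq> 0} | W h. (W, h) \<in> \<F>},
     regular = (\<lambda>U. {f. \<forall>x\<in>U. \<exists>W a b. (W, a) \<in> \<F> \<and> (W, b) \<in> \<F> \<and> x \<in> W \<and> b x \<noteq> 0 \<and>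
                          (\<forall>y\<in>U \<inter> W. b y \<noteq> 0 \<longrightarrow> f y = a y / b y)})\<rparr>"

text \<open>
  Products in the category of spaces with functions, hence of varieties: the generators on
  \<open>U \<times> V\<close> are the elements of the image of the tensor product of the rings of regular functions.
  The topology is in general finer than the product topology.
\<close>

definition prod_fspace :: "'a fspace \<Rightarrow> 'b fspace \<Rightarrow> ('a \<times> 'b) fspace" (infixr "\<times>\<^sub>v" 80) where
  "X \<times>\<^sub>v Y = generated_fspace
    {(U \<times> V, \<lambda>(x, y). \<Sum>k<m. a k x * b k y) | U V m a b.
       openin (zariski X) U \<and> openin (zariski Y) V \<and>
       (\<forall>k<(m::nat). a k \<in> regular X U \<and> b k \<in> regular Y V)}"

definition Prod_fspace :: "'i set \<Rightarrow> ('i \<Rightarrow> 'a fspace) \<Rightarrow> ('i \<Rightarrow> 'a) fspace" where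
  "Prod_fspace I X = generated_fspace
    {(Pi\<^sub>E I U, \<lambda>x. \<Sum>k<m. \<Prod>i\<in>I. g k i (x i)) | U m g.
       \<forall>i\<in>I. openin (zariski (X i)) (U i) \<and> (\<forall>k<(m::nat). g k i \<in> regular (X i) (U i))}"


text \<open>
  Polynomials in the variables \<open>x\<^sub>0, x\<^sub>1, \<dots>\<close>: finitely supported functions on monomials, a monomial
  being its finitely supported exponent function.
\<close>

type_synonym cpoly = "(nat \<Rightarrow>\<^sub>0 nat) \<Rightarrow>\<^sub>0 complex"

definition eval_poly :: "cpoly \<Rightarrow> (nat \<Rightarrow> complex) \<Rightarrow> complex" where
  "eval_poly F v = (\<Sum>m\<in>Poly_Mapping.keys F. Poly_Mapping.lookup F m *
     (\<Prod>j\<in>Poly_Mapping.keys m. v j ^ Poly_Mapping.lookup m j))"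

text \<open>The value at \<open>v\<close> of the formal partial derivative of \<open>F\<close> with respect to \<open>x\<^sub>i\<close>.\<close>

definition eval_partial :: "nat \<Rightarrow> cpoly \<Rightarrow> (nat \<Rightarrow> complex) \<Rightarrow> complex" where
  "eval_partial i F v = (\<Sum>m\<in>Poly_Mapping.keys F. Poly_Mapping.lookup F m *
     of_nat (Poly_Mapping.lookup m i) *
     (\<Prod>j\<in>Poly_Mapping.keys m. v j ^ (Poly_Mapping.lookup m j - (if j = i then 1 else 0))))"

text \<open>Forms of degree \<open>d\<close> in \<open>x\<^sub>0, \<dots>, x\<^sub>n\<close>; the zero polynomial is a form of every degree.\<close>

definition form :: "nat \<Rightarrow> nat \<Rightarrow> cpoly \<Rightarrow> bool" where
  "form n d F \<longleftrightarrow> (\<forall>m\<in>Poly_Mapping.keys F.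
     Poly_Mapping.keys m \<subseteq> {..n} \<and> (\<Sum>j\<in>Poly_Mapping.keys m. Poly_Mapping.lookup m j) = d)"

definition affine_space :: "nat \<Rightarrow> (nat \<Rightarrow> complex) fspace" where
  "affine_space n = generated_fspace {({v. \<forall>i\<ge>n. v i = 0}, eval_poly F) | F. True}"

text \<open>
  A point of projective \<open>n\<close>-space is the set of all its homogeneous coordinate vectors, that is, a
  punctured line in the space of vectors supported on \<open>{..n}\<close>.
\<close>

definition homog_coords :: "nat \<Rightarrow> (nat \<Rightarrow> complex) set" where
  "homog_coords n = {v. v \<noteq> (\<lambda>_. 0) \<and> (\<forall>i>n. v i = 0)}"

definition proj_point :: "(nat \<Rightarrow> complex) \<Rightarrow> (nat \<Rightarrow> complex) set" where
  "proj_point v = {(\<lambda>i. c * v i) | c. c \<noteq> 0}"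

definition projective_space :: "nat \<Rightarrow> (nat \<Rightarrow> complex) set fspace" where
  "projective_space n =
    \<lparr>zariski = topology_generated_by
       {{proj_point v | v. v \<in> homog_coords n \<and> eval_poly F v \<noteq> 0} | F. \<exists>d. form n d F},
     regular = (\<lambda>U. {f. \<forall>x\<in>U. \<exists>d F G. form n d F \<and> form n d G \<and> (\<forall>v\<in>x. eval_poly G v \<noteq> 0) \<and>
       (\<forall>y\<in>U. \<forall>v\<in>y. eval_poly G v \<noteq> 0 \<longrightarrow> f y = eval_poly F v / eval_poly G v)})\<rparr>"

definition irreducible_topology :: "'a topology \<Rightarrow> bool" where
  "irreducible_topology T \<longleftrightarrow> topspace T \<noteq> {} \<and>
    (\<forall>C D. closedin T C \<longrightarrow> closedin T D \<longrightarrow> C \<union> D = topspace T \<longrightarrow> C = topspace T \<or> D = topspace T)"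

definition projective_variety :: "'a fspace \<Rightarrow> bool" where
  "projective_variety X \<longleftrightarrow> fspace X \<and> irreducible_topology (zariski X) \<and>
    (\<exists>n Z f. closedin (zariski (projective_space n)) Z \<and>
             isomorphism X (subspace_of (projective_space n) Z) f)"

text \<open>
  The hypersurface is the zero locus of a form of degree \<open>d\<close> whose partial derivatives have no
  common zero on it. In particular \<open>F\<close> is nonzero and squarefree, so \<open>d\<close> is the degree of the
  hypersurface.
\<close>

definition smooth_hypersurface :: "nat \<Rightarrow> nat \<Rightarrow> (nat \<Rightarrow> complex) set set \<Rightarrow> bool" where
  "smooth_hypersurface n d S \<longleftrightarrow> (\<exists>F. form n d F \<and>
     S = {proj_point v | v. v \<in> homog_coords n \<and> eval_poly F v = 0} \<and>
     (\<forall>v\<in>homog_coords n. eval_poly F v = 0 \<longrightarrow> (\<exists>i\<le>n. eval_partial i F v \<noteq> 0)))"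


text \<open>Abelian varieties are written multiplicatively, following HOL-Algebra.\<close>

record 'a group_variety = "'a monoid" +
  variety :: "'a fspace"

definition abelian_variety :: "'a group_variety \<Rightarrow> bool" where
  "abelian_variety A \<longleftrightarrow> group A \<and> projective_variety (variety A) \<and> carrier A = points (variety A) \<and>
    morphism (variety A \<times>\<^sub>v variety A) (variety A) (\<lambda>(x, y). x \<otimes>\<^bsub>A\<^esub> y) \<and>
    morphism (variety A) (variety A) (\<lambda>x. inv\<^bsub>A\<^esub> x)"

definition sub_gv :: "'a group_variety \<Rightarrow> 'a set \<Rightarrow> 'a group_variety" where
  "sub_gv A B = A\<lparr>carrier := B, variety := subspace_of (variety A) B\<rparr>"

definition quotient_gv :: "'a group_variety \<Rightarrow> 'a set \<Rightarrow> 'a set group_variety" where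
  "quotient_gv A H =
    monoid.extend (A Mod H) \<lparr>variety = quotient_fspace (variety A) (rcosets\<^bsub>A\<^esub> H)\<rparr>"

definition product_gv :: "'i set \<Rightarrow> ('i \<Rightarrow> 'a group_variety) \<Rightarrow> ('i \<Rightarrow> 'a) group_variety" where
  "product_gv I B =
    monoid.extend (product_group I B) \<lparr>variety = Prod_fspace I (\<lambda>i. variety (B i))\<rparr>"

definition abelian_subvariety :: "'a set \<Rightarrow> 'a group_variety \<Rightarrow> bool" where
  "abelian_subvariety B A \<longleftrightarrow>
    subgroup B A \<and> closedin (zariski (variety A)) B \<and> abelian_variety (sub_gv A B)"

definition simple_abelian_variety :: "'a group_variety \<Rightarrow> bool" where
  "simple_abelian_variety A \<longleftrightarrow> abelian_variety A \<and> carrier A \<noteq> {\<one>\<^bsub>A\<^esub>} \<and>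
    (\<forall>B. abelian_subvariety B A \<longrightarrow> B = {\<one>\<^bsub>A\<^esub>} \<or> B = carrier A)"

definition isogeny :: "'a group_variety \<Rightarrow> 'b group_variety \<Rightarrow> ('a \<Rightarrow> 'b) \<Rightarrow> bool" where
  "isogeny A B f \<longleftrightarrow> f \<in> hom A B \<and> morphism (variety A) (variety B) f \<and>
    f ` carrier A = carrier B \<and> finite (kernel A B f)"

definition torsion_points :: "'a group_variety \<Rightarrow> nat \<Rightarrow> 'a set" where
  "torsion_points A n = {x \<in> carrier A. x [^]\<^bsub>A\<^esub> n = \<one>\<^bsub>A\<^esub>}"

definition Aut0 :: "'a group_variety \<Rightarrow> ('a \<Rightarrow> 'a) set" where
  "Aut0 A = auto A \<inter> carrier (Aut (variety A))"

text \<open>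
  \<open>Aut Y\<close> is isomorphic to \<open>A\<close> not just as an abstract group (which would determine little more
  than the dimension of \<open>A\<close>) but as an algebraic group: there is an isomorphism \<open>\<Phi>\<close> of groups that
  identifies \<open>A\<close> with the automorphism functor of \<open>Y\<close>. So the action of \<open>A\<close> on \<open>Y\<close> through \<open>\<Phi>\<close>
  is a morphism, and every algebraic family of automorphisms of \<open>Y\<close>, i.e. every automorphism \<open>\<Psi>\<close> of
  \<open>T \<times> Y\<close> over an affine algebraic set \<open>T\<close>, corresponds under \<open>\<Phi>\<close> to a morphism from \<open>T\<close> to \<open>A\<close>.
  Reduced bases \<open>T\<close> suffice because group schemes over the complex numbers are reduced.
\<close>

definition Aut_isomorphic_to :: "'b fspace \<Rightarrow> 'a group_variety \<Rightarrow> bool" where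
  "Aut_isomorphic_to Y A \<longleftrightarrow> (\<exists>\<Phi> \<in> iso A (Aut Y).
     morphism (variety A \<times>\<^sub>v Y) Y (\<lambda>(a, y). \<Phi> a y) \<and>
     (\<forall>n Z T \<Psi>. closedin (zariski (affine_space n)) Z \<longrightarrow> T = subspace_of (affine_space n) Z \<longrightarrow>
        \<Psi> \<in> carrier (Aut (T \<times>\<^sub>v Y)) \<longrightarrow> (\<forall>t\<in>Z. \<forall>y\<in>points Y. fst (\<Psi> (t, y)) = t) \<longrightarrow>
        morphism T (variety A)
          (\<lambda>t. inv_into (carrier A) \<Phi> (\<lambda>y\<in>points Y. snd (\<Psi> (t, y))))))"

end

theory Submission
  imports Defs "HOL-Computational_Algebra.Computational_Algebra" "HOL-Computational_Algebra.Field_as_Ring" "HOL-Analysis.Analysis"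
begin

text \<open>
 Let \<open>f\<close> be an automorphism of \<open>Y\<close>, and \<open>a\<close> a point of \<open>A\<close>. The \<open>A\<close>-component of \<open>f[s, a]\<close> is defined up to multiples of
 \<open>P\<close>, so its \<open>p\<close>-fold is a morphism from \<open>S\<close> to \<open>A\<close>. It is constant, as \<open>S\<close> has no \<open>1\<close>-forms: these would be given by
 syzygies between the partial derivatives of the equation, in degrees where the Koszul complex has none. Torsion being
 discrete, \<open>f\<close> carries the image of \<open>S \<times> {a}\<close> onto that of some \<open>S \<times> {b}\<close>, by an element of \<open>Aut S = G\<close>. Hence
 \<open>f[s, a] = [s, \<tau> a]\<close> where \<open>\<tau> (a + P) = \<tau> a + P\<close>, and by rigidity \<open>\<tau>\<close> is a translation after an automorphism \<open>\<phi>\<close> of the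
 group \<open>A\<close> that fixes \<open>P\<close>. Its order \<open>m\<close> is finite and prime to \<open>p\<close>, since for \<open>\<psi>\<close> of order \<open>p\<close> the endomorphism
 \<open>\<psi>\<^sup>2 - \<psi> + 1\<close> would be a unit of infinite order. So \<open>P\<close> lies in the image of \<open>1 + \<phi> + \<dots> + \<phi>\<^sup>m\<^sup>-\<^sup>1\<close>, an abelian subvariety
 on which \<open>\<phi>\<close> is trivial, and \<open>\<phi> = 1\<close>. A family of automorphisms gives a morphism to \<open>A\<close> because functions on \<open>S \<times> A\<close>
 descend to \<open>Y\<close> after averaging against a function that separates the points of the \<open>G\<close>-orbits.
\<close>

text \<open>Two obstacles shape the proof. Coordinates on an abelian variety are only local, so
  differentials are handled on the affine cone over \<open>S\<close>: near the diagonal the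
  coordinates of c(x) / c(y) are quotients of forms, their gradients at x = y count modulo the
  gradient of the equation, and a vanishing differential becomes local constancy through an
  algebraic relation of least degree. The minors have degree p - 2 and the quotients p - 3, both
  below the degree p - 1 of the partial derivatives. In the endomorphism ring, identities need only
  hold up to a nonzero integer factor, because torsion points are isolated. The bound p >= 7 enters
  as: p is prime to 6. Then 3k = 1 + lp with k odd, which inverts \<psi>^2 - \<psi> + 1; and at a
  p-th root of unity z other than 1 this expression has absolute value |2 Re z - 1|, which is not 1,
  so none of its powers is the identity unless \<psi> is.\<close>

abbreviation "lk == Poly_Mapping.lookup"
abbreviation "keys == Poly_Mapping.keys"
abbreviation "sg == Poly_Mapping.single"
abbreviation "ev == eval_poly"
abbreviation "opn X == openin (zariski X)"
abbreviation "cls X == closedin (zariski X)"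

section \<open>Monomials and evaluation of polynomials\<close>

definition mon :: "(nat \<Rightarrow>\<^sub>0 nat) => (nat => complex) => complex" where
 "mon m v = (PROD j:keys m. v j ^ lk m j)"

definition mdeg :: "(nat \<Rightarrow>\<^sub>0 nat) => nat" where
 "mdeg m = (SUM j:keys m. lk m j)"

definition const_poly :: "complex => cpoly" where
 "const_poly c = sg 0 c"

definition Xv :: "nat => cpoly" where
 "Xv i = sg (sg i 1) 1"

lemma mon_superset:
 "finite J ==> keys m <= J ==> mon m v = (PROD j:J. v j ^ lk m j)"
 unfolding mon_def by (rule prod.mono_neutral_left) (auto simp: in_keys_iff)

lemma mon_add: "mon (m + m') v = mon m v * mon m' v"
proof -
 let ?J = "keys m Un keys m'"
 have "mon (m + m') v = (PROD j:?J. v j ^ lk (m + m') j)"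
  by (rule mon_superset) (auto simp: Poly_Mapping.keys_add)
 also have "... = mon m v * mon m' v"
  by (subst (1 2) mon_superset[where J = ?J])
   (auto simp: lookup_add power_add prod.distrib)
 finally show ?thesis .
qed

lemma mon_0 [simp]: "mon 0 v = 1"
 by (simp add: mon_def)

lemma mon_single [simp]: "mon (sg i k) v = v i ^ k"
 by (cases "k = 0") (auto simp: mon_def)

lemma mon_mult: "mon m (%i. v i * w i) = mon m v * mon m w"
 by (simp add: mon_def power_mult_distrib prod.distrib)

lemma mon_scale: "mon m (%i. c * v i) = c ^ mdeg m * mon m v"
 by (simp add: mon_def mdeg_def power_mult_distrib prod.distrib power_sum)

lemma mdeg_superset:
 "finite J ==> keys m <= J ==> mdeg m = (SUM j:J. lk m j)"
 unfolding mdeg_def by (rule sum.mono_neutral_left) (auto simp: in_keys_iff)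

lemma mdeg_add: "mdeg (m + m') = mdeg m + mdeg m'"
proof -
 let ?J = "keys m Un keys m'"
 have "mdeg (m + m') = (SUM j:?J. lk (m + m') j)"
  by (rule mdeg_superset) (auto simp: Poly_Mapping.keys_add)
 also have "... = mdeg m + mdeg m'"
  by (subst (1 2) mdeg_superset[where J = ?J]) (auto simp: lookup_add sum.distrib)
 finally show ?thesis .
qed

lemma mdeg_0 [simp]: "mdeg 0 = 0"
 by (simp add: mdeg_def)

lemma mdeg_single [simp]: "mdeg (sg i k) = k"
 by (cases "k = 0") (auto simp: mdeg_def)

lemma lookup_le_mdeg: "lk m j <= mdeg m"
 by (cases "j : keys m")
   (auto simp: mdeg_def in_keys_iff intro: member_le_sum)

lemma keys_add_nat:
 fixes m m' :: "nat \<Rightarrow>\<^sub>0 nat"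
 shows "keys (m + m') = keys m Un keys m'"
 by (auto simp: in_keys_iff lookup_add)

lemma poly_sum_monomials:
 fixes F :: cpoly
 shows "F = (SUM m:keys F. sg m (lk F m))"
proof (rule poly_mapping_eqI)
 fix k
 show "lk F k =
  lk (SUM m:keys F. sg m (lk F m)) k"
  by (auto simp: lookup_sum lookup_single when_def sum.delta in_keys_iff)
qed

lemma cpoly_induct [case_names single add]:
 fixes F :: cpoly
 assumes "!!m c. P (sg m c)" "!!F G. P F ==> P G ==> P (F + G)"
 shows "P F"
proof -
 have "finite K ==> P (SUM m:K. sg m (lk F m))" for K
  by (induction K rule: finite_induct) (use assms(1)[of 0 0] assms in auto)
 from this[of "keys F"] show ?thesis
  using poly_sum_monomials[of F] by simp
qed

lemma eval_superset:
 "finite K ==> keys F <= K ==>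
  ev F v = (SUM m:K. lk F m * mon m v)"
 unfolding eval_poly_def mon_def[symmetric]
 by (rule sum.mono_neutral_left) (auto simp: in_keys_iff)

lemma eval_single [simp]: "ev (sg m c) v = c * mon m v"
 by (subst eval_superset[of "{m}"]) auto

lemma eval_add [simp]: "ev (F + G) v = ev F v + ev G v"
 using Poly_Mapping.keys_add[of F G]
 by (subst (1 2 3) eval_superset[of "keys F Un keys G"])
   (auto simp: lookup_add sum.distrib algebra_simps)

lemma eval_0 [simp]: "ev 0 v = 0"
 by (simp add: eval_poly_def)

lemma eval_const [simp]: "ev (const_poly c) v = c"
 by (simp add: const_poly_def)

lemma eval_1 [simp]: "ev 1 v = 1"
 using eval_single[of 0 1 v] by (simp del: eval_single)

lemma eval_X [simp]: "ev (Xv i) v = v i"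
 by (simp add: Xv_def)

lemma eval_mult [simp]: "ev (F * G) v = ev F v * ev G v"
proof (induction F rule: cpoly_induct)
 case (single m c)
 show ?case
  by (induction G rule: cpoly_induct) (auto simp: mult_single mon_add algebra_simps)
qed (auto simp: algebra_simps)

lemma eval_uminus [simp]: "ev (- F) v = - ev F v"
 using eval_add[of F "- F" v] by (simp add: eq_neg_iff_add_eq_0 add.commute del: eval_add)

lemma eval_diff [simp]: "ev (F - G) v = ev F v - ev G v"
 using eval_add[of F "- G" v] by simp

lemma eval_sum [simp]: "ev (sum f A) v = (SUM x:A. ev (f x) v)"
 by (induction A rule: infinite_finite_induct) auto

lemma eval_power [simp]: "ev (F ^ k) v = ev F v ^ k"
 by (induction k) auto

lemma of_nat_const: "(of_nat k :: cpoly) = const_poly (of_nat k)"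
 by (simp add: const_poly_def)

lemma single_sum: "(SUM i:A. sg m (f i)) = sg m (sum f A)"
 by (induction A rule: infinite_finite_induct) (auto simp: single_add)

lemma const_poly_mult_single: "const_poly c * sg m d = sg m (c * d)"
 by (simp add: const_poly_def mult_single)

subsection \<open>Linear independence of monomials\<close>

lemma mon_separates:
 assumes "m ~= m'"
 shows "EX v. mon m v ~= mon m' v"
proof -
 obtain j where j: "lk m j ~= lk m' j"
  using assms poly_mapping_eqI by metis
 let ?v = "%i. if i = j then 2 else (1::complex)"
 have *: "mon k ?v = 2 ^ lk k j" for k
 proof -
  have "mon k ?v = (PROD i:insert j (keys k). ?v i ^ lk k i)"
   by (rule mon_superset) auto
  also have "... = (PROD i:insert j (keys k). if i = j then 2 ^ lk k j else 1)"
   by (rule prod.cong) auto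
  also have "... = 2 ^ lk k j"
   by (subst prod.delta) auto
  finally show ?thesis .
 qed
 have "(2::complex) ^ lk m j ~= 2 ^ lk m' j"
 proof
  assume "(2::complex) ^ lk m j = 2 ^ lk m' j"
  hence "norm ((2::complex) ^ lk m j) = norm ((2::complex) ^ lk m' j)"
   by simp
  hence "(2::real) ^ lk m j = 2 ^ lk m' j"
   by (simp add: norm_power)
  thus False using j by simp
 qed
 with * show ?thesis by metis
qed

text \<open>Dedekind's argument on the independence of characters.\<close>

lemma mon_independent:
 assumes "finite K" "!!v. (SUM m:K. c m * mon m v) = 0" "m : K"
 shows "c m = 0"
 using assms
proof (induction K arbitrary: c m rule: finite_induct)
 case (insert k K)
 have K0: "c m = 0" if m: "m : K" for m
 proof -
  have "m ~= k" using m insert by auto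
  then obtain w where w: "mon m w ~= mon k w" using mon_separates by blast
  have "(SUM m:K. (c m * (mon m w - mon k w)) * mon m v) = 0" for v
  proof -
   have 1: "c k * mon k v + (SUM m:K. c m * mon m v) = 0"
    using insert.prems(1)[of v] insert.hyps by simp
   have 2: "c k * (mon k v * mon k w) + (SUM m:K. c m * (mon m v * mon m w)) = 0"
    using insert.prems(1)[of "%i. v i * w i"] insert.hyps by (simp add: mon_mult)
   have "(SUM m:K. (c m * (mon m w - mon k w)) * mon m v) =
     (SUM m:K. c m * (mon m v * mon m w)) - mon k w * (SUM m:K. c m * mon m v)"
    by (simp add: sum_distrib_left sum_subtractf algebra_simps)
   also have "... = 0"
   proof -
    have "(SUM m:K. c m * mon m v) = - (c k * mon k v)"
     "(SUM m:K. c m * (mon m v * mon m w)) = - (c k * (mon k v * mon k w))"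
     using 1 2 by (metis add.commute eq_neg_iff_add_eq_0)+
    thus ?thesis by simp
   qed
   finally show ?thesis .
  qed
  from insert.IH[OF this m] w show ?thesis by simp
 qed
 have "c k * mon k (%_. 1) = 0"
  using insert.prems(1)[of "%_. 1"] insert.hyps K0 by simp
 hence "c k = 0" by (simp add: mon_def)
 with K0 insert.prems show ?case by auto
qed auto

lemma eval_eq_0_imp:
 assumes "!!v. ev F v = 0"
 shows "F = 0"
proof (rule poly_mapping_eqI)
 fix k
 have "!!v. (SUM m:keys F. lk F m * mon m v) = 0"
  using assms by (simp add: eval_poly_def mon_def)
 from mon_independent[OF _ this] show "lk F k = lk 0 k"
  by (cases "k : keys F") (auto simp: in_keys_iff)
qed

lemma eval_inject: "(!!v. ev F v = ev G v) ==> F = G"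
 using eval_eq_0_imp[of "F - G"] by simp

subsection \<open>Forms\<close>

lemma form_iff: "form n d F \<longleftrightarrow> (ALL m:keys F. keys m <= {..n} & mdeg m = d)"
 by (simp add: form_def mdeg_def)

lemma form_0 [simp]: "form n d 0"
 by (simp add: form_iff)

lemma form_single: "keys m <= {..n} ==> mdeg m = d ==> form n d (sg m c)"
 by (auto simp: form_iff split: if_splits)

lemma form_const [simp]: "form n 0 (const_poly c)"
 by (simp add: const_poly_def form_single)

lemma form_1 [simp]: "form n 0 1"
 using form_const[of n 1] by (simp add: const_poly_def)

lemma form_X: "i <= n ==> form n 1 (Xv i)"
 by (simp add: Xv_def form_single)

lemma form_add: "form n d F ==> form n d G ==> form n d (F + G)"
 using Poly_Mapping.keys_add[of F G] by (auto simp: form_iff)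

lemma form_uminus: "form n d F ==> form n d (- F)"
 by (auto simp: form_iff in_keys_iff)

lemma form_diff: "form n d F ==> form n d G ==> form n d (F - G)"
 using form_add[of n d F "- G"] form_uminus by simp

lemma form_mult:
 assumes "form n d F" "form n e G"
 shows "form n (d + e) (F * G)"
proof -
 have "EX a:keys F. EX b:keys G. m = a + b" if "m : keys (F * G)" for m
  using keys_mult[of F G] that by blast
 thus ?thesis
  using assms by (fastforce simp: form_iff mdeg_add keys_add_nat)
qed

lemma form_mult': "form n d F ==> form n e G ==> k = d + e ==> form n k (F * G)"
 using form_mult by simp

lemma form_cmult: "form n d F ==> form n d (const_poly c * F)"
 by (rule form_mult'[of n 0]) auto

lemma form_sum: "(!!x. x : A ==> form n d (f x)) ==> form n d (sum f A)"
 by (induction A rule: infinite_finite_induct) (auto intro: form_add)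

lemma form_power: "form n d F ==> form n (k * d) (F ^ k)"
 by (induction k) (auto intro: form_mult)

lemma form_scale:
 assumes "form n d F"
 shows "ev F (%i. c * v i) = c ^ d * ev F v"
proof -
 have "ev F (%i. c * v i) = (SUM m:keys F. lk F m * (c ^ mdeg m * mon m v))"
  by (simp add: eval_poly_def flip: mon_scale mon_def)
 also have "... = (SUM m:keys F. lk F m * (c ^ d * mon m v))"
  using assms by (intro sum.cong) (auto simp: form_iff)
 also have "... = c ^ d * ev F v"
  by (simp add: eval_poly_def sum_distrib_left mon_def algebra_simps)
 finally show ?thesis .
qed

lemma form_eval_cong:
 assumes "form n d F" "!!i. i <= n ==> v i = w i"
 shows "ev F v = ev F w"
proof -
 have "mon m v = mon m w" if "m : keys F" for m
  unfolding mon_def using assms that by (intro prod.cong) (force simp: form_iff)+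
 thus ?thesis
  by (simp add: eval_poly_def flip: mon_def)
qed

subsection \<open>Selecting monomials\<close>

definition select :: "((nat \<Rightarrow>\<^sub>0 nat) => bool) => cpoly => cpoly" where
 "select P F = (SUM m:{m:keys F. P m}. sg m (lk F m))"

lemma lookup_select: "lk (select P F) m = (if P m then lk F m else 0)"
 by (auto simp: select_def lookup_sum lookup_single when_def sum.delta in_keys_iff)

lemma keys_select: "keys (select P F) = {m:keys F. P m}"
 by (auto simp: in_keys_iff lookup_select split: if_splits)

lemma select_add: "select P (F + G) = select P F + select P G"
 by (rule poly_mapping_eqI) (simp add: lookup_select lookup_add)

lemma select_0 [simp]: "select P 0 = 0"
 by (simp add: select_def)

lemma select_single: "select P (sg m c) = (if P m then sg m c else 0)"
 by (rule poly_mapping_eqI) (simp add: lookup_select lookup_single when_def)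

lemma select_id: "(!!m. m : keys F ==> P m) ==> select P F = F"
 by (rule poly_mapping_eqI) (auto simp: lookup_select in_keys_iff)

text \<open>Multiplying by a monomial of \<open>F\<close> shifts exponents, and the hypothesis says
  that \<open>P'\<close> after the shift is \<open>P\<close> before it. This is how homogeneous
  components are compared on both sides of a product.\<close>

lemma select_mult:
 assumes "!!m m'. m : keys F ==> P' (m + m') \<longleftrightarrow> P m'"
 shows "select P' (F * Q) = F * select P Q"
proof -
 have *: "select P' (sg m c * Q) = sg m c * select P Q"
  if "!!m'. P' (m + m') \<longleftrightarrow> P m'" for m c
  by (induction Q rule: cpoly_induct)
    (auto simp: select_single mult_single that select_add distrib_left)
 have "select P' ((SUM m:K. sg m (lk F m)) * Q) =
   (SUM m:K. sg m (lk F m)) * select P Q"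
  if "finite K" "K <= keys F" for K
  using that by (induction K rule: finite_induct)
   (auto simp: distrib_right select_add * assms)
 from this[of "keys F"] show ?thesis
  using poly_sum_monomials[of F] by simp
qed

lemma form_select: "form n d (select (%m. mdeg m = d & keys m <= {..n}) F)"
 by (auto simp: form_iff keys_select)

lemma form_select_id: "form n d F ==> select (%m. mdeg m = d & keys m <= {..n}) F = F"
 by (rule select_id) (auto simp: form_iff)

text \<open>The cofactor \<open>Q\<close> may have stray degrees and variables; selecting its
  component of degree \<open>e - d\<close> in the admissible variables changes nothing in the
  product. The last clause covers the case where the difference is truncated.\<close>

lemma form_divide:
 assumes "form n d F" "form n e G" "G = F * Q"
 shows "EX Q'. G = F * Q' & form n (e - d) Q' & (e < d --> Q' = 0)"
proof (cases "e < d")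
 case True
 let ?P' = "%m. mdeg m = e & keys m <= {..n}"
 have "select ?P' (F * Q) = F * select (%_. False) Q"
  using assms(1) True by (intro select_mult) (auto simp: form_iff mdeg_add)
 hence "G = F * select (%_. False) Q"
  using form_select_id[OF assms(2)] unfolding assms(3) by metis
 also have "select (%_. False) Q = 0" by (simp add: select_def)
 finally show ?thesis by (intro exI[of _ 0]) auto
next
 case False
 let ?P' = "%m. mdeg m = e & keys m <= {..n}"
 let ?P = "%m. mdeg m = e - d & keys m <= {..n}"
 have "select ?P' (F * Q) = F * select ?P Q"
  using assms(1) False by (intro select_mult) (auto simp: form_iff mdeg_add keys_add_nat)
 hence "G = F * select ?P Q"
  using form_select_id[OF assms(2)] unfolding assms(3) by metis
 thus ?thesis using form_select False by blast
qed

subsection \<open>Partial derivatives\<close>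

text \<open>The truncated exponent is harmless: where \<open>m - sg i 1\<close> does not lower the
  degree, the coefficient has the factor 0.\<close>

definition pd :: "nat => cpoly => cpoly" where
 "pd i F = (SUM m:keys F.
   sg (m - sg i 1) (lk F m * of_nat (lk m i)))"

lemma pd_superset:
 "finite K ==> keys F <= K ==> pd i F = (SUM m:K.
   sg (m - sg i 1) (lk F m * of_nat (lk m i)))"
 unfolding pd_def by (rule sum.mono_neutral_left) (auto simp: in_keys_iff)

lemma pd_single: "pd i (sg m c) =
  sg (m - sg i 1) (c * of_nat (lk m i))"
 by (subst pd_superset[of "{m}"]) auto

lemma pd_add: "pd i (F + G) = pd i F + pd i G"
 using Poly_Mapping.keys_add[of F G]
 by (subst (1 2 3) pd_superset[of "keys F Un keys G"])
   (auto simp: lookup_add sum.distrib algebra_simps single_add)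

lemma pd_0 [simp]: "pd i 0 = 0"
 by (simp add: pd_def)

lemma pd_uminus: "pd i (- F) = - pd i F"
 using pd_add[of i F "- F"] by (simp add: eq_neg_iff_add_eq_0 add.commute)

lemma pd_diff: "pd i (F - G) = pd i F - pd i G"
 using pd_add[of i F "- G"] by (simp add: pd_uminus)

lemma pd_sum: "pd i (sum f A) = (SUM x:A. pd i (f x))"
 by (induction A rule: infinite_finite_induct) (auto simp: pd_add)

lemma pd_mult: "pd i (F * G) = pd i F * G + F * pd i G"
proof (induction F rule: cpoly_induct)
 case (single m c)
 show ?case
 proof (induction G rule: cpoly_induct)
  case (single m' c')
  have 1: "sg (m + m' - sg i 1) (x * of_nat (lk m i)) =
    sg (m - sg i 1 + m') (x * of_nat (lk m i))" for x :: complex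
  proof (cases "lk m i = 0")
   case False
   have "m + m' - sg i 1 = m - sg i 1 + m'"
    using False by (intro poly_mapping_eqI) (auto simp: lookup_add lookup_minus lookup_single when_def)
   thus ?thesis by simp
  qed auto
  have 2: "sg (m + m' - sg i 1) (x * of_nat (lk m' i)) =
    sg (m + (m' - sg i 1)) (x * of_nat (lk m' i))" for x :: complex
  proof (cases "lk m' i = 0")
   case False
   have "m + m' - sg i 1 = m + (m' - sg i 1)"
    using False by (intro poly_mapping_eqI) (auto simp: lookup_add lookup_minus lookup_single when_def)
   thus ?thesis by simp
  qed auto
  show ?case
   by (simp only: mult_single pd_single lookup_add distrib_left single_add of_nat_add 1 2)
     (simp add: 1[of "c * c'", symmetric] 2[of "c * c'", symmetric] 1 2 mult_ac add_ac)
 qed (auto simp: pd_add distrib_left algebra_simps)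
qed (auto simp: pd_add distrib_right algebra_simps)

lemma eval_pd: "ev (pd i F) v = eval_partial i F v"
proof -
 have "c * mon (m - sg i 1) v * of_nat (lk m i) =
   c * of_nat (lk m i) *
   (PROD j:keys m. v j ^ (lk m j - (if j = i then 1 else 0)))" for c m
 proof -
  have "mon (m - sg i 1) v =
    (PROD j:keys m. v j ^ (lk m j - (if j = i then 1 else 0)))"
   by (subst mon_superset[of "keys m"])
     (auto simp: in_keys_iff lookup_minus lookup_single when_def intro!: prod.cong)
  thus ?thesis by simp
 qed
 note * = this
 show ?thesis
  unfolding pd_def eval_partial_def eval_sum eval_single
  by (rule sum.cong[OF refl]) (use * in "simp add: mult_ac")
qed

lemma form_pd:
 assumes "form n d F"
 shows "form n (d - 1) (pd i F)"
 unfolding pd_def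
proof (rule form_sum)
 fix m assume m: "m : keys F"
 show "form n (d - 1) (sg (m - sg i 1)
   (lk F m * of_nat (lk m i)))"
 proof (cases "lk m i = 0")
  case False
  have "m = (m - sg i 1) + sg i 1"
   using False by (intro poly_mapping_eqI) (auto simp: lookup_add lookup_minus lookup_single when_def)
  hence "mdeg m = mdeg (m - sg i 1) + 1"
   by (metis mdeg_add mdeg_single)
  moreover have "keys (m - sg i 1) <= keys m"
   by (auto simp: in_keys_iff lookup_minus)
  ultimately show ?thesis
   using assms m by (intro form_single) (auto simp: form_iff)
 qed auto
qed

lemma euler:
 assumes "form n d F"
 shows "(SUM i<=n. Xv i * pd i F) = of_nat d * F"
proof -
 have *: "(SUM i<=n. Xv i * pd i (sg m c)) = of_nat d * sg m c"
  if "keys m <= {..n}" "mdeg m = d" for m c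
 proof -
  have "Xv i * pd i (sg m c) = sg m (c * of_nat (lk m i))" for i
  proof (cases "lk m i = 0")
   case False
   have "sg i 1 + (m - sg i 1) = m"
    using False by (intro poly_mapping_eqI) (auto simp: lookup_add lookup_minus lookup_single when_def)
   thus ?thesis by (simp add: pd_single Xv_def mult_single)
  qed (auto simp: pd_single)
  hence "(SUM i<=n. Xv i * pd i (sg m c)) =
    sg m (SUM i<=n. c * of_nat (lk m i))"
   by (simp add: single_sum)
  also have "(SUM i<=n. c * of_nat (lk m i)) = c * of_nat (mdeg m)"
   by (simp add: mdeg_superset[OF _ that(1)] sum_distrib_left)
  also have "sg m (c * of_nat (mdeg m)) = of_nat d * sg m c"
   by (simp add: that(2) of_nat_const const_poly_mult_single mult.commute[of c])
  finally show ?thesis .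
 qed
 have "(SUM i<=n. Xv i * pd i (SUM m:K. sg m (lk F m))) =
   of_nat d * (SUM m:K. sg m (lk F m))"
  if "finite K" "K <= keys F" for K
  using that assms by (induction K rule: finite_induct)
   (auto simp: pd_add distrib_left sum.distrib * form_iff)
 from this[of "keys F"] show ?thesis
  using poly_sum_monomials[of F] by simp
qed

lemma euler_eval:
 "form n d F ==> (SUM i<=n. v i * ev (pd i F) v) = of_nat d * ev F v"
 using arg_cong[OF euler, of n d F "%G. ev G v"]
 by (simp add: of_nat_const)

text \<open>Gaussian elimination, one coordinate at a time: a vector with nonzero entry at
  \<open>j\<close> clears that coordinate from all others and then leaves the family.\<close>

lemma linear_dependence:
 fixes w :: "'k => 'j => 'f::field"
 assumes "finite J" "finite K" "card J < card K"
 shows "EX c. (EX k:K. c k ~= 0) & (ALL j:J. (SUM k:K. c k * w k j) = 0)"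
 using assms
proof (induction J arbitrary: K w rule: finite_induct)
 case empty
 hence "K ~= {}" by auto
 thus ?case by (intro exI[of _ "%_. 1"]) auto
next
 case (insert j J)
 show ?case
 proof (cases "ALL k:K. w k j = 0")
  case True
  have "card J < card K" using insert by simp
  then obtain c where "EX k:K. c k ~= 0" "ALL j:J. (SUM k:K. c k * w k j) = 0"
   using insert.IH[OF insert.prems(1), of w] by blast
  with True show ?thesis by (intro exI[of _ c]) auto
 next
  case False
  then obtain k0 where k0: "k0 : K" "w k0 j ~= 0" by auto
  let ?K = "K - {k0}"
  let ?w = "%k i. w k i - w k j / w k0 j * w k0 i"
  have "card J < card ?K" using insert k0 by simp
  then obtain c where c: "EX k:?K. c k ~= 0" "ALL i:J. (SUM k:?K. c k * ?w k i) = 0"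
   using insert.IH[of ?K ?w] insert.prems(1) by blast
  let ?s = "- (SUM k:?K. c k * w k j / w k0 j)"
  let ?c = "%k. if k = k0 then ?s else c k"
  have split: "(SUM k:K. ?c k * w k i) = ?s * w k0 i + (SUM k:?K. c k * w k i)" for i
  proof -
   have "(SUM k:K. ?c k * w k i) = ?c k0 * w k0 i + (SUM k:?K. ?c k * w k i)"
    using insert k0 by (intro sum.remove) auto
   also have "(SUM k:?K. ?c k * w k i) = (SUM k:?K. c k * w k i)"
    by (rule sum.cong) auto
   finally show ?thesis by simp
  qed
  have "(SUM k:K. ?c k * w k i) = 0" if "i : insert j J" for i
  proof (cases "i = j")
   case True
   show ?thesis unfolding split using True k0
    by (simp add: sum_distrib_right)
  next
   case False
   hence "(SUM k:?K. c k * ?w k i) = 0" using c that by auto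
   moreover have "(SUM k:?K. c k * ?w k i) = ?s * w k0 i + (SUM k:?K. c k * w k i)"
    by (simp add: algebra_simps sum_subtractf sum_distrib_left sum_distrib_right)
   ultimately show ?thesis unfolding split by simp
  qed
  moreover have "EX k:K. ?c k ~= 0" using c(1) by auto
  ultimately show ?thesis by (intro exI[of _ ?c]) blast
 qed
qed

subsection \<open>Function algebras and the Nullstellensatz\<close>

definition fun_alg :: "('x => complex) set => bool" where
 "fun_alg \<O> \<longleftrightarrow> (ALL c. (%_. c) : \<O>) &
  (ALL f:\<O>. ALL g:\<O>. (%x. f x + g x) : \<O> & (%x. f x * g x) : \<O>)"

lemma fun_alg_const: "fun_alg \<O> ==> (%_. c) : \<O>"
 and fun_alg_add: "fun_alg \<O> ==> f : \<O> ==> g : \<O> ==> (%x. f x + g x) : \<O>"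
 and fun_alg_mult: "fun_alg \<O> ==> f : \<O> ==> g : \<O> ==> (%x. f x * g x) : \<O>"
 by (auto simp: fun_alg_def)

lemma fun_alg_cmult: "fun_alg \<O> ==> f : \<O> ==> (%x. c * f x) : \<O>"
 using fun_alg_mult[of \<O> "%_. c" f] fun_alg_const by blast

lemma fun_alg_uminus: "fun_alg \<O> ==> f : \<O> ==> (%x. - f x) : \<O>"
 using fun_alg_cmult[of \<O> f "-1"] by simp

lemma fun_alg_diff: "fun_alg \<O> ==> f : \<O> ==> g : \<O> ==> (%x. f x - g x) : \<O>"
 using fun_alg_add[of \<O> f "%x. - g x"] fun_alg_uminus[of \<O> g] by simp

lemma fun_alg_sum: "fun_alg \<O> ==> (!!k. k : K ==> f k : \<O>) ==> (%x. SUM k:K. f k x) : \<O>"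
 by (induction K rule: infinite_finite_induct) (auto intro: fun_alg_const fun_alg_add)

lemma fun_alg_prod: "fun_alg \<O> ==> (!!k. k : K ==> f k : \<O>) ==> (%x. PROD k:K. f k x) : \<O>"
 by (induction K rule: infinite_finite_induct) (auto intro: fun_alg_const fun_alg_mult)

lemma fun_alg_power: "fun_alg \<O> ==> f : \<O> ==> (%x. f x ^ n) : \<O>"
 by (induction n) (auto intro: fun_alg_const fun_alg_mult)

lemma fun_alg_poly: "fun_alg \<O> ==> f : \<O> ==> (%x. poly q (f x)) : \<O>"
 by (induction q) (auto intro: fun_alg_const fun_alg_add fun_alg_mult)

text \<open>Indexing by natural numbers encodes countable dimension. Equality is asked on
  \<open>X\<close> only, since the functions are total.\<close>

definition in_span :: "'x set => (nat => 'x => complex) => ('x => complex) => bool" where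
 "in_span X b f \<longleftrightarrow> (EX K c. finite K & (ALL x:X. f x = (SUM k:K. c k * b k x)))"

text \<open>An algebra homomorphism to the complex numbers. The last clause makes it factor through
  restriction to \<open>X\<close>.\<close>

definition character :: "'x set => ('x => complex) set => (('x => complex) => complex) => bool" where
 "character X \<O> h \<longleftrightarrow> (ALL c. h (%_. c) = c) &
   (ALL f:\<O>. ALL g:\<O>. h (%x. f x + g x) = h f + h g & h (%x. f x * g x) = h f * h g &
    ((ALL x:X. f x = g x) --> h f = h g))"

text \<open>Countable dimension replaces finite generation: it is all the proof of the Nullstellensatz
  over an uncountable field needs.\<close>

definition affine_alg :: "'x set => ('x => complex) set => bool" where
 "affine_alg X \<O> \<longleftrightarrow> fun_alg \<O> & (EX b. ALL f:\<O>. in_span X b f) &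
   (ALL h. character X \<O> h --> (EX x:X. ALL f:\<O>. h f = f x))"

text \<open>Containing all functions that vanish on \<open>X\<close> makes these the ideals of the
  ring of restrictions to \<open>X\<close>.\<close>

definition fun_ideal :: "'x set => ('x => complex) set => ('x => complex) set => bool" where
 "fun_ideal X \<O> I \<longleftrightarrow> I <= \<O> & (ALL f:\<O>. (ALL x:X. f x = 0) --> f : I) &
   (ALL f:I. ALL g:I. (%x. f x + g x) : I) & (ALL f:I. ALL g:\<O>. (%x. f x * g x) : I)"

lemma maximal_ideal_exists:
 assumes \<O>: "fun_alg \<O>" and I: "fun_ideal X \<O> I" "(%_. 1) ~: I"
 shows "EX M. fun_ideal X \<O> M & I <= M & (%_. 1) ~: M &
   (ALL f:\<O>. f ~: M --> (EX g:\<O>. (%x. 1 - f x * g x) : M))"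
proof -
 define \<A> where "\<A> = {M. fun_ideal X \<O> M & I <= M & (%_. 1) ~: M}"
 have "\<A> ~= {}" using I by (auto simp: \<A>_def)
 moreover have "\<Union>\<C> : \<A>" if C: "\<C> ~= {}" "subset.chain \<A> \<C>" for \<C>
 proof -
  have sub: "!!M. M : \<C> ==> fun_ideal X \<O> M & I <= M & (%_. 1) ~: M"
   using C(2) by (auto simp: subset.chain_def \<A>_def)
  have lin: "!!M N. M : \<C> ==> N : \<C> ==> M <= N \<or> N <= M"
   using C(2) by (auto simp: subset.chain_def)
  have "fun_ideal X \<O> (\<Union>\<C>)"
   unfolding fun_ideal_def
  proof (intro conjI ballI impI)
   show "\<Union>\<C> <= \<O>" using sub unfolding fun_ideal_def by blast
   show "f : \<Union>\<C>" if "f : \<O>" "ALL x:X. f x = 0" for f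
    using sub C(1) that unfolding fun_ideal_def by blast
   show "(%x. f x * g x) : \<Union>\<C>" if "f : \<Union>\<C>" "g : \<O>" for f g
    using sub that unfolding fun_ideal_def by blast
   fix f g assume "f : \<Union>\<C>" "g : \<Union>\<C>"
   then obtain M N where MN: "M : \<C>" "N : \<C>" "f : M" "g : N" by auto
   hence "EX M:\<C>. f : M & g : M" using lin[OF MN(1,2)] by auto
   thus "(%x. f x + g x) : \<Union>\<C>"
    using sub unfolding fun_ideal_def by blast
  qed
  thus ?thesis using sub C(1) unfolding \<A>_def by blast
 qed
 ultimately obtain M where M: "M : \<A>" "!!N. N : \<A> ==> M <= N ==> N = M"
  using subset_Zorn_nonempty[of \<A>] by blast
 have MI: "fun_ideal X \<O> M" "I <= M" "(%_. 1) ~: M" using M(1) by (auto simp: \<A>_def)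
 have "EX g:\<O>. (%x. 1 - f x * g x) : M" if f: "f : \<O>" "f ~: M" for f
 proof -
  \<comment> \<open>The ideal generated by \<open>M\<close> and \<open>f\<close>; maximality forces
    it to contain 1.\<close>
  let ?N = "{h:\<O>. EX g:\<O>. (%x. h x - f x * g x) : M}"
  have Madd: "!!h k. h : M ==> k : M ==> (%x. h x + k x) : M"
   and Mmult: "!!h k. h : M ==> k : \<O> ==> (%x. h x * k x) : M"
   using MI(1) unfolding fun_ideal_def by blast+
  have NI: "h : ?N" if "h : \<O>" "g : \<O>" "(%x. h x - f x * g x) : M" for h g
   using that by blast
  have "fun_ideal X \<O> ?N"
   unfolding fun_ideal_def
  proof (intro conjI ballI impI)
   show "?N <= \<O>" by auto
  next
   fix h assume h: "h : \<O>" "ALL x:X. h x = 0"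
   thus "h : ?N" using MI(1) fun_alg_const[OF \<O>, of 0]
    by (intro NI[of h "%_. 0"]) (auto simp: fun_ideal_def)
  next
   fix h k assume "h : ?N" "k : ?N"
   then obtain g g' where g: "h : \<O>" "k : \<O>" "g : \<O>" "g' : \<O>"
    "(%x. h x - f x * g x) : M" "(%x. k x - f x * g' x) : M" by auto
   have "(%x. (h x - f x * g x) + (k x - f x * g' x)) : M"
    by (rule Madd[OF g(5,6)])
   thus "(%x. h x + k x) : ?N" using g fun_alg_add[OF \<O>]
    by (intro NI[of _ "%x. g x + g' x"]) (auto simp: algebra_simps)
  next
   fix h k assume "h : ?N" and k: "k : \<O>"
   then obtain g where g: "h : \<O>" "g : \<O>" "(%x. h x - f x * g x) : M" by auto
   have "(%x. (h x - f x * g x) * k x) : M"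
    by (rule Mmult[OF g(3) k])
   thus "(%x. h x * k x) : ?N" using g k fun_alg_mult[OF \<O>]
    by (intro NI[of _ "%x. g x * k x"]) (auto simp: algebra_simps)
  qed
  moreover have "M <= ?N"
  proof
   fix h assume h: "h : M"
   thus "h : ?N" using MI(1) fun_alg_const[OF \<O>, of 0]
    by (intro NI[of h "%_. 0"]) (auto simp: fun_ideal_def)
  qed
  moreover have "f : ?N"
  proof -
   show ?thesis using MI(1) f(1) fun_alg_const[OF \<O>, of 0] fun_alg_const[OF \<O>, of 1]
    by (intro NI[of f "%_. 1"]) (auto simp: fun_ideal_def)
  qed
  ultimately have "(%_. 1) : ?N" using M(2)[of ?N] f(2) MI(2) unfolding \<A>_def by blast
  thus ?thesis by auto
 qed
 with MI show ?thesis by blast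
qed

text \<open>If no \<open>f - l\<close> lies in \<open>M\<close>, its inverses modulo
  \<open>M\<close> for real \<open>l\<close> form an uncountable family in a space of countable
  dimension. A linear dependence among them, cleared of denominators, is a nonzero polynomial in
  \<open>f\<close> lying in \<open>M\<close>; over the complex numbers it splits into linear
  factors, and \<open>M\<close> is prime.\<close>

lemma maximal_ideal_residue:
 assumes \<O>: "fun_alg \<O>" and span: "!!f. f : \<O> ==> in_span X b f"
  and M: "fun_ideal X \<O> M" "(%_. 1) ~: M"
  and max: "!!f. f : \<O> ==> f ~: M ==> EX g:\<O>. (%x. 1 - f x * g x) : M"
  and f: "f : \<O>"
 shows "EX l. (%x. f x - l) : M"
proof (rule ccontr)
 assume no: "~ ?thesis"
 note alg = fun_alg_const[OF \<O>] fun_alg_add[OF \<O>] fun_alg_mult[OF \<O>] fun_alg_diff[OF \<O>]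
  fun_alg_poly[OF \<O>] fun_alg_cmult[OF \<O>] f
 have fsub: "(%x. f x - c) : \<O>" for c
  using fun_alg_diff[OF \<O> f fun_alg_const[OF \<O>, of c]] by simp
 have Mz: "!!h. h : \<O> ==> (ALL x:X. h x = 0) ==> h : M"
  and Madd: "!!h k. h : M ==> k : M ==> (%x. h x + k x) : M"
  and Mmult: "!!h k. h : M ==> k : \<O> ==> (%x. h x * k x) : M"
  and MO: "!!h. h : M ==> h : \<O>"
  using M(1) unfolding fun_ideal_def by blast+
 have Msum: "finite K ==> (!!k. k : K ==> h k : M) ==> (%x. SUM k:K. h k x) : M"
  for K :: "real set" and h
  by (induction K rule: finite_induct) (auto intro: Madd Mz alg)
 have prime: "h : M \<or> k : M" if "h : \<O>" "k : \<O>" "(%x. h x * k x) : M" for h k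
 proof (rule ccontr)
  assume "~ ?thesis"
  with max[OF that(1)] obtain u where u: "u : \<O>" "(%x. 1 - h x * u x) : M" by blast
  have "(%x. (1 - h x * u x) * k x + (h x * k x) * u x) : M"
   using Madd[OF Mmult[OF u(2) that(2)] Mmult[OF that(3) u(1)]] .
  hence "k : M" by (simp add: algebra_simps)
  with \<open>~ ?thesis\<close> show False by blast
 qed
 have nopoly: "(%x. poly q (f x)) ~: M" if "q ~= 0" for q
  using that
 proof (induction "degree q" arbitrary: q rule: less_induct)
  case less
  show ?case
  proof (cases "degree q = 0")
   case True
   then obtain c where q: "q = [:c:]" by (meson degree_eq_zeroE)
   with less.prems have "c ~= 0" by auto
   show ?thesis
   proof
    assume "(%x. poly q (f x)) : M"
    from Mmult[OF this alg(1)[of "1 / c"]] show False using q M(2) \<open>c ~= 0\<close> by simp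
   qed
  next
   case False
   then obtain r where "poly q r = 0"
    using fundamental_theorem_of_algebra[of q] by (auto simp: constant_degree)
   then obtain q' where q': "q = [:-r, 1:] * q'" by (auto simp: poly_eq_0_iff_dvd elim: dvdE)
   with less.prems have "q' ~= 0" by auto
   hence "degree q' < degree q" unfolding q' by (subst degree_mult_eq) auto
   hence nq: "(%x. poly q' (f x)) ~: M" using less.hyps \<open>q' ~= 0\<close> by blast
   show ?thesis
   proof
    assume "(%x. poly q (f x)) : M"
    hence "(%x. (f x - r) * poly q' (f x)) : M" by (simp add: q' algebra_simps)
    with prime[OF fsub[of r] fun_alg_poly[OF \<O> f, of q']] nq no show False
     by blast
   qed
  qed
 qed
 have "EX g:\<O>. (%x. 1 - (f x - complex_of_real l) * g x) : M" for l
  using no by (intro max fsub) auto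
 then obtain g where g: "!!l. g l : \<O>" "!!l. (%x. 1 - (f x - complex_of_real l) * g l x) : M"
  by metis
 have "ALL l. EX m c. ALL x:X. g l x = (SUM k<m. c k * b k x)"
 proof
  fix l
  obtain K c where K: "finite K" "ALL x:X. g l x = (SUM k:K. c k * b k x)"
   using span[OF g(1)] unfolding in_span_def by blast
  obtain m where m: "K <= {..<m}" using K(1) finite_nat_bounded by blast
  have "ALL x:X. g l x = (SUM k<m. (if k : K then c k else 0) * b k x)"
   using K m by (auto intro!: sum.mono_neutral_cong_left)
  thus "EX m c. ALL x:X. g l x = (SUM k<m. c k * b k x)" by (intro exI)
 qed
 then obtain m where "ALL l. EX c. ALL x:X. g l x = (SUM k<m l. c k * b k x)" unfolding choice_iff by blast
 then obtain c where mc: "!!l x. x : X ==> g l x = (SUM k<m l. c l k * b k x)" unfolding choice_iff by blast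
 \<comment> \<open>Uncountably many inverses but countably many lengths: infinitely many inverses
   lie in the span of the same \<open>n\<close> basis functions, so \<open>n + 1\<close> of them are
   dependent.\<close>
 have "EX n. infinite {l. m l = n}"
 proof (rule ccontr)
  assume "~ ?thesis"
  hence "countable (\<Union>n. {l. m l = n})" by (auto intro: countable_finite)
  moreover have "(\<Union>n. {l. m l = n}) = (UNIV :: real set)" by auto
  ultimately show False using uncountable_UNIV_real by simp
 qed
 then obtain n where "infinite {l. m l = n}" by blast
 then obtain K where K: "K <= {l. m l = n}" "finite K" "card K = Suc n"
  using infinite_arbitrarily_large by blast
 obtain d where d: "EX l:K. d l ~= 0" "!!k. k < n ==> (SUM l:K. d l * c l k) = 0"
  using linear_dependence[of "{..<n}" K c] K by auto
 have zero: "(SUM l:K. d l * g l x) = 0" if "x : X" for x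
 proof -
  have "(SUM l:K. d l * g l x) = (SUM l:K. d l * (SUM k<n. c l k * b k x))"
   using K(1) mc[OF that] by (intro sum.cong) auto
  also have "... = (SUM k<n. (SUM l:K. d l * c l k) * b k x)"
   by (simp add: sum_distrib_left sum_distrib_right sum.swap[of _ K] mult.assoc)
  also have "... = 0" using d(2) by simp
  finally show ?thesis .
 qed
 \<comment> \<open>The numerator of the sum of \<open>d l / (z - l)\<close>. At a point
   \<open>l\<close> with \<open>d l\<close> nonzero only one summand survives, so \<open>q\<close>
   is not zero.\<close>
 define q where "q = (SUM l:K. smult (d l) (PROD u:K - {l}. [:- complex_of_real u, 1:]))"
 have pq: "poly q z = (SUM l:K. d l * (PROD u:K - {l}. z - complex_of_real u))" for z
  by (simp add: q_def poly_sum poly_prod)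
 have "q ~= 0"
 proof -
  obtain l where l: "l : K" "d l ~= 0" using d(1) by blast
  have "poly q (of_real l) = d l * (PROD u:K - {l}. of_real l - complex_of_real u)"
   unfolding pq using K(2) l(1)
   by (subst sum.remove[of _ l]) (auto intro!: sum.neutral simp: prod_zero_iff)
  also have "... ~= 0" using K(2) l by auto
  finally show ?thesis by auto
 qed
 have "(%x. d l * (PROD u:K - {l}. f x - complex_of_real u) * (1 - (f x - complex_of_real l) * g l x)) : M"
  if "l : K" for l
 proof -
  have "(%x. d l * (PROD u:K - {l}. f x - complex_of_real u)) : \<O>"
   by (intro fun_alg_cmult fun_alg_prod \<O> fsub)
  from Mmult[OF g(2)[of l] this] show ?thesis by (simp add: mult.commute)
 qed
 hence "(%x. SUM l:K. d l * (PROD u:K - {l}. f x - complex_of_real u) * (1 - (f x - complex_of_real l) * g l x)) : M"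
  by (rule Msum[OF K(2)])
 moreover have "(SUM l:K. d l * (PROD u:K - {l}. f x - complex_of_real u) * (1 - (f x - complex_of_real l) * g l x))
   = poly q (f x) - (PROD u:K. f x - complex_of_real u) * (SUM l:K. d l * g l x)" for x
 proof -
  have "d l * (PROD u:K - {l}. f x - complex_of_real u) * (1 - (f x - complex_of_real l) * g l x) =
    d l * (PROD u:K - {l}. f x - complex_of_real u) - (PROD u:K. f x - complex_of_real u) * (d l * g l x)"
   if "l : K" for l
   unfolding prod.remove[OF K(2) that, of "%u. f x - complex_of_real u"] by (simp add: algebra_simps)
  thus ?thesis by (simp add: pq sum_subtractf sum_distrib_left)
 qed
 ultimately have 1: "(%x. poly q (f x) - (PROD u:K. f x - complex_of_real u) * (SUM l:K. d l * g l x)) : M"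
  by simp
 have 2: "(%x. (PROD u:K. f x - complex_of_real u) * (SUM l:K. d l * g l x)) : M"
  by (intro Mz fun_alg_mult fun_alg_prod fun_alg_sum fun_alg_cmult fsub \<O> g) (simp add: zero)
 from Madd[OF 1 2] have "(%x. poly q (f x)) : M" by simp
 with nopoly[OF \<open>q ~= 0\<close>] show False by simp
qed

text \<open>Were the ideal generated by \<open>J\<close> proper, a maximal ideal above it would have
  the complex numbers as residue field. The residue map is a character, hence evaluation at a point
  of \<open>X\<close>, and there all of \<open>J\<close> would vanish.\<close>

theorem nullstellensatz:
 assumes aff: "affine_alg X \<O>" and J: "J <= \<O>" "!!x. x : X ==> EX f:J. f x ~= 0"
 shows "EX m f g. (ALL k<(m::nat). f k : J & g k : \<O>) & (ALL x:X. (SUM k<m. f k x * g k x) = 1)"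
proof (rule ccontr)
 assume no: "~ ?thesis"
 have \<O>: "fun_alg \<O>" using aff by (simp add: affine_alg_def)
 note alg = fun_alg_const[OF \<O>] fun_alg_add[OF \<O>] fun_alg_mult[OF \<O>] fun_alg_diff[OF \<O>]
 define I where "I = {h:\<O>. EX m f g. (ALL k<(m::nat). f k : J & g k : \<O>) & (ALL x:X. h x = (SUM k<m. f k x * g k x))}"
 have II: "h : I" if "h : \<O>" "ALL k<(m::nat). f k : J & g k : \<O>" "ALL x:X. h x = (SUM k<m. f k x * g k x)"
  for h m f g
  unfolding I_def using that by (intro CollectI conjI exI)
 have IE: "EX m f g. h : \<O> & (ALL k<(m::nat). f k : J & g k : \<O>) & (ALL x:X. h x = (SUM k<m. f k x * g k x))"
  if "h : I" for h
  using that unfolding I_def by auto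
 have "fun_ideal X \<O> I"
  unfolding fun_ideal_def
 proof (intro conjI ballI impI)
  show "I <= \<O>" by (auto simp: I_def)
 next
  fix h assume "h : \<O>" "ALL x:X. h x = 0"
  thus "h : I" unfolding I_def by (auto intro!: exI[of _ 0])
 next
  fix h h' assume "h : I" "h' : I"
  from IE[OF this(1)] IE[OF this(2)] obtain m f g m' f' g' where h: "h : \<O>" "h' : \<O>"
   "ALL k<(m::nat). f k : J & g k : \<O>"
   "ALL x:X. h x = (SUM k<m. f k x * g k x)" "ALL k<(m'::nat). f' k : J & g' k : \<O>"
   "ALL x:X. h' x = (SUM k<m'. f' k x * g' k x)" by (elim exE conjE)
  let ?f = "%k. if k < m then f k else f' (k - m)"
  let ?g = "%k. if k < m then g k else g' (k - m)"
  have "h x + h' x = (SUM k<m+m'. ?f k x * ?g k x)" if "x : X" for x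
  proof -
   have "(SUM k<m+m'. ?f k x * ?g k x) = (SUM k<m. ?f k x * ?g k x) + (SUM k<m'. ?f (m + k) x * ?g (m + k) x)"
    by (induction m') (auto simp: algebra_simps)
   thus ?thesis using h(4,6) that by simp
  qed
  moreover have "ALL k<m+m'. ?f k : J & ?g k : \<O>" using h(3,5) by auto
  ultimately show "(%x. h x + h' x) : I"
   by (intro II[of _ "m + m'" ?f ?g] alg h) auto
 next
  fix h k assume "h : I" and k: "k : \<O>"
  from IE[OF this(1)] obtain m f g where h: "h : \<O>" "ALL k<(m::nat). f k : J & g k : \<O>"
   "ALL x:X. h x = (SUM k<m. f k x * g k x)" by (elim exE conjE)
  thus "(%x. h x * k x) : I"
   by (intro II[of _ m f "%i x. g i x * k x"]) (auto simp: sum_distrib_right mult.assoc intro: alg k)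
 qed
 moreover have "(%_. 1) ~: I" 
 proof
  assume "(%_. 1) : I"
  from IE[OF this] no show False by metis
 qed
 ultimately obtain M where M: "fun_ideal X \<O> M" "I <= M" "(%_. 1) ~: M"
  and max: "ALL f:\<O>. f ~: M --> (EX g:\<O>. (%x. 1 - f x * g x) : M)"
  by (rule maximal_ideal_exists[OF \<O>, THEN exE]) (elim conjE)
 note max = max[rule_format]
 obtain b where b: "!!f. f : \<O> ==> in_span X b f" using aff by (auto simp: affine_alg_def)
 have Mz: "!!h. h : \<O> ==> (ALL x:X. h x = 0) ==> h : M"
  and Madd: "!!h k. h : M ==> k : M ==> (%x. h x + k x) : M"
  and Mmult: "!!h k. h : M ==> k : \<O> ==> (%x. h x * k x) : M"
  and MO: "!!h. h : M ==> h : \<O>"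
  using M(1) unfolding fun_ideal_def by blast+
 have ex: "EX l. (%x. f x - l) : M" if "f : \<O>" for f
  by (rule maximal_ideal_residue[OF \<O> b M(1,3) max that])
 define h where "h f = (SOME l. (%x. f x - l) : M)" for f
 have h: "(%x. f x - h f) : M" if "f : \<O>" for f
  unfolding h_def using ex[OF that] by (rule someI_ex)
 have noconst: "(%_. c) ~: M" if "c ~= 0" for c
  using Mmult[of "%_. c" "%_. 1 / c"] alg(1) M(3) that by auto
 have huniq: "h f = l" if "f : \<O>" "(%x. f x - l) : M" for f l
 proof (rule ccontr)
  assume "h f ~= l"
  have "(%x. (f x - h f) * (-1) + (f x - l)) : M"
   by (rule Madd[OF Mmult[OF h[OF that(1)] alg(1)] that(2)])
  hence "(%_. h f - l) : M" by simp
  with noconst \<open>h f ~= l\<close> show False by simp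
 qed
 have "character X \<O> h"
  unfolding character_def
 proof (intro conjI allI ballI impI)
  show "h (%_. c) = c" for c
   by (rule huniq) (auto intro: alg Mz)
  fix f g assume fg: "f : \<O>" "g : \<O>"
  show "h (%x. f x + g x) = h f + h g"
   using Madd[OF h[OF fg(1)] h[OF fg(2)]] by (intro huniq alg fg) (simp add: algebra_simps)
  show "h (%x. f x * g x) = h f * h g"
   using Madd[OF Mmult[OF h[OF fg(1)] fg(2)] Mmult[OF h[OF fg(2)] alg(1)[of "h f"]]]
   by (intro huniq alg fg) (simp add: algebra_simps)
  assume eq: "ALL x:X. f x = g x"
  have "(%x. f x - g x) : M" using eq by (intro Mz alg fg) auto
  from Madd[OF this h[OF fg(2)]] show "h f = h g"
   by (intro huniq fg) (simp add: algebra_simps)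
 qed
 then obtain x where x: "x : X" "!!f. f : \<O> ==> h f = f x"
  using aff by (auto simp: affine_alg_def)
 obtain f where f: "f : J" "f x ~= 0" using J(2)[OF x(1)] by blast
 hence fO: "f : \<O>" using J by auto
 have "f : I" using f(1) fO alg(1)[of 1] by (intro II[of f "Suc 0" "%_. f" "%_ _. 1"]) auto
 hence "h f = 0" using M(2) by (intro huniq fO) auto
 with x(2)[OF fO] f(2) show False by simp
qed

section \<open>Tensor products of function algebras\<close>

inductive_set tens :: "('x => complex) set => ('y => complex) set => ('x \<times> 'y => complex) set"
 for A B where
 tens_base: "a : A ==> b : B ==> (%z. a (fst z) * b (snd z)) : tens A B"
| tens_add: "f : tens A B ==> g : tens A B ==> (%z. f z + g z) : tens A B"

lemma tens_fst: "fun_alg B ==> a : A ==> (%z. a (fst z)) : tens A B"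
 using tens_base[of a A "%_. 1" B] fun_alg_const by auto

lemma tens_snd: "fun_alg A ==> b : B ==> (%z. b (snd z)) : tens A B"
 using tens_base[of "%_. 1" A b B] fun_alg_const by auto

lemma fun_alg_tens:
 assumes A: "fun_alg A" and B: "fun_alg B"
 shows "fun_alg (tens A B)"
proof -
 have mult: "(%z. f z * g z) : tens A B" if "f : tens A B" "g : tens A B" for f g
  using that
 proof (induction f)
  case (tens_base a b)
  from tens_base(3,1,2) show ?case
  proof (induction g)
   case (tens_base a' b')
   have "(%z. (a (fst z) * a' (fst z)) * (b (snd z) * b' (snd z))) : tens A B"
    by (rule tens.tens_base[where a = "%x. a x * a' x" and b = "%y. b y * b' y"])
     (use tens_base A B fun_alg_mult in blast)+
   thus ?case by (simp add: algebra_simps)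
  next
   case (tens_add f g)
   thus ?case using tens.tens_add by (simp add: distrib_left)
  qed
 next
  case (tens_add f f')
  thus ?case using tens.tens_add by (simp add: distrib_right)
 qed
 show ?thesis
  unfolding fun_alg_def using mult tens_add tens_fst[OF B fun_alg_const[OF A]] by auto
qed

text \<open>Links the inductive description, suited to rule induction, with the indexed sums by
  which the product of spaces is defined.\<close>

lemma tens_sum_repr:
 assumes "f : tens A B"
 shows "EX m a b. (ALL k<(m::nat). a k : A & b k : B) & f = (%(x, y). SUM k<m. a k x * b k y)"
 using assms
proof induction
 case (tens_base a b)
 thus ?case
  by (intro exI[of _ 1] exI[of _ "%_. a"] exI[of _ "%_. b"]) auto
next
 case (tens_add f g)
 obtain m a b where 1: "ALL k<(m::nat). a k : A & b k : B" "f = (%(x, y). SUM k<m. a k x * b k y)"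
  using tens_add.IH(1) by blast
 obtain m' a' b' where 2: "ALL k<(m'::nat). a' k : A & b' k : B" "g = (%(x, y). SUM k<m'. a' k x * b' k y)"
  using tens_add.IH(2) by blast
 let ?a = "%k. if k < m then a k else a' (k - m)"
 let ?b = "%k. if k < m then b k else b' (k - m)"
 have "(SUM k<m+m'. ?a k x * ?b k y) = (SUM k<m. a k x * b k y) + (SUM k<m'. a' k x * b' k y)" for x y
 proof -
  have "(SUM k<m+m'. ?a k x * ?b k y) = (SUM k<m. ?a k x * ?b k y) + (SUM k<m'. ?a (m + k) x * ?b (m + k) y)"
   by (induction m') (auto simp: algebra_simps)
  thus ?thesis by simp
 qed
 hence "(%z. f z + g z) = (%(x, y). SUM k<m+m'. ?a k x * ?b k y)"
  using 1(2) 2(2) by auto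
 moreover have "ALL k<m+m'. ?a k : A & ?b k : B" using 1 2 by auto
 ultimately show ?case by (intro exI[of _ "m + m'"] exI[of _ ?a] exI[of _ ?b] conjI)
qed

lemma tens_sum:
 assumes "fun_alg A" "fun_alg B" "!!k. k : K ==> a k : A & b k : B"
 shows "(%(x, y). SUM k:K. a k x * b k y) : tens A B"
proof -
 have "(%z. SUM k:K. a k (fst z) * b k (snd z)) : tens A B"
  by (rule fun_alg_sum[OF fun_alg_tens]) (use assms tens_base in blast)+
 moreover have "(%z. SUM k:K. a k (fst z) * b k (snd z)) = (%(x, y). SUM k:K. a k x * b k y)" by auto
 ultimately show ?thesis by simp
qed

section \<open>Spaces with functions: the axioms as rules\<close>

lemmas conjunct3 = conjunct2[THEN conjunct2]
lemmas conjunct4 = conjunct3[THEN conjunct2]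
lemmas conjunct5 = conjunct4[THEN conjunct2]
lemmas conjunct6 = conjunct5[THEN conjunct2]
lemmas conjunct7 = conjunct6[THEN conjunct2]

lemmas fspaceD = fspace_def[THEN iffD1]
lemmas fs_cong = fspaceD[THEN conjunct1, rule_format]
lemmas fs_restrict = fspaceD[THEN conjunct2, THEN conjunct1, rule_format]
lemmas fs_union = fspaceD[THEN conjunct3, THEN conjunct1, rule_format]
lemmas fs_const = fspaceD[THEN conjunct4, THEN conjunct1, rule_format]
lemmas fs_ring = fspaceD[THEN conjunct5, THEN conjunct1, rule_format]
lemmas fs_add = fs_ring[THEN conjunct1]
lemmas fs_mult = fs_ring[THEN conjunct2]
lemmas fs_local = fspaceD[THEN conjunct6, rule_format]
lemmas fs_open = fs_local[THEN conjunct1]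
lemmas fs_inverse = fs_local[THEN conjunct2]

lemma fs_alg: "fspace X ==> opn X U ==> fun_alg (regular X U)"
 by (auto simp: fun_alg_def intro: fs_const fs_add fs_mult)

lemma fs_glue:
 assumes X: "fspace X" and U: "opn X U"
  and loc: "!!x. x : U ==> EX V. opn X V & x : V & f : regular X V"
 shows "f : regular X U"
proof -
 let ?\<U> = "{V. opn X V & V <= U & f : regular X V}"
 have "f : regular X (\<Union>?\<U>)" by (rule fs_union[OF X]) auto
 moreover have "\<Union>?\<U> = U"
 proof
  show "U <= \<Union>?\<U>"
  proof
   fix x assume x: "x : U"
   from loc[OF x] obtain V where V: "opn X V" "x : V" "f : regular X V" by (elim exE conjE)
   hence o: "opn X (V Int U)" using U by blast
   moreover have "f : regular X (V Int U)" using fs_restrict[OF X V(1) o _ V(3)] by blast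
   ultimately show "x : \<Union>?\<U>" using V x by blast
  qed
 qed auto
 ultimately show ?thesis by simp
qed

lemma fs_divide:
 assumes X: "fspace X" and U: "opn X U" "f : regular X U" "g : regular X U"
  and nz: "!!x. x : U ==> g x ~= 0"
 shows "(%x. f x / g x) : regular X U"
proof -
 have "{x:U. g x ~= 0} = U" using nz by auto
 hence "(%x. 1 / g x) : regular X U" using fs_inverse[OF X U(1,3)] by simp
 from fs_mult[OF X U(1,2) this] show ?thesis by simp
qed

lemma fs_eq_open: "fspace X ==> opn X U ==> f : regular X U ==> g : regular X U ==> opn X {x:U. f x ~= g x}"
 using fs_open[of X U "%x. f x - g x"] fun_alg_diff[OF fs_alg, of X U f g] by simp

lemma points_open [simp, intro]: "opn X (points X)"
 by simp

subsection \<open>Morphisms\<close>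

lemma morphism_pull: "morphism X Y f ==> opn Y V ==> g : regular Y V ==> (%x. g (f x)) : regular X {x : points X. f x : V}"
 unfolding morphism_def o_def by blast

lemma morphism_in: "morphism X Y f ==> x : points X ==> f x : points Y"
 unfolding morphism_def continuous_map_def by auto

lemma morphism_open: "morphism X Y f ==> opn Y V ==> opn X {x : points X. f x : V}"
 unfolding morphism_def continuous_map_def by auto

lemma morphism_closed: "morphism X Y f ==> cls Y C ==> cls X {x : points X. f x : C}"
 unfolding morphism_def by (auto intro: closedin_continuous_map_preimage)

text \<open>Continuity is no separate obligation: applied to a constant function, the local
  condition already yields a neighbourhood that is mapped into \<open>V\<close>.\<close>

lemma morphism_localI:
 assumes X: "fspace X" and "!!x. x : points X ==> f x : points Y"
  and loc: "!!V g x. opn Y V ==> g : regular Y V ==> x : points X ==> f x : V ==>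
   EX U. opn X U & x : U & f ` U <= V & (%x. g (f x)) : regular X U"
  and Y: "fspace Y"
 shows "morphism X Y f"
 unfolding morphism_def continuous_map_def
proof (intro conjI allI impI)
 show "f : points X \<rightarrow> points Y" using assms(2) by auto
 fix V assume V: "opn Y V"
 show op: "opn X {x : points X. f x : V}"
 proof (subst openin_subopen, intro ballI)
  fix x assume "x : {x : points X. f x : V}"
  then obtain U where U: "opn X U" "x : U" "f ` U <= V"
   using loc[OF V fs_const[OF Y V]] by blast
  thus "EX T. opn X T & x : T & T <= {x : points X. f x : V}"
   using openin_subset[OF U(1)] by blast
 qed
 fix g assume g: "g : regular Y V"
 show "g \<circ> f : regular X {x : points X. f x : V}"
  unfolding o_def by (rule fs_glue[OF X op]) (use loc[OF V g] in blast)
qed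

lemma morphism_id: "fspace X ==> morphism X X (%x. x)"
 unfolding morphism_def
proof (intro conjI allI impI)
 fix V g assume "fspace X" "opn X V" "g : regular X V"
 moreover from this have "{x : points X. x : V} = V" using openin_subset by blast
 ultimately show "g \<circ> (%x. x) : regular X {x : points X. x : V}" by (simp add: o_def)
qed auto

lemma morphism_comp:
 assumes "morphism X Y f" "morphism Y Z g"
 shows "morphism X Z (%x. g (f x))"
 unfolding morphism_def
proof (intro conjI allI impI)
 show "continuous_map (zariski X) (zariski Z) (%x. g (f x))"
  using assms continuous_map_compose[of _ _ f _ g] by (auto simp: morphism_def o_def)
 fix V h assume V: "opn Z V" "h : regular Z V"
 have "(%x. h (g (f x))) : regular X {x : points X. f x : {y : points Y. g y : V}}"
  by (rule morphism_pull[OF assms(1) morphism_open[OF assms(2) V(1)] morphism_pull[OF assms(2) V]])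
 moreover have "{x : points X. f x : {y : points Y. g y : V}} = {x : points X. g (f x) : V}"
  using morphism_in[OF assms(1)] by auto
 ultimately show "h \<circ> (%x. g (f x)) : regular X {x : points X. g (f x) : V}" by (simp add: o_def)
qed

lemma morphism_cong:
 assumes X: "fspace X" and f: "morphism X Y f" and eq: "!!x. x : points X ==> g x = f x"
 shows "morphism X Y g"
 unfolding morphism_def
proof (intro conjI allI impI)
 show "continuous_map (zariski X) (zariski Y) g"
  using f eq by (auto simp: morphism_def intro: continuous_map_eq)
 fix V h assume V: "opn Y V" "h : regular Y V"
 have "{x : points X. g x : V} = {x : points X. f x : V}" using eq by auto
 thus "h \<circ> g : regular X {x : points X. g x : V}"
  using fs_cong[OF X morphism_open[OF f V(1)] morphism_pull[OF f V], of "h \<circ> g"] eq by simp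
qed

lemma morphism_const:
 assumes X: "fspace X" and c: "c : points Y"
 shows "morphism X Y (%_. c)"
 unfolding morphism_def
proof (intro conjI allI impI)
 show "continuous_map (zariski X) (zariski Y) (%_. c)" using c by simp
 fix V h assume V: "opn Y V" "h : regular Y V"
 have "opn X {x : points X. c : V}" by (cases "c : V") auto
 thus "h \<circ> (%_. c) : regular X {x : points X. c : V}"
  unfolding o_def by (rule fs_const[OF X])
qed

subsection \<open>Subspaces\<close>

lemma zariski_subspace [simp]: "zariski (subspace_of X Z) = subtopology (zariski X) Z"
 by (simp add: subspace_of_def)

lemma regular_subspace: "f : regular (subspace_of X Z) U \<longleftrightarrow> (ALL x:U. EX W g. opn X W & x : W &
  g : regular X W & (ALL y:U Int W. f y = g y))"
 by (simp add: subspace_of_def)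

lemma regular_subspaceE:
 assumes "f : regular (subspace_of X Z) U" "x : U"
 obtains W g where "opn X W" "x : W" "g : regular X W" "ALL y:U Int W. f y = g y"
 using bspec[OF assms(1)[unfolded regular_subspace] assms(2)] by (elim exE conjE) 

lemma regular_subspaceI: "opn X W ==> f : regular X W ==> U <= W ==> f : regular (subspace_of X Z) U"
 unfolding regular_subspace by blast

lemma fspace_subspace:
 assumes X: "fspace X"
 shows "fspace (subspace_of X Z)"
 unfolding fspace_def
proof (intro conjI allI impI)
 fix U f g
 assume "f : regular (subspace_of X Z) U" "ALL x:U. g x = f x"
 thus "g : regular (subspace_of X Z) U" unfolding regular_subspace by auto
next
 fix U V f
 assume VU: "V <= U" and f: "f : regular (subspace_of X Z) U"
 show "f : regular (subspace_of X Z) V"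
  unfolding regular_subspace
 proof
  fix x assume "x : V"
  hence x: "x : U" using VU by auto
  obtain W g where "opn X W" "x : W" "g : regular X W" "ALL y:U Int W. f y = g y"
   by (rule regular_subspaceE[OF f x])
  thus "EX W g. opn X W & x : W & g : regular X W & (ALL y:V Int W. f y = g y)"
   using VU by (intro exI[of _ W] exI[of _ g]) auto
 qed
next
 fix \<U> f
 assume *: "ALL U:\<U>. opn (subspace_of X Z) U & f : regular (subspace_of X Z) U"
 show "f : regular (subspace_of X Z) (\<Union>\<U>)"
  unfolding regular_subspace
 proof
  fix x assume "x : \<Union>\<U>"
  then obtain U where U: "U : \<U>" "x : U" by auto
  then obtain W g where W: "opn X W" "x : W" "g : regular X W" "ALL y:U Int W. f y = g y"
   using * regular_subspaceE[of f X Z U x] by blast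
  obtain T where T: "opn X T" "U = T Int Z" using * U by (auto simp: openin_subtopology)
  have TW: "opn X (T Int W)" using T W by blast
  have "ALL y:\<Union>\<U> Int (T Int W). f y = g y"
  proof
   fix y assume y: "y : \<Union>\<U> Int (T Int W)"
   hence "y : Z" using * openin_subset by fastforce
   with y W T show "f y = g y" by blast
  qed
  thus "EX W g. opn X W & x : W & g : regular X W & (ALL y:\<Union>\<U> Int W. f y = g y)"
   using TW fs_restrict[OF X W(1) TW _ W(3)] U T W by blast
 qed
next
 fix U c
 show "(%_. c) : regular (subspace_of X Z) U" if "opn (subspace_of X Z) U"
  by (rule regular_subspaceI[OF points_open fs_const[OF X points_open]])
   (use openin_subset[OF that] in auto)
next
 fix U f g
 assume U: "opn (subspace_of X Z) U" and f: "f : regular (subspace_of X Z) U"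
  and g: "g : regular (subspace_of X Z) U"
 have ex: "EX W a b. opn X W & x : W & a : regular X W & b : regular X W &
   (ALL y:U Int W. f y = a y & g y = b y)" if x: "x : U" for x
 proof -
  obtain W a where W: "opn X W" "x : W" "a : regular X W" "ALL y:U Int W. f y = a y"
   by (rule regular_subspaceE[OF f x])
  obtain W' b where W': "opn X W'" "x : W'" "b : regular X W'" "ALL y:U Int W'. g y = b y"
   by (rule regular_subspaceE[OF g x])
  have o: "opn X (W Int W')" using W W' by blast
  show ?thesis
   by (intro exI[of _ "W Int W'"] exI[of _ a] exI[of _ b])
    (use o fs_restrict[OF X W(1) o _ W(3)] fs_restrict[OF X W'(1) o _ W'(3)] W W' in blast)
 qed
 show "(%x. f x + g x) : regular (subspace_of X Z) U" "(%x. f x * g x) : regular (subspace_of X Z) U"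
  unfolding regular_subspace
 proof (safe)
  fix x assume "x : U"
  from ex[OF this] obtain W a b where W: "opn X W" "x : W" "a : regular X W" "b : regular X W"
   "ALL y:U Int W. f y = a y & g y = b y" by (elim exE conjE)
  show "EX W h. opn X W & x : W & h : regular X W & (ALL y:U Int W. f y + g y = h y)"
   by (intro exI[of _ W] exI[of _ "%x. a x + b x"]) (use W fs_add[OF X W(1,3,4)] in auto)
  show "EX W h. opn X W & x : W & h : regular X W & (ALL y:U Int W. f y * g y = h y)"
   by (intro exI[of _ W] exI[of _ "%x. a x * b x"]) (use W fs_mult[OF X W(1,3,4)] in auto)
 qed
next
 fix U f
 assume U: "opn (subspace_of X Z) U" and f: "f : regular (subspace_of X Z) U"
 obtain T where T: "opn X T" "U = T Int Z" using U by (auto simp: openin_subtopology)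
 have ex: "EX W a. opn X W & x : W & W <= T & a : regular X W & (ALL y:W. a y ~= 0) & (ALL y:U Int W. f y = a y)"
  if x: "x : U" "f x ~= 0" for x
 proof -
  obtain W a where W: "opn X W" "x : W" "a : regular X W" "ALL y:U Int W. f y = a y"
   by (rule regular_subspaceE[OF f x(1)])
  let ?W = "{y:W. a y ~= 0} Int T"
  have o: "opn X ?W" using fs_open[OF X W(1,3)] T by blast
  show ?thesis
   by (intro exI[of _ ?W] exI[of _ a])
    (use o fs_restrict[OF X W(1) o _ W(3)] W x T in auto)
 qed
 show "opn (subspace_of X Z) {x : U. f x ~= 0}"
 proof (subst openin_subopen, intro ballI)
  fix x assume x: "x : {x : U. f x ~= 0}"
  hence x1: "x : U" "f x ~= 0" by auto
  from ex[OF x1] obtain W a where W: "opn X W" "x : W" "W <= T" "a : regular X W" "ALL y:W. a y ~= 0"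
   "ALL y:U Int W. f y = a y" by (elim exE conjE)
  have "opn (subspace_of X Z) (W Int Z)" using W by (auto simp: openin_subtopology)
  thus "EX V. opn (subspace_of X Z) V & x : V & V <= {x : U. f x ~= 0}"
   using W T x by (intro exI[of _ "W Int Z"]) auto
 qed
 show "(%x. 1 / f x) : regular (subspace_of X Z) {x : U. f x ~= 0}"
  unfolding regular_subspace
 proof
  fix x assume x: "x : {x : U. f x ~= 0}"
  hence x1: "x : U" "f x ~= 0" by auto
  from ex[OF x1] obtain W a where W: "opn X W" "x : W" "W <= T" "a : regular X W" "ALL y:W. a y ~= 0"
   "ALL y:U Int W. f y = a y" by (elim exE conjE)
  show "EX W g. opn X W & x : W & g : regular X W & (ALL y:{x : U. f x ~= 0} Int W. 1 / f y = g y)"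
   by (intro exI[of _ W] exI[of _ "%x. 1 / a x"])
    (use W fs_divide[OF X W(1) fs_const[OF X W(1), of 1] W(4)] in auto)
 qed
qed

lemma morphism_inclusion: "morphism (subspace_of X Z) X (%x. x)"
 unfolding morphism_def
proof (intro conjI allI impI)
 show "continuous_map (zariski (subspace_of X Z)) (zariski X) (%x. x)"
  by (simp add: continuous_map_from_subtopology)
 fix V g assume "opn X V" "g : regular X V"
 thus "g \<circ> (%x. x) : regular (subspace_of X Z) {x : points (subspace_of X Z). x : V}"
  unfolding o_def by (rule regular_subspaceI) auto
qed

lemma morphism_into_subspace:
 assumes f: "morphism X Y f" and X: "fspace X" and Y: "fspace Y" and Z: "!!x. x : points X ==> f x : Z"
 shows "morphism X (subspace_of Y Z) f"
proof (rule morphism_localI[OF X])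
 fix x assume "x : points X"
 thus "f x : points (subspace_of Y Z)" using morphism_in[OF f] Z by auto
next
 fix V g x
 assume V: "opn (subspace_of Y Z) V" "g : regular (subspace_of Y Z) V" "x : points X" "f x : V"
 obtain T where T: "opn Y T" "V = T Int Z" using V(1) by (auto simp: openin_subtopology)
 obtain W a where W: "opn Y W" "f x : W" "a : regular Y W" "ALL y:V Int W. g y = a y"
  by (rule regular_subspaceE[OF V(2,4)])
 have o: "opn Y (W Int T)" using T W by blast
 have a: "a : regular Y (W Int T)" using fs_restrict[OF Y W(1) o _ W(3)] by blast
 let ?U = "{x : points X. f x : W Int T}"
 have "(%x. g (f x)) : regular X ?U"
  by (rule fs_cong[OF X morphism_open[OF f o] morphism_pull[OF f o a]]) (use W T Z in auto)
 thus "EX U. opn X U & x : U & f ` U <= V & (%x. g (f x)) : regular X U"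
  using morphism_open[OF f o] W T V Z by (intro exI[of _ ?U]) auto
qed (rule fspace_subspace[OF Y])

subsection \<open>Generated spaces\<close>

text \<open>The closure conditions under which nonvanishing sets form a basis: the product of two
  generators cuts out the intersection of their nonvanishing sets.\<close>

definition gen_family :: "('a set \<times> ('a => complex)) set => bool" where
 "gen_family \<F> \<longleftrightarrow> (ALL W a. (W, a) : \<F> --> (ALL c. (W, %_. c) : \<F>) &
   (ALL W' b. (W', b) : \<F> --> (W Int W', %x. a x + b x) : \<F> & (W Int W', %x. a x * b x) : \<F>))"

lemma gen_const: "gen_family \<F> ==> (W, a) : \<F> ==> (W, %_. c) : \<F>"
 and gen_add: "gen_family \<F> ==> (W, a) : \<F> ==> (W', b) : \<F> ==> (W Int W', %x. a x + b x) : \<F>"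
 and gen_mult: "gen_family \<F> ==> (W, a) : \<F> ==> (W', b) : \<F> ==> (W Int W', %x. a x * b x) : \<F>"
 unfolding gen_family_def by blast+

lemma openin_generated:
 assumes F: "gen_family \<F>"
 shows "opn (generated_fspace \<F>) V \<longleftrightarrow>
  (ALL x:V. EX W h. (W, h) : \<F> & x : W & h x ~= 0 & (ALL y:W. h y ~= 0 --> y : V))"
proof
 assume "opn (generated_fspace \<F>) V"
 hence "generate_topology_on {{x:W. h x ~= 0} | W h. (W, h) : \<F>} V"
  by (simp add: generated_fspace_def openin_topology_generated_by_iff)
 thus "ALL x:V. EX W h. (W, h) : \<F> & x : W & h x ~= 0 & (ALL y:W. h y ~= 0 --> y : V)"
 proof induction
  case (Int a b)
  show ?case
  proof
   fix x assume "x : a Int b"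
   hence x: "x : a" "x : b" by auto
   from bspec[OF Int.IH(1) x(1)] bspec[OF Int.IH(2) x(2)]
   obtain W h W' h' where "(W, h) : \<F>" "x : W" "h x ~= 0" "ALL y:W. h y ~= 0 --> y : a"
    "(W', h') : \<F>" "x : W'" "h' x ~= 0" "ALL y:W'. h' y ~= 0 --> y : b"
    by (elim exE conjE)
   thus "EX W h. (W, h) : \<F> & x : W & h x ~= 0 & (ALL y:W. h y ~= 0 --> y : a Int b)"
    using gen_mult[OF F] by (intro exI[of _ "W Int W'"] exI[of _ "%x. h x * h' x"]) auto
  qed
 next
  case (UN K)
  show ?case
  proof
   fix x assume "x : \<Union>K"
   then obtain k where k: "k : K" "x : k" by auto
   from bspec[OF UN.IH[OF k(1)] k(2)] k(1)
   show "EX W h. (W, h) : \<F> & x : W & h x ~= 0 & (ALL y:W. h y ~= 0 --> y : \<Union>K)"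
    by (elim exE conjE, intro exI conjI) auto
  qed
 next
  case (Basis s)
  thus ?case by auto
 qed auto
next
 assume *: "ALL x:V. EX W h. (W, h) : \<F> & x : W & h x ~= 0 & (ALL y:W. h y ~= 0 --> y : V)"
 show "opn (generated_fspace \<F>) V"
 proof (subst openin_subopen, intro ballI)
  fix x assume "x : V"
  from bspec[OF * this] obtain W h where W: "(W, h) : \<F>" "x : W" "h x ~= 0" "ALL y:W. h y ~= 0 --> y : V"
   by (elim exE conjE)
  have "opn (generated_fspace \<F>) {x:W. h x ~= 0}"
   unfolding generated_fspace_def by (simp, rule topology_generated_by_Basis) (use W in auto)
  thus "EX T. opn (generated_fspace \<F>) T & x : T & T <= V"
   using W by blast
 qed
qed

lemma points_generated: "gen_family \<F> ==> points (generated_fspace \<F>) = (\<Union>(W, h)\<in>\<F>. W)"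
proof
 assume F: "gen_family \<F>"
 show "points (generated_fspace \<F>) <= (\<Union>(W, h)\<in>\<F>. W)"
  using openin_generated[OF F, of "points (generated_fspace \<F>)"] by fastforce
 have "opn (generated_fspace \<F>) (\<Union>(W, h)\<in>\<F>. W)"
  unfolding openin_generated[OF F]
 proof
  fix x assume "x : (\<Union>(W, h)\<in>\<F>. W)"
  then obtain W h where W: "(W, h) : \<F>" "x : W" by auto
  thus "EX W h. (W, h) : \<F> & x : W & h x ~= 0 & (ALL y:W. h y ~= 0 --> y : (\<Union>(W, h)\<in>\<F>. W))"
   using gen_const[OF F W(1), of 1] by (intro exI[of _ W] exI[of _ "%_. 1"]) auto
 qed
 thus "(\<Union>(W, h)\<in>\<F>. W) <= points (generated_fspace \<F>)" using openin_subset by blast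
qed

lemma regular_generated: "f : regular (generated_fspace \<F>) U \<longleftrightarrow> (ALL x:U. EX W a b. (W, a) : \<F> & (W, b) : \<F> &
  x : W & b x ~= 0 & (ALL y:U Int W. b y ~= 0 --> f y = a y / b y))"
 by (simp add: generated_fspace_def)

lemma openin_generatedE:
 assumes "gen_family \<F>" "opn (generated_fspace \<F>) V" "x : V"
 obtains W h where "(W, h) : \<F>" "x : W" "h x ~= 0" "ALL y:W. h y ~= 0 --> y : V"
 using bspec[OF assms(2)[unfolded openin_generated[OF assms(1)]] assms(3)] by (elim exE conjE)

lemma regular_generatedE:
 assumes "f : regular (generated_fspace \<F>) U" "x : U"
 obtains W a b where "(W, a) : \<F>" "(W, b) : \<F>" "x : W" "b x ~= 0" "ALL y:U Int W. b y ~= 0 --> f y = a y / b y"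
 using bspec[OF assms(1)[unfolded regular_generated] assms(2)] by (elim exE conjE)

lemma fspace_generated:
 assumes F: "gen_family \<F>"
 shows "fspace (generated_fspace \<F>)"
proof -
 let ?X = "generated_fspace \<F>"
 note op = openin_generated[OF F]
 show ?thesis unfolding fspace_def
 proof (intro conjI allI impI)
  fix U f g
  assume "f : regular ?X U" "ALL x:U. g x = f x"
  thus "g : regular ?X U" unfolding regular_generated by auto
 next
  fix U V f
  assume VU: "V <= U" and f: "f : regular ?X U"
  show "f : regular ?X V"
   unfolding regular_generated
  proof
   fix x assume "x : V"
   hence x: "x : U" using VU by auto
   obtain W a b where "(W, a) : \<F>" "(W, b) : \<F>" "x : W" "b x ~= 0" "ALL y:U Int W. b y ~= 0 --> f y = a y / b y"
    by (rule regular_generatedE[OF f x])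
   thus "EX W a b. (W, a) : \<F> & (W, b) : \<F> & x : W & b x ~= 0 & (ALL y:V Int W. b y ~= 0 --> f y = a y / b y)"
    using VU by (intro exI[of _ W] exI[of _ a] exI[of _ b]) auto
  qed
 next
  fix \<U> f
  assume *: "ALL U:\<U>. opn ?X U & f : regular ?X U"
  show "f : regular ?X (\<Union>\<U>)"
   unfolding regular_generated
  proof
   fix x assume "x : \<Union>\<U>"
   then obtain U where U: "U : \<U>" "x : U" by auto
   have fU: "f : regular ?X U" and oU: "opn ?X U" using * U by auto
   obtain W a b where W: "(W, a) : \<F>" "(W, b) : \<F>" "x : W" "b x ~= 0"
    "ALL y:U Int W. b y ~= 0 --> f y = a y / b y" by (rule regular_generatedE[OF fU U(2)])
   obtain W' h where W': "(W', h) : \<F>" "x : W'" "h x ~= 0" "ALL y:W'. h y ~= 0 --> y : U"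
    by (rule openin_generatedE[OF F oU U(2)])
   show "EX W a b. (W, a) : \<F> & (W, b) : \<F> & x : W & b x ~= 0 &
     (ALL y:\<Union>\<U> Int W. b y ~= 0 --> f y = a y / b y)"
    \<comment> \<open>Multiplying numerator and denominator by \<open>h\<close> confines the
      nonvanishing set of the denominator to \<open>U\<close>, where \<open>f\<close> is
      known.\<close>
    by (intro exI[of _ "W Int W'"] exI[of _ "%x. a x * h x"] exI[of _ "%x. b x * h x"])
     (use W W' gen_mult[OF F] in auto)
  qed
 next
  fix U c
  assume "opn ?X U"
  thus "(%_. c) : regular ?X U"
   unfolding regular_generated
  proof (intro ballI)
   fix x assume "opn ?X U" "x : U"
   then obtain W h where W: "(W, h) : \<F>" "x : W" by (rule openin_generatedE[OF F])
   show "EX W a b. (W, a) : \<F> & (W, b) : \<F> & x : W & b x ~= 0 & (ALL y:U Int W. b y ~= 0 --> c = a y / b y)"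
    by (intro exI[of _ W] exI[of _ "%_. c"] exI[of _ "%_. 1"]) (use W gen_const[OF F W(1)] in auto)
  qed
 next
  fix U f g
  assume f: "f : regular ?X U" and g: "g : regular ?X U"
  have ex: "EX W a b c. (W, a) : \<F> & (W, b) : \<F> & (W, c) : \<F> & x : W & b x ~= 0 &
    (ALL y:U Int W. b y ~= 0 --> f y = a y / b y & g y = c y / b y)" if x: "x : U" for x
  proof -
   obtain W a b where W: "(W, a) : \<F>" "(W, b) : \<F>" "x : W" "b x ~= 0"
    "ALL y:U Int W. b y ~= 0 --> f y = a y / b y" by (rule regular_generatedE[OF f x])
   obtain W' c d where W': "(W', c) : \<F>" "(W', d) : \<F>" "x : W'" "d x ~= 0"
    "ALL y:U Int W'. d y ~= 0 --> g y = c y / d y" by (rule regular_generatedE[OF g x])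
   show ?thesis
    by (intro exI[of _ "W Int W'"] exI[of _ "%x. a x * d x"] exI[of _ "%x. b x * d x"] exI[of _ "%x. b x * c x"])
     (use W W' gen_mult[OF F] in auto)
  qed
  show "(%x. f x + g x) : regular ?X U" "(%x. f x * g x) : regular ?X U"
   unfolding regular_generated
  proof safe
   fix x assume x: "x : U"
   from ex[OF x] obtain W a b c where W: "(W, a) : \<F>" "(W, b) : \<F>" "(W, c) : \<F>" "x : W" "b x ~= 0"
    "ALL y:U Int W. b y ~= 0 --> f y = a y / b y & g y = c y / b y" by (elim exE conjE)
   show "EX W a b. (W, a) : \<F> & (W, b) : \<F> & x : W & b x ~= 0 &
      (ALL y:U Int W. b y ~= 0 --> f y + g y = a y / b y)"
    by (intro exI[of _ W] exI[of _ "%x. a x + c x"] exI[of _ b])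
     (use W gen_add[OF F W(1,3)] in "auto simp: add_divide_distrib")
   show "EX W a b. (W, a) : \<F> & (W, b) : \<F> & x : W & b x ~= 0 &
      (ALL y:U Int W. b y ~= 0 --> f y * g y = a y / b y)"
    by (intro exI[of _ W] exI[of _ "%x. a x * c x"] exI[of _ "%x. b x * b x"])
     (use W gen_mult[OF F W(1,3)] gen_mult[OF F W(2,2)] in auto)
  qed
 next
  fix U f
  assume U: "opn ?X U" and f: "f : regular ?X U"
  have ex: "EX W a b. (W, a) : \<F> & (W, b) : \<F> & x : W & a x ~= 0 & b x ~= 0 &
    (ALL y:W. b y ~= 0 --> y : U & f y = a y / b y)" if x: "x : U" and nz: "f x ~= 0" for x
  proof -
   obtain W a b where W: "(W, a) : \<F>" "(W, b) : \<F>" "x : W" "b x ~= 0"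
    "ALL y:U Int W. b y ~= 0 --> f y = a y / b y" by (rule regular_generatedE[OF f x])
   obtain W' h where W': "(W', h) : \<F>" "x : W'" "h x ~= 0" "ALL y:W'. h y ~= 0 --> y : U"
    by (rule openin_generatedE[OF F U x])
   show ?thesis
    by (intro exI[of _ "W Int W'"] exI[of _ "%x. a x * h x"] exI[of _ "%x. b x * h x"])
     (use W W' gen_mult[OF F] x nz in auto)
  qed
  show "opn ?X {x : U. f x ~= 0}"
   unfolding op
  proof
   fix x assume x: "x : {x : U. f x ~= 0}"
   hence x1: "x : U" "f x ~= 0" by auto
   from ex[OF x1] obtain W a b where W: "(W, a) : \<F>" "(W, b) : \<F>" "x : W" "a x ~= 0" "b x ~= 0"
    "ALL y:W. b y ~= 0 --> y : U & f y = a y / b y" by (elim exE conjE)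
   show "EX W h. (W, h) : \<F> & x : W & h x ~= 0 & (ALL y:W. h y ~= 0 --> y : {x : U. f x ~= 0})"
    by (intro exI[of _ W] exI[of _ "%x. a x * b x"]) (use W gen_mult[OF F W(1,2)] in auto)
  qed
  show "(%x. 1 / f x) : regular ?X {x : U. f x ~= 0}"
   unfolding regular_generated
  proof
   fix x assume x: "x : {x : U. f x ~= 0}"
   hence x1: "x : U" "f x ~= 0" by auto
   from ex[OF x1] obtain W a b where W: "(W, a) : \<F>" "(W, b) : \<F>" "x : W" "a x ~= 0" "b x ~= 0"
    "ALL y:W. b y ~= 0 --> y : U & f y = a y / b y" by (elim exE conjE)
   show "EX W a b. (W, a) : \<F> & (W, b) : \<F> & x : W & b x ~= 0 &
     (ALL y:{x : U. f x ~= 0} Int W. b y ~= 0 --> 1 / f y = a y / b y)"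
    by (intro exI[of _ W] exI[of _ "%x. b x * b x"] exI[of _ "%x. a x * b x"])
     (use W gen_mult[OF F W(1,2)] gen_mult[OF F W(2,2)] in auto)
  qed
 qed
qed

subsection \<open>Products\<close>

definition prod_family :: "'a fspace => 'b fspace => (('a \<times> 'b) set \<times> ('a \<times> 'b => complex)) set" where
 "prod_family X Y = {(U \<times> V, h) | U V h. opn X U & opn Y V &
   h : tens (regular X U) (regular Y V)}"

lemma prod_family:
 assumes X: "fspace X" and Y: "fspace Y"
 shows "X \<times>\<^sub>v Y = generated_fspace (prod_family X Y)"
proof -
 have "{(U \<times> V, %(x, y). SUM k<m. a k x * b k y) | U V m a b.
    opn X U & opn Y V &
    (ALL k<(m::nat). a k : regular X U & b k : regular Y V)} = prod_family X Y"
 proof (rule Set.set_eqI, rule iffI)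
  fix z assume "z : {(U \<times> V, %(x, y). SUM k<m. a k x * b k y) | U V m a b.
    opn X U & opn Y V &
    (ALL k<(m::nat). a k : regular X U & b k : regular Y V)}"
  then obtain U V m a b where *: "z = (U \<times> V, %(x, y). SUM k<m. a k x * b k y)"
   "opn X U" "opn Y V" "ALL k<(m::nat). a k : regular X U & b k : regular Y V"
   by (elim CollectE exE conjE)
  thus "z : prod_family X Y"
   using tens_sum[OF fs_alg[OF X *(2)] fs_alg[OF Y *(3)], of "{..<m}" a b]
   by (auto simp: prod_family_def)
 next
  fix z assume "z : prod_family X Y"
  then obtain U V h where *: "z = (U \<times> V, h)" "opn X U" "opn Y V"
    "h : tens (regular X U) (regular Y V)" by (auto simp: prod_family_def)
  from tens_sum_repr[OF *(4)] *(1-3)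
  show "z : {(U \<times> V, %(x, y). SUM k<m. a k x * b k y) | U V m a b.
    opn X U & opn Y V &
    (ALL k<(m::nat). a k : regular X U & b k : regular Y V)}"
   by (elim exE conjE, intro CollectI exI conjI) auto
 qed
 thus ?thesis by (simp add: prod_fspace_def)
qed

lemma tens_mono: "A <= A' ==> B <= B' ==> f : tens A B ==> f : tens A' B'"
 by (rotate_tac 2, induction rule: tens.induct) (auto intro: tens_base tens_add)

lemma gen_family_prod:
 assumes X: "fspace X" and Y: "fspace Y"
 shows "gen_family (prod_family X Y)"
 unfolding gen_family_def
proof (intro allI impI conjI)
 fix W a assume "(W, a) : prod_family X Y"
 then obtain U V where UV: "W = U \<times> V" "opn X U" "opn Y V"
  "a : tens (regular X U) (regular Y V)" by (auto simp: prod_family_def)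
 note alg = fun_alg_tens[OF fs_alg[OF X UV(2)] fs_alg[OF Y UV(3)]]
 show "(W, %_. c) : prod_family X Y" for c
  using UV fun_alg_const[OF alg] by (auto simp: prod_family_def)
 fix W' b assume "(W', b) : prod_family X Y"
 then obtain U' V' where UV': "W' = U' \<times> V'" "opn X U'" "opn Y V'"
  "b : tens (regular X U') (regular Y V')" by (auto simp: prod_family_def)
 have o: "opn X (U Int U')" "opn Y (V Int V')" using UV UV' by auto
 have W: "W Int W' = (U Int U') \<times> (V Int V')" using UV UV' by auto
 note alg = fun_alg_tens[OF fs_alg[OF X o(1)] fs_alg[OF Y o(2)]]
 have ab: "a : tens (regular X (U Int U')) (regular Y (V Int V'))" "b : tens (regular X (U Int U')) (regular Y (V Int V'))"
  by (rule tens_mono[OF _ _ UV(4)] tens_mono[OF _ _ UV'(4)];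
    use fs_restrict[OF X _ o(1)] fs_restrict[OF Y _ o(2)] UV UV' in blast)+
 show "(W Int W', %x. a x + b x) : prod_family X Y"
  unfolding prod_family_def W using o fun_alg_add[OF alg ab] by blast
 show "(W Int W', %x. a x * b x) : prod_family X Y"
  unfolding prod_family_def W using o fun_alg_mult[OF alg ab] by blast
qed

lemma fspace_prod: "fspace X ==> fspace Y ==> fspace (X \<times>\<^sub>v Y)"
 by (simp add: prod_family fspace_generated gen_family_prod)

lemma points_prod:
 assumes "fspace X" "fspace Y"
 shows "points (X \<times>\<^sub>v Y) = points X \<times> points Y"
proof -
 have "(\<Union>(W, h)\<in>prod_family X Y. W) = points X \<times> points Y"
 proof
  show "(\<Union>(W, h)\<in>prod_family X Y. W) <= points X \<times> points Y"
   unfolding prod_family_def by (auto dest!: openin_subset)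
  have "(points X \<times> points Y, %_. 1) : prod_family X Y"
   unfolding prod_family_def
   using fun_alg_const[OF fun_alg_tens[OF fs_alg[OF assms(1) points_open] fs_alg[OF assms(2) points_open]]] by blast
  thus "points X \<times> points Y <= (\<Union>(W, h)\<in>prod_family X Y. W)" by blast
 qed
 thus ?thesis by (simp add: prod_family[OF assms] points_generated[OF gen_family_prod[OF assms]])
qed

lemma openin_prodI:
 assumes X: "fspace X" and Y: "fspace Y"
  and "!!z. z : S ==> EX U V h. opn X U & opn Y V &
   h : tens (regular X U) (regular Y V) & z : U \<times> V & h z ~= 0 & (ALL w:U \<times> V. h w ~= 0 --> w : S)"
 shows "opn (X \<times>\<^sub>v Y) S"
 unfolding prod_family[OF X Y] openin_generated[OF gen_family_prod[OF X Y]]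
proof
 fix z assume "z : S"
 from assms(3)[OF this] show "EX W h. (W, h) : prod_family X Y & z : W & h z ~= 0 & (ALL y:W. h y ~= 0 --> y : S)"
 proof (elim exE conjE)
  fix U V h
  assume "opn X U" "opn Y V" "h : tens (regular X U) (regular Y V)" "z : U \<times> V"
   "h z ~= 0" "ALL w:U \<times> V. h w ~= 0 --> w : S"
  thus ?thesis by (intro exI[of _ "U \<times> V"] exI[of _ h]) (auto simp: prod_family_def)
 qed
qed

lemma openin_prodE:
 assumes X: "fspace X" and Y: "fspace Y" and "opn (X \<times>\<^sub>v Y) S" "z : S"
 obtains U V h where "opn X U" "opn Y V" "h : tens (regular X U) (regular Y V)"
  "z : U \<times> V" "h z ~= 0" "ALL w:U \<times> V. h w ~= 0 --> w : S"
proof -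
 obtain W h where W: "(W, h) : prod_family X Y" "z : W" "h z ~= 0" "ALL y:W. h y ~= 0 --> y : S"
  by (rule openin_generatedE[OF gen_family_prod[OF X Y] assms(3)[unfolded prod_family[OF X Y]] assms(4)])
 then obtain U V where "W = U \<times> V" "opn X U" "opn Y V" "h : tens (regular X U) (regular Y V)"
  by (auto simp: prod_family_def)
 with W show thesis by (intro that[of U V h]) auto
qed

lemma regular_prodI:
 assumes X: "fspace X" and Y: "fspace Y"
  and "!!z. z : S ==> EX U V a b. opn X U & opn Y V &
   a : tens (regular X U) (regular Y V) & b : tens (regular X U) (regular Y V) & z : U \<times> V & b z ~= 0 &
   (ALL w:S Int U \<times> V. b w ~= 0 --> f w = a w / b w)"
 shows "f : regular (X \<times>\<^sub>v Y) S"
 unfolding prod_family[OF X Y] regular_generated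
proof
 fix z assume "z : S"
 from assms(3)[OF this] show "EX W a b. (W, a) : prod_family X Y & (W, b) : prod_family X Y & z : W & b z ~= 0 &
  (ALL y:S Int W. b y ~= 0 --> f y = a y / b y)"
 proof (elim exE conjE)
  fix U V a b
  assume "opn X U" "opn Y V" "a : tens (regular X U) (regular Y V)"
   "b : tens (regular X U) (regular Y V)" "z : U \<times> V"
   "b z ~= 0" "ALL w:S Int U \<times> V. b w ~= 0 --> f w = a w / b w"
  thus ?thesis
   by (intro exI[of _ "U \<times> V"] exI[of _ a] exI[of _ b]) (auto simp: prod_family_def)
 qed
qed

lemma regular_prodE:
 assumes X: "fspace X" and Y: "fspace Y" and "f : regular (X \<times>\<^sub>v Y) S" "z : S"
 obtains U V a b where "opn X U" "opn Y V" "a : tens (regular X U) (regular Y V)"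
  "b : tens (regular X U) (regular Y V)" "z : U \<times> V" "b z ~= 0" "ALL w:S Int U \<times> V. b w ~= 0 --> f w = a w / b w"
proof -
 obtain W a b where W: "(W, a) : prod_family X Y" "(W, b) : prod_family X Y" "z : W" "b z ~= 0"
  "ALL y:S Int W. b y ~= 0 --> f y = a y / b y"
  by (rule regular_generatedE[OF assms(3)[unfolded prod_family[OF X Y]] assms(4)])
 obtain U V where UV: "W = U \<times> V" "opn X U" "opn Y V" "a : tens (regular X U) (regular Y V)"
  using W(1) by (auto simp: prod_family_def)
 obtain U' V' where "W = U' \<times> V'" "b : tens (regular X U') (regular Y V')"
  using W(2) by (auto simp: prod_family_def)
 moreover have "U' = U" "V' = V" using UV(1) calculation(1) W(3) by (auto simp: times_eq_iff)
 ultimately show thesis using W UV by (intro that[of U V a b]) auto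
qed

lemma regular_tens:
 assumes "fspace X" "fspace Y" "opn X U" "opn Y V" "f : tens (regular X U) (regular Y V)"
 shows "f : regular (X \<times>\<^sub>v Y) (U \<times> V)"
 by (rule regular_prodI[OF assms(1,2)], intro exI[of _ U] exI[of _ V] exI[of _ f] exI[of _ "%_. 1"])
  (use assms fun_alg_const[OF fun_alg_tens[OF fs_alg[OF assms(1,3)] fs_alg[OF assms(2,4)]]] in auto)

lemma openin_times:
 assumes "fspace X" "fspace Y" "opn X U" "opn Y V"
 shows "opn (X \<times>\<^sub>v Y) (U \<times> V)"
 by (rule openin_prodI[OF assms(1,2)], intro exI[of _ U] exI[of _ V] exI[of _ "%_. 1"])
  (use assms fun_alg_const[OF fun_alg_tens[OF fs_alg[OF assms(1,3)] fs_alg[OF assms(2,4)]]] in auto)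

lemma morphism_fst:
 assumes X: "fspace X" and Y: "fspace Y"
 shows "morphism (X \<times>\<^sub>v Y) X fst"
proof (rule morphism_localI[OF fspace_prod[OF assms] _ _ X])
 show "fst x : points X" if "x : points (X \<times>\<^sub>v Y)" for x
  using that by (auto simp: points_prod[OF assms])
 fix V g x assume V: "opn X V" "g : regular X V" "x : points (X \<times>\<^sub>v Y)" "fst x : V"
 have "(%x. g (fst x)) : regular (X \<times>\<^sub>v Y) (V \<times> points Y)"
  by (rule regular_tens[OF assms V(1) points_open tens_fst[OF fs_alg[OF Y points_open] V(2)]])
 moreover have "opn (X \<times>\<^sub>v Y) (V \<times> points Y)" by (rule openin_times[OF assms V(1) points_open])
 ultimately show "EX U. opn (X \<times>\<^sub>v Y) U & x : U & fst ` U <= V & (%x. g (fst x)) : regular (X \<times>\<^sub>v Y) U"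
  using V by (intro exI[of _ "V \<times> points Y"]) (auto simp: points_prod[OF assms] mem_Times_iff)
qed

lemma morphism_snd:
 assumes X: "fspace X" and Y: "fspace Y"
 shows "morphism (X \<times>\<^sub>v Y) Y snd"
proof (rule morphism_localI[OF fspace_prod[OF assms] _ _ Y])
 show "snd x : points Y" if "x : points (X \<times>\<^sub>v Y)" for x
  using that by (auto simp: points_prod[OF assms])
 fix V g x assume V: "opn Y V" "g : regular Y V" "x : points (X \<times>\<^sub>v Y)" "snd x : V"
 have "(%x. g (snd x)) : regular (X \<times>\<^sub>v Y) (points X \<times> V)"
  by (rule regular_tens[OF assms points_open V(1) tens_snd[OF fs_alg[OF X points_open] V(2)]])
 moreover have "opn (X \<times>\<^sub>v Y) (points X \<times> V)" by (rule openin_times[OF assms points_open V(1)])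
 ultimately show "EX U. opn (X \<times>\<^sub>v Y) U & x : U & snd ` U <= V & (%x. g (snd x)) : regular (X \<times>\<^sub>v Y) U"
  using V by (intro exI[of _ "points X \<times> V"]) (auto simp: points_prod[OF assms] mem_Times_iff)
qed

lemma regular_pair:
 assumes Z: "fspace Z" and f: "morphism Z X f" and g: "morphism Z Y g"
  and UV: "opn X U" "opn Y V" and h: "h : tens (regular X U) (regular Y V)"
 shows "(%z. h (f z, g z)) : regular Z {z : points Z. f z : U & g z : V}"
proof -
 let ?W = "{z : points Z. f z : U & g z : V}"
 have W: "?W = {z : points Z. f z : U} Int {z : points Z. g z : V}" by auto
 have o: "opn Z ?W"
  unfolding W using morphism_open[OF f UV(1)] morphism_open[OF g UV(2)] by blast
 from h show ?thesis
 proof induction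
  case (tens_base a b)
  have "(%z. a (f z)) : regular Z ?W" "(%z. b (g z)) : regular Z ?W"
   by (rule fs_restrict[OF Z morphism_open[OF f UV(1)] o _ morphism_pull[OF f UV(1) tens_base(1)]]
        fs_restrict[OF Z morphism_open[OF g UV(2)] o _ morphism_pull[OF g UV(2) tens_base(2)]]; auto)+
  from fs_mult[OF Z o this] show ?case by simp
 next
  case (tens_add h h')
  thus ?case using fs_add[OF Z o] by simp
 qed
qed

lemma morphism_pair:
 assumes Z: "fspace Z" and X: "fspace X" and Y: "fspace Y" and f: "morphism Z X f" and g: "morphism Z Y g"
 shows "morphism Z (X \<times>\<^sub>v Y) (%z. (f z, g z))"
proof (rule morphism_localI[OF Z _ _ fspace_prod[OF X Y]])
 show "(f z, g z) : points (X \<times>\<^sub>v Y)" if "z : points Z" for z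
  using morphism_in[OF f that] morphism_in[OF g that] by (simp add: points_prod[OF X Y])
 fix O' k z assume O: "opn (X \<times>\<^sub>v Y) O'" "k : regular (X \<times>\<^sub>v Y) O'" "z : points Z" "(f z, g z) : O'"
 obtain U V h where h: "opn X U" "opn Y V" "h : tens (regular X U) (regular Y V)"
  "(f z, g z) : U \<times> V" "h (f z, g z) ~= 0" "ALL w:U \<times> V. h w ~= 0 --> w : O'"
  by (rule openin_prodE[OF X Y O(1,4)])
 obtain U' V' a b where ab: "opn X U'" "opn Y V'" "a : tens (regular X U') (regular Y V')"
  "b : tens (regular X U') (regular Y V')" "(f z, g z) : U' \<times> V'" "b (f z, g z) ~= 0"
  "ALL w:O' Int U' \<times> V'. b w ~= 0 --> k w = a w / b w"
  by (rule regular_prodE[OF X Y O(2,4)])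
 let ?N = "%U V. {z : points Z. f z : U & g z : V}"
 have No: "opn Z (?N U V)" if "opn X U" "opn Y V" for U V
 proof -
  have "?N U V = {z : points Z. f z : U} Int {z : points Z. g z : V}" by auto
  thus ?thesis using morphism_open[OF f that(1)] morphism_open[OF g that(2)] by auto
 qed
 let ?T = "{z : ?N U V. h (f z, g z) ~= 0} Int {z : ?N U' V'. b (f z, g z) ~= 0}"
 have T: "opn Z ?T"
  by (intro openin_Int fs_open[OF Z] No regular_pair[OF Z f g] h ab)
 have "(%z. a (f z, g z) / b (f z, g z)) : regular Z ?T"
  by (intro fs_divide[OF Z T]; (rule fs_restrict[OF Z No[OF ab(1,2)] T _ regular_pair[OF Z f g ab(1,2)]])?) (use ab in auto)
 hence "(%z. k (f z, g z)) : regular Z ?T"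
  by (rule fs_cong[OF Z T]) (use h ab in auto)
 moreover have "z : ?T" using O h ab by auto
 moreover have "(%z. (f z, g z)) ` ?T <= O'" using h by auto
 ultimately show "EX U. opn Z U & z : U & (%z. (f z, g z)) ` U <= O' & (%z. k (f z, g z)) : regular Z U"
  using T by blast
qed

subsection \<open>Matrices close to the identity\<close>

text \<open>The diagonal pivot is 1 at \<open>x0\<close>, hence invertible on a neighbourhood, and
  elimination reduces the size of the matrix. This does the work of a determinant, for completeness
  as well as for isolating torsion points.\<close>

lemma near_identity:
 fixes r :: "'i => 'i => 'a => complex"
 assumes X: "fspace X" and "finite I" and U: "opn X U" "x0 : U"
  and "!!i j. i : I ==> j : I ==> r i j : regular X U & r i j x0 = (if i = j then 1 else 0)"
 shows "EX V. opn X V & x0 : V & V <= U &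
  (ALL x:V. ALL v. (ALL i:I. (SUM j:I. r i j x * v j) = 0) --> (ALL j:I. v j = 0))"
 using assms(2-)
proof (induction I arbitrary: U r rule: finite_induct)
 case empty
 thus ?case by auto
next
 case (insert k I)
 let ?U = "{x:U. r k k x ~= 0}"
 have kk: "r k k : regular X U" "r k k x0 = 1" using insert.prems(3)[of k k] by auto
 have o: "opn X ?U" by (rule fs_open[OF X insert.prems(1) kk(1)])
 have x0: "x0 : ?U" using insert.prems kk by auto
 have reg: "r i j : regular X ?U" if "i : insert k I" "j : insert k I" for i j
  using fs_restrict[OF X insert.prems(1) o] insert.prems(3)[OF that] by blast
 \<comment> \<open>The Schur complement of the pivot. Since \<open>r i k\<close> vanishes at
   \<open>x0\<close>, it is again the identity there.\<close>
 let ?r = "%i j x. r i j x - r i k x * (r k j x / r k k x)"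
 have "?r i j : regular X ?U & ?r i j x0 = (if i = j then 1 else 0)" if "i : I" "j : I" for i j
 proof
  note alg = fs_alg[OF X o]
  show "?r i j : regular X ?U"
   using that by (intro fun_alg_diff[OF alg] fun_alg_mult[OF alg] reg fs_divide[OF X o]) auto
  have "r i k x0 = 0" using insert.prems(3)[of i k] insert.hyps that by auto
  thus "?r i j x0 = (if i = j then 1 else 0)" using insert.prems(3)[of i j] that by auto
 qed
 then obtain V where V: "opn X V" "x0 : V" "V <= ?U"
  "!!x v. x : V ==> (ALL i:I. (SUM j:I. ?r i j x * v j) = 0) ==> (ALL j:I. v j = 0)"
  by (rule insert.IH[OF o x0, of ?r, THEN exE]) auto
 have "ALL j:insert k I. v j = 0" if x: "x : V" and v: "ALL i:insert k I. (SUM j:insert k I. r i j x * v j) = 0" for x v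
 proof -
  have nz: "r k k x ~= 0" using x V by auto
  have s: "r i k x * v k + (SUM j:I. r i j x * v j) = 0" if "i : insert k I" for i
   using v[rule_format, OF that] insert.hyps by simp
  have vk: "v k = - (SUM j:I. r k j x * v j) / r k k x"
   using s[of k] nz by (simp add: field_simps eq_neg_iff_add_eq_0)
  have "ALL i:I. (SUM j:I. ?r i j x * v j) = 0"
  proof
   fix i assume i: "i : I"
   have "(SUM j:I. ?r i j x * v j) = (SUM j:I. r i j x * v j) + r i k x * (- (SUM j:I. r k j x * v j) / r k k x)"
    by (simp add: left_diff_distrib sum_subtractf sum_distrib_left sum_divide_distrib sum_negf mult.assoc)
   also have "... = 0" using s[of i] i vk by (simp add: add.commute)
   finally show "(SUM j:I. ?r i j x * v j) = 0" .
  qed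
  from V(4)[OF x this] have "ALL j:I. v j = 0" .
  moreover from this have "v k = 0" unfolding vk by simp
  ultimately show ?thesis by simp
 qed
 thus ?case using V(1-3) by blast
qed

subsection \<open>Affine charts\<close>

text \<open>\<open>\<O>\<close> acts as coordinate ring of \<open>U\<close>: its principal open sets
  form a basis of \<open>U\<close>, and germs of regular functions are fractions from it. A single
  denominator \<open>b\<close> serves both purposes, shrinking into \<open>W\<close> and expressing
  \<open>f\<close>.\<close>

definition chart :: "'a fspace => 'a set => ('a => complex) set => bool" where
 "chart X U \<O> \<longleftrightarrow> opn X U & fun_alg \<O> & \<O> <= regular X U &
  (ALL x:U. ALL W f. opn X W --> x : W --> f : regular X W -->
   (EX a:\<O>. EX b:\<O>. b x ~= 0 & (ALL y:U. b y ~= 0 --> y : W & f y = a y / b y)))"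

lemma chartD: "chart X U \<O> ==> x : U ==> opn X W ==> x : W ==> f : regular X W ==>
  EX a:\<O>. EX b:\<O>. b x ~= 0 & (ALL y:U. b y ~= 0 --> y : W & f y = a y / b y)"
 unfolding chart_def by blast

lemma tens_chart_fraction:
 assumes X: "fspace X" and Y: "fspace Y" and c: "chart X U \<O>" "chart Y V \<P>" and xy: "x : U" "y : V"
  and W: "opn X U'" "opn Y V'" "x : U'" "y : V'" "h : tens (regular X U') (regular Y V')"
 shows "EX a:tens \<O> \<P>. EX b:tens \<O> \<P>. b (x, y) ~= 0 & (ALL w:U \<times> V. b w ~= 0 --> w : U' \<times> V' & h w = a w / b w)"
 using W(5)
proof induction
 have fO: "fun_alg \<O>" "fun_alg \<P>" using c by (auto simp: chart_def)
 note alg = fun_alg_tens[OF fO]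
 {
  case (tens_base f g)
  obtain a b where ab: "a : \<O>" "b : \<O>" "b x ~= 0" "ALL y:U. b y ~= 0 --> y : U' & f y = a y / b y"
   using chartD[OF c(1) xy(1) W(1,3) tens_base(1)] by blast
  obtain a' b' where ab': "a' : \<P>" "b' : \<P>" "b' y ~= 0" "ALL y:V. b' y ~= 0 --> y : V' & g y = a' y / b' y"
   using chartD[OF c(2) xy(2) W(2,4) tens_base(2)] by blast
  show ?case
   by (intro bexI[of _ "%z. a (fst z) * a' (snd z)"] bexI[of _ "%z. b (fst z) * b' (snd z)"] tens.tens_base)
    (use ab ab' in auto)
 next
  case (tens_add f g)
  obtain a b where ab: "a : tens \<O> \<P>" "b : tens \<O> \<P>" "b (x, y) ~= 0"
   "ALL w:U \<times> V. b w ~= 0 --> w : U' \<times> V' & f w = a w / b w" using tens_add.IH(1) by blast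
  obtain a' b' where ab': "a' : tens \<O> \<P>" "b' : tens \<O> \<P>" "b' (x, y) ~= 0"
   "ALL w:U \<times> V. b' w ~= 0 --> w : U' \<times> V' & g w = a' w / b' w" using tens_add.IH(2) by blast
  show ?case
   by (intro bexI[of _ "%z. a z * b' z + a' z * b z"] bexI[of _ "%z. b z * b' z"]
     fun_alg_add[OF alg] fun_alg_mult[OF alg])
    (use ab ab' in "auto simp: field_simps")
 }
qed

lemma chart_prod:
 assumes X: "fspace X" and Y: "fspace Y" and c: "chart X U \<O>" "chart Y V \<P>"
 shows "chart (X \<times>\<^sub>v Y) (U \<times> V) (tens \<O> \<P>)"
 unfolding chart_def
proof (intro conjI ballI allI impI)
 have U: "opn X U" "fun_alg \<O>" "\<O> <= regular X U"
  and V: "opn Y V" "fun_alg \<P>" "\<P> <= regular Y V" using c by (auto simp: chart_def)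
 show "opn (X \<times>\<^sub>v Y) (U \<times> V)" by (rule openin_times[OF X Y U(1) V(1)])
 show alg: "fun_alg (tens \<O> \<P>)" by (rule fun_alg_tens[OF U(2) V(2)])
 show "tens \<O> \<P> <= regular (X \<times>\<^sub>v Y) (U \<times> V)"
  using regular_tens[OF X Y U(1) V(1)] tens_mono[OF U(3) V(3)] by blast
 fix z W f
 assume z: "z : U \<times> V" and W: "opn (X \<times>\<^sub>v Y) W" "z : W" "f : regular (X \<times>\<^sub>v Y) W"
 obtain x y where xy: "z = (x, y)" "x : U" "y : V" using z by auto
 obtain U1 V1 h where h: "opn X U1" "opn Y V1" "h : tens (regular X U1) (regular Y V1)"
  "z : U1 \<times> V1" "h z ~= 0" "ALL w:U1 \<times> V1. h w ~= 0 --> w : W"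
  by (rule openin_prodE[OF X Y W(1,2)])
 obtain U' V' a b where ab: "opn X U'" "opn Y V'" "a : tens (regular X U') (regular Y V')"
  "b : tens (regular X U') (regular Y V')" "z : U' \<times> V'" "b z ~= 0"
  "ALL w:W Int U' \<times> V'. b w ~= 0 --> f w = a w / b w"
  by (rule regular_prodE[OF X Y W(3,2)])
 have fr: "EX a':tens \<O> \<P>. EX b':tens \<O> \<P>. b' z ~= 0 & (ALL w:U \<times> V. b' w ~= 0 --> w : U' \<times> V' & k w = a' w / b' w)"
  if "opn X U'" "opn Y V'" "z : U' \<times> V'" "k : tens (regular X U') (regular Y V')" for U' V' k
  using tens_chart_fraction[OF X Y c xy(2,3) that(1,2) _ _ that(4)] that(3) xy(1) by auto
 obtain p q where pq: "p : tens \<O> \<P>" "q : tens \<O> \<P>" "q z ~= 0"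
  "ALL w:U \<times> V. q w ~= 0 --> w : U1 \<times> V1 & h w = p w / q w" using fr[OF h(1,2,4,3)] by blast
 obtain p1 q1 where pq1: "p1 : tens \<O> \<P>" "q1 : tens \<O> \<P>" "q1 z ~= 0"
  "ALL w:U \<times> V. q1 w ~= 0 --> w : U' \<times> V' & a w = p1 w / q1 w" using fr[OF ab(1,2,5,3)] by blast
 obtain p2 q2 where pq2: "p2 : tens \<O> \<P>" "q2 : tens \<O> \<P>" "q2 z ~= 0"
  "ALL w:U \<times> V. q2 w ~= 0 --> w : U' \<times> V' & b w = p2 w / q2 w" using fr[OF ab(1,2,5,4)] by blast
 \<comment> \<open>With \<open>a = p1 / q1\<close> and \<open>b = p2 / q2\<close> the function is
   \<open>p1 * q2 / (q1 * p2)\<close>. The factors \<open>p\<close> and \<open>q\<close> force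
   \<open>h\<close> to be nonzero, so that the point lies in \<open>W\<close>.\<close>
 let ?e = "%w. p w * q w * q1 w * p2 w * q2 w"
 let ?A = "%w. p1 w * q2 w * (p w * q w * q2 w)"
 show "EX a:tens \<O> \<P>. EX b:tens \<O> \<P>. b z ~= 0 & (ALL y:U \<times> V. b y ~= 0 --> y : W & f y = a y / b y)"
 proof (rule bexI[of _ ?A], rule bexI[of _ ?e], intro conjI ballI impI)
  show "?e z ~= 0" using pq pq1 pq2 ab(6) h(5) z by auto
  fix w assume w: "w : U \<times> V" "?e w ~= 0"
  hence nz: "p w ~= 0" "q w ~= 0" "q1 w ~= 0" "p2 w ~= 0" "q2 w ~= 0" by auto
  hence "w : W" using h(6) pq(4) w(1) by auto
  thus "w : W" .
  have "f w = a w / b w" using \<open>w : W\<close> ab(7) pq1(4) pq2(4) w(1) nz by auto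
  thus "f w = ?A w / ?e w" using pq1(4) pq2(4) w(1) nz by simp
 qed (intro fun_alg_mult[OF alg] pq pq1 pq2)+
qed

section \<open>Homogeneous coordinates on projective varieties\<close>

definition Dset :: "'a fspace => ('a => nat => complex) => cpoly => 'a set" where
 "Dset X rh F = {x : points X. ev F (rh x) ~= 0}"

definition ratio_at :: "nat => ('a => nat => complex) => 'a set => ('a => complex) => 'a => bool" where
 "ratio_at n rh U f x \<longleftrightarrow> (EX d F G. form n d F & form n d G & ev G (rh x) ~= 0 &
   (ALL y:U. ev G (rh y) ~= 0 --> f y = ev F (rh y) / ev G (rh y)))"

text \<open>Homogeneous coordinates on \<open>X\<close>: a choice \<open>rh\<close> of coordinate vectors that realises \<open>X\<close> as a
  closed subspace of projective \<open>n\<close>-space.\<close>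

definition proj_coords :: "nat => 'a fspace => ('a => nat => complex) => bool" where
 "proj_coords n X rh \<longleftrightarrow> fspace X & (ALL x:points X. rh x : homog_coords n) &
  (ALL F d. form n d F --> opn X (Dset X rh F)) &
  (ALL U x. opn X U --> x : U --> (EX F d. form n d F & x : Dset X rh F & Dset X rh F <= U)) &
  (ALL U f. opn X U --> (f : regular X U \<longleftrightarrow> (ALL x:U. ratio_at n rh U f x))) &
  (ALL v:homog_coords n. (ALL F d. form n d F --> (ALL x:points X. ev F (rh x) = 0) --> ev F v = 0) -->
    (EX x:points X. EX c. c ~= 0 & v = (%i. c * rh x i))) &
  (ALL x:points X. ALL y:points X. ALL c. c ~= 0 --> rh y = (%i. c * rh x i) --> x = y)"

lemmas pcD = proj_coords_def[THEN iffD1]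
lemmas pc_fspace = pcD[THEN conjunct1]
lemmas pc_homog = pcD[THEN conjunct2, THEN conjunct1, rule_format]
lemmas pc_open = pcD[THEN conjunct3, THEN conjunct1, rule_format]
lemmas pc_basis = pcD[THEN conjunct4, THEN conjunct1, rule_format]
lemmas pc_regular = pcD[THEN conjunct5, THEN conjunct1, rule_format]
lemmas pc_closed = pcD[THEN conjunct6, THEN conjunct1, rule_format]
lemmas pc_inj = pcD[THEN conjunct7, rule_format]

definition rep :: "(nat => complex) set => nat => complex" where
 "rep x = (SOME v. v : x)"

lemma proj_point_self: "v : proj_point v"
 unfolding proj_point_def by (auto intro!: exI[of _ 1])

lemma proj_point_scale: "c ~= 0 ==> proj_point (%i. c * v i) = proj_point v"
 unfolding proj_point_def
proof (intro equalityI subsetI)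
 fix w assume c: "c ~= 0" and "w : {%i. d * (c * v i) |d. d ~= 0}"
 then obtain d where "d ~= 0" "w = (%i. d * (c * v i))" by auto
 thus "w : {%i. d * v i |d. d ~= 0}" using c by (auto intro!: exI[of _ "d * c"])
next
 fix w assume c: "c ~= 0" and "w : {%i. d * v i |d. d ~= 0}"
 then obtain d where "d ~= 0" "w = (%i. d * v i)" by auto
 thus "w : {%i. d * (c * v i) |d. d ~= 0}" using c by (auto intro!: exI[of _ "d / c"])
qed

lemma proj_point_memD: "w : proj_point v ==> EX c. c ~= 0 & w = (%i. c * v i)"
 unfolding proj_point_def by auto

lemma proj_point_eq: "w : proj_point v ==> proj_point w = proj_point v"
 using proj_point_memD proj_point_scale by blast

lemma homog_scale: "v : homog_coords n ==> c ~= 0 ==> (%i. c * v i) : homog_coords n"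
 by (auto simp: homog_coords_def fun_eq_iff)

lemma rep_proj_point: "rep (proj_point v) : proj_point v"
 unfolding rep_def using proj_point_self[of v] by (rule someI[of "%w. w : proj_point v"])

lemma rep_scale: "EX c. c ~= 0 & rep (proj_point v) = (%i. c * v i)"
 using proj_point_memD[OF rep_proj_point] .

definition ppoints :: "nat => (nat => complex) set set" where
 "ppoints n = {proj_point v | v. v : homog_coords n}"

lemma ppoints_rep: "x : ppoints n ==> rep x : homog_coords n & x = proj_point (rep x) & rep x : x"
 unfolding ppoints_def using rep_scale rep_proj_point homog_scale proj_point_eq
 by (smt (verit) mem_Collect_eq)

lemma ppoints_mem: "x : ppoints n ==> v : x ==> EX c. c ~= 0 & v = (%i. c * rep x i)"
 using ppoints_rep proj_point_memD by metis

lemma form_nonzero_mem: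
 assumes "x : ppoints n" "v : x" "form n d F"
 shows "ev F v = 0 \<longleftrightarrow> ev F (rep x) = 0"
 using ppoints_mem[OF assms(1,2)] form_scale[OF assms(3)] by auto

lemma form_ratio_mem:
 assumes "x : ppoints n" "v : x" "form n d F" "form n d G"
 shows "ev F v / ev G v = ev F (rep x) / ev G (rep x)"
 using ppoints_mem[OF assms(1,2)] form_scale[OF assms(3)] form_scale[OF assms(4)] by auto

text \<open>Fractions of degree zero on principal open sets. Presented as a generated space,
  projective space inherits the axioms of a space with functions.\<close>

definition pfamily :: "nat => ((nat => complex) set set \<times> ((nat => complex) set => complex)) set" where
 "pfamily n = {(W, h). EX d F L. form n d F & form n d L & W = {x : ppoints n. ev L (rep x) ~= 0} &
   (ALL x:W. h x = ev F (rep x) / ev L (rep x))}"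

lemma pfamilyI:
 "form n d F ==> form n d L ==> (!!x. x : ppoints n ==> ev L (rep x) ~= 0 ==> h x = ev F (rep x) / ev L (rep x)) ==>
  W = {x : ppoints n. ev L (rep x) ~= 0} ==> (W, h) : pfamily n"
 unfolding pfamily_def by blast

lemma gen_family_pfamily: "gen_family (pfamily n)"
 unfolding gen_family_def
proof (intro allI impI conjI)
 fix W a assume "(W, a) : pfamily n"
 then obtain d F L where 1: "form n d F" "form n d L" "W = {x : ppoints n. ev L (rep x) ~= 0}"
  "ALL x:W. a x = ev F (rep x) / ev L (rep x)" by (auto simp: pfamily_def)
 show "(W, %_. c) : pfamily n" for c
  by (rule pfamilyI[OF form_cmult[OF 1(2), of c] 1(2) _ 1(3)]) simp
 fix W' b assume "(W', b) : pfamily n"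
 then obtain d' F' L' where 2: "form n d' F'" "form n d' L'" "W' = {x : ppoints n. ev L' (rep x) ~= 0}"
  "ALL x:W'. b x = ev F' (rep x) / ev L' (rep x)" by (auto simp: pfamily_def)
 have W: "W Int W' = {x : ppoints n. ev (L * L') (rep x) ~= 0}" using 1 2 by auto
 have f: "form n (d + d') (F * L' + L * F')" "form n (d + d') (L * L')" "form n (d + d') (F * F')"
  using 1 2 by (auto intro: form_add form_mult)
 show "(W Int W', %x. a x + b x) : pfamily n"
  by (rule pfamilyI[OF f(1,2) _ W]) (use 1 2 in "simp add: add_frac_eq mult.commute")
 show "(W Int W', %x. a x * b x) : pfamily n"
  by (rule pfamilyI[OF f(3,2) _ W]) (use 1 2 in simp)
qed

lemma openin_projective:
 "opn (projective_space n) V \<longleftrightarrow> V <= ppoints n & (ALL x:V. EX d F. form n d F &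
   ev F (rep x) ~= 0 & {y : ppoints n. ev F (rep y) ~= 0} <= V)"
proof -
 have basis: "{proj_point v | v. v : homog_coords n & ev F v ~= 0} = {y : ppoints n. ev F (rep y) ~= 0}"
  if "form n d F" for d F
 proof (intro equalityI subsetI)
  fix x assume "x : {proj_point v | v. v : homog_coords n & ev F v ~= 0}"
  then obtain v where v: "x = proj_point v" "v : homog_coords n" "ev F v ~= 0" by auto
  hence "x : ppoints n" by (auto simp: ppoints_def)
  with v form_nonzero_mem[OF this _ that, of v] proj_point_self
  show "x : {y : ppoints n. ev F (rep y) ~= 0}" by auto
 next
  fix x assume "x : {y : ppoints n. ev F (rep y) ~= 0}"
  thus "x : {proj_point v | v. v : homog_coords n & ev F v ~= 0}"
   using ppoints_rep[of x n] by auto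
 qed
 have gen: "zariski (projective_space n) =
   topology_generated_by {{y : ppoints n. ev F (rep y) ~= 0} | F. EX d. form n d F}"
 proof -
  have "{{proj_point v | v. v : homog_coords n & ev F v ~= 0} | F. EX d. form n d F} =
    {{y : ppoints n. ev F (rep y) ~= 0} | F. EX d. form n d F}"
   using basis by (metis (no_types, lifting))
  thus ?thesis by (simp add: projective_space_def)
 qed
 show ?thesis
 proof
  assume "opn (projective_space n) V"
  hence "generate_topology_on {{y : ppoints n. ev F (rep y) ~= 0} | F. EX d. form n d F} V"
   by (simp add: gen openin_topology_generated_by_iff)
  thus "V <= ppoints n & (ALL x:V. EX d F. form n d F &
    ev F (rep x) ~= 0 & {y : ppoints n. ev F (rep y) ~= 0} <= V)"
  proof induction
   case (Int a b)
   have "EX d F. form n d F & ev F (rep x) ~= 0 & {y : ppoints n. ev F (rep y) ~= 0} <= a Int b"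
    if x: "x : a Int b" for x
   proof -
    obtain d F where 1: "form n d F" "ev F (rep x) ~= 0" "{y : ppoints n. ev F (rep y) ~= 0} <= a"
     using Int.IH(1) x by blast
    obtain d' F' where 2: "form n d' F'" "ev F' (rep x) ~= 0" "{y : ppoints n. ev F' (rep y) ~= 0} <= b"
     using Int.IH(2) x by blast
    show ?thesis
     by (intro exI[of _ "d + d'"] exI[of _ "F * F'"]) (use 1 2 form_mult in auto)
   qed
   with Int.IH show ?case by blast
  next
   case (UN K)
   show ?case
   proof (intro conjI ballI)
    show "\<Union>K <= ppoints n" using UN.IH by blast
    fix x assume "x : \<Union>K"
    then obtain k where k: "k : K" "x : k" by auto
    from UN.IH[OF k(1)] k(2) obtain d F where "form n d F" "ev F (rep x) ~= 0"
     "{y : ppoints n. ev F (rep y) ~= 0} <= k" by blast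
    thus "EX d F. form n d F & ev F (rep x) ~= 0 & {y : ppoints n. ev F (rep y) ~= 0} <= \<Union>K"
     using k(1) by (intro exI[of _ d] exI[of _ F]) auto
   qed
  qed auto
 next
  assume V: "V <= ppoints n & (ALL x:V. EX d F. form n d F &
    ev F (rep x) ~= 0 & {y : ppoints n. ev F (rep y) ~= 0} <= V)"
  show "opn (projective_space n) V"
  proof (subst openin_subopen, intro ballI)
   fix x assume x: "x : V"
   then obtain d F where F: "form n d F" "ev F (rep x) ~= 0" "{y : ppoints n. ev F (rep y) ~= 0} <= V"
    using V by blast
   have "opn (projective_space n) {y : ppoints n. ev F (rep y) ~= 0}"
    unfolding gen by (rule topology_generated_by_Basis) (use F in auto)
   thus "EX T. opn (projective_space n) T & x : T & T <= V"
    using F x V by blast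
  qed
 qed
qed

lemma points_projective: "points (projective_space n) = ppoints n"
proof
 show "points (projective_space n) <= ppoints n" using openin_projective[of n "points (projective_space n)"] by simp
 have "opn (projective_space n) (ppoints n)"
  unfolding openin_projective by (intro conjI ballI exI[of _ 0] exI[of _ "1 :: cpoly"]) auto
 thus "ppoints n <= points (projective_space n)" by (rule openin_subset)
qed

lemma regular_projective:
 assumes "U <= ppoints n"
 shows "f : regular (projective_space n) U \<longleftrightarrow> (ALL x:U. ratio_at n rep U f x)"
proof -
 have 1: "(ALL v:x. ev G v ~= 0) \<longleftrightarrow> ev G (rep x) ~= 0" if "form n d G" "x : U" for d G x
  using form_nonzero_mem[OF _ _ that(1), of x] ppoints_rep[of x n] assms that(2) by auto
 have 2: "(ALL v:y. ev G v ~= 0 --> f y = ev F v / ev G v) \<longleftrightarrow>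
   (ev G (rep y) ~= 0 --> f y = ev F (rep y) / ev G (rep y))"
  if "form n d F" "form n d G" "y : U" for d F G y
 proof -
  have y: "y : ppoints n" using that assms by auto
  show ?thesis
  proof
   assume "ALL v:y. ev G v ~= 0 --> f y = ev F v / ev G v"
   thus "ev G (rep y) ~= 0 --> f y = ev F (rep y) / ev G (rep y)"
    using ppoints_rep[OF y] by blast
  next
   assume *: "ev G (rep y) ~= 0 --> f y = ev F (rep y) / ev G (rep y)"
   show "ALL v:y. ev G v ~= 0 --> f y = ev F v / ev G v"
   proof (intro ballI impI)
    fix v assume v: "v : y" "ev G v ~= 0"
    hence "ev G (rep y) ~= 0" using form_nonzero_mem[OF y v(1) that(2)] by simp
    thus "f y = ev F v / ev G v" using * form_ratio_mem[OF y v(1) that(1,2)] by simp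
   qed
  qed
 qed
 show ?thesis
  unfolding projective_space_def ratio_at_def fspace.simps mem_Collect_eq
  by (intro ball_cong refl ex_cong1 conj_cong) (use 1 2 in blast)+
qed

lemma fspace_transfer:
 assumes X: "fspace X" and z: "zariski X' = zariski X" and r: "!!U. opn X U ==> regular X' U = regular X U"
 shows "fspace X'"
 unfolding fspace_def z
proof (intro conjI allI impI)
 fix U f g assume "opn X U" "f : regular X' U" "ALL x:U. g x = f x"
 thus "g : regular X' U" using fs_cong[OF X, of U f g] by (simp add: r)
next
 fix U V f assume "opn X U" "opn X V" "V <= U" "f : regular X' U"
 thus "f : regular X' V" using fs_restrict[OF X, of U V f] by (simp add: r)
next
 fix \<U> f assume *: "ALL U:\<U>. opn X U & f : regular X' U"
 hence "opn X (\<Union>\<U>)" by auto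
 moreover have "f : regular X (\<Union>\<U>)" by (rule fs_union[OF X]) (use * r in auto)
 ultimately show "f : regular X' (\<Union>\<U>)" by (simp add: r)
next
 fix U c assume "opn X U"
 thus "(%_. c) : regular X' U" using fs_const[OF X] by (simp add: r)
next
 fix U f g assume "opn X U" "f : regular X' U" "g : regular X' U"
 thus "(%x. f x + g x) : regular X' U" "(%x. f x * g x) : regular X' U"
  using fs_add[OF X, of U f g] fs_mult[OF X, of U f g] by (simp_all add: r)
next
 fix U f assume U: "opn X U" "f : regular X' U"
 hence f: "f : regular X U" by (simp add: r)
 from fs_open[OF X U(1) f] show "opn X {x : U. f x ~= 0}" .
 from this fs_inverse[OF X U(1) f] show "(%x. 1 / f x) : regular X' {x : U. f x ~= 0}" by (simp add: r)
qed

lemma fspace_projective: "fspace (projective_space n)"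
proof (rule fspace_transfer[OF fspace_generated[OF gen_family_pfamily[of n]]])
 note op = openin_generated[OF gen_family_pfamily]
 have "opn (projective_space n) V \<longleftrightarrow> opn (generated_fspace (pfamily n)) V" for V
 proof
  assume V: "opn (projective_space n) V"
  show "opn (generated_fspace (pfamily n)) V"
   unfolding op
  proof
   fix x assume x: "x : V"
   then obtain d F where F: "form n d F" "ev F (rep x) ~= 0" "{y : ppoints n. ev F (rep y) ~= 0} <= V"
    using V unfolding openin_projective by blast
   show "EX W h. (W, h) : pfamily n & x : W & h x ~= 0 & (ALL y:W. h y ~= 0 --> y : V)"
    by (intro exI[of _ "{y : ppoints n. ev F (rep y) ~= 0}"] exI[of _ "%_. 1"])
     (use F x V in "auto simp: pfamily_def openin_projective")
  qed
 next
  assume V: "opn (generated_fspace (pfamily n)) V"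
  show "opn (projective_space n) V"
   unfolding openin_projective
  proof (intro conjI subsetI ballI)
   fix x assume x: "x : V"
   obtain W h where W: "(W, h) : pfamily n" "x : W" "h x ~= 0" "ALL y:W. h y ~= 0 --> y : V"
    by (rule openin_generatedE[OF gen_family_pfamily V x])
   then obtain d F L where 1: "form n d F" "form n d L" "W = {x : ppoints n. ev L (rep x) ~= 0}"
    "ALL x:W. h x = ev F (rep x) / ev L (rep x)" by (auto simp: pfamily_def)
   show "x : ppoints n" using W 1 by auto
   show "EX d F. form n d F & ev F (rep x) ~= 0 & {y : ppoints n. ev F (rep y) ~= 0} <= V"
    by (intro exI[of _ "d + d"] exI[of _ "F * L"]) (use W 1 form_mult[OF 1(1,2)] in auto)
  qed
 qed
 thus z: "zariski (projective_space n) = zariski (generated_fspace (pfamily n))" by (simp add: topology_eq)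
 fix U assume U: "opn (generated_fspace (pfamily n)) U"
 hence U': "U <= ppoints n" using openin_subset points_projective by (metis z)
 show "regular (projective_space n) U = regular (generated_fspace (pfamily n)) U"
 proof (intro Set.set_eqI iffI)
  fix f assume "f : regular (projective_space n) U"
  hence *: "ALL x:U. ratio_at n rep U f x" using regular_projective[OF U'] by blast
  show "f : regular (generated_fspace (pfamily n)) U"
   unfolding regular_generated
  proof
   fix x assume x: "x : U"
   then obtain d F G where F: "form n d F" "form n d G" "ev G (rep x) ~= 0"
    "ALL y:U. ev G (rep y) ~= 0 --> f y = ev F (rep y) / ev G (rep y)"
    using * unfolding ratio_at_def by blast
   show "EX W a b. (W, a) : pfamily n & (W, b) : pfamily n & x : W & b x ~= 0 &
     (ALL y:U Int W. b y ~= 0 --> f y = a y / b y)"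
    by (intro exI[of _ "{y : ppoints n. ev G (rep y) ~= 0}"]
      exI[of _ "%y. ev F (rep y) / ev G (rep y)"] exI[of _ "%_. 1"])
     (use F x U' in "auto simp: pfamily_def")
  qed
 next
  fix f assume f: "f : regular (generated_fspace (pfamily n)) U"
  have "ratio_at n rep U f x" if x: "x : U" for x
  proof -
   obtain W a b where W: "(W, a) : pfamily n" "(W, b) : pfamily n" "x : W" "b x ~= 0"
    "ALL y:U Int W. b y ~= 0 --> f y = a y / b y" by (rule regular_generatedE[OF f x])
   obtain d F L where 1: "form n d F" "form n d L" "W = {x : ppoints n. ev L (rep x) ~= 0}"
    "ALL x:W. a x = ev F (rep x) / ev L (rep x)" using W(1) by (auto simp: pfamily_def)
   obtain d' F' L' where 2: "form n d' F'" "form n d' L'" "W = {x : ppoints n. ev L' (rep x) ~= 0}"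
    "ALL x:W. b x = ev F' (rep x) / ev L' (rep x)" using W(2) by (auto simp: pfamily_def)
   have f: "form n (d + d' + d') (F * L' * L')" "form n (d + d' + d') (L * F' * L')"
    using 1 2 by (auto intro!: form_mult)
   show ?thesis
    unfolding ratio_at_def
    by (intro exI[of _ "d + d' + d'"] exI[of _ "F * L' * L'"] exI[of _ "L * F' * L'"])
     (use f 1 2 W U' in auto)
  qed
  thus "f : regular (projective_space n) U" using regular_projective[OF U'] by blast
 qed
qed

lemma proj_coords_closed:
 assumes Z: "cls (projective_space n) Z"
 shows "proj_coords n (subspace_of (projective_space n) Z) rep"
proof -
 let ?P = "projective_space n" and ?X = "subspace_of (projective_space n) Z"
 have Zp: "Z <= ppoints n" using closedin_subset[OF Z] points_projective by auto
 have pts: "points ?X = Z" using Zp by (auto simp: points_projective)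
 have D: "opn ?P {y : ppoints n. ev F (rep y) ~= 0}" if "form n d F" for d F
  unfolding openin_projective using that by auto
 have DX: "opn ?X (Dset ?X rep F)" if "form n d F" for d F
 proof -
  have "Dset ?X rep F = {y : ppoints n. ev F (rep y) ~= 0} Int Z"
   unfolding Dset_def pts using Zp by auto
  thus ?thesis using D[OF that] by (auto simp: openin_subtopology)
 qed
 have basis: "EX F d. form n d F & x : Dset ?X rep F & Dset ?X rep F <= U" if U: "opn ?X U" and x: "x : U" for U x
 proof -
  obtain T where T: "opn ?P T" "U = T Int Z" using U by (auto simp: openin_subtopology)
  then obtain d F where F: "form n d F" "ev F (rep x) ~= 0" "{y : ppoints n. ev F (rep y) ~= 0} <= T"
   using x unfolding openin_projective by blast
  thus ?thesis using T x Zp by (intro exI[of _ F] exI[of _ d]) (auto simp: Dset_def pts simp del: topspace_subtopology zariski_subspace)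
 qed
 show ?thesis
  unfolding proj_coords_def
 proof (intro conjI allI ballI impI)
  show "fspace ?X" by (rule fspace_subspace[OF fspace_projective])
  show "rep x : homog_coords n" if "x : points ?X" for x using that Zp ppoints_rep unfolding pts by blast
  show "opn ?X (Dset ?X rep F)" if "form n d F" for F d by (rule DX[OF that])
  show "EX F d. form n d F & x : Dset ?X rep F & Dset ?X rep F <= U" if "opn ?X U" "x : U" for U x
   by (rule basis[OF that])
 next
  fix U f assume U: "opn ?X U"
  have UZ: "U <= Z" using openin_subset[OF U] pts by auto
  show "f : regular ?X U \<longleftrightarrow> (ALL x:U. ratio_at n rep U f x)"
  proof
   assume f: "f : regular ?X U"
   show "ALL x:U. ratio_at n rep U f x"
   proof
    fix x assume x: "x : U"
    obtain W g where W: "opn ?P W" "x : W" "g : regular ?P W" "ALL y:U Int W. f y = g y"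
     by (rule regular_subspaceE[OF f x])
    have Wp: "W <= ppoints n" using openin_subset[OF W(1)] points_projective by auto
    obtain d F G where F: "form n d F" "form n d G" "ev G (rep x) ~= 0"
     "ALL y:W. ev G (rep y) ~= 0 --> g y = ev F (rep y) / ev G (rep y)"
     using W(2,3) regular_projective[OF Wp] unfolding ratio_at_def by blast
    obtain e H where H: "form n e H" "ev H (rep x) ~= 0" "{y : ppoints n. ev H (rep y) ~= 0} <= W"
     using W(1,2) unfolding openin_projective by blast
    show "ratio_at n rep U f x"
     unfolding ratio_at_def
    proof (rule exI[of _ "d + e"], rule exI[of _ "F * H"], rule exI[of _ "G * H"], intro conjI form_mult F H ballI impI)
     show "ev (G * H) (rep x) ~= 0" using F H by simp
     fix y assume y: "y : U" "ev (G * H) (rep y) ~= 0"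
     hence "y : W" using H UZ Zp by auto
     thus "f y = ev (F * H) (rep y) / ev (G * H) (rep y)" using y W(4) F(4) by simp
    qed
   qed
  next
   assume *: "ALL x:U. ratio_at n rep U f x"
   show "f : regular ?X U"
    unfolding regular_subspace
   proof
    fix x assume x: "x : U"
    then obtain d F G where F: "form n d F" "form n d G" "ev G (rep x) ~= 0"
     "ALL y:U. ev G (rep y) ~= 0 --> f y = ev F (rep y) / ev G (rep y)"
     using * unfolding ratio_at_def by blast
    let ?W = "{y : ppoints n. ev G (rep y) ~= 0}"
    have "(%y. ev F (rep y) / ev G (rep y)) : regular ?P ?W"
     by (subst regular_projective) (use F in "auto simp: ratio_at_def")
    thus "EX W g. opn ?P W & x : W & g : regular ?P W & (ALL y:U Int W. f y = g y)"
     using F x UZ Zp D[OF F(2)]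
     by (intro exI[of _ ?W] exI[of _ "%y. ev F (rep y) / ev G (rep y)"]) auto
   qed
  qed
 next
  fix v assume v: "v : homog_coords n" and van: "ALL F d. form n d F --> (ALL x:points ?X. ev F (rep x) = 0) --> ev F v = 0"
  have vp: "proj_point v : ppoints n" using v by (auto simp: ppoints_def)
  have "proj_point v : Z"
  proof (rule ccontr)
   assume "proj_point v ~: Z"
   moreover have "opn ?P (ppoints n - Z)" using Z by (auto simp: closedin_def points_projective)
   ultimately obtain d F where F: "form n d F" "ev F (rep (proj_point v)) ~= 0"
    "{y : ppoints n. ev F (rep y) ~= 0} <= ppoints n - Z"
    using vp unfolding openin_projective by blast
   hence "ALL x:points ?X. ev F (rep x) = 0" using Zp unfolding pts by blast
   hence "ev F v = 0" using van F(1) by blast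
   thus False using F(2) form_nonzero_mem[OF vp proj_point_self F(1)] by simp
  qed
  thus "EX x:points ?X. EX c. c ~= 0 & v = (%i. c * rep x i)"
   unfolding pts using ppoints_mem[OF vp proj_point_self] by blast
 next
  fix x y c assume "x : points ?X" "y : points ?X" "c ~= 0" "rep y = (%i. c * rep x i)"
  thus "x = y" using ppoints_rep Zp proj_point_scale unfolding pts by (metis subsetD)
 qed
qed

lemma proj_coords_iso:
 assumes X: "fspace X" and f: "isomorphism X X' f" and c: "proj_coords n X' rh"
 shows "proj_coords n X (%x. rh (f x))"
proof -
 let ?g = "inv_into (points X) f"
 have bij: "bij_betw f (points X) (points X')" and mf: "morphism X X' f" and mg: "morphism X' X ?g"
  using f by (auto simp: isomorphism_def)
 have gf: "?g (f x) = x" if "x : points X" for x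
  using bij that by (simp add: bij_betw_def)
 have fg: "f (?g y) = y" "?g y : points X" if "y : points X'" for y
  using bij that by (auto simp: bij_betw_def f_inv_into_f inv_into_into)
 have fX: "f x : points X'" if "x : points X" for x using mf that by (rule morphism_in)
 have op: "opn X U ==> opn X' (f ` U)" for U
 proof -
  assume U: "opn X U"
  have "f ` U = {y : points X'. ?g y : U}" using openin_subset[OF U] gf fg fX by force
  thus ?thesis using morphism_open[OF mg U] by simp
 qed
 have Dset: "Dset X (%x. rh (f x)) F = {x : points X. f x : Dset X' rh F}" for F
  using fX by (auto simp: Dset_def)
 show ?thesis
  unfolding proj_coords_def
 proof (intro conjI allI ballI impI)
  show "fspace X" by fact
  show "rh (f x) : homog_coords n" if "x : points X" for x using pc_homog[OF c] fX[OF that] by blast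
  show "opn X (Dset X (%x. rh (f x)) F)" if "form n d F" for F d
   unfolding Dset by (rule morphism_open[OF mf pc_open[OF c that]])
  show "EX F d. form n d F & x : Dset X (%x. rh (f x)) F & Dset X (%x. rh (f x)) F <= U"
   if U: "opn X U" and x: "x : U" for U x
  proof -
   obtain F d where F: "form n d F" "f x : Dset X' rh F" "Dset X' rh F <= f ` U"
    using pc_basis[OF c op[OF U], of "f x"] x by blast
   have "Dset X (%x. rh (f x)) F <= U"
    unfolding Dset using F(3) openin_subset[OF U] gf by (auto simp: image_iff) (metis imageE subsetD)
   thus ?thesis using F U x openin_subset[OF U] unfolding Dset by blast
  qed
 next
  fix U k assume U: "opn X U"
  have Us: "U <= points X" by (rule openin_subset[OF U])
  have ratio: "(ALL x:U. ratio_at n (%x. rh (f x)) U k x) \<longleftrightarrow> (ALL y:f ` U. ratio_at n rh (f ` U) (k \<circ> ?g) y)"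
   unfolding ratio_at_def using gf Us by (simp add: subset_iff)
  have "k : regular X U \<longleftrightarrow> k \<circ> ?g : regular X' (f ` U)"
  proof
   assume k: "k : regular X U"
   have "f ` U = {y : points X'. ?g y : U}" using Us gf fg fX by force
   thus "k \<circ> ?g : regular X' (f ` U)" using morphism_pull[OF mg U k] by (simp add: o_def)
  next
   assume k: "k \<circ> ?g : regular X' (f ` U)"
   have e: "{x : points X. f x : f ` U} = U" using Us gf by (auto simp: image_iff) (metis subsetD)
   have "(%x. (k \<circ> ?g) (f x)) : regular X U" using morphism_pull[OF mf op[OF U] k] unfolding e .
   thus "k : regular X U" by (rule fs_cong[OF X U]) (use gf Us in auto)
  qed
  thus "k : regular X U \<longleftrightarrow> (ALL x:U. ratio_at n (%x. rh (f x)) U k x)"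
   unfolding ratio using pc_regular[OF c op[OF U]] by simp
 next
  fix v assume v: "v : homog_coords n" "ALL F d. form n d F --> (ALL x:points X. ev F (rh (f x)) = 0) --> ev F v = 0"
  have "EX y:points X'. EX c. c ~= 0 & v = (%i. c * rh y i)"
   by (rule pc_closed[OF c v(1)]) (use v(2) fX in blast)
  thus "EX x:points X. EX c. c ~= 0 & v = (%i. c * rh (f x) i)" using fg by metis
 next
  fix x y d assume "x : points X" "y : points X" "d ~= 0" "rh (f y) = (%i. d * rh (f x) i)"
  hence "f x = f y" using pc_inj[OF c, of "f x" "f y" d] fX by blast
  thus "x = y" using gf \<open>x : points X\<close> \<open>y : points X\<close> by metis
 qed
qed

lemma projective_variety_coords: "projective_variety X ==> EX n rh. proj_coords n X rh"
 unfolding projective_variety_def using proj_coords_iso proj_coords_closed by blast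

subsection \<open>Affine charts of projective varieties\<close>

text \<open>The part of degree zero of the homogeneous coordinate ring localised at
  \<open>L\<close>. As \<open>L\<close> is linear, its powers can match every degree.\<close>

definition chart_alg :: "nat => 'a fspace => ('a => nat => complex) => cpoly => ('a => complex) set" where
 "chart_alg n X rh L = {h. EX k F. form n k F & (ALL x:Dset X rh L. h x = ev F (rh x) / ev L (rh x) ^ k)}"

lemma chart_algI: "form n k F ==> (!!x. x : Dset X rh L ==> h x = ev F (rh x) / ev L (rh x) ^ k) ==> h : chart_alg n X rh L"
 unfolding chart_alg_def by blast

lemma chart_algE:
 assumes "h : chart_alg n X rh L"
 obtains k F where "form n k F" "ALL x:Dset X rh L. h x = ev F (rh x) / ev L (rh x) ^ k"
 using assms unfolding chart_alg_def by (elim CollectE exE conjE)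

lemma fun_alg_chart:
 assumes L: "form n 1 L"
 shows "fun_alg (chart_alg n X rh L)"
 unfolding fun_alg_def
proof (intro conjI allI ballI)
 show "(%_. c) : chart_alg n X rh L" for c by (rule chart_algI[of n 0 "const_poly c"]) auto
 fix f g assume "f : chart_alg n X rh L" "g : chart_alg n X rh L"
 then obtain k F k' F' where 1: "form n k F" "ALL x:Dset X rh L. f x = ev F (rh x) / ev L (rh x) ^ k"
  "form n k' F'" "ALL x:Dset X rh L. g x = ev F' (rh x) / ev L (rh x) ^ k'"
  by (elim chart_algE)
 have Lp: "form n m (L ^ m)" for m using form_power[OF L, of m] by simp
 show "(%x. f x + g x) : chart_alg n X rh L"
 proof (rule chart_algI)
  show "form n (k + k') (F * L ^ k' + L ^ k * F')" by (intro form_add form_mult 1 Lp)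
  fix x assume x: "x : Dset X rh L"
  thus "f x + g x = ev (F * L ^ k' + L ^ k * F') (rh x) / ev L (rh x) ^ (k + k')"
   using 1 by (simp add: Dset_def power_add add_divide_distrib)
 qed
 show "(%x. f x * g x) : chart_alg n X rh L"
  by (rule chart_algI[of n "k + k'" "F * F'"]) (use 1 in "auto intro!: form_mult simp: power_add")
qed

lemma chart_proj:
 assumes c: "proj_coords n X rh" and L: "form n 1 L"
 shows "chart X (Dset X rh L) (chart_alg n X rh L)"
 unfolding chart_def
proof (intro conjI ballI allI impI)
 have Lp: "form n m (L ^ m)" for m using form_power[OF L, of m] by simp
 show o: "opn X (Dset X rh L)" by (rule pc_open[OF c L])
 show "fun_alg (chart_alg n X rh L)" by (rule fun_alg_chart[OF L])
 show "chart_alg n X rh L <= regular X (Dset X rh L)"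
 proof
  fix h assume "h : chart_alg n X rh L"
  then obtain k F where 1: "form n k F" "ALL x:Dset X rh L. h x = ev F (rh x) / ev L (rh x) ^ k"
   by (elim chart_algE)
  show "h : regular X (Dset X rh L)"
   unfolding pc_regular[OF c o] ratio_at_def
   by (rule ballI, rule exI[of _ k], rule exI[of _ F], rule exI[of _ "L ^ k"]) (use 1 Lp in "auto simp: Dset_def")
 qed
 fix x W f assume x: "x : Dset X rh L" and W: "opn X W" "x : W" "f : regular X W"
 obtain H e where H: "form n e H" "x : Dset X rh H" "Dset X rh H <= W" using pc_basis[OF c W(1,2)] by blast
 obtain d F G where F: "form n d F" "form n d G" "ev G (rh x) ~= 0"
   "ALL y:W. ev G (rh y) ~= 0 --> f y = ev F (rh y) / ev G (rh y)"
  using W(2,3) unfolding pc_regular[OF c W(1)] ratio_at_def by blast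
 let ?a = "%x. ev (F * H) (rh x) / ev L (rh x) ^ (d + e)"
 let ?b = "%x. ev (G * H) (rh x) / ev L (rh x) ^ (d + e)"
 show "EX a:chart_alg n X rh L. EX b:chart_alg n X rh L. b x ~= 0 &
   (ALL y:Dset X rh L. b y ~= 0 --> y : W & f y = a y / b y)"
 proof (rule bexI[of _ ?a], rule bexI[of _ ?b], intro conjI ballI impI)
  show "?a : chart_alg n X rh L" "?b : chart_alg n X rh L"
   by (rule chart_algI[OF form_mult[OF F(1) H(1)]] chart_algI[OF form_mult[OF F(2) H(1)]]; simp)+
  show "?b x ~= 0" using F H x by (simp add: Dset_def)
  fix y assume y: "y : Dset X rh L" "?b y ~= 0"
  thus "y : W" using H by (auto simp: Dset_def)
  thus "f y = ?a y / ?b y" using y F by (auto simp: Dset_def)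
 qed
qed

lemmas characterD = character_def[THEN iffD1, THEN conjunct2, THEN bspec, THEN bspec]
lemmas character_const = character_def[THEN iffD1, THEN conjunct1, rule_format]
lemmas character_add = characterD[THEN conjunct1]
lemmas character_mult = characterD[THEN conjunct2, THEN conjunct1]
lemmas character_cong = characterD[THEN conjunct3, rule_format]

lemma character_sum:
 assumes "character X \<O> h" "fun_alg \<O>" "!!k. k : K ==> f k : \<O>"
 shows "h (%x. SUM k:K. f k x) = (SUM k:K. h (f k))"
 using assms(3)
proof (induction K rule: infinite_finite_induct)
 case (insert k K)
 have "h (%x. f k x + (SUM k:K. f k x)) = h (f k) + h (%x. SUM k:K. f k x)"
  using insert.prems by (intro character_add[OF assms(1)] fun_alg_sum[OF assms(2)]) auto
 thus ?case using insert by simp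
qed (use assms(1) in "auto simp: character_def")

lemma character_prod:
 assumes "character X \<O> h" "fun_alg \<O>" "!!k. k : K ==> f k : \<O>"
 shows "h (%x. PROD k:K. f k x) = (PROD k:K. h (f k))"
 using assms(3)
proof (induction K rule: infinite_finite_induct)
 case (insert k K)
 have "h (%x. f k x * (PROD k:K. f k x)) = h (f k) * h (%x. PROD k:K. f k x)"
  using insert.prems by (intro character_mult[OF assms(1)] fun_alg_prod[OF assms(2)]) auto
 thus ?case using insert by simp
qed (use assms(1) in "auto simp: character_def")

lemma character_power: "character X \<O> h ==> fun_alg \<O> ==> f : \<O> ==> h (%x. f x ^ k) = h f ^ k"
 using character_prod[of X \<O> h "{..<k}" "%_. f"] by simp

text \<open>Monomials divided by powers of \<open>L\<close> are a countable spanning family. The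
  values of a character on the ratios \<open>x_i / L\<close> form a vector with \<open>L = 1\<close>
  that kills every form vanishing on \<open>X\<close>; by closedness of \<open>X\<close> it
  represents a point.\<close>

lemma affine_chart:
 assumes c: "proj_coords n X rh" and L: "form n 1 L"
 shows "affine_alg (Dset X rh L) (chart_alg n X rh L)"
proof -
 let ?U = "Dset X rh L" and ?O = "chart_alg n X rh L"
 have alg: "fun_alg ?O" by (rule fun_alg_chart[OF L])
 \<comment> \<open>An enumeration of all monomials: a natural number is decoded to the list of
   exponents.\<close>
 define mo :: "nat => nat \<Rightarrow>\<^sub>0 nat" where
  "mo i = (SUM j<length (from_nat i :: nat list). sg j ((from_nat i :: nat list) ! j))" for i
 have mo: "EX i. mo i = m" for m
 proof -
  obtain b where b: "keys m <= {..<b}" using finite_nat_bounded finite_keys by blast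
  let ?l = "map (lk m) [0..<b]"
  have "mo (to_nat ?l) = (SUM j<b. sg j (lk m j))" by (simp add: mo_def)
  also have "... = m"
   using b by (intro poly_mapping_eqI) (auto simp: lookup_sum lookup_single when_def in_keys_iff)
  finally show ?thesis by blast
 qed
 let ?b = "%i x. mon (mo i) (rh x) / ev L (rh x) ^ mdeg (mo i)"
 have span: "in_span ?U ?b h" if h: "h : ?O" for h
 proof -
  obtain k F where 1: "form n k F" "ALL x:?U. h x = ev F (rh x) / ev L (rh x) ^ k"
   using h by (elim chart_algE)
  define ix where "ix m = (SOME i. mo i = m)" for m
  have ix: "mo (ix m) = m" for m unfolding ix_def using mo by (rule someI_ex)
  have inj: "inj_on ix (keys F)" by (rule inj_onI) (metis ix)
  have "h x = (SUM i:ix ` keys F. lk F (mo i) * ?b i x)" if "x : ?U" for x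
  proof -
   have "h x = (SUM m:keys F. lk F m * (mon m (rh x) / ev L (rh x) ^ mdeg m))"
    using 1 that by (simp add: eval_poly_def sum_divide_distrib form_iff flip: mon_def)
   thus ?thesis by (simp add: sum.reindex[OF inj] ix)
  qed
  thus ?thesis unfolding in_span_def
   by (intro exI[of _ "ix ` keys F"] exI[of _ "%i. lk F (mo i)"]) auto
 qed
 have char: "EX x:?U. ALL f:?O. h f = f x" if h: "character ?U ?O h" for h
 proof -
  let ?t = "%i x. ev (Xv i) (rh x) / ev L (rh x)"
  have t: "?t i : ?O" if "i <= n" for i by (rule chart_algI[OF form_X[OF that]]) auto
  \<comment> \<open>The default 0 beyond \<open>n\<close> makes \<open>v\<close> a vector of
    homogeneous coordinates of projective \<open>n\<close>-space.\<close>
  define v where "v i = (if i <= n then h (?t i) else 0)" for i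
  have hF: "h f = ev F v" if F: "form n k F" and f: "f : ?O"
   "ALL x:?U. f x = ev F (rh x) / ev L (rh x) ^ k" for f F k
  proof -
   let ?p = "%m x. PROD j:keys m. ?t j x ^ lk m j"
   have p: "?p m : ?O" "h (?p m) = mon m v" if m: "m : keys F" for m
   proof -
    have mk: "j <= n" if "j : keys m" for j using F m that by (auto simp: form_iff)
    show "?p m : ?O" by (intro fun_alg_prod[OF alg] fun_alg_power[OF alg] t mk)
    have "h (?p m) = (PROD j:keys m. h (%x. ?t j x ^ lk m j))"
     by (rule character_prod[OF h alg]) (intro fun_alg_power[OF alg] t mk)
    also have "... = (PROD j:keys m. h (?t j) ^ lk m j)"
     by (intro prod.cong refl character_power[OF h alg t] mk)
    finally show "h (?p m) = mon m v" using mk by (simp add: mon_def v_def)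
   qed
   let ?g = "%x. SUM m:keys F. (%_. lk F m) x * ?p m x"
   have gO: "?g : ?O" by (intro fun_alg_sum[OF alg] fun_alg_mult[OF alg] fun_alg_const[OF alg] p)
   have "h f = h ?g"
   proof (rule character_cong[OF h f(1) gO])
    fix x assume x: "x : ?U"
    have "lk F m * ?p m x = lk F m * mon m (rh x) / ev L (rh x) ^ k"
     if m: "m : keys F" for m
    proof -
     have "?p m x = mon m (rh x) / ev L (rh x) ^ mdeg m"
      by (simp add: mon_def mdeg_def power_divide prod_dividef power_sum)
     thus ?thesis using F m by (simp add: form_iff)
    qed
    thus "f x = ?g x" using f(2) x by (simp add: eval_poly_def sum_divide_distrib mon_def)
   qed
   also have "h ?g = (SUM m:keys F. h (%x. (%_. lk F m) x * ?p m x))"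
    by (rule character_sum[OF h alg]) (intro fun_alg_mult[OF alg] fun_alg_const[OF alg] p)
   also have "... = (SUM m:keys F. lk F m * mon m v)"
   proof (rule sum.cong[OF refl])
    fix m assume m: "m : keys F"
    have "h (%x. (%_. lk F m) x * ?p m x) = h (%_. lk F m) * h (?p m)"
     by (rule character_mult[OF h fun_alg_const[OF alg] p(1)[OF m]])
    thus "h (%x. (%_. lk F m) x * ?p m x) = lk F m * mon m v"
     using p(2)[OF m] character_const[OF h] by simp
   qed
   also have "... = ev F v" by (simp add: eval_poly_def mon_def)
   finally show ?thesis .
  qed
  have "h (%_. 1) = ev L v"
   by (rule hF[OF L fun_alg_const[OF alg]]) (auto simp: Dset_def)
  hence Lv: "ev L v = 1" using character_const[OF h] by simp
  have "v ~= (%_. 0)"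
   using Lv form_scale[OF L, of 0 v] by auto
  hence vh: "v : homog_coords n" by (auto simp: homog_coords_def v_def)
  have "EX x:points X. EX c. c ~= 0 & v = (%i. c * rh x i)"
  proof (rule pc_closed[OF c vh])
   fix d F assume F: "form n d F" "!!x. x : points X ==> ev F (rh x) = 0"
   have "h (%_. 0) = ev F v"
    by (rule hF[OF F(1) fun_alg_const[OF alg]]) (use F(2) in "auto simp: Dset_def")
   thus "ev F v = 0" using character_const[OF h] by simp
  qed
  then obtain x a where x: "x : points X" "a ~= 0" "v = (%i. a * rh x i)" by blast
  have La: "a * ev L (rh x) = 1" using Lv form_scale[OF L, of a "rh x"] x by simp
  have xU: "x : ?U" using La x by (auto simp: Dset_def)
  have "h f = f x" if f: "f : ?O" for f
  proof -
   obtain k F where 1: "form n k F" "ALL x:?U. f x = ev F (rh x) / ev L (rh x) ^ k"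
    using f by (elim chart_algE)
   have "h f = a ^ k * ev F (rh x)" using hF[OF 1(1) f 1(2)] form_scale[OF 1(1)] x by simp
   also have "a = 1 / ev L (rh x)" using La by (metis eq_divide_eq mult_zero_right zero_neq_one)
   finally show ?thesis using 1(2) xU by (simp add: power_divide)
  qed
  with xU show ?thesis by blast
 qed
 show ?thesis unfolding affine_alg_def using alg span char by blast
qed

subsection \<open>The projective Nullstellensatz\<close>

text \<open>The graded pieces of the homogeneous ideal generated by \<open>J\<close>. Degrees are
  carried along because the zero polynomial has every degree.\<close>

inductive_set hideal :: "nat => (nat \<times> cpoly) set => (nat \<times> cpoly) set" for n J where
 hid_0: "(D, 0) : hideal n J"
| hid_add: "(D, G) : hideal n J ==> (d, F) : J ==> form n e Q ==> D = d + e ==> (D, G + F * Q) : hideal n J"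

lemma hideal_plus:
 assumes "(D, G') : hideal n J" "(D, G) : hideal n J"
 shows "(D, G + G') : hideal n J"
 using assms
proof (induction D G')
 case (hid_add D G' d F e Q)
 thus ?case using hideal.hid_add[of D "G + G'" n J d F e Q] by (simp add: add.assoc)
qed auto

lemma hideal_mult:
 assumes "(D, G) : hideal n J" "form n k R"
 shows "(D + k, G * R) : hideal n J"
 using assms
proof (induction D G)
 case (hid_add D G d F e Q)
 thus ?case using hideal.hid_add[of "D + k" "G * R" n J d F "e + k" "Q * R"] form_mult[of n e Q k R]
  by (simp add: distrib_right mult.assoc)
qed (auto intro: hid_0)

lemma hideal_sum:
 assumes "!!k. k : K ==> (D, G k) : hideal n J"
 shows "(D, SUM k:K. G k) : hideal n J"
 using assms by (induction K rule: infinite_finite_induct) (auto intro: hid_0 hideal_plus simp: add.commute)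

lemma hideal_single: "(d, F) : J ==> form n e Q ==> D = d + e ==> (D, F * Q) : hideal n J"
 using hid_add[OF hid_0, of d F J n e Q] by simp

text \<open>On the chart where \<open>x_j\<close> is nonzero the dehomogenised generators have no
  common zero, so they generate 1; homogenising this identity expresses a power of
  \<open>x_j\<close>.\<close>

lemma proj_nullstellensatz_chart:
 assumes c: "proj_coords n X rh" and J: "!!d F. (d, F) : J ==> form n d F"
  and nz: "!!x. x : points X ==> EX (d, F):J. ev F (rh x) ~= 0" and j: "j <= n"
 shows "EX N G. (N, G) : hideal n J & N > 0 & (ALL x:points X. rh x j ^ N = ev G (rh x))"
proof -
 let ?L = "Xv j"
 let ?U = "Dset X rh ?L" and ?O = "chart_alg n X rh ?L"
 have L: "form n 1 ?L" by (rule form_X[OF j])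
 have Lp: "form n m (?L ^ m)" for m using form_power[OF L, of m] by simp
 have U: "x : ?U \<longleftrightarrow> x : points X & rh x j ~= 0" for x by (auto simp: Dset_def)
 let ?J = "{%x. ev F (rh x) / rh x j ^ d | d F. (d, F) : J}"
 have JO: "?J <= ?O" using J by (auto intro!: chart_algI)
 have nzJ: "EX f:?J. f x ~= 0" if x: "x : ?U" for x
 proof -
  obtain d F where "(d, F) : J" "ev F (rh x) ~= 0" using nz[of x] x by (auto simp: U)
  thus ?thesis using x by (intro bexI[of _ "%x. ev F (rh x) / rh x j ^ d"]) (auto simp: U)
 qed
 have "EX m f g. (ALL k<(m::nat). f k : ?J & g k : ?O) & (ALL x:?U. (SUM k<m. f k x * g k x) = 1)"
  by (rule nullstellensatz[OF affine_chart[OF c L] JO nzJ])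
 then obtain m f g where
  fg: "ALL k<(m::nat). f k : ?J & g k : ?O" and one: "ALL x:?U. (SUM k<m. f k x * g k x) = 1"
  by (elim exE conjE)
 have "EX d F. (d, F) : J & f k = (%x. ev F (rh x) / rh x j ^ d)" if "k < m" for k
  using fg[rule_format, OF that] by (elim conjE CollectE exE) (intro exI conjI)
 hence "ALL k<m. EX d F. (d, F) : J & f k = (%x. ev F (rh x) / rh x j ^ d)" by blast
 then obtain d where "ALL k<m. EX F. (d k, F) : J & f k = (%x. ev F (rh x) / rh x j ^ d k)" by metis
 then obtain F where F: "!!k. k < m ==> (d k, F k) : J & f k = (%x. ev (F k) (rh x) / rh x j ^ d k)" by metis
 have "EX e Q. form n e Q & (ALL x:?U. g k x = ev Q (rh x) / rh x j ^ e)" if "k < m" for k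
  using fg[rule_format, OF that] by (elim conjE chart_algE) (auto intro!: exI)
 hence "ALL k<m. EX e Q. form n e Q & (ALL x:?U. g k x = ev Q (rh x) / rh x j ^ e)" by blast
 then obtain e where "ALL k<m. EX Q. form n (e k) Q & (ALL x:?U. g k x = ev Q (rh x) / rh x j ^ e k)" by metis
 then obtain Q where Q: "!!k. k < m ==> form n (e k) (Q k) & (ALL x:?U. g k x = ev (Q k) (rh x) / rh x j ^ e k)" by metis
 \<comment> \<open>One more than needed to clear denominators: the spare factor makes both sides
   vanish where \<open>x_j = 0\<close>, so the identity holds on all of \<open>X\<close>.\<close>
 define N where "N = Suc (SUM k<m. d k + e k)"
 have N: "d k + e k < N" if "k < m" for k
  unfolding N_def using member_le_sum[of k "{..<m}" "%k. d k + e k"] that by simp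
 let ?G = "SUM k<m. F k * (Q k * ?L ^ (N - d k - e k))"
 have "(N, ?G) : hideal n J"
 proof (intro hideal_sum)
  fix k assume "k : {..<m}"
  hence k: "k < m" by simp
  show "(N, F k * (Q k * ?L ^ (N - d k - e k))) : hideal n J"
   by (rule hideal_single[of "d k"]) (use F[OF k] Q[OF k] N[OF k] Lp in "auto intro: form_mult")
 qed
 moreover have "rh x j ^ N = ev ?G (rh x)" if x: "x : points X" for x
 proof (cases "rh x j = 0")
  case True
  have "(SUM k<m. ev (F k) (rh x) * (ev (Q k) (rh x) * rh x j ^ (N - d k - e k))) = 0"
  proof (intro sum.neutral ballI)
   fix k assume "k : {..<m}"
   hence "N - d k - e k ~= 0" using N[of k] by simp
   thus "ev (F k) (rh x) * (ev (Q k) (rh x) * rh x j ^ (N - d k - e k)) = 0"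
    using True by simp
  qed
  moreover have "rh x j ^ N = 0" using True by (simp add: N_def)
  ultimately show ?thesis by simp
 next
  case False
  hence xU: "x : ?U" using x U by simp
  have "rh x j ^ N = (SUM k<m. rh x j ^ N * (f k x * g k x))" using one xU by (simp flip: sum_distrib_left)
  also have "... = (SUM k<m. ev (F k) (rh x) * (ev (Q k) (rh x) * rh x j ^ (N - d k - e k)))"
  proof (rule sum.cong[OF refl])
   fix k assume "k : {..<m}"
   hence k: "k < m" by simp
   have "rh x j ^ N = rh x j ^ (N - d k - e k) * (rh x j ^ d k * rh x j ^ e k)"
    using N[OF k] by (simp flip: power_add)
   thus "rh x j ^ N * (f k x * g k x) = ev (F k) (rh x) * (ev (Q k) (rh x) * rh x j ^ (N - d k - e k))"
    using F[OF k] Q[OF k] xU False by simp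
  qed
  finally show ?thesis by simp
 qed
 ultimately show ?thesis by (intro exI[of _ N] exI[of _ ?G]) (auto simp: N_def)
qed

text \<open>In degree \<open>D = N_0 + ... + N_n\<close> every monomial contains some
  \<open>x_j\<close> at least \<open>N_j\<close> times, and this power of \<open>x_j\<close> lies in
  the ideal on \<open>X\<close>.\<close>

theorem proj_nullstellensatz:
 assumes c: "proj_coords n X rh" and J: "!!d F. (d, F) : J ==> form n d F"
  and nz: "!!x. x : points X ==> EX (d, F):J. ev F (rh x) ~= 0"
 shows "EX D. ALL E. form n D E --> (EX G. (D, G) : hideal n J & (ALL x:points X. ev E (rh x) = ev G (rh x)))"
proof -
 have "ALL j. EX N. EX G. j <= n --> (N, G) : hideal n J & N > 0 & (ALL x:points X. rh x j ^ N = ev G (rh x))"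
  using proj_nullstellensatz_chart[OF c J nz] by blast
 then obtain N where "ALL j. EX G. j <= n --> (N j, G) : hideal n J & N j > 0 & (ALL x:points X. rh x j ^ N j = ev G (rh x))"
  unfolding choice_iff by blast
 then obtain G where NG: "!!j. j <= n ==> (N j, G j) : hideal n J & N j > 0 & (ALL x:points X. rh x j ^ N j = ev (G j) (rh x))"
  unfolding choice_iff by blast
 define D where "D = (SUM j<=n. N j)"
 have mono: "EX H. (D, H) : hideal n J & (ALL x:points X. c * mon m (rh x) = ev H (rh x))"
  if m: "keys m <= {..n}" "mdeg m = D" for m c
 proof -
  have "EX j<=n. N j <= lk m j"
  proof (rule ccontr)
   assume "~ ?thesis"
   hence "(SUM j<=n. lk m j) < (SUM j<=n. N j)" by (intro sum_strict_mono) auto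
   moreover have "mdeg m = (SUM j<=n. lk m j)" using m by (intro mdeg_superset) auto
   ultimately show False using m by (simp add: D_def)
  qed
  then obtain j where j: "j <= n" "N j <= lk m j" by blast
  let ?m = "m - sg j (N j)"
  have mm: "m = sg j (N j) + ?m"
   using j by (intro poly_mapping_eqI) (auto simp: lookup_add lookup_minus lookup_single when_def)
  have "mdeg m = N j + mdeg ?m" by (subst mm) (simp add: mdeg_add)
  moreover have "keys ?m <= {..n}" using m(1) mm keys_add_nat by (metis le_sup_iff)
  ultimately have f: "form n (D - N j) (sg ?m c)" "N j <= D"
   using m by (auto intro!: form_single)
  have "(N j + (D - N j), G j * sg ?m c) : hideal n J"
   by (rule hideal_mult) (use NG[OF j(1)] f in auto)
  moreover have "c * mon m (rh x) = ev (G j * sg ?m c) (rh x)" if "x : points X" for x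
   by (subst mm) (use NG[OF j(1)] that in "simp add: mon_add")
  ultimately show ?thesis using f(2) by auto
 qed
 have "EX H. (D, H) : hideal n J & (ALL x:points X. ev E (rh x) = ev H (rh x))" if E: "form n D E" for E
 proof -
  have "ALL m. EX H. m : keys E --> (D, H) : hideal n J &
    (ALL x:points X. lk E m * mon m (rh x) = ev H (rh x))"
   using mono E by (metis form_iff)
  then obtain H where H: "!!m. m : keys E ==> (D, H m) : hideal n J &
    (ALL x:points X. lk E m * mon m (rh x) = ev (H m) (rh x))"
   unfolding choice_iff by blast
  show ?thesis
   by (intro exI[of _ "SUM m:keys E. H m"] conjI hideal_sum ballI)
    (use H in "auto simp: eval_poly_def[of E] simp flip: mon_def")
 qed
 thus ?thesis by blast
qed

definition monomials :: "nat => nat => (nat \<Rightarrow>\<^sub>0 nat) set" where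
 "monomials n D = {m. keys m <= {..n} & mdeg m = D}"

lemma finite_monomials: "finite (monomials n D)"
proof -
 let ?f = "%m. map (lk m) [0..<Suc n]"
 have "inj_on ?f (monomials n D)"
 proof (rule inj_onI, rule poly_mapping_eqI)
  fix m m' k assume m: "m : monomials n D" "m' : monomials n D" "?f m = ?f m'"
  show "lk m k = lk m' k"
  proof (cases "k <= n")
   case True
   from m(3) have "?f m ! k = ?f m' ! k" by (rule arg_cong)
   with True show ?thesis by (simp del: upt_Suc)
  next
   case False
   hence "k ~: keys m" "k ~: keys m'" using m(1,2) by (auto simp: monomials_def)
   thus ?thesis by (simp add: in_keys_iff)
  qed
 qed
 moreover have "?f ` monomials n D <= {xs. set xs <= {..D} & length xs = Suc n}"
  using lookup_le_mdeg by (fastforce simp: monomials_def)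
 hence "finite (?f ` monomials n D)"
  using finite_lists_length_eq[of "{..D}" "Suc n"] finite_subset by blast
 ultimately show ?thesis using finite_imageD by blast
qed

lemma form_monomials: "form n D E ==> ev E v = (SUM m:monomials n D. lk E m * mon m v)"
 by (rule eval_superset[OF finite_monomials]) (auto simp: form_iff monomials_def)

lemma monomials_nonzero:
 assumes "v : homog_coords n"
 shows "EX m:monomials n D. mon m v ~= 0"
proof -
 obtain j where j: "v j ~= 0" "j <= n" using assms by (auto simp: homog_coords_def fun_eq_iff) (meson not_le_imp_less)
 thus ?thesis
  by (intro bexI[of _ "sg j D"]) (auto simp: monomials_def)
qed

text \<open>A global regular function \<open>h\<close> multiplies the forms of some large degree into themselves, so every
  value of \<open>h\<close> is an eigenvalue of one constant matrix.\<close>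

lemma regular_finite_values:
 assumes c: "proj_coords n X rh" and h: "h : regular X (points X)"
 shows "finite (h ` points X)"
proof -
 \<comment> \<open>The admissible denominators of \<open>h\<close>, with the relation cleared to
   hold on all of \<open>X\<close>; squaring a local denominator achieves this.\<close>
 let ?J = "{(d, G). form n d G & (EX F. form n d F & (ALL x:points X. ev G (rh x) * h x = ev F (rh x)))}"
 have "EX (d, F):?J. ev F (rh x) ~= 0" if x: "x : points X" for x
 proof -
  obtain d F G where F: "form n d F" "form n d G" "ev G (rh x) ~= 0"
   "ALL y:points X. ev G (rh y) ~= 0 --> h y = ev F (rh y) / ev G (rh y)"
   using h x unfolding pc_regular[OF c points_open] ratio_at_def by blast
  have "(d + d, G * G) : ?J"
   using F form_mult[OF F(2,2)] form_mult[OF F(2,1)] by (auto intro!: exI[of _ "G * F"])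
  with F(3) show ?thesis by (intro bexI[of _ "(d + d, G * G)"]) auto
 qed
 with proj_nullstellensatz[OF c, of ?J] obtain D where D: "!!E. form n D E ==>
   EX G. (D, G) : hideal n ?J & (ALL x:points X. ev E (rh x) = ev G (rh x))" by blast
 have hid: "EX F. form n D F & (ALL x:points X. ev G (rh x) * h x = ev F (rh x))"
  if "(D, G) : hideal n ?J" for D G
  using that
 proof induction
  case (hid_add D G d F e Q)
  then obtain F1 F2 where "form n D F1" "ALL x:points X. ev G (rh x) * h x = ev F1 (rh x)"
   "form n d F2" "ALL x:points X. ev F (rh x) * h x = ev F2 (rh x)" by blast
  thus ?case using hid_add(3,4)
   by (intro exI[of _ "F1 + F2 * Q"]) (auto intro!: form_add form_mult simp: algebra_simps)
 qed (auto intro!: exI[of _ 0])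
 let ?M = "monomials n D"
 have fin: "finite ?M" by (rule finite_monomials)
 have "ALL m. EX F. m : ?M --> form n D F & (ALL x:points X. mon m (rh x) * h x = ev F (rh x))"
 proof
  fix m
  show "EX F. m : ?M --> form n D F & (ALL x:points X. mon m (rh x) * h x = ev F (rh x))"
  proof (cases "m : ?M")
   case True
   hence "form n D (sg m 1)" by (auto intro: form_single simp: monomials_def)
   then obtain G where G: "(D, G) : hideal n ?J" "ALL x:points X. ev (sg m 1) (rh x) = ev G (rh x)"
    using D by blast
   obtain F where "form n D F" "ALL x:points X. ev G (rh x) * h x = ev F (rh x)" using hid[OF G(1)] by blast
   with G(2) show ?thesis by auto
  qed auto
 qed
 then obtain F where F: "!!m. m : ?M ==> form n D (F m) & (ALL x:points X. mon m (rh x) * h x = ev (F m) (rh x))"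
  unfolding choice_iff by blast
 define A where "A m m' = lk (F m) m'" for m m'
 have A: "mon m (rh x) * h x = (SUM m':?M. A m m' * mon m' (rh x))" if "m : ?M" "x : points X" for m x
  using F[OF that(1)] that form_monomials[of n D "F m" "rh x"] unfolding A_def by simp
 \<comment> \<open>The powers of the matrix \<open>A\<close> by which \<open>h\<close> multiplies
   the monomials of degree \<open>D\<close>.\<close>
 define T where "T = rec_nat (%m m'. if m = m' then 1 else 0) (%_ t m m'. SUM l:?M. t m l * A l m')"
 have T: "mon m (rh x) * h x ^ k = (SUM m':?M. T k m m' * mon m' (rh x))" if m: "m : ?M" and x: "x : points X" for m x k
 proof (induction k)
  case 0
  have "(SUM m':?M. (if m = m' then 1 else 0) * mon m' (rh x)) = (SUM m':?M. if m = m' then mon m' (rh x) else 0)"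
   by (rule sum.cong) auto
  thus ?case using m fin by (simp add: T_def)
 next
  case (Suc k)
  have "mon m (rh x) * h x ^ Suc k = (SUM l:?M. T k m l * (mon l (rh x) * h x))"
  proof -
   have "mon m (rh x) * h x ^ Suc k = (mon m (rh x) * h x ^ k) * h x" by simp
   thus ?thesis unfolding Suc by (simp add: sum_distrib_right mult.assoc)
  qed
  also have "... = (SUM l:?M. T k m l * (SUM m':?M. A l m' * mon m' (rh x)))"
   using A x by (intro sum.cong) auto
  also have "... = (SUM m':?M. (SUM l:?M. T k m l * A l m') * mon m' (rh x))"
   unfolding sum_distrib_left sum_distrib_right by (subst sum.swap) (simp add: mult.assoc)
  finally show ?case by (simp add: T_def)
 qed
 \<comment> \<open>One more power than the matrix has entries, so some nontrivial combination of
   powers of \<open>A\<close> is zero.\<close>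
 let ?K = "{..card (?M \<times> ?M)}"
 obtain q where q: "EX k:?K. q k ~= 0" "ALL p:?M \<times> ?M. (SUM k:?K. q k * T k (fst p) (snd p)) = 0"
  using linear_dependence[of "?M \<times> ?M" ?K "%k p. T k (fst p) (snd p)"] fin by auto
 define P where "P = (SUM k:?K. Polynomial.monom (q k) k)"
 have "P ~= 0"
 proof -
  obtain k where "k : ?K" "q k ~= 0" using q(1) by blast
  hence "coeff P k ~= 0" by (simp add: P_def coeff_sum)
  thus ?thesis by auto
 qed
 have "poly P (h x) = 0" if x: "x : points X" for x
 proof -
  obtain m where m: "m : ?M" "mon m (rh x) ~= 0" using monomials_nonzero[OF pc_homog[OF c x]] by blast
  have "mon m (rh x) * poly P (h x) = (SUM k:?K. q k * (mon m (rh x) * h x ^ k))"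
   by (simp add: P_def poly_sum poly_monom sum_distrib_left algebra_simps)
  also have "... = (SUM k:?K. q k * (SUM m':?M. T k m m' * mon m' (rh x)))"
   using T[OF m(1) x] by simp
  also have "... = (SUM m':?M. (SUM k:?K. q k * T k m m') * mon m' (rh x))"
   unfolding sum_distrib_left sum_distrib_right by (subst sum.swap) (simp add: mult.assoc)
  also have "... = 0" using q(2) m(1) by simp
  finally show ?thesis using m by simp
 qed
 hence "h ` points X <= {z. poly P z = 0}" by auto
 thus ?thesis using poly_roots_finite[OF \<open>P ~= 0\<close>] finite_subset by blast
qed


subsection \<open>Completeness\<close>

text \<open>Forms of degree \<open>d\<close> in the coordinates of projective space whose
  coefficients are regular functions of a parameter in \<open>V\<close>.\<close>

inductive_set fam :: "nat => 'z fspace => 'z set => (nat \<times> ((nat => complex) => 'z => complex)) set" for n Z V where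
 fam_base: "form n d F ==> b : regular Z V ==> (d, %v z. ev F v * b z) : fam n Z V"
| fam_add: "(d, R) : fam n Z V ==> (d, R') : fam n Z V ==> (d, %v z. R v z + R' v z) : fam n Z V"

lemma fam_mult:
 assumes "(d, R) : fam n Z V" "form n e Q"
 shows "(d + e, %v z. R v z * ev Q v) : fam n Z V"
 using assms
proof (induction d R)
 case (fam_base d F b)
 thus ?case using fam.fam_base[OF form_mult[OF fam_base(1) fam_base(3)] fam_base(2)] by (simp add: mult_ac)
next
 case (fam_add d R R')
 thus ?case using fam.fam_add by (simp add: distrib_right)
qed

lemma fam_restrict:
 assumes "(d, R) : fam n Z V" "fspace Z" "opn Z V" "opn Z V'" "V' <= V"
 shows "(d, R) : fam n Z V'"
 using assms(1) by induction (auto intro: fam.intros fs_restrict[OF assms(2-5)])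

lemma fam_coeffs:
 assumes "(d, R) : fam n Z V" "fspace Z" "opn Z V"
 shows "EX c. (ALL m. c m : regular Z V) & (ALL v z. R v z = (SUM m:monomials n d. c m z * mon m v))"
 using assms(1)
proof induction
 case (fam_base d F b)
 have "(%z. lk F m * b z) : regular Z V" for m
  by (rule fun_alg_cmult[OF fs_alg[OF assms(2,3)] fam_base(2)])
 thus ?case using form_monomials[OF fam_base(1)]
  by (intro exI[of _ "%m z. lk F m * b z"]) (simp add: sum_distrib_left sum_distrib_right mult_ac)
next
 case (fam_add d R R')
 then obtain c c' where c: "ALL m. c m : regular Z V" "ALL v z. R v z = (SUM m:monomials n d. c m z * mon m v)"
  "ALL m. c' m : regular Z V" "ALL v z. R' v z = (SUM m:monomials n d. c' m z * mon m v)" by (elim exE conjE)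
 thus ?case using fs_add[OF assms(2,3)]
  by (intro exI[of _ "%m z. c m z + c' m z"]) (simp add: sum.distrib distrib_right)
qed

text \<open>Describes open subsets of \<open>X \<times> Z\<close> by polynomial families homogeneous
  in the first factor, so that elimination can be applied to their complements.\<close>

lemma fam_basis:
 assumes c: "proj_coords n X rh" and Z: "fspace Z" and S: "opn (X \<times>\<^sub>v Z) S" "(x, z0) : S"
 shows "EX d V R. opn Z V & z0 : V & (d, R) : fam n Z V & R (rh x) z0 ~= 0 &
  (ALL x':points X. ALL z:V. R (rh x') z ~= 0 --> (x', z) : S)"
proof -
 note X = pc_fspace[OF c]
 obtain U V h where h: "opn X U" "opn Z V" "h : tens (regular X U) (regular Z V)"
  "(x, z0) : U \<times> V" "h (x, z0) ~= 0" "ALL w:U \<times> V. h w ~= 0 --> w : S"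
  by (rule openin_prodE[OF X Z S])
 have "EX e q R. form n e q & ev q (rh x) ~= 0 & (e, R) : fam n Z V &
   (ALL x':points X. ev q (rh x') ~= 0 --> x' : U & (ALL z:V. h (x', z) * ev q (rh x') = R (rh x') z))"
  using h(3)
 proof induction
  case (tens_base a b)
  have x: "x : U" using h(4) by simp
  obtain H e where H: "form n e H" "x : Dset X rh H" "Dset X rh H <= U" using pc_basis[OF c h(1) x] by blast
  obtain d F G where F: "form n d F" "form n d G" "ev G (rh x) ~= 0"
   "ALL y:U. ev G (rh y) ~= 0 --> a y = ev F (rh y) / ev G (rh y)"
   using tens_base(1) x unfolding pc_regular[OF c h(1)] ratio_at_def by blast
  show ?case
  proof (rule exI[of _ "d + e"], rule exI[of _ "G * H"], rule exI[of _ "%v z. ev (F * H) v * b z"], intro conjI ballI impI)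
   show "form n (d + e) (G * H)" by (intro form_mult F H)
   show "ev (G * H) (rh x) ~= 0" using F H by (simp add: Dset_def)
   show "(d + e, %v z. ev (F * H) v * b z) : fam n Z V" by (intro fam.fam_base form_mult F H tens_base)
   fix x' assume x': "x' : points X" "ev (G * H) (rh x') ~= 0"
   thus "x' : U" using H by (auto simp: Dset_def)
   thus "a (fst (x', z)) * b (snd (x', z)) * ev (G * H) (rh x') = ev (F * H) (rh x') * b z" for z
    using F(4) x' by simp
  qed
 next
  case (tens_add f g)
  obtain e q R where 1: "form n e q" "ev q (rh x) ~= 0" "(e, R) : fam n Z V"
   "ALL x':points X. ev q (rh x') ~= 0 --> x' : U & (ALL z:V. f (x', z) * ev q (rh x') = R (rh x') z)"
   using tens_add.IH(1) by (elim exE conjE)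
  obtain e' q' R' where 2: "form n e' q'" "ev q' (rh x) ~= 0" "(e', R') : fam n Z V"
   "ALL x':points X. ev q' (rh x') ~= 0 --> x' : U & (ALL z:V. g (x', z) * ev q' (rh x') = R' (rh x') z)"
   using tens_add.IH(2) by (elim exE conjE)
  show ?case
  proof (rule exI[of _ "e + e'"], rule exI[of _ "q * q'"], rule exI[of _ "%v z. R v z * ev q' v + R' v z * ev q v"], intro conjI ballI impI)
   show "form n (e + e') (q * q')" by (intro form_mult 1 2)
   show "ev (q * q') (rh x) ~= 0" using 1 2 by simp
   show "(e + e', %v z. R v z * ev q' v + R' v z * ev q v) : fam n Z V"
    using fam.fam_add[OF fam_mult[OF 1(3) 2(1)]] fam_mult[OF 2(3) 1(1)] by (simp add: add.commute)
   fix x' assume x': "x' : points X" "ev (q * q') (rh x') ~= 0"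
   thus "x' : U" using 1 by auto
   fix z assume z: "z : V"
   have "f (x', z) * ev q (rh x') = R (rh x') z" "g (x', z) * ev q' (rh x') = R' (rh x') z"
    using 1(4) 2(4) x' z by auto
   thus "(f (x', z) + g (x', z)) * ev (q * q') (rh x') =
     R (rh x') z * ev q' (rh x') + R' (rh x') z * ev q (rh x')"
    by (simp add: algebra_simps)
  qed
 qed
 then obtain e q R where 1: "form n e q" "ev q (rh x) ~= 0" "(e, R) : fam n Z V"
   "ALL x':points X. ev q (rh x') ~= 0 --> x' : U & (ALL z:V. h (x', z) * ev q (rh x') = R (rh x') z)"
  by (elim exE conjE)
 have x: "x : points X" using openin_subset[OF h(1)] h(4) by auto
 have "R (rh x) z0 ~= 0" using 1(2,4) x h(4,5) by fastforce
 moreover have "(x', z) : S" if "x' : points X" "z : V" "R (rh x') z * ev q (rh x') ~= 0" for x' z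
  using 1(4) that h(6) by fastforce
 ultimately show ?thesis using h(2,4) fam_mult[OF 1(3,1)] 1(2)
  by (intro exI[of _ "e + e"] exI[of _ V] exI[of _ "%v z. R v z * ev q v"]) auto
qed

text \<open>Elimination theory. Over a point \<open>z0\<close> outside the image the equations have
  no common zero, so their ideal contains all forms of some degree \<open>D\<close> on
  \<open>X\<close>. The relations expressing this deform with \<open>z\<close> and, near
  \<open>z0\<close>, still force all monomials of degree \<open>D\<close> to vanish at a point of
  \<open>C\<close>, which is impossible.\<close>

theorem completeness:
 assumes c: "proj_coords n X rh" and Z: "fspace Z" and C: "cls (X \<times>\<^sub>v Z) C"
 shows "cls Z (snd ` C)"
proof -
 note X = pc_fspace[OF c]
 have Cs: "C <= points X \<times> points Z" using closedin_subset[OF C] by (simp add: points_prod[OF X Z])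
 have oC: "opn (X \<times>\<^sub>v Z) (points X \<times> points Z - C)"
  using C by (simp add: closedin_def points_prod[OF X Z])
 have "opn Z (points Z - snd ` C)"
 proof (subst openin_subopen, intro ballI)
  fix z0 assume z0: "z0 : points Z - snd ` C"
  \<comment> \<open>A family that vanishes on \<open>C\<close> over \<open>V\<close> and specialises
    to the form \<open>F\<close> at \<open>z0\<close>.\<close>
  define good where "good V d R F \<longleftrightarrow> opn Z V & z0 : V & (d, R) : fam n Z V & form n d F &
    (ALL v. R v z0 = ev F v) & (ALL x z. (x, z) : C --> z : V --> R (rh x) z = 0)" for V d R F
  let ?J = "{(d, F). EX V R. good V d R F}"
  have fam_form: "EX F. form n d F & (ALL v. R v z0 = ev F v)" if "(d, R) : fam n Z V" for d R V
   using that
  proof induction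
   case (fam_base d F b)
   thus ?case by (intro exI[of _ "const_poly (b z0) * F"]) (auto intro: form_cmult)
  next
   case (fam_add d R R')
   then obtain F F' where "form n d F" "form n d F'" "ALL v. R v z0 = ev F v" "ALL v. R' v z0 = ev F' v" by blast
   thus ?case by (intro exI[of _ "F + F'"]) (auto intro: form_add)
  qed
  have "EX (d, F):?J. ev F (rh x) ~= 0" if x: "x : points X" for x
  proof -
   have "(x, z0) : points X \<times> points Z - C" using x z0 by force
   from fam_basis[OF c Z oC this] obtain d V R where R: "opn Z V" "z0 : V" "(d, R) : fam n Z V"
    "R (rh x) z0 ~= 0" "ALL x':points X. ALL z:V. R (rh x') z ~= 0 --> (x', z) : points X \<times> points Z - C"
    by (elim exE conjE)
   obtain F where F: "form n d F" "ALL v. R v z0 = ev F v" using fam_form[OF R(3)] by blast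
   have "good V d R F" unfolding good_def using R F Cs by fastforce
   thus ?thesis using R(4) F(2) by (intro bexI[of _ "(d, F)"]) auto
  qed
  with proj_nullstellensatz[OF c, of ?J] obtain D where D: "!!E. form n D E ==>
   EX G. (D, G) : hideal n ?J & (ALL x:points X. ev E (rh x) = ev G (rh x))"
   unfolding good_def by blast
  have hid: "EX V R. good V D R G" if "(D, G) : hideal n ?J" for D G
   using that
  proof induction
   case (hid_0 D)
   have "good (points Z) D (%v z. ev 0 v * (%_. 0) z) 0"
    unfolding good_def using z0 by (auto intro!: fam_base[of n D 0 "%_. 0", simplified] fs_const[OF Z])
   thus ?case by blast
  next
   case (hid_add D G d F e Q)
   then obtain V R V' R' where g: "good V D R G" "good V' d R' F" by blast
   let ?V = "V Int V'"
   have o: "opn Z ?V" using g unfolding good_def by blast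
   have 1: "(D, R) : fam n Z ?V" "(d, R') : fam n Z ?V"
    using g o unfolding good_def by (auto intro!: fam_restrict[OF _ Z _ o])
   have "(D, %v z. R v z + R' v z * ev Q v) : fam n Z ?V"
    using fam_add[OF 1(1)] fam_mult[OF 1(2) hid_add(3)] hid_add(4) by simp
   moreover have "form n D (G + F * Q)" using g hid_add(3,4) unfolding good_def by (auto intro: form_add form_mult)
   ultimately have "good ?V D (%v z. R v z + R' v z * ev Q v) (G + F * Q)"
    using g o unfolding good_def by auto
   thus ?case by blast
  qed
  let ?M = "monomials n D"
  have fin: "finite ?M" by (rule finite_monomials)
  have "ALL l. EX G. l : ?M --> (D, G) : hideal n ?J & (ALL x:points X. mon l (rh x) = ev G (rh x))"
  proof
   fix l
   show "EX G. l : ?M --> (D, G) : hideal n ?J & (ALL x:points X. mon l (rh x) = ev G (rh x))"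
   proof (cases "l : ?M")
    case True
    hence "form n D (sg l 1)" by (auto intro: form_single simp: monomials_def)
    from D[OF this] show ?thesis by auto
   qed auto
  qed
  then obtain G where G: "!!l. l : ?M ==> (D, G l) : hideal n ?J & (ALL x:points X. mon l (rh x) = ev (G l) (rh x))"
   unfolding choice_iff by blast
  have "ALL l. EX V. EX R. l : ?M --> good V D R (G l)" using hid G by blast
  then obtain V where "ALL l. EX R. l : ?M --> good (V l) D R (G l)" unfolding choice_iff by blast
  then obtain R where R: "!!l. l : ?M ==> good (V l) D (R l) (G l)" unfolding choice_iff by blast
  let ?V = "points Z Int (\<Inter>l\<in>?M. V l)"
  have oV: "opn Z ?V"
  proof (cases "?M = {}")
   case False
   have "opn Z (\<Inter>l\<in>?M. V l)"
    by (rule openin_INT2[OF fin False]) (use R in "auto simp: good_def")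
   thus ?thesis by blast
  qed auto
  have z0V: "z0 : ?V" using z0 R unfolding good_def by blast
  have "ALL l. EX c. l : ?M --> (ALL m. c m : regular Z ?V) & (ALL v z. R l v z = (SUM m:?M. c m z * mon m v))"
  proof
   fix l
   show "EX c. l : ?M --> (ALL m. c m : regular Z ?V) & (ALL v z. R l v z = (SUM m:?M. c m z * mon m v))"
   proof (cases "l : ?M")
    case True
    hence "(D, R l) : fam n Z ?V"
     using R[OF True] unfolding good_def by (intro fam_restrict[OF _ Z _ oV]) auto
    from fam_coeffs[OF this Z oV] show ?thesis by blast
   qed auto
  qed
  then obtain co where co: "!!l. l : ?M ==> (ALL m. co l m : regular Z ?V) & (ALL v z. R l v z = (SUM m:?M. co l m z * mon m v))"
   unfolding choice_iff by blast
  \<comment> \<open>The coefficients of the families, corrected by those of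
    \<open>mon l - G l\<close>, which vanishes on \<open>X\<close>. The correction makes the matrix
    exactly the identity at \<open>z0\<close>.\<close>
  let ?r = "%l m z. co l m z + ((if l = m then 1 else 0) - lk (G l) m)"
  have r: "?r l m : regular Z ?V & ?r l m z0 = (if l = m then 1 else 0)" if lm: "l : ?M" "m : ?M" for l m
  proof
   show "?r l m : regular Z ?V" using co[OF lm(1)] by (intro fs_add[OF Z oV] fs_const[OF Z oV]) auto
   have "(SUM m:?M. (co l m z0 - lk (G l) m) * mon m v) = 0" for v
    using co[OF lm(1)] R[OF lm(1)] form_monomials[of n D "G l" v] unfolding good_def
    by (auto simp: left_diff_distrib sum_subtractf)
   from mon_independent[OF fin this lm(2)] show "?r l m z0 = (if l = m then 1 else 0)" by simp
  qed
  have "EX W. opn Z W & z0 : W & W <= ?V &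
   (ALL x:W. ALL v. (ALL i:?M. (SUM j:?M. ?r i j x * v j) = 0) --> (ALL j:?M. v j = 0))"
   by (rule near_identity[OF Z fin oV z0V r])
  then obtain W where W: "opn Z W" "z0 : W" "W <= ?V"
   "ALL x:W. ALL v. (ALL i:?M. (SUM j:?M. ?r i j x * v j) = 0) --> (ALL j:?M. v j = 0)"
   by (elim exE conjE)
  have "(x, z) ~: C" if z: "z : W" for x z
  proof
   assume xz: "(x, z) : C"
   hence x: "x : points X" using Cs by auto
   have "(SUM m:?M. ?r l m z * mon m (rh x)) = 0" if l: "l : ?M" for l
   proof -
    have "(SUM m:?M. (if l = m then 1 else 0) * mon m (rh x)) = (SUM m:?M. if l = m then mon m (rh x) else 0)"
     by (rule sum.cong) auto
    hence d: "(SUM m:?M. (if l = m then 1 else 0) * mon m (rh x)) = mon l (rh x)" using l fin by simp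
    have "(SUM m:?M. ?r l m z * mon m (rh x)) = R l (rh x) z + (mon l (rh x) - ev (G l) (rh x))"
     using co[OF l] form_monomials[of n D "G l" "rh x"] R[OF l] d unfolding good_def
     by (auto simp: distrib_right left_diff_distrib sum.distrib sum_subtractf)
    also have "R l (rh x) z = 0" using R[OF l] xz z W(3) l unfolding good_def by blast
    finally show ?thesis using G[OF l] x by simp
   qed
   hence "ALL m:?M. mon m (rh x) = 0" using W(4)[rule_format, OF z, of "%m. mon m (rh x)"] by blast
   thus False using monomials_nonzero[OF pc_homog[OF c x]] by blast
  qed
  thus "EX T. opn Z T & z0 : T & T <= points Z - snd ` C"
   using W(1,2) openin_subset[OF W(1)] by (intro exI[of _ W]) auto
 qed
 thus ?thesis using Cs unfolding closedin_def by auto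
qed

subsection \<open>Irreducible and connected spaces\<close>

lemma irreducible_closed_open:
 assumes T: "irreducible_topology T" and C: "closedin T C" and U: "openin T U" "U ~= {}" "U <= C"
 shows "C = topspace T"
proof -
 have "closedin T (topspace T - U)" using U by blast
 moreover have "C Un (topspace T - U) = topspace T" using U closedin_subset[OF C] by blast
 ultimately have "C = topspace T \<or> topspace T - U = topspace T"
  using T C unfolding irreducible_topology_def by blast
 thus ?thesis using U openin_subset[OF U(1)] by blast
qed

lemma irreducible_connected:
 assumes "irreducible_topology T"
 shows "connected_space T"
 unfolding connected_space_clopen_in
proof (intro allI impI)
 fix U assume U: "openin T U & closedin T U"
 thus "U = {} \<or> U = topspace T" using irreducible_closed_open[OF assms, of U U] by blast
qed

lemma connected_clopen: "connected_space T ==> openin T U ==> closedin T U ==> U ~= {} ==> U = topspace T"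
 unfolding connected_space_clopen_in by blast

text \<open>The fibres of \<open>h\<close> are closed; being finite in number they are open too, and
  the space is connected.\<close>

lemma regular_constant:
 assumes X: "fspace X" and con: "connected_space (zariski X)" and h: "h : regular X (points X)"
  and fin: "finite (h ` points X)" and xy: "x : points X" "y : points X"
 shows "h x = h y"
proof -
 have cl: "cls X {z : points X. h z = l}" for l
 proof -
  have "opn X {z : points X. h z ~= l}"
   by (rule fs_eq_open[OF X points_open h fs_const[OF X points_open]])
  moreover have "points X - {z : points X. h z = l} = {z : points X. h z ~= l}" by auto
  ultimately show ?thesis unfolding closedin_def by auto
 qed
 let ?R = "\<Union>l\<in>h ` points X - {h x}. {z : points X. h z = l}"
 have "cls X ?R" using fin cl by (intro closedin_Union) auto
 hence "opn X (points X - ?R)" by blast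
 moreover have "points X - ?R = {z : points X. h z = h x}" by auto
 ultimately have "opn X {z : points X. h z = h x}" by simp
 hence "{z : points X. h z = h x} = points X"
  by (rule connected_clopen[OF con _ cl]) (use xy in blast)
 with xy(2) have "y : {z : points X. h z = h x}" by simp
 thus ?thesis by simp
qed

lemma proj_regular_constant:
 "proj_coords n X rh ==> connected_space (zariski X) ==> h : regular X (points X) ==>
  x : points X ==> y : points X ==> h x = h y"
 by (rule regular_constant[OF pc_fspace _ _ regular_finite_values])

lemma homog_nonzero: "v : homog_coords n ==> EX j<=n. v j ~= 0"
 by (auto simp: homog_coords_def fun_eq_iff) (meson not_le_imp_less)

lemma proportional:
 assumes "v : homog_coords n" "w : homog_coords n" "v i ~= 0" "!!j. j <= n ==> v i * w j = v j * w i"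
 shows "EX c. c ~= 0 & w = (%j. c * v j)"
proof (intro exI[of _ "w i / v i"] conjI ext)
 have eq: "w j = w i / v i * v j" for j
 proof (cases "j <= n")
  case True thus ?thesis using assms(3) assms(4)[OF True] by (simp add: field_simps)
 next
  case False thus ?thesis using assms(1,2) by (simp add: homog_coords_def)
 qed
 show "w j = w i / v i * v j" for j by (rule eq)
 show "w i / v i ~= 0"
 proof
  assume "w i / v i = 0"
  hence "w i = 0" using assms(3) by simp
  hence "w j = 0" for j using eq[of j] by simp
  thus False using assms(2) by (auto simp: homog_coords_def)
 qed
qed

lemma proj_point_closed:
 assumes c: "proj_coords n X rh" and x: "x : points X"
 shows "cls X {x}"
proof -
 obtain i where i: "i <= n" "rh x i ~= 0" using homog_nonzero[OF pc_homog[OF c x]] by blast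
 have "opn X (points X - {x})"
 proof (subst openin_subopen, intro ballI)
  fix y assume y: "y : points X - {x}"
  have "EX j<=n. rh x i * rh y j ~= rh x j * rh y i"
  proof (rule ccontr)
   assume "~ ?thesis"
   hence "EX c. c ~= 0 & rh y = (%j. c * rh x j)"
    using proportional[OF pc_homog[OF c x] pc_homog[OF c, of y] i(2)] y by blast
   thus False using pc_inj[OF c x, of y] y by blast
  qed
  then obtain j where j: "j <= n" "rh x i * rh y j ~= rh x j * rh y i" by blast
  let ?L = "const_poly (rh x i) * Xv j - const_poly (rh x j) * Xv i"
  have "opn X (Dset X rh ?L)"
   by (rule pc_open[OF c, of 1]) (intro form_diff form_cmult form_X i j)
  thus "EX T. opn X T & y : T & T <= points X - {x}"
   using j(2) y by (intro exI[of _ "Dset X rh ?L"]) (auto simp: Dset_def)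
 qed
 thus ?thesis using x unfolding closedin_def by auto
qed

definition irr :: "'a topology => 'a set => bool" where
 "irr T S \<longleftrightarrow> S <= topspace T & S ~= {} &
  (ALL C D. closedin T C --> closedin T D --> S <= C Un D --> S <= C \<or> S <= D)"

lemma irr_subtopology: "irr T S ==> irreducible_topology (subtopology T S)"
 unfolding irreducible_topology_def
proof (intro conjI allI impI)
 assume S: "irr T S"
 hence t: "topspace (subtopology T S) = S" by (auto simp: irr_def)
 show "topspace (subtopology T S) ~= {}" using S unfolding t by (simp add: irr_def)
 fix C D assume "closedin (subtopology T S) C" "closedin (subtopology T S) D" "C Un D = topspace (subtopology T S)"
 then obtain C' D' where "closedin T C'" "closedin T D'" "C = C' Int S" "D = D' Int S" "S <= C' Un D'"
  unfolding closedin_subtopology t by blast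
 thus "C = topspace (subtopology T S) \<or> D = topspace (subtopology T S)"
  using S unfolding t irr_def by blast
qed

lemma irr_topspace: "irreducible_topology T ==> irr T (topspace T)"
 unfolding irr_def irreducible_topology_def
proof (intro conjI allI impI)
 fix C D assume *: "topspace T ~= {} & (ALL C D. closedin T C --> closedin T D --> C Un D = topspace T -->
   C = topspace T \<or> D = topspace T)" and C: "closedin T C" and D: "closedin T D" and sub: "topspace T <= C Un D"
 have "C Un D = topspace T" using sub closedin_subset[OF C] closedin_subset[OF D] by blast
 with * C D show "topspace T <= C \<or> topspace T <= D" by blast
qed auto

lemma irr_image:
 assumes f: "continuous_map T T' f" and S: "irr T S"
 shows "irr T' (f ` S)"
 unfolding irr_def
proof (intro conjI allI impI)
 have St: "S <= topspace T" using S by (simp add: irr_def)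
 show "f ` S <= topspace T'" using continuous_map_image_subset_topspace[OF f] St by blast
 show "f ` S ~= {}" using S by (simp add: irr_def)
 fix C D assume CD: "closedin T' C" "closedin T' D" "f ` S <= C Un D"
 have "closedin T {x : topspace T. f x : C}" "closedin T {x : topspace T. f x : D}"
  using closedin_continuous_map_preimage[OF f] CD by auto
 moreover have "S <= {x : topspace T. f x : C} Un {x : topspace T. f x : D}" using CD(3) St by auto
 ultimately have "S <= {x : topspace T. f x : C} \<or> S <= {x : topspace T. f x : D}" using S unfolding irr_def by blast
 thus "f ` S <= C \<or> f ` S <= D" by blast
qed

subsection \<open>Abelian varieties\<close>

locale abvar = group A for A :: "'a group_variety" (structure) +
 assumes av: "abelian_variety A"
begin

abbreviation "V == variety A"

lemma proj_var: "projective_variety V" and carrier_points: "carrier A = points V"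
 and mult_morphism0: "morphism (V \<times>\<^sub>v V) V (%(x, y). x \<otimes> y)"
 and inv_morphism0: "morphism V V (%x. inv x)"
 using av by (auto simp: abelian_variety_def)

lemma fsV: "fspace V" and irrV: "irreducible_topology (zariski V)"
 using proj_var by (auto simp: projective_variety_def)

lemma conV: "connected_space (zariski V)"
 by (rule irreducible_connected[OF irrV])

lemma coords: "EX n rh. proj_coords n V rh"
 by (rule projective_variety_coords[OF proj_var])

lemma mult_morphism:
 assumes Z: "fspace Z" and f: "morphism Z V f" and g: "morphism Z V g"
 shows "morphism Z V (%z. f z \<otimes> g z)"
 using morphism_comp[OF morphism_pair[OF Z fsV fsV f g] mult_morphism0] by simp

lemma inv_morphism: "morphism Z V f ==> morphism Z V (%z. inv (f z))"
 using morphism_comp[OF _ inv_morphism0] by blast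

lemma const_morphism: "fspace Z ==> a : carrier A ==> morphism Z V (%_. a)"
 by (rule morphism_const) (auto simp: carrier_points)

lemma pow_morphism:
 assumes Z: "fspace Z" and f: "morphism Z V f"
 shows "morphism Z V (%z. f z [^] (k::nat))"
proof (induction k)
 case 0 thus ?case using const_morphism[OF Z one_closed] by simp
next
 case (Suc k) thus ?case using mult_morphism[OF Z Suc f] by simp
qed

lemma morphism_carrier: "morphism Z V f ==> z : points Z ==> f z : carrier A"
 using morphism_in carrier_points by metis

lemma point_closed: "a : carrier A ==> cls V {a}"
 using coords proj_point_closed carrier_points by metis

lemma equalizer_closed:
 assumes Z: "fspace Z" and f: "morphism Z V f" and g: "morphism Z V g"
 shows "cls Z {z : points Z. f z = g z}"
proof -
 have "cls Z {z : points Z. f z \<otimes> inv g z : {\<one>}}"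
  by (rule morphism_closed[OF mult_morphism[OF Z f inv_morphism[OF g]] point_closed]) simp
 moreover have "f z \<otimes> inv g z : {\<one>} \<longleftrightarrow> f z = g z" if "z : points Z" for z
  using morphism_carrier[OF f that] morphism_carrier[OF g that] inv_equality[of "f z" "inv g z"] by auto
 ultimately show ?thesis by (simp cong: conj_cong)
qed

text \<open>By completeness the slices near \<open>y0\<close> stay inside one affine chart around
  \<open>z0\<close>. There the coordinate ratios are global functions on a connected projective
  space, hence constant; the equality then spreads from a nonempty open set to the irreducible
  \<open>Y\<close>.\<close>

theorem rigidity:
 assumes X: "proj_coords m X rh" "connected_space (zariski X)"
  and Y: "fspace Y" "irreducible_topology (zariski Y)"
  and F: "morphism (X \<times>\<^sub>v Y) V F" and y0: "y0 : points Y" "!!x. x : points X ==> F (x, y0) = z0"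
  and xs: "x : points X" "x' : points X" and y: "y : points Y"
 shows "F (x, y) = F (x', y)"
proof -
 note fsX = pc_fspace[OF X(1)]
 obtain n \<sigma> where c: "proj_coords n V \<sigma>" using coords by blast
 have z0: "z0 : points V" using morphism_in[OF F, of "(x, y0)"] xs y0 by (simp add: points_prod[OF fsX Y(1)])
 obtain j where j: "j <= n" "\<sigma> z0 j ~= 0" using homog_nonzero[OF pc_homog[OF c z0]] by blast
 let ?U = "Dset V \<sigma> (Xv j)"
 have oU: "opn V ?U" by (rule pc_open[OF c form_X[OF j(1)]])
 have "cls V (points V - ?U)" using oU by blast
 from morphism_closed[OF F this] have cl: "cls (X \<times>\<^sub>v Y) {w : points (X \<times>\<^sub>v Y). F w : points V - ?U}" .
 let ?C = "{w : points (X \<times>\<^sub>v Y). F w : points V - ?U}"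
 have "cls Y (snd ` ?C)" by (rule completeness[OF X(1) Y(1) cl])
 hence oW: "opn Y (points Y - snd ` ?C)" by blast
 \<comment> \<open>The parameters \<open>y\<close> whose whole slice is mapped into the
   chart.\<close>
 let ?W = "points Y - snd ` ?C"
 have y0W: "y0 : ?W"
 proof -
  have "z0 : ?U" using z0 j by (auto simp: Dset_def)
  thus ?thesis using y0 by (auto simp: points_prod[OF fsX Y(1)])
 qed
 have slice: "morphism X V (%x. F (x, y))" if "y : points Y" for y
  using morphism_comp[OF morphism_pair[OF fsX fsX Y(1) morphism_id[OF fsX] morphism_const[OF fsX that]] F] .
 have slice': "morphism Y V (%y. F (x, y))" if "x : points X" for x
  using morphism_comp[OF morphism_pair[OF Y(1) fsX Y(1) morphism_const[OF Y(1) that] morphism_id[OF Y(1)]] F] .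
 have W: "F (x, y) = F (x', y)" if y: "y : ?W" for y
 proof -
  have yY: "y : points Y" using y by auto
  have inU: "F (a, y) : ?U" if a: "a : points X" for a
  proof (rule ccontr)
   assume "F (a, y) ~: ?U"
   hence "(a, y) : ?C" using morphism_in[OF slice[OF yY] a] a yY by (simp add: points_prod[OF fsX Y(1)])
   hence "y : snd ` ?C" by force
   with y show False by blast
  qed
  have eq: "\<sigma> (F (x, y)) i / \<sigma> (F (x, y)) j = \<sigma> (F (x', y)) i / \<sigma> (F (x', y)) j" if i: "i <= n" for i
  proof -
   have "(%z. \<sigma> z i / \<sigma> z j) : chart_alg n V \<sigma> (Xv j)"
    by (rule chart_algI[OF form_X[OF i]]) simp
   hence "(%z. \<sigma> z i / \<sigma> z j) : regular V ?U"
    using chart_proj[OF c form_X[OF j(1)]] unfolding chart_def by blast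
   from morphism_pull[OF slice[OF yY] oU this]
   have "(%a. \<sigma> (F (a, y)) i / \<sigma> (F (a, y)) j) : regular X {a : points X. F (a, y) : ?U}" .
   moreover have "{a : points X. F (a, y) : ?U} = points X" using inU by auto
   ultimately show ?thesis using proj_regular_constant[OF X _ xs] by simp
  qed
  have P: "F (x, y) : points V" "F (x', y) : points V" using inU xs by (auto simp: Dset_def)
  have nz: "\<sigma> (F (x, y)) j ~= 0" "\<sigma> (F (x', y)) j ~= 0" using inU xs by (auto simp: Dset_def)
  have "EX d. d ~= 0 & \<sigma> (F (x', y)) = (%i. d * \<sigma> (F (x, y)) i)"
   by (rule proportional[OF pc_homog[OF c P(1)] pc_homog[OF c P(2)] nz(1)])
    (use eq nz in "simp add: frac_eq_eq mult.commute")
  thus ?thesis using pc_inj[OF c P] by blast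
 qed
 have "{y : points Y. F (x, y) = F (x', y)} = points Y"
  by (rule irreducible_closed_open[OF Y(2) equalizer_closed[OF Y(1) slice'[OF xs(1)] slice'[OF xs(2)]] oW])
   (use W y0W in auto)
 thus ?thesis using y by blast
qed

text \<open>Conjugation is constant along the slice \<open>y = 1\<close>, so by rigidity the
  conjugate of \<open>y\<close> by \<open>x\<close> does not depend on \<open>x\<close>.\<close>

lemma comm: "x : carrier A ==> y : carrier A ==> x \<otimes> y = y \<otimes> x"
proof -
 assume xy: "x : carrier A" "y : carrier A"
 obtain n \<sigma> where c: "proj_coords n V \<sigma>" using coords by blast
 note f = morphism_fst[OF fsV fsV] and s = morphism_snd[OF fsV fsV] and p = fspace_prod[OF fsV fsV]
 let ?F = "%w. (fst w \<otimes> snd w) \<otimes> inv (fst w)"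
 have "?F (x, y) = ?F (\<one>, y)"
  by (rule rigidity[OF c conV fsV irrV, where ?y0.0 = \<one> and ?z0.0 = \<one>])
   (use xy in "auto simp flip: carrier_points intro!: mult_morphism[OF p] inv_morphism f s")
 hence "x \<otimes> y \<otimes> inv x = y" using xy by simp
 hence "(x \<otimes> y \<otimes> inv x) \<otimes> x = y \<otimes> x" by simp
 thus ?thesis using xy by (simp add: m_assoc)
qed

sublocale comm_group A
 by (unfold_locales) (auto intro: comm)

end

lemma abvarI: "abelian_variety A ==> abvar A"
 by (simp add: abvar_def abvar_axioms_def abelian_variety_def)

text \<open>Rigidity for the defect f(xy) f(y)^-1 f(x)^-1, which is trivial on the slice
  \<open>y = 1\<close>, and at \<open>x = 1\<close> because \<open>f\<close> preserves the neutral
  element.\<close>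

lemma morphism_hom:
 assumes A: "abelian_variety A" and B: "abelian_variety B" and f: "morphism (variety A) (variety B) f"
  and one: "f \<one>\<^bsub>A\<^esub> = \<one>\<^bsub>B\<^esub>"
 shows "f : hom A B"
proof -
 interpret A: abvar A by (rule abvarI[OF A])
 interpret B: abvar B by (rule abvarI[OF B])
 obtain n \<sigma> where c: "proj_coords n (variety A) \<sigma>" using A.coords by blast
 note p = fspace_prod[OF A.fsV A.fsV]
 note fs = morphism_fst[OF A.fsV A.fsV] and sn = morphism_snd[OF A.fsV A.fsV]
 have fc: "f x : carrier B" if "x : carrier A" for x using B.morphism_carrier[OF f] that A.carrier_points by metis
 let ?F = "%w. f (fst w \<otimes>\<^bsub>A\<^esub> snd w) \<otimes>\<^bsub>B\<^esub> inv\<^bsub>B\<^esub> (f (snd w)) \<otimes>\<^bsub>B\<^esub> inv\<^bsub>B\<^esub> (f (fst w))"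
 have F: "morphism (variety A \<times>\<^sub>v variety A) (variety B) ?F"
  by (intro B.mult_morphism[OF p] B.inv_morphism morphism_comp[OF _ f] A.mult_morphism[OF p] fs sn)
 have F1: "?F (x, \<one>\<^bsub>A\<^esub>) = \<one>\<^bsub>B\<^esub>" if "x : carrier A" for x
  using that fc by (simp add: one)
 have "f (x \<otimes>\<^bsub>A\<^esub> y) = f x \<otimes>\<^bsub>B\<^esub> f y" if x: "x : carrier A" and y: "y : carrier A" for x y
 proof -
  have "?F (x, y) = ?F (\<one>\<^bsub>A\<^esub>, y)"
   by (rule B.rigidity[OF c A.conV A.fsV A.irrV F, where ?y0.0 = "\<one>\<^bsub>A\<^esub>" and ?z0.0 = "\<one>\<^bsub>B\<^esub>"])
    (use F1 x y in "auto simp flip: A.carrier_points")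
  hence "f (x \<otimes>\<^bsub>A\<^esub> y) \<otimes>\<^bsub>B\<^esub> inv\<^bsub>B\<^esub> (f y) \<otimes>\<^bsub>B\<^esub> inv\<^bsub>B\<^esub> (f x) = \<one>\<^bsub>B\<^esub>"
   using x y fc by (simp add: one)
  hence "f (x \<otimes>\<^bsub>A\<^esub> y) \<otimes>\<^bsub>B\<^esub> inv\<^bsub>B\<^esub> (f y) = f x"
   using x y fc B.inv_equality[of "f (x \<otimes>\<^bsub>A\<^esub> y) \<otimes>\<^bsub>B\<^esub> inv\<^bsub>B\<^esub> (f y)" "inv\<^bsub>B\<^esub> (f x)"] by simp
  thus ?thesis using x y fc B.inv_solve_right[of "f x" "f (x \<otimes>\<^bsub>A\<^esub> y)" "f y"] by simp
 qed
 thus ?thesis using fc by (auto simp: hom_def)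
qed

lemma closed_irreducible_subspace:
 assumes X: "projective_variety X" and H: "cls X H" "irr (zariski X) H"
 shows "projective_variety (subspace_of X H)"
proof -
 have fsX: "fspace X" using X by (simp add: projective_variety_def)
 obtain n Z f where Z: "cls (projective_space n) Z" "isomorphism X (subspace_of (projective_space n) Z) f"
  using X by (auto simp: projective_variety_def)
 let ?P = "projective_space n"
 note fP = fspace_projective[of n]
 let ?Z = "subspace_of ?P Z" and ?g = "inv_into (points X) f"
 have Zs: "points ?Z = Z" using closedin_subset[OF Z(1)] by auto
 have bij: "bij_betw f (points X) Z" and mf: "morphism X ?Z f" and mg: "morphism ?Z X ?g"
  using Z(2) unfolding isomorphism_def Zs by auto
 have Hs: "H <= points X" using H(2) by (simp add: irr_def)
 have gf: "?g (f x) = x" if "x : points X" for x using bij that by (simp add: bij_betw_def)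
 have fH: "f ` H <= Z" using bij Hs by (auto simp: bij_betw_def)
 have "f ` H = {y : points ?Z. ?g y : H}"
  unfolding Zs using gf Hs bij by (auto simp: bij_betw_def f_inv_into_f image_iff)
 hence "cls ?Z (f ` H)" using morphism_closed[OF mg H(1)] by simp
 hence cl: "cls ?P (f ` H)" using closedin_trans_full Z(1) by (metis zariski_subspace)
 let ?H = "subspace_of X H" and ?fH = "subspace_of ?P (f ` H)"
 have ptsH: "points ?H = H" using Hs by auto
 have ptsfH: "points ?fH = f ` H" using closedin_subset[OF cl] by auto
 have inj: "inj_on f H" using bij Hs by (auto simp: bij_betw_def intro: inj_on_subset)
 have 1: "morphism ?H ?fH f"
  by (rule morphism_into_subspace[OF morphism_comp[OF morphism_inclusion morphism_comp[OF mf morphism_inclusion]]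
    fspace_subspace[OF fsX] fP]) (auto simp: ptsH)
 have 2: "morphism ?fH ?Z (%x. x)"
  by (rule morphism_into_subspace[OF morphism_inclusion fspace_subspace[OF fP] fP]) (use ptsfH fH in auto)
 have 3: "morphism ?fH ?H ?g"
  by (rule morphism_into_subspace[OF morphism_comp[OF 2 mg] fspace_subspace[OF fP] fsX])
   (use ptsfH gf Hs in auto)
 have 4: "morphism ?fH ?H (inv_into (points ?H) f)"
  by (rule morphism_cong[OF fspace_subspace[OF fP] 3]) (use ptsfH ptsH gf Hs inj in "auto simp: inv_into_f_f")
 have "isomorphism ?H ?fH f"
  unfolding isomorphism_def using 1 4 inj by (auto simp: ptsH ptsfH bij_betw_def simp del: topspace_subtopology zariski_subspace)
 thus ?thesis
  unfolding projective_variety_def using fspace_subspace[OF fsX] irr_subtopology[OF H(2)] cl by auto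
qed

lemma sub_gv_simps [simp]: "carrier (sub_gv A B) = B" "variety (sub_gv A B) = subspace_of (variety A) B"
 "x \<otimes>\<^bsub>sub_gv A B\<^esub> y = x \<otimes>\<^bsub>A\<^esub> y" "\<one>\<^bsub>sub_gv A B\<^esub> = \<one>\<^bsub>A\<^esub>"
 by (simp_all add: sub_gv_def)

context abvar
begin

lemma group_sub_gv:
 assumes "subgroup H A"
 shows "group (sub_gv A H)"
proof -
 have "group (A\<lparr>carrier := H\<rparr>)" by (rule subgroup.subgroup_is_group[OF assms is_group])
 thus ?thesis unfolding group_def group_axioms_def monoid_def Units_def by simp
qed

lemma inv_sub_gv:
 assumes "subgroup H A" "x : H"
 shows "inv\<^bsub>sub_gv A H\<^esub> x = inv x"
 using group.inv_equality[OF group_sub_gv[OF assms(1)], of "inv x" x] assms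
 by (simp add: subgroup.m_inv_closed subgroup.mem_carrier)

lemma abelian_subvarietyI:
 assumes H: "subgroup H A" "cls V H" "irr (zariski V) H"
 shows "abelian_subvariety H A"
 unfolding abelian_subvariety_def abelian_variety_def
proof (intro conjI)
 let ?H = "subspace_of V H"
 have Hs: "H <= points V" using H(3) by (simp add: irr_def)
 have pts: "points ?H = H" using Hs by auto
 note fsH = fspace_subspace[OF fsV, of H]
 show "subgroup H A" "cls V H" by fact+
 show "group (sub_gv A H)" by (rule group_sub_gv[OF H(1)])
 show "projective_variety (variety (sub_gv A H))"
  using closed_irreducible_subspace[OF proj_var H(2,3)] by simp
 show "carrier (sub_gv A H) = points (variety (sub_gv A H))" using pts by simp
 note p = fspace_prod[OF fsH fsH]
 have pp: "points (?H \<times>\<^sub>v ?H) = H \<times> H" using points_prod[OF fsH fsH] pts by simp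
 have "morphism (?H \<times>\<^sub>v ?H) ?H (%w. fst w \<otimes> snd w)"
 proof (rule morphism_into_subspace[OF _ p fsV])
  show "morphism (?H \<times>\<^sub>v ?H) V (%w. fst w \<otimes> snd w)"
   by (intro mult_morphism[OF p] morphism_comp[OF morphism_fst[OF fsH fsH] morphism_inclusion]
     morphism_comp[OF morphism_snd[OF fsH fsH] morphism_inclusion])
  show "fst w \<otimes> snd w : H" if "w : points (?H \<times>\<^sub>v ?H)" for w
   using that H(1) unfolding pp by (auto intro: subgroup.m_closed)
 qed
 thus "morphism (variety (sub_gv A H) \<times>\<^sub>v variety (sub_gv A H)) (variety (sub_gv A H))
   (%(x, y). x \<otimes>\<^bsub>sub_gv A H\<^esub> y)" by (simp add: case_prod_unfold)
 have "morphism ?H ?H (%x. inv x)"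
  by (rule morphism_into_subspace[OF inv_morphism[OF morphism_inclusion] fsH fsV])
   (use pts H(1) in "auto intro: subgroup.m_inv_closed")
 hence "morphism ?H ?H (%x. inv\<^bsub>sub_gv A H\<^esub> x)"
  by (rule morphism_cong[OF fsH]) (use pts inv_sub_gv[OF H(1)] in auto)
 thus "morphism (variety (sub_gv A H)) (variety (sub_gv A H)) (%x. inv\<^bsub>sub_gv A H\<^esub> x)" by simp
qed

lemma trivial_subvariety: "abelian_subvariety {\<one>} A"
 by (rule abelian_subvarietyI) (auto intro: triv_subgroup point_closed simp: irr_def carrier_points[symmetric])

end

section \<open>Expansion of functions at a point of an affine chart\<close>

lemma chart_alg_induct:
 assumes L: "form n 1 L" and h: "h : chart_alg n X rh L"
  and cong: "!!f g. P f ==> (!!x. x : Dset X rh L ==> g x = f x) ==> P g"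
  and const: "!!c. P (%_. c)" and gen: "!!i. i <= n ==> P (%x. rh x i / ev L (rh x))"
  and add: "!!f g. P f ==> P g ==> P (%x. f x + g x)" and mult: "!!f g. P f ==> P g ==> P (%x. f x * g x)"
 shows "P h"
proof -
 obtain k F where F: "form n k F" "ALL x:Dset X rh L. h x = ev F (rh x) / ev L (rh x) ^ k"
  using h by (elim chart_algE)
 let ?t = "%i x. rh x i / ev L (rh x)"
 have pow: "P (%x. ?t i x ^ e)" if i: "i <= n" for i e
 proof (induction e)
  case (Suc e)
  show ?case using mult[OF gen[OF i] Suc] by (simp only: power_Suc)
 qed (use const[of 1] in simp)
 have prod: "finite J ==> J <= {..n} ==> P (%x. PROD j:J. ?t j x ^ e j)" for J e
 proof (induction J rule: finite_induct)
  case (insert j J)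
  thus ?case using mult[OF pow[of j "e j"], of "%x. PROD j:J. ?t j x ^ e j"] by simp
 qed (use const[of 1] in simp)
 have sum: "finite K ==> K <= keys F ==>
   P (%x. SUM m:K. lk F m * (PROD j:keys m. ?t j x ^ lk m j))" for K
 proof (induction K rule: finite_induct)
  case (insert m K)
  have "P (%x. PROD j:keys m. ?t j x ^ lk m j)"
   by (rule prod) (use insert.prems F(1) in "auto simp: form_iff")
  from add[OF mult[OF const[of "lk F m"] this] insert.IH] insert show ?case by simp
 qed (use const[of 0] in simp)
 show ?thesis
 proof (rule cong[OF sum[OF finite_keys order_refl]])
  fix x assume x: "x : Dset X rh L"
  have "lk F m * (PROD j:keys m. ?t j x ^ lk m j) =
    lk F m * mon m (rh x) / ev L (rh x) ^ k" if m: "m : keys F" for m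
  proof -
   have "(PROD j:keys m. ?t j x ^ lk m j) = mon m (rh x) / ev L (rh x) ^ mdeg m"
    by (simp add: mon_def mdeg_def power_divide prod_dividef power_sum)
   thus ?thesis using F m by (simp add: form_iff)
  qed
  thus "h x = (SUM m:keys F. lk F m * (PROD j:keys m. ?t j x ^ lk m j))"
   using F(2) x by (simp add: eval_poly_def sum_divide_distrib mon_def)
 qed
qed

lemma chart_gen: "i <= n ==> (%x. rh x i / ev L (rh x)) : chart_alg n X rh L"
 by (rule chart_algI[OF form_X]) auto

text \<open>The ideal of the point \<open>e\<close> is generated by the translated coordinates
  \<open>t i\<close>; products are handled by fg - f(e)g(e) = (f - f(e))g + f(e)(g - g(e)).\<close>

lemma chart_ideal:
 assumes L: "form n 1 L" and h: "h : chart_alg n X rh L" and t: "t = (%i x. rh x i / ev L (rh x) - rh e i / ev L (rh e))"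
  and e: "e : Dset X rh L"
 shows "EX g. (ALL i<=n. g i : chart_alg n X rh L) & (ALL x:Dset X rh L. h x - h e = (SUM i<=n. t i x * g i x))"
proof -
 let ?O = "chart_alg n X rh L" and ?U = "Dset X rh L"
 note alg = fun_alg_chart[OF L, of X rh]
 define P where "P h \<longleftrightarrow> h : ?O & (EX g. (ALL i<=n. g i : ?O) & (ALL x:?U. h x - h e = (SUM i<=n. t i x * g i x)))" for h
 have "P h"
 proof (rule chart_alg_induct[OF L h, where P = P])
  fix f g assume f: "P f" and eq: "!!x. x : ?U ==> g x = f x"
  have "g : ?O" using f eq unfolding P_def chart_alg_def by auto
  thus "P g" using f eq e unfolding P_def by auto
 next
  show "P (%_. c)" for c
   unfolding P_def using fun_alg_const[OF alg] by (auto intro!: exI[of _ "%_ _. 0"])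
 next
  fix i assume i: "i <= n"
  have "t i x = (SUM j<=n. t j x * (if j = i then 1 else 0))" for x
   using i by (simp add: sum.delta' if_distrib cong: if_cong)
  thus "P (%x. rh x i / ev L (rh x))"
   unfolding P_def using chart_gen[OF i] fun_alg_const[OF alg]
   by (intro conjI exI[of _ "%j _. if j = i then 1 else 0"]) (auto simp: t)
 next
  fix f g assume "P f" "P g"
  then obtain a b where a: "f : ?O" "ALL i<=n. a i : ?O" "ALL x:?U. f x - f e = (SUM i<=n. t i x * a i x)"
   and b: "g : ?O" "ALL i<=n. b i : ?O" "ALL x:?U. g x - g e = (SUM i<=n. t i x * b i x)" unfolding P_def by blast
  show "P (%x. f x + g x)" unfolding P_def
  proof (intro conjI exI[of _ "%i x. a i x + b i x"] allI impI ballI)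
   show "(%x. f x + g x) : ?O" by (rule fun_alg_add[OF alg a(1) b(1)])
   show "(%x. a i x + b i x) : ?O" if "i <= n" for i using a b that by (intro fun_alg_add[OF alg]) auto
   show "f x + g x - (f e + g e) = (SUM i<=n. t i x * (a i x + b i x))" if "x : ?U" for x
    using a(3) b(3) that by (simp add: distrib_left sum.distrib) (metis add_diff_add)
  qed
  show "P (%x. f x * g x)" unfolding P_def
  proof (intro conjI exI[of _ "%i x. a i x * g x + f e * b i x"] allI impI ballI)
   show "(%x. f x * g x) : ?O" by (rule fun_alg_mult[OF alg a(1) b(1)])
   show "(%x. a i x * g x + f e * b i x) : ?O" if "i <= n" for i
    using a b that by (intro fun_alg_add[OF alg] fun_alg_mult[OF alg] fun_alg_cmult[OF alg]) auto
   show "f x * g x - f e * g e = (SUM i<=n. t i x * (a i x * g x + f e * b i x))" if x: "x : ?U" for x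
   proof -
    have "f x * g x - f e * g e = (f x - f e) * g x + f e * (g x - g e)" by (simp add: algebra_simps)
    also have "... = (SUM i<=n. t i x * a i x) * g x + f e * (SUM i<=n. t i x * b i x)" using a(3) b(3) x by simp
    finally show ?thesis by (simp add: distrib_left sum.distrib sum_distrib_left sum_distrib_right mult_ac)
   qed
  qed
 qed
 thus ?thesis unfolding P_def by blast
qed

text \<open>The mixed difference vanishes on both axes through \<open>e\<close>, so it lies in the
  product of the two ideals: besides the factor \<open>t i\<close> in \<open>x\<close>, the
  cofactors vanish for \<open>y = e\<close>.\<close>

lemma chart_ideal_tens:
 assumes L: "form n 1 L" and h: "h : tens (chart_alg n X rh L) (chart_alg n X rh L)"
  and t: "t = (%i x. rh x i / ev L (rh x) - rh e i / ev L (rh e))"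
  and e: "e : Dset X rh L"
 shows "EX r. (ALL i<=n. r i : tens (chart_alg n X rh L) (chart_alg n X rh L)) & (ALL i<=n. ALL x. r i (x, e) = 0) &
  (ALL x:Dset X rh L. ALL y. h (x, y) - h (e, y) - h (x, e) + h (e, e) = (SUM i<=n. t i x * r i (x, y)))"
 using h
proof induction
 note alg = fun_alg_chart[OF L, of X rh]
 note alg2 = fun_alg_tens[OF alg alg]
 {
  case (tens_base a b)
  obtain g where g: "ALL i<=n. g i : chart_alg n X rh L" "ALL x:Dset X rh L. a x - a e = (SUM i<=n. t i x * g i x)"
   using chart_ideal[OF L tens_base(1) t e] by blast
  let ?r = "%i z. g i (fst z) * (%y. b y - b e) (snd z)"
  show ?case
  proof (intro exI[of _ ?r] conjI allI impI ballI)
   show "?r i : tens (chart_alg n X rh L) (chart_alg n X rh L)" if "i <= n" for i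
    using that g tens_base fun_alg_diff[OF alg tens_base(2) fun_alg_const[OF alg]]
    by (intro tens.tens_base) auto
   show "?r i (x, e) = 0" for i x by simp
   fix x y assume x: "x : Dset X rh L"
   have "(a x - a e) * (b y - b e) = (SUM i<=n. t i x * ?r i (x, y))"
    using g(2) x by (simp add: sum_distrib_right mult.assoc)
   thus "a (fst (x, y)) * b (snd (x, y)) - a (fst (e, y)) * b (snd (e, y)) - a (fst (x, e)) * b (snd (x, e)) +
     a (fst (e, e)) * b (snd (e, e)) = (SUM i<=n. t i x * ?r i (x, y))"
    by (simp add: algebra_simps)
  qed
 next
  case (tens_add f g)
  then obtain r r' where r: "ALL i<=n. r i : tens (chart_alg n X rh L) (chart_alg n X rh L)" "ALL i<=n. ALL x. r i (x, e) = 0"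
   "ALL x:Dset X rh L. ALL y. f (x, y) - f (e, y) - f (x, e) + f (e, e) = (SUM i<=n. t i x * r i (x, y))"
   and r': "ALL i<=n. r' i : tens (chart_alg n X rh L) (chart_alg n X rh L)" "ALL i<=n. ALL x. r' i (x, e) = 0"
   "ALL x:Dset X rh L. ALL y. g (x, y) - g (e, y) - g (x, e) + g (e, e) = (SUM i<=n. t i x * r' i (x, y))"
   by (elim exE conjE)
  show ?case
  proof (intro exI[of _ "%i z. r i z + r' i z"] conjI allI impI ballI)
   show "(%z. r i z + r' i z) : tens (chart_alg n X rh L) (chart_alg n X rh L)" if "i <= n" for i
    using r r' that by (intro fun_alg_add[OF alg2]) auto
   show "r i (x, e) + r' i (x, e) = 0" if "i <= n" for i x using r r' that by simp
   fix x y assume x: "x : Dset X rh L"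
   have "(f (x, y) - f (e, y) - f (x, e) + f (e, e)) + (g (x, y) - g (e, y) - g (x, e) + g (e, e)) =
    (SUM i<=n. t i x * (r i (x, y) + r' i (x, y)))"
    using r(3) r'(3) x by (simp add: distrib_left sum.distrib)
   thus "f (x, y) + g (x, y) - (f (e, y) + g (e, y)) - (f (x, e) + g (x, e)) + (f (e, e) + g (e, e)) =
    (SUM i<=n. t i x * (r i (x, y) + r' i (x, y)))" by (simp add: algebra_simps)
  qed
 }
qed

context abvar
begin

text \<open>To first order multiplication is addition, so \<open>x \<mapsto> x\<^sup>k\<close> is multiplication by \<open>k\<close> on the coordinates \<open>t\<close>.\<close>

lemma torsion_isolated:
 assumes k: "k > 0"
 shows "EX U. opn V U & \<one> : U & (ALL x:U. x [^] (k::nat) = \<one> --> x = \<one>)"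
proof -
 obtain n rh where c: "proj_coords n V rh" using coords by blast
 have e: "\<one> : points V" using carrier_points by blast
 obtain j where j: "j <= n" "rh \<one> j ~= 0" using homog_nonzero[OF pc_homog[OF c e]] by blast
 let ?L = "Xv j"
 have L: "form n 1 ?L" by (rule form_X[OF j(1)])
 let ?U = "Dset V rh ?L" and ?O = "chart_alg n V rh ?L"
 have eU: "\<one> : ?U" using e j by (simp add: Dset_def)
 define t where "t = (%i x. rh x i / ev ?L (rh x) - rh \<one> i / ev ?L (rh \<one>))"
 note alg = fun_alg_chart[OF L, of V rh]
 note alg2 = fun_alg_tens[OF alg alg]
 note ch = chart_proj[OF c L]
 have oU: "opn V ?U" and Oreg: "?O <= regular V ?U" using ch by (auto simp: chart_def)
 have tO: "t i : ?O" if "i <= n" for i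
  unfolding t_def using fun_alg_diff[OF alg chart_gen[OF that] fun_alg_const[OF alg]] by simp
 have t1: "t i \<one> = 0" for i by (simp add: t_def)
 note p = fspace_prod[OF fsV fsV]
 have mm: "morphism (V \<times>\<^sub>v V) V (%w. fst w \<otimes> snd w)"
  by (rule mult_morphism[OF p morphism_fst[OF fsV fsV] morphism_snd[OF fsV fsV]])
 have prodrule: "EX b r. b : tens ?O ?O & b (\<one>, \<one>) ~= 0 & (ALL l<=n. r l : tens ?O ?O & r l (\<one>, \<one>) = 0) &
   (ALL x:?U. ALL y:?U. b (x, y) ~= 0 --> b (\<one>, y) ~= 0 --> b (x, \<one>) ~= 0 --> x \<otimes> y : ?U &
    t i (x \<otimes> y) = t i x + t i y + (SUM l<=n. t l x * (r l (x, y) / b (x, y))))" if i: "i <= n" for i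
 proof -
  let ?W = "{w : points (V \<times>\<^sub>v V). fst w \<otimes> snd w : ?U}"
  have oW: "opn (V \<times>\<^sub>v V) ?W" by (rule morphism_open[OF mm oU])
  have reg: "(%w. t i (fst w \<otimes> snd w)) : regular (V \<times>\<^sub>v V) ?W"
   by (rule morphism_pull[OF mm oU]) (use Oreg tO[OF i] in blast)
  have eW: "(\<one>, \<one>) : ?W" using eU e by (simp add: points_prod[OF fsV fsV])
  obtain a b where ab: "a : tens ?O ?O" "b : tens ?O ?O" "b (\<one>, \<one>) ~= 0"
   "ALL w:?U \<times> ?U. b w ~= 0 --> w : ?W & t i (fst w \<otimes> snd w) = a w / b w"
   using chartD[OF chart_prod[OF fsV fsV ch ch] _ oW eW reg] eU by blast
  \<comment> \<open>The numerator of t(xy) - t(x) - t(y). It vanishes on both axes, so it equals its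
    own mixed difference, and the remainder is of second order at the neutral element.\<close>
  let ?N = "%w. a w - b w * (t i (fst w) + t i (snd w))"
  have NO: "?N : tens ?O ?O"
   using ab tens_fst[OF alg tO[OF i]] tens_snd[OF alg tO[OF i]]
   by (intro fun_alg_diff[OF alg2] fun_alg_mult[OF alg2] fun_alg_add[OF alg2]) auto
  obtain r where r: "ALL l<=n. r l : tens ?O ?O" "ALL l<=n. ALL x. r l (x, \<one>) = 0"
   "ALL x:?U. ALL y. ?N (x, y) - ?N (\<one>, y) - ?N (x, \<one>) + ?N (\<one>, \<one>) = (SUM l<=n. t l x * r l (x, y))"
   using chart_ideal_tens[OF L NO t_def eU] by blast
  have N1: "?N (\<one>, y) = 0" if "y : ?U" "b (\<one>, y) ~= 0" for y
  proof -
   have "(\<one>, y) : ?U \<times> ?U" using that eU by blast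
   hence "t i (\<one> \<otimes> y) = a (\<one>, y) / b (\<one>, y)" using ab(4) that(2) by fastforce
   moreover have "\<one> \<otimes> y = y" using that(1) carrier_points by (simp add: Dset_def)
   ultimately show ?thesis using that(2) by (simp add: t1)
  qed
  have N2: "?N (x, \<one>) = 0" if "x : ?U" "b (x, \<one>) ~= 0" for x
  proof -
   have "(x, \<one>) : ?U \<times> ?U" using that eU by blast
   hence "t i (x \<otimes> \<one>) = a (x, \<one>) / b (x, \<one>)" using ab(4) that(2) by fastforce
   moreover have "x \<otimes> \<one> = x" using that(1) carrier_points by (simp add: Dset_def)
   ultimately show ?thesis using that(2) by (simp add: t1)
  qed
  have "x \<otimes> y : ?U & t i (x \<otimes> y) = t i x + t i y + (SUM l<=n. t l x * (r l (x, y) / b (x, y)))"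
   if xy: "x : ?U" "y : ?U" "b (x, y) ~= 0" "b (\<one>, y) ~= 0" "b (x, \<one>) ~= 0" for x y
  proof -
   have "(x, y) : ?W & t i (x \<otimes> y) = a (x, y) / b (x, y)" using ab(4) xy by fastforce
   moreover have "?N (x, y) = (SUM l<=n. t l x * r l (x, y))"
    using r(3)[rule_format, OF xy(1), of y] N1[OF xy(2,4)] N2[OF xy(1,5)] N1[OF eU ab(3)] by simp
   hence "a (x, y) = b (x, y) * (t i x + t i y) + (SUM l<=n. t l x * r l (x, y))" by (simp add: diff_eq_eq add.commute)
   hence "a (x, y) / b (x, y) = t i x + t i y + (SUM l<=n. t l x * r l (x, y)) / b (x, y)"
    using xy(3) by (simp add: add_divide_distrib)
   ultimately show ?thesis by (simp add: sum_divide_distrib)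
  qed
  thus ?thesis using ab r by (intro exI[of _ b] exI[of _ r]) auto
 qed
 \<comment> \<open>Induction on the exponent with x^(m+1) = x x^m; the second-order remainder of the
   product rule joins the coefficients \<open>r l\<close>, which still vanish at the neutral
   element.\<close>
 have powers: "EX W r. opn V W & \<one> : W & W <= ?U & (ALL l<=n. r l : regular V W & r l \<one> = 0) &
   (ALL x:W. x [^] m : ?U & t i (x [^] m) = of_nat m * t i x + (SUM l<=n. t l x * r l x))" if i: "i <= n" for i and m :: nat
 proof (induction m)
  case 0
  show ?case
   by (intro exI[of _ ?U] exI[of _ "%_ _. 0"]) (use oU eU fs_const[OF fsV oU] in "auto simp: t1")
 next
  case (Suc m)
  then obtain W r where W: "opn V W" "\<one> : W" "W <= ?U" "ALL l<=n. r l : regular V W & r l \<one> = 0"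
   "ALL x:W. x [^] m : ?U & t i (x [^] m) = of_nat m * t i x + (SUM l<=n. t l x * r l x)" by (elim exE conjE)
  obtain b R where b: "b : tens ?O ?O" "b (\<one>, \<one>) ~= 0" "ALL l<=n. R l : tens ?O ?O & R l (\<one>, \<one>) = 0"
   "ALL x:?U. ALL y:?U. b (x, y) ~= 0 --> b (\<one>, y) ~= 0 --> b (x, \<one>) ~= 0 --> x \<otimes> y : ?U &
    t i (x \<otimes> y) = t i x + t i y + (SUM l<=n. t l x * (R l (x, y) / b (x, y)))"
   using prodrule[OF i] by (elim exE conjE)
  have pm: "morphism V V (%x. x [^] m)" by (rule pow_morphism[OF fsV morphism_id[OF fsV]])
  note mid = morphism_id[OF fsV] and mc = const_morphism[OF fsV one_closed]
  have reg: "(%x. h (f x, g x)) : regular V W"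
   if "h : tens ?O ?O" "morphism V V f" "morphism V V g" "!!x. x : W ==> f x : ?U & g x : ?U" for h f g
  proof -
   have r: "(%x. h (f x, g x)) : regular V {x : points V. f x : ?U & g x : ?U}"
    by (rule regular_pair[OF fsV that(2,3) oU oU tens_mono[OF Oreg Oreg that(1)]])
   have "{x : points V. f x : ?U & g x : ?U} = {x : points V. f x : ?U} Int {x : points V. g x : ?U}" by auto
   hence o: "opn V {x : points V. f x : ?U & g x : ?U}"
    using morphism_open[OF that(2) oU] morphism_open[OF that(3) oU] by auto
   show ?thesis by (rule fs_restrict[OF fsV o W(1) _ r]) (use that(4) openin_subset[OF W(1)] in auto)
  qed
  have b1: "(%x. b (x, x [^] m)) : regular V W" "(%x. b (\<one>, x [^] m)) : regular V W" "(%x. b (x, \<one>)) : regular V W"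
   by (rule reg[OF b(1) mid pm] reg[OF b(1) mc pm] reg[OF b(1) mid mc]; use W eU in auto)+
  let ?W = "{x:W. b (x, x [^] m) ~= 0} Int {x:W. b (\<one>, x [^] m) ~= 0} Int {x:W. b (x, \<one>) ~= 0}"
  have oW: "opn V ?W" by (intro openin_Int fs_open[OF fsV W(1)] b1)
  let ?r = "%l x. r l x + R l (x, x [^] m) / b (x, x [^] m)"
  have "?r l : regular V ?W & ?r l \<one> = 0" if l: "l <= n" for l
  proof
   have "(%x. R l (x, x [^] m)) : regular V W" by (rule reg[OF _ mid pm]) (use b(3) l W in auto)
   hence "(%x. R l (x, x [^] m)) : regular V ?W" "(%x. b (x, x [^] m)) : regular V ?W" "r l : regular V ?W"
    using b1(1) W(4) l by (auto intro!: fs_restrict[OF fsV W(1) oW])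
   thus "?r l : regular V ?W" by (intro fs_add[OF fsV oW] fs_divide[OF fsV oW]) auto
   show "?r l \<one> = 0" using W(4) b(3) l by simp
  qed
  moreover have "x [^] Suc m : ?U & t i (x [^] Suc m) = of_nat (Suc m) * t i x + (SUM l<=n. t l x * ?r l x)"
   if x: "x : ?W" for x
  proof -
   have xU: "x : ?U" "x [^] m : ?U" using x W by auto
   have xc: "x : carrier A" using xU(1) carrier_points by (simp add: Dset_def)
   have s: "x [^] Suc m = x \<otimes> x [^] m" using xc comm[of x "x [^] m"] by simp
   have "x \<otimes> x [^] m : ?U & t i (x \<otimes> x [^] m) = t i x + t i (x [^] m) + (SUM l<=n. t l x * (R l (x, x [^] m) / b (x, x [^] m)))"
    using b(4) xU x by blast
   thus ?thesis unfolding s using W(5) x by (simp add: algebra_simps sum.distrib)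
  qed
  ultimately show ?case
   using oW W(2,3) b(2) by (intro exI[of _ ?W] exI[of _ ?r]) auto
 qed
 have "ALL i. EX W. EX r. i <= n --> opn V W & \<one> : W & W <= ?U & (ALL l<=n. r l : regular V W & r l \<one> = 0) &
   (ALL x:W. x [^] k : ?U & t i (x [^] k) = of_nat k * t i x + (SUM l<=n. t l x * r l x))"
  (is "ALL i. EX W. EX r. _ --> ?Q i W r")
 proof
  fix i
  show "EX W. EX r. i <= n --> ?Q i W r"
  proof (cases "i <= n")
   case True
   from powers[OF True, of k] obtain W r where "?Q i W r" by (elim exE)
   thus ?thesis by (intro exI impI)
  qed simp
 qed
 then obtain W where "ALL i. EX r. i <= n --> opn V (W i) & \<one> : W i & W i <= ?U & (ALL l<=n. r l : regular V (W i) & r l \<one> = 0) &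
   (ALL x:W i. x [^] k : ?U & t i (x [^] k) = of_nat k * t i x + (SUM l<=n. t l x * r l x))" unfolding choice_iff by blast
 then obtain r where r: "!!i. i <= n ==> opn V (W i) & \<one> : W i & W i <= ?U & (ALL l<=n. r i l : regular V (W i) & r i l \<one> = 0) &
   (ALL x:W i. x [^] k : ?U & t i (x [^] k) = of_nat k * t i x + (SUM l<=n. t l x * r i l x))" unfolding choice_iff by blast
 let ?W = "\<Inter>i\<in>{..n}. W i"
 have oW: "opn V ?W" by (rule openin_INT2) (use r in auto)
 have eW: "\<one> : ?W" using r by auto
 \<comment> \<open>If \<open>x [^] k\<close> is neutral, the expansion of t_i(x^k), divided by
   \<open>k\<close>, says that this matrix kills the vector of the \<open>t l x\<close>. It is the
   identity at the neutral element.\<close>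
 let ?M = "%i l x. (if i = l then 1 else 0) + r i l x / of_nat k"
 have M: "?M i l : regular V ?W & ?M i l \<one> = (if i = l then 1 else 0)" if "i : {..n}" "l : {..n}" for i l
 proof
  have "r i l : regular V ?W" using fs_restrict[OF fsV _ oW _] r that by blast
  thus "?M i l : regular V ?W"
   using fun_alg_cmult[OF fs_alg[OF fsV oW], of "r i l" "1 / of_nat k"]
   by (intro fs_add[OF fsV oW] fs_const[OF fsV oW]) simp
  show "?M i l \<one> = (if i = l then 1 else 0)" using r that by simp
 qed
 have "EX O'. opn V O' & \<one> : O' & O' <= ?W &
   (ALL x:O'. ALL v. (ALL i:{..n}. (SUM l:{..n}. ?M i l x * v l) = 0) --> (ALL l:{..n}. v l = 0))"
  by (rule near_identity[OF fsV finite_atMost oW eW M])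
 then obtain O' where O: "opn V O'" "\<one> : O'" "O' <= ?W"
   "ALL x:O'. ALL v. (ALL i:{..n}. (SUM l:{..n}. ?M i l x * v l) = 0) --> (ALL l:{..n}. v l = 0)" by (elim exE conjE)
 have "x = \<one>" if x: "x : O'" "x [^] k = \<one>" for x
 proof -
  have "(SUM l:{..n}. ?M i l x * t l x) = 0" if i: "i : {..n}" for i
  proof -
   have "(SUM l<=n. t l x * r i l x) = - (of_nat k * t i x)" unfolding eq_neg_iff_add_eq_0 add.commute[of "sum _ _"]
    using r[of i] i x O(3) t1[of i] by (metis (no_types, lifting) INT_E atMost_iff subsetD)
   moreover have "(SUM l:{..n}. ?M i l x * t l x) = t i x + (SUM l<=n. t l x * r i l x) / of_nat k"
   proof -
    have "(SUM l:{..n}. ?M i l x * t l x) = (SUM l:{..n}. (if i = l then t l x else 0) + t l x * r i l x / of_nat k)"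
     by (rule sum.cong) (auto simp: field_simps)
    thus ?thesis using i by (simp add: sum.distrib sum_divide_distrib)
   qed
   ultimately show ?thesis using k by simp
  qed
  hence t0: "ALL l:{..n}. t l x = 0" using O(4)[rule_format, OF x(1), of "%l. t l x"] by blast
  have xU: "x : ?U" using x O(3) r[of 0] by auto
  hence xp: "x : points V" "rh x j ~= 0" by (auto simp: Dset_def)
  have "EX d. d ~= 0 & rh x = (%i. d * rh \<one> i)"
  proof (rule proportional[OF pc_homog[OF c e] pc_homog[OF c xp(1)] j(2)])
   fix i assume "i <= n"
   hence "rh x i / rh x j = rh \<one> i / rh \<one> j" using t0 by (simp add: t_def)
   thus "rh \<one> j * rh x i = rh \<one> i * rh x j" using xp(2) j(2) by (simp add: field_simps)
  qed
  thus "x = \<one>" using pc_inj[OF c e xp(1)] by blast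
 qed
 thus ?thesis using O by blast
qed

end

subsection \<open>Localisation\<close>

text \<open>Nothing is demanded where \<open>g\<close> vanishes, so these are the functions of the
  localised ring on the principal open set, with arbitrary values elsewhere.\<close>

definition localize :: "'x set => ('x => complex) set => ('x => complex) => ('x => complex) set" where
 "localize X \<O> g = {f. EX a:\<O>. EX k. ALL x:X. g x ~= 0 --> f x = a x / g x ^ k}"

lemma localizeI: "a : \<O> ==> (!!x. x : X ==> g x ~= 0 ==> f x = a x / g x ^ k) ==> f : localize X \<O> g"
 unfolding localize_def by blast

lemma localizeE:
 assumes "f : localize X \<O> g"
 obtains a k where "a : \<O>" "ALL x:X. g x ~= 0 --> f x = a x / g x ^ k"
 using assms unfolding localize_def by (elim CollectE bexE exE)

lemma localize_superset: "\<O> <= localize X \<O> g"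
 by (rule subsetI, rule localizeI[where k = 0]) auto

lemma fun_alg_localize:
 assumes O: "fun_alg \<O>" and g: "g : \<O>"
 shows "fun_alg (localize X \<O> g)"
 unfolding fun_alg_def
proof (intro conjI allI ballI)
 show "(%_. c) : localize X \<O> g" for c using localize_superset fun_alg_const[OF O] by blast
 fix f f' assume "f : localize X \<O> g" "f' : localize X \<O> g"
 then obtain a k a' k' where a: "a : \<O>" "ALL x:X. g x ~= 0 --> f x = a x / g x ^ k"
  and a': "a' : \<O>" "ALL x:X. g x ~= 0 --> f' x = a' x / g x ^ k'" by (elim localizeE)
 show "(%x. f x + f' x) : localize X \<O> g"
 proof (rule localizeI[where k = "k + k'"])
  show "(%x. a x * g x ^ k' + a' x * g x ^ k) : \<O>"
   by (intro fun_alg_add[OF O] fun_alg_mult[OF O] fun_alg_power[OF O] a a' g)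
 qed (use a a' in "simp add: power_add field_simps")
 show "(%x. f x * f' x) : localize X \<O> g"
  by (rule localizeI[where k = "k + k'", OF fun_alg_mult[OF O a(1) a'(1)]]) (use a a' in "simp add: power_add")
qed

text \<open>A character of the localisation restricts to a point evaluation, and \<open>g\<close> is
  invertible in the localisation, so \<open>g\<close> is not zero at that point. Countability
  survives because a basis index and an exponent pair up to one natural number.\<close>

lemma affine_alg_localize:
 assumes aff: "affine_alg X \<O>" and g: "g : \<O>"
 shows "affine_alg {x:X. g x ~= 0} (localize X \<O> g)"
proof -
 have O: "fun_alg \<O>" using aff by (simp add: affine_alg_def)
 let ?L = "localize X \<O> g" and ?D = "{x:X. g x ~= 0}"
 obtain b where b: "!!f. f : \<O> ==> in_span X b f" using aff by (auto simp: affine_alg_def)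
 let ?b = "%i x. b (fst (prod_decode i)) x / g x ^ snd (prod_decode i)"
 have span: "in_span ?D ?b f" if f: "f : ?L" for f
 proof -
  obtain a k where a: "a : \<O>" "ALL x:X. g x ~= 0 --> f x = a x / g x ^ k" using f by (elim localizeE)
  obtain K c where K: "finite K" "ALL x:X. a x = (SUM i:K. c i * b i x)"
   using b[OF a(1)] unfolding in_span_def by (elim exE conjE)
  have "f x = (SUM i:(%i. prod_encode (i, k)) ` K. c (fst (prod_decode i)) * ?b i x)" if "x : ?D" for x
  proof -
   have "inj_on (%i. prod_encode (i, k)) K" by (rule inj_onI) auto
   thus ?thesis using a(2) K(2) that by (simp add: sum.reindex sum_divide_distrib)
  qed
  thus ?thesis unfolding in_span_def using K(1)
   by (intro exI[of _ "(%i. prod_encode (i, k)) ` K"] exI[of _ "%i. c (fst (prod_decode i))"]) simp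
 qed
 have "EX x:?D. ALL f:?L. h f = f x" if h: "character ?D ?L h" for h
 proof -
  have sub: "f : ?L" if "f : \<O>" for f using that localize_superset by blast
  have "character X \<O> h" unfolding character_def
  proof (intro conjI allI ballI impI)
   show "h (%_. c) = c" for c by (rule character_const[OF h])
   fix f f' assume f: "f : \<O>" "f' : \<O>"
   show "h (%x. f x + f' x) = h f + h f'" by (rule character_add[OF h sub[OF f(1)] sub[OF f(2)]])
   show "h (%x. f x * f' x) = h f * h f'" by (rule character_mult[OF h sub[OF f(1)] sub[OF f(2)]])
   assume "ALL x:X. f x = f' x"
   thus "h f = h f'" by (intro character_cong[OF h sub[OF f(1)] sub[OF f(2)]]) auto
  qed
  then obtain x where x: "x : X" "!!f. f : \<O> ==> h f = f x" using aff unfolding affine_alg_def by blast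
  have inv: "(%x. 1 / g x) : ?L"
   by (rule localizeI[where k = 1, OF fun_alg_const[OF O, of 1]]) simp
  have "h (%x. g x * (1 / g x)) = h g * h (%x. 1 / g x)" by (rule character_mult[OF h sub[OF g] inv])
  moreover have "h (%x. g x * (1 / g x)) = h (%_. 1)"
   by (rule character_cong[OF h])
    (use fun_alg_mult[OF fun_alg_localize[OF O g] sub[OF g] inv] sub[OF fun_alg_const[OF O]] in auto)
  ultimately have gx: "g x ~= 0" using character_const[OF h, of 1] x(2)[OF g] by auto
  have "h f = f x" if f: "f : ?L" for f
  proof -
   obtain a k where a: "a : \<O>" "ALL x:X. g x ~= 0 --> f x = a x / g x ^ k" using f by (elim localizeE)
   note gk = fun_alg_power[OF O g, of k]
   have "h (%x. f x * g x ^ k) = h a"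
    by (rule character_cong[OF h fun_alg_mult[OF fun_alg_localize[OF O g] f sub[OF gk]] sub[OF a(1)]])
     (use a in auto)
   hence "h f * g x ^ k = a x"
    using character_mult[OF h f sub[OF gk]] x(2)[OF gk] x(2)[OF a(1)] by simp
   thus ?thesis using a(2)[rule_format, OF x(1) gx] gx
    by (metis nonzero_eq_divide_eq power_not_zero)
  qed
  thus ?thesis using x(1) gx by blast
 qed
 thus ?thesis unfolding affine_alg_def using fun_alg_localize[OF O g] span by blast
qed

text \<open>The trick of Rabinowitsch, with localisation at \<open>g\<close> in place of an extra
  variable: where \<open>g\<close> is nonzero, \<open>J\<close> has no common zero.\<close>

lemma radical_nullstellensatz:
 assumes aff: "affine_alg X \<O>" and g: "g : \<O>" and J: "J <= \<O>"
  and zero: "!!x. x : X ==> ALL f:J. f x = 0 ==> g x = 0"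
 shows "EX n m s f. (ALL k<(m::nat). s k : J & f k : \<O>) & (ALL x:X. g x ^ n = (SUM k<m. s k x * f k x))"
proof -
 have O: "fun_alg \<O>" using aff by (simp add: affine_alg_def)
 have "EX m s f. (ALL k<(m::nat). s k : J & f k : localize X \<O> g) &
   (ALL x:{x:X. g x ~= 0}. (SUM k<m. s k x * f k x) = 1)"
  by (rule nullstellensatz[OF affine_alg_localize[OF aff g]]) (use J localize_superset zero in blast)+
 then obtain m s f where s: "ALL k<(m::nat). s k : J & f k : localize X \<O> g"
  "ALL x:{x:X. g x ~= 0}. (SUM k<m. s k x * f k x) = 1" by (elim exE conjE)
 have "ALL k. EX a. EX e. k < m --> a : \<O> & (ALL x:X. g x ~= 0 --> f k x = a x / g x ^ e)"
 proof
  fix k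
  show "EX a. EX e. k < m --> a : \<O> & (ALL x:X. g x ~= 0 --> f k x = a x / g x ^ e)"
  proof (cases "k < m")
   case True
   then obtain a e where "a : \<O>" "ALL x:X. g x ~= 0 --> f k x = a x / g x ^ e" using s(1) by (meson localizeE)
   thus ?thesis by (intro exI impI conjI)
  qed simp
 qed
 then obtain a e where a: "!!k. k < m ==> a k : \<O>" "!!k x. k < m ==> x : X ==> g x ~= 0 ==> f k x = a k x / g x ^ e k"
  unfolding choice_iff by blast
 let ?E = "SUM k<m. e k"
 \<comment> \<open>The additional factor \<open>g x\<close> makes the identity true also where
   \<open>g\<close> vanishes.\<close>
 let ?f = "%k x. g x * (a k x * g x ^ (?E - e k))"
 have "g x ^ Suc ?E = (SUM k<m. s k x * ?f k x)" if x: "x : X" for x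
 proof (cases "g x = 0")
  case False
  have "g x ^ Suc ?E = g x ^ Suc ?E * (SUM k<m. s k x * f k x)" using s(2) x False by simp
  also have "... = (SUM k<m. s k x * ?f k x)"
   unfolding sum_distrib_left
  proof (rule sum.cong)
   fix k assume k: "k : {..<m}"
   hence "e k <= ?E" by (intro member_le_sum) auto
   hence "g x ^ ?E = g x ^ (?E - e k) * g x ^ e k" by (simp flip: power_add)
   thus "g x ^ Suc ?E * (s k x * f k x) = s k x * ?f k x" using a(2)[of k x] k x False by simp
  qed simp
  finally show ?thesis .
 qed simp
 moreover have "?f k : \<O>" if "k < m" for k
  using a(1)[OF that] by (intro fun_alg_mult[OF O] fun_alg_power[OF O] g)
 ultimately show ?thesis using s(1)
  by (intro exI[of _ "Suc ?E"] exI[of _ m] exI[of _ s] exI[of _ ?f]) auto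
qed

context abvar
begin

text \<open>The quotient f(z) / f(x) is a \<open>k\<close>-torsion point, and the neutral element is
  isolated among these, so the fibre of \<open>f\<close> through \<open>x\<close> is open as well as
  closed.\<close>

lemma torsion_constant:
 assumes X: "fspace X" "connected_space (zariski X)" and f: "morphism X V f" and k: "k > 0"
  and t: "!!x. x : points X ==> f x [^] (k::nat) = c" and xy: "x : points X" "y : points X"
 shows "f x = f y"
proof -
 obtain U where U: "opn V U" "\<one> : U" "ALL x:U. x [^] k = \<one> --> x = \<one>" using torsion_isolated[OF k] by blast
 have fc: "f z : carrier A" if "z : points X" for z by (rule morphism_carrier[OF f that])
 have m: "morphism X V (%z. f z \<otimes> inv (f x))"
  by (intro mult_morphism[OF X(1) f] const_morphism[OF X(1)] inv_closed fc xy)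
 have "{z : points X. f z \<otimes> inv (f x) : U} = {z : points X. f z \<otimes> inv (f x) = \<one>}"
 proof -
  have "(f z \<otimes> inv (f x)) [^] k = \<one>" if "z : points X" for z
  proof -
   have "f z [^] k = f x [^] k" using t[OF that] t[OF xy(1)] by simp
   thus ?thesis using fc[OF that] fc[OF xy(1)] by (simp add: nat_pow_distrib nat_pow_inv)
  qed
  thus ?thesis using U fc xy(1) by auto
 qed
 hence o: "opn X {z : points X. f z \<otimes> inv (f x) = \<one>}" using morphism_open[OF m U(1)] by simp
 have "cls X {z : points X. f z \<otimes> inv (f x) : {\<one>}}" by (rule morphism_closed[OF m point_closed]) simp
 hence cl: "cls X {z : points X. f z \<otimes> inv (f x) = \<one>}" by simp
 have "{z : points X. f z \<otimes> inv (f x) = \<one>} = points X"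
  by (rule connected_clopen[OF X(2) o cl]) (use xy(1) fc in auto)
 hence "f y \<otimes> inv (f x) = \<one>" using xy(2) by blast
 thus ?thesis using fc xy inv_solve_right[of \<one> "f y" "f x"] by simp
qed

end

subsection \<open>Quotients\<close>

lemma partition_disjoint: "partition_on S Q ==> B : Q ==> B' : Q ==> x : B ==> x : B' ==> B = B'"
 unfolding partition_on_def disjoint_def by blast

lemma openin_quotient:
 assumes Q: "partition_on (points X) Q"
 shows "opn (quotient_fspace X Q) W \<longleftrightarrow> W <= Q & opn X (\<Union>W)"
proof
 assume "opn (quotient_fspace X Q) W"
 hence "generate_topology_on {W. W <= Q & opn X (\<Union>W)} W"
  by (simp add: quotient_fspace_def openin_topology_generated_by_iff)
 thus "W <= Q & opn X (\<Union>W)"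
 proof induction
  case (Int a b)
  hence "\<Union>(a Int b) = \<Union>a Int \<Union>b" using partition_disjoint[OF Q] by blast
  thus ?case using Int by auto
 next
  case (UN K)
  hence "opn X (\<Union>k\<in>K. \<Union>k)" by (intro openin_Union) auto
  moreover have "\<Union>(\<Union>K) = (\<Union>k\<in>K. \<Union>k)" by blast
  moreover have "\<Union>K <= Q" using UN by blast
  ultimately show ?case by simp
 qed auto
next
 assume "W <= Q & opn X (\<Union>W)"
 thus "opn (quotient_fspace X Q) W"
  by (auto simp: quotient_fspace_def intro!: topology_generated_by_Basis)
qed

lemma points_quotient:
 assumes Q: "partition_on (points X) Q"
 shows "points (quotient_fspace X Q) = Q"
proof -
 have "opn (quotient_fspace X Q) Q" using Q by (simp add: openin_quotient[OF Q] partition_on_def)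
 thus ?thesis using openin_subset openin_quotient[OF Q, of "points (quotient_fspace X Q)"] by blast
qed

lemma regular_quotient: "f : regular (quotient_fspace X Q) W \<longleftrightarrow> (EX g:regular X (\<Union>W). ALL B:W. ALL x:B. g x = f B)"
 by (simp add: quotient_fspace_def)

text \<open>Composition with the projection identifies functions on the quotient with functions
  constant on blocks, and each axiom is inherited from \<open>X\<close> through it.\<close>

lemma fspace_quotient:
 assumes X: "fspace X" and Q: "partition_on (points X) Q"
 shows "fspace (quotient_fspace X Q)"
proof -
 let ?Y = "quotient_fspace X Q"
 define \<pi> where "\<pi> x = (SOME B. B : Q & x : B)" for x
 have pi: "\<pi> x = B" if "B : Q" "x : B" for x B
 proof -
  have "\<pi> x : Q & x : \<pi> x" unfolding \<pi>_def by (rule someI[of _ B]) (use that in blast)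
  thus ?thesis using partition_disjoint[OF Q] that by blast
 qed
 note op = openin_quotient[OF Q]
 have reg: "f : regular ?Y W \<longleftrightarrow> (%x. f (\<pi> x)) : regular X (\<Union>W)" if W: "opn ?Y W" for f W
 proof
  assume "f : regular ?Y W"
  then obtain g where g: "g : regular X (\<Union>W)" "ALL B:W. ALL x:B. g x = f B" unfolding regular_quotient by blast
  show "(%x. f (\<pi> x)) : regular X (\<Union>W)"
   by (rule fs_cong[OF X _ g(1)]) (use W[unfolded op] g(2) pi in auto)
 next
  assume "(%x. f (\<pi> x)) : regular X (\<Union>W)"
  thus "f : regular ?Y W" unfolding regular_quotient
   by (rule bexI[rotated]) (use W[unfolded op] pi in auto)
 qed
 show ?thesis
  unfolding fspace_def
 proof (intro conjI allI impI)
  fix U f g assume U: "opn ?Y U" "f : regular ?Y U" "ALL x:U. g x = f x"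
  show "g : regular ?Y U" unfolding reg[OF U(1)]
   by (rule fs_cong[OF X _ U(2)[unfolded reg[OF U(1)]]]) (use U(1,3)[unfolded op] pi in auto)
 next
  fix U W f assume U: "opn ?Y U" "opn ?Y W" "W <= U" "f : regular ?Y U"
  show "f : regular ?Y W" unfolding reg[OF U(2)]
   by (rule fs_restrict[OF X _ _ _ U(4)[unfolded reg[OF U(1)]]]) (use U(1,2,3)[unfolded op] in auto)
 next
  fix \<U> f assume U: "ALL U:\<U>. opn ?Y U & f : regular ?Y U"
  hence o: "opn ?Y (\<Union>\<U>)" by blast
  have "(%x. f (\<pi> x)) : regular X (\<Union>(Union ` \<U>))"
   by (rule fs_union[OF X]) (use U reg op in auto)
  moreover have "\<Union>(Union ` \<U>) = \<Union>(\<Union>\<U>)" by blast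
  ultimately show "f : regular ?Y (\<Union>\<U>)" unfolding reg[OF o] by simp
 next
  fix U c assume U: "opn ?Y U"
  show "(%_. c) : regular ?Y U" unfolding reg[OF U] by (rule fs_const[OF X]) (use U[unfolded op] in blast)
 next
  fix U f g assume U: "opn ?Y U" "f : regular ?Y U" "g : regular ?Y U"
  note o = U(1)[unfolded op, THEN conjunct2] and f = U(2)[unfolded reg[OF U(1)]] and g = U(3)[unfolded reg[OF U(1)]]
  show "(%x. f x + g x) : regular ?Y U" unfolding reg[OF U(1)] by (rule fs_add[OF X o f g])
  show "(%x. f x * g x) : regular ?Y U" unfolding reg[OF U(1)] by (rule fs_mult[OF X o f g])
 next
  fix U f assume U: "opn ?Y U" "f : regular ?Y U"
  note o = U(1)[unfolded op, THEN conjunct2] and f = U(2)[unfolded reg[OF U(1)]]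
  have un: "\<Union>{x : U. f x ~= 0} = {x : \<Union>U. f (\<pi> x) ~= 0}" using U(1)[unfolded op] pi by auto
  show o': "opn ?Y {x : U. f x ~= 0}"
   using fs_open[OF X o f] U(1)[unfolded op] unfolding op un by auto
  show "(%x. 1 / f x) : regular ?Y {x : U. f x ~= 0}"
   unfolding reg[OF o'] un by (rule fs_inverse[OF X o f])
 qed
qed

lemma quotient_projection:
 assumes X: "fspace X" and Q: "partition_on (points X) Q" and \<pi>: "!!x. x : points X ==> \<pi> x : Q & x : \<pi> x"
 shows "morphism X (quotient_fspace X Q) \<pi>"
proof -
 have pre: "{x : points X. \<pi> x : W} = \<Union>W" if "W <= Q" for W
  using Q \<pi> that partition_disjoint[OF Q] unfolding partition_on_def by blast
 show ?thesis
  unfolding morphism_def continuous_map_def points_quotient[OF Q]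
 proof (intro conjI allI impI)
  show "\<pi> : points X \<rightarrow> Q" using \<pi> by blast
  show "opn X {x : points X. \<pi> x : W}" if "opn (quotient_fspace X Q) W" for W
   using that pre unfolding openin_quotient[OF Q] by auto
  fix W g assume W: "opn (quotient_fspace X Q) W" "g : regular (quotient_fspace X Q) W"
  hence W': "W <= Q" "opn X (\<Union>W)" unfolding openin_quotient[OF Q] by auto
  obtain h where h: "h : regular X (\<Union>W)" "ALL B:W. ALL x:B. h x = g B" using W(2) unfolding regular_quotient by blast
  show "g \<circ> \<pi> : regular X {x : points X. \<pi> x : W}"
   unfolding pre[OF W'(1)]
  proof (rule fs_cong[OF X W'(2) h(1)])
   fix x assume "x : \<Union>W"
   hence "x : points X" "\<pi> x : W" using pre[OF W'(1)] by auto
   thus "(g \<circ> \<pi>) x = h x" using h(2) \<pi> by auto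
  qed
 qed
qed

lemma quotient_universal:
 assumes X: "fspace X" and Q: "partition_on (points X) Q" and f: "morphism X Z f"
  and F: "!!B x. B : Q ==> x : B ==> F B = f x"
 shows "morphism (quotient_fspace X Q) Z F"
proof -
 have pre: "\<Union>{B : Q. F B : W} = {x : points X. f x : W}" for W
 proof (intro equalityI subsetI)
  fix x assume x: "x : {x : points X. f x : W}"
  then obtain B where "B : Q" "x : B" using Q unfolding partition_on_def by blast
  thus "x : \<Union>{B : Q. F B : W}" using F x by auto
 qed (use F Q in "auto simp: partition_on_def")
 show ?thesis
  unfolding morphism_def continuous_map_def points_quotient[OF Q]
 proof (intro conjI allI impI)
  show "F : Q \<rightarrow> points Z"
  proof
   fix B assume B: "B : Q"
   then obtain x where x: "x : B" using Q unfolding partition_on_def by (metis ex_in_conv)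
   hence "x : points X" using B Q unfolding partition_on_def by blast
   thus "F B : points Z" using F[OF B x] morphism_in[OF f] by simp
  qed
  show "opn (quotient_fspace X Q) {B : Q. F B : W}" if "opn Z W" for W
   unfolding openin_quotient[OF Q] pre using morphism_open[OF f that] by auto
  fix W g assume W: "opn Z W" "g : regular Z W"
  show "g \<circ> F : regular (quotient_fspace X Q) {B : Q. F B : W}"
   unfolding regular_quotient pre using morphism_pull[OF f W] F by (intro bexI[of _ "%x. g (f x)"]) auto
 qed
qed

lemma isomorphismI:
 assumes f: "morphism X Y f" and g: "morphism Y X g" and gf: "!!x. x : points X ==> g (f x) = x"
  and fg: "!!y. y : points Y ==> f (g y) = y" and Y: "fspace Y"
 shows "isomorphism X Y f"
proof -
 have bij: "bij_betw f (points X) (points Y)"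
  by (rule bij_betw_byWitness[where f' = g]) (use gf fg morphism_in[OF f] morphism_in[OF g] in auto)
 moreover have "morphism Y X (inv_into (points X) f)"
 proof (rule morphism_cong[OF Y g])
  show "inv_into (points X) f y = g y" if "y : points Y" for y
   using inv_into_f_f[OF bij_betw_imp_inj_on[OF bij] morphism_in[OF g that]] fg[OF that] by simp
 qed
 ultimately show ?thesis using f by (simp add: isomorphism_def)
qed

lemma carrier_Aut: "f : carrier (Aut X) \<longleftrightarrow> f : Bij (points X) & isomorphism X X f"
 by (simp add: Aut_def)

lemma AutI:
 assumes X: "fspace X" and f: "morphism X X f" and g: "morphism X X g"
  and gf: "!!x. x : points X ==> g (f x) = x" and fg: "!!x. x : points X ==> f (g x) = x"
 shows "restrict f (points X) : carrier (Aut X)"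
proof -
 let ?f = "restrict f (points X)"
 have "morphism X X ?f" by (rule morphism_cong[OF X f]) auto
 hence "isomorphism X X ?f"
  by (rule isomorphismI[OF _ g _ _ X]) (use gf fg morphism_in[OF g] in auto)
 thus ?thesis unfolding carrier_Aut Bij_def isomorphism_def by auto
qed

lemma AutE:
 assumes "f : carrier (Aut X)"
 obtains g where "morphism X X f" "morphism X X g" "!!x. x : points X ==> g (f x) = x" "!!x. x : points X ==> f (g x) = x"
proof
 have iso: "isomorphism X X f" using assms by (simp add: carrier_Aut)
 thus "morphism X X f" "morphism X X (inv_into (points X) f)" by (auto simp: isomorphism_def)
 have "bij_betw f (points X) (points X)" using iso by (simp add: isomorphism_def)
 thus "inv_into (points X) f (f x) = x" "f (inv_into (points X) f x) = x" if "x : points X" for x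
  using that by (auto simp: bij_betw_def f_inv_into_f)
qed

lemma Aut0I:
 assumes X: "fspace (variety A)" and A: "carrier A = points (variety A)"
  and f: "morphism (variety A) (variety A) f" "morphism (variety A) (variety A) g"
  and gf: "!!x. x : carrier A ==> g (f x) = x" and fg: "!!x. x : carrier A ==> f (g x) = x"
  and hom: "!!x y. x : carrier A ==> y : carrier A ==> x \<otimes>\<^bsub>A\<^esub> y : carrier A & f (x \<otimes>\<^bsub>A\<^esub> y) = f x \<otimes>\<^bsub>A\<^esub> f y"
 shows "restrict f (carrier A) : Aut0 A"
proof -
 have *: "restrict f (carrier A) : carrier (Aut (variety A))"
  unfolding A by (rule AutI[OF X f]) (use gf fg A in auto)
 hence "restrict f (carrier A) : Bij (carrier A)" unfolding A carrier_Aut by blast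
 moreover have "restrict f (carrier A) : hom A A"
  using hom morphism_in[OF f(1)] unfolding hom_def A[symmetric] by auto
 ultimately show ?thesis using * by (simp add: Aut0_def auto_def)
qed

context abvar
begin

end

subsection \<open>Automorphisms fixing a generic torsion point\<close>

context abvar
begin

text \<open>The image is the projection of the graph, and the graph is closed as an
  equaliser.\<close>

lemma image_closed:
 assumes c: "proj_coords m X \<gamma>" and f: "morphism X V f"
 shows "cls V (f ` points X)"
proof -
 note fX = pc_fspace[OF c]
 note p = fspace_prod[OF fX fsV]
 have "cls V (snd ` {w : points (X \<times>\<^sub>v V). f (fst w) = snd w})"
  by (rule completeness[OF c fsV equalizer_closed[OF p morphism_comp[OF morphism_fst[OF fX fsV] f] morphism_snd[OF fX fsV]]])
 moreover have "snd ` {w : points (X \<times>\<^sub>v V). f (fst w) = snd w} = f ` points X"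
  using morphism_in[OF f] by (force simp: points_prod[OF fX fsV])
 ultimately show ?thesis by simp
qed

lemma subgroup_nat_pow: "subgroup H A ==> x : H ==> x [^] (k::nat) : H"
 by (induction k) (auto intro: subgroup.one_closed subgroup.m_closed)

lemma nat_pow_gcd_closed:
 assumes H: "subgroup H A" and a: "a : carrier A" "a [^] (d::nat) : H" "a [^] (p::nat) : H" "coprime d p" "d > 0"
 shows "a : H"
proof -
 obtain x y where xy: "d * x = p * y + 1" using bezout_nat[of d p] a(4,5) by auto
 have "(a [^] d) [^] x : H" "(a [^] p) [^] y : H" using H a(2,3) by (auto intro: subgroup_nat_pow)
 hence h: "a [^] (d * x) : H" "a [^] (p * y) : H" using a(1) by (simp_all add: nat_pow_pow)
 have "a [^] (d * x) = a [^] (p * y) \<otimes> a" unfolding xy using a(1) by (simp add: nat_pow_mult[symmetric])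
 hence "a = inv (a [^] (p * y)) \<otimes> a [^] (d * x)" using a(1) by (simp flip: m_assoc)
 thus ?thesis using h H by (metis subgroup.m_closed subgroup.m_inv_closed)
qed

end

abbreviation evc :: "int poly => complex => complex" where
 "evc q == poly (map_poly of_int q)"

lemma evc_pCons: "evc (pCons a q) z = of_int a + z * evc q z"
 by (simp add: map_poly_pCons)

lemma evc_add: "evc (q + r) z = evc q z + evc r z"
 by (induction q r rule: poly_induct2) (simp_all add: evc_pCons algebra_simps)

lemma evc_smult: "evc (smult a q) z = of_int a * evc q z"
 by (induction q) (simp_all add: evc_pCons algebra_simps)

lemma evc_mult: "evc (q * r) z = evc q z * evc r z"
 by (induction q) (simp_all add: evc_pCons evc_add evc_smult algebra_simps)

lemma evc_power: "evc (q ^ k) z = evc q z ^ k"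
 by (induction k) (simp_all add: evc_mult one_pCons evc_pCons)

text \<open>An element of least degree in the ideal divides every element up to a nonzero integer,
  by pseudo-division. A complex root of it would be a common root, so it is constant.\<close>

lemma coprime_int_polys:
 fixes a b :: "int poly"
 assumes b: "b ~= 0" and no: "!!z. evc a z = 0 ==> evc b z = 0 ==> False"
 shows "EX s t N. N ~= 0 & s * a + t * b = [:N:]"
proof -
 let ?J = "{g. g ~= 0 & (EX s t. g = s * a + t * b)}"
 have "b : ?J" using b by (auto intro: exI[of _ 0] exI[of _ 1])
 then obtain g where g: "g : ?J" "!!h. h : ?J ==> degree g <= degree h"
  using ex_has_least_nat[of "%g. g : ?J" b degree] by blast
 then obtain s t where st: "g ~= 0" "g = s * a + t * b" by blast
 have dvd: "EX c q. c ~= 0 & smult c f = g * q" if f: "f = s' * a + t' * b" for f s' t'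
 proof -
  obtain q r where qr: "pseudo_divmod f g = (q, r)" by (metis surj_pair)
  let ?c = "coeff g (degree g) ^ (Suc (degree f) - degree g)"
  note d = pseudo_divmod[OF st(1) qr]
  have "r = smult ?c f - g * q" using d(1) by simp
  also have "... = (smult ?c s' - q * s) * a + (smult ?c t' - q * t) * b" unfolding f st(2) by (simp add: algebra_simps smult_add_right)
  finally have "r = 0" using d(2) g(2)[of r] by fastforce
  thus ?thesis using d(1) st(1) by (intro exI[of _ ?c] exI[of _ q]) simp
 qed
 have "degree g = 0"
 proof (rule ccontr)
  assume "degree g ~= 0"
  hence "~ constant (evc g)" by (simp add: constant_degree degree_map_poly)
  then obtain z where z: "evc g z = 0" using fundamental_theorem_of_algebra by blast
  have "evc f z = 0" if fst: "f = s' * a + t' * b" for f s' t'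
  proof -
   obtain c q where "c ~= 0" "smult c f = g * q" using dvd[OF fst] by blast
   thus ?thesis using z evc_smult[of c f z] by (simp add: evc_mult)
  qed
  from this[of a 1 0] this[of b 0 1] show False using no by simp
 qed
 then obtain N where "g = [:N:]" by (rule degree_eq_zeroE)
 thus ?thesis using st by (intro exI[of _ s] exI[of _ t] exI[of _ N]) simp
qed

text \<open>For |z| = 1 the absolute value is |z + 1/z - 1| = |2 Re z - 1|. It equals 1 only for z =
  1, i or -i, and neither i nor -i is a root of unity of odd order.\<close>

lemma root_of_unity_norm:
 fixes z :: complex
 assumes z: "z ^ p = 1" "z ~= 1" and p: "odd p"
 shows "norm (1 - z + z\<^sup>2) ~= 1"
proof
 assume n: "norm (1 - z + z\<^sup>2) = 1"
 have "p > 0" using p by (rule odd_pos)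
 moreover have "norm z ^ p = 1 ^ p" using arg_cong[OF z(1), of norm] by (simp add: norm_power)
 ultimately have nz: "norm z = 1" using power_eq_imp_eq_base[of "norm z" p 1] by simp
 hence zz: "z * cnj z = 1" by (simp add: complex_norm_square[symmetric])
 have "1 - z + z\<^sup>2 = z * (z + cnj z - 1)" using zz by (simp add: algebra_simps power2_eq_square)
 also have "z + cnj z - 1 = of_real (2 * Re z - 1)" by (simp add: complex_eq_iff)
 finally have "\<bar>2 * Re z - 1\<bar> = 1" using n nz by (simp add: norm_mult del: of_real_diff of_real_mult)
 hence "Re z = 0 \<or> Re z = 1" by linarith
 moreover have c: "(Re z)\<^sup>2 + (Im z)\<^sup>2 = 1" using nz by (simp add: cmod_def)
 moreover have "Re z ~= 1" using c z(2) by (auto simp: complex_eq_iff)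
 ultimately have "z\<^sup>2 = -1" by (simp add: complex_eq_iff power2_eq_square)
 hence "z ^ (2 * (p div 2)) = 1 \<or> z ^ (2 * (p div 2)) = -1" unfolding power_mult by (metis minus_one_power_iff)
 moreover have "p = Suc (2 * (p div 2))" using p by presburger
 hence "z * z ^ (2 * (p div 2)) = 1" using z(1) power_Suc[of z "2 * (p div 2)"] by simp
 ultimately have "z = 1 \<or> z = -1" by (auto simp: minus_equation_iff)
 thus False using \<open>z\<^sup>2 = -1\<close> by auto
qed

context abvar
begin

lemma int_pow_morphism:
 assumes "fspace Z" "morphism Z V f"
 shows "morphism Z V (%z. f z [^] (k::int))"
 using pow_morphism[OF assms] inv_morphism[OF pow_morphism[OF assms]] by (cases "k < 0") (simp_all only: int_pow_def2 if_True if_False)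

text \<open>\<open>poly_act f q\<close> is the value of \<open>q\<close> at \<open>f\<close> in the endomorphism ring.\<close>

definition poly_act :: "('a => 'a) => int poly => 'a => 'a" where
 "poly_act f q x = fold_coeffs (%a y. x [^] a \<otimes> f y) q \<one>"

context
 fixes f assumes f: "f : hom A A"
begin

interpretation f: group_hom A A f
 by (intro group_hom.intro group_hom_axioms.intro is_group f)

lemma act_0 [simp]: "poly_act f 0 x = \<one>"
 by (simp add: poly_act_def)

lemma act_pCons [simp]: "x : carrier A ==> poly_act f (pCons a q) x = x [^] a \<otimes> f (poly_act f q x)"
 by (cases "a = 0 & q = 0") (auto simp: poly_act_def)

lemma act_closed [simp]: "x : carrier A ==> poly_act f q x : carrier A"
 by (induction q) auto

lemma act_1 [simp]: "x : carrier A ==> poly_act f 1 x = x"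
 by (simp add: one_pCons)

lemma act_add: "x : carrier A ==> poly_act f (q + r) x = poly_act f q x \<otimes> poly_act f r x"
 by (induction q r rule: poly_induct2) (simp_all add: int_pow_mult m_ac)

lemma act_smult: "x : carrier A ==> poly_act f (smult a q) x = poly_act f q x [^] a"
 by (induction q) (simp_all add: int_pow_distrib int_pow_pow f.hom_int_pow mult.commute)

lemma act_minus: "x : carrier A ==> poly_act f (- q) x = inv (poly_act f q x)"
 using act_smult[of x "-1" q] by (simp add: int_pow_neg)

lemma act_diff: "x : carrier A ==> poly_act f (q - r) x = poly_act f q x \<otimes> inv (poly_act f r x)"
 using act_add[of x q "- r"] by (simp add: act_minus)

lemma act_mult: "x : carrier A ==> poly_act f (q * r) x = poly_act f q (poly_act f r x)"
 by (induction q) (simp_all add: act_add act_smult)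

lemma act_power: "x : carrier A ==> poly_act f (q ^ k) x = (poly_act f q ^^ k) x"
 by (induction k) (simp_all add: act_mult)

lemma act_X: "x : carrier A ==> poly_act f [:0, 1:] x = f x"
 by simp

lemma act_monomial: "x : carrier A ==> poly_act f ([:0, 1:] ^ k) x = (f ^^ k) x"
proof (induction k)
 case (Suc k)
 have "(f ^^ k) x : carrier A" using act_closed[OF Suc.prems, of "[:0, 1:] ^ k"] Suc by simp
 thus ?case unfolding power_Suc act_mult[OF Suc.prems] Suc.IH[OF Suc.prems] by (simp del: act_pCons add: act_X)
qed simp

lemma act_hom: "poly_act f q : hom A A"
proof (rule homI)
 show "poly_act f q (x \<otimes> y) = poly_act f q x \<otimes> poly_act f q y" if "x : carrier A" "y : carrier A" for x y
  using that by (induction q) (simp_all add: int_pow_distrib m_ac)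
qed simp

lemma act_morphism: "morphism V V f ==> morphism V V (poly_act f q)"
proof (induction q)
 case 0
 thus ?case using const_morphism[OF fsV one_closed] by simp
next
 case (pCons a q)
 hence "morphism V V (%x. x [^] a \<otimes> f (poly_act f q x))"
  using mult_morphism[OF fsV int_pow_morphism[OF fsV morphism_id[OF fsV]] morphism_comp[OF pCons.IH pCons.prems]] by blast
 thus ?case by (rule morphism_cong[OF fsV]) (simp add: carrier_points)
qed

lemma act_fixed: "f P = P ==> P : carrier A ==> poly_act f q P = P [^] poly q 1"
 by (induction q) (simp_all add: int_pow_mult f.hom_int_pow)

end

text \<open>A morphism from a connected space into torsion points is constant. Hence identities
  between endomorphisms may be checked up to a nonzero integer multiple.\<close>

lemma torsion_endomorphism:
 assumes f: "morphism V V f" "f : hom A A" and N: "N ~= (0::int)" and t: "!!x. x : carrier A ==> f x [^] N = \<one>"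
  and x: "x : carrier A"
 shows "f x = \<one>"
proof -
 have "f y [^] nat \<bar>N\<bar> = \<one>" if y: "y : points V" for y
 proof -
  have e: "f y [^] N = \<one>" using t[of y] y unfolding carrier_points .
  have c: "f y : carrier A" by (rule morphism_carrier[OF f(1) y])
  have "f y [^] \<bar>N\<bar> = \<one>" using e int_pow_neg[OF c, of N] by (cases "N < 0") (simp_all add: abs_if)
  thus ?thesis using int_pow_int[of A "f y" "nat \<bar>N\<bar>"] by simp
 qed
 hence "f x = f \<one>"
  using torsion_constant[OF fsV conV f(1), of "nat \<bar>N\<bar>" \<one> x \<one>] N x one_closed carrier_points by simp
 thus ?thesis using hom_one[OF f(2) is_group is_group] by simp
qed

text \<open>Two powers of \<open>f\<close> coincide by finiteness of \<open>Aut0 A\<close>, and the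
  smaller one is cancelled with the inverse \<open>g\<close>.\<close>

lemma finite_order:
 assumes fin: "finite (Aut0 A)" and f: "morphism V V f" "f : hom A A" "morphism V V g"
  and gf: "!!x. x : carrier A ==> g (f x) = x" "!!x. x : carrier A ==> f (g x) = x"
 shows "EX m>0. ALL x:carrier A. (f ^^ m) x = x"
proof -
 have c: "(h ^^ k) x : carrier A" if "morphism V V h" "x : carrier A" for h k x
  using that(2) by (induction k) (use morphism_carrier[OF that(1)] carrier_points in auto)
 have m: "morphism V V (h ^^ k)" if "morphism V V h" for h k
 proof (induction k)
  case (Suc k)
  thus ?case using morphism_comp[OF Suc that] by (simp add: comp_def)
 qed (simp add: id_def morphism_id[OF fsV])
 have inv: "(h' ^^ k) ((h ^^ k) x) = x" if "morphism V V h" "!!x. x : carrier A ==> h' (h x) = x" "x : carrier A" for h h' k x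
 proof (induction k)
  case (Suc k)
  have "(h' ^^ Suc k) ((h ^^ Suc k) x) = (h' ^^ k) (h' (h ((h ^^ k) x)))" by (simp add: funpow_swap1)
  thus ?case using Suc that(2)[OF c[OF that(1,3)]] by simp
 qed simp
 have "restrict (f ^^ k) (carrier A) : Aut0 A" for k
 proof (rule Aut0I[OF fsV carrier_points m[OF f(1)] m[OF f(3)]])
  show "x \<otimes> y : carrier A & (f ^^ k) (x \<otimes> y) = (f ^^ k) x \<otimes> (f ^^ k) y" if "x : carrier A" "y : carrier A" for x y
   using that by (induction k) (use f(2) c[OF f(1)] in "auto simp: hom_def")
 qed (use inv f gf in auto)
 hence "finite (range (%k. restrict (f ^^ k) (carrier A)))" by (intro finite_subset[OF _ fin] image_subsetI)
 hence "~ inj (%k::nat. restrict (f ^^ k) (carrier A))" using finite_imageD infinite_UNIV_nat by blast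
 then obtain i j where ne: "i ~= j" "restrict (f ^^ i) (carrier A) = restrict (f ^^ j) (carrier A)" unfolding inj_def by blast
 obtain i j where ij: "i < j" "restrict (f ^^ i) (carrier A) = restrict (f ^^ j) (carrier A)"
  by (cases "i < j") (rule that[of i j], use ne in simp_all, rule that[of j i], use ne in simp_all)
 have "(f ^^ (j - i)) x = x" if x: "x : carrier A" for x
 proof -
  have "(f ^^ i) ((f ^^ (j - i)) x) = (f ^^ j) x" using ij(1) by (simp add: funpow_add[THEN fun_cong, unfolded comp_def, symmetric])
  also have "... = (f ^^ i) x" using ij(2) x fun_cong[of _ _ x] by (metis (no_types) restrict_apply')
  finally have "(g ^^ i) ((f ^^ i) ((f ^^ (j - i)) x)) = (g ^^ i) ((f ^^ i) x)" by simp
  thus ?thesis using inv[OF f(1) gf(1) x] inv[OF f(1) gf(1) c[OF f(1) x]] by simp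
 qed
 thus ?thesis using ij(1) by (intro exI[of _ "j - i"]) simp
qed

text \<open>\<open>f\<^sup>2 - f + 1 = (f\<^sup>3 + 1) / (f + 1)\<close> is invertible, of infinite order unless \<open>f = 1\<close>.\<close>

lemma no_prime_order:
 assumes fin: "finite (Aut0 A)" and f: "morphism V V f" "f : hom A A" and p: "odd p" "~ 3 dvd p"
  and fp: "!!x. x : carrier A ==> (f ^^ p) x = x" and x: "x : carrier A"
 shows "f x = x"
proof -
 interpret f: group_hom A A f by (intro group_hom.intro group_hom_axioms.intro is_group f(2))
 define X where "X = [:0, 1::int:]"
 define U where "U = X\<^sup>2 - X + 1"
 note act = act_add[OF f(2)] act_mult[OF f(2)] act_diff[OF f(2)] act_1[OF f(2)]
  act_X[OF f(2), folded X_def] act_monomial[OF f(2), folded X_def] act_power[OF f(2)]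
 note cl = act_closed[OF f(2)] and am = act_morphism[OF f(2,1)] and ah = act_hom[OF f(2)]
 \<comment> \<open>An odd number not divisible by 3 is 1 or 5 modulo 6. In both cases an odd
   \<open>k\<close> with \<open>3 * k = 1 + l * p\<close> is written down, so that
   \<open>X ^ (3 * k)\<close> acts as \<open>X\<close>.\<close>
 have "p = 6 * (p div 6) + 1 \<or> p = 6 * (p div 6) + 5" using p by presburger
 then obtain q where "p = 6 * q + 1 \<or> p = 6 * q + 5" by blast
 then obtain k l where k: "odd k" "3 * k = 1 + l * p"
 proof
  assume "p = 6 * q + 1"
  thus ?thesis by (intro that[of "4 * q + 1" 2]) auto
 next
  assume "p = 6 * q + 5"
  thus ?thesis by (intro that[of "8 * q + 7" 4]) auto
 qed
 have flp: "(f ^^ (l * p)) y = y" if "y : carrier A" for y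
  by (induction l) (use that fp in "simp_all add: funpow_add")
 \<comment> \<open>The quotient of \<open>1 + X ^ (3 * k)\<close> by \<open>1 + X ^ 3\<close>, a
   polynomial because \<open>k\<close> is odd; it will act as the inverse of
   \<open>U\<close>.\<close>
 define W where "W = (SUM j<k. (- (X ^ 3)) ^ j)"
 have "(1 + X ^ 3) * W = 1 - (- (X ^ 3)) ^ k" unfolding W_def by (simp add: one_diff_power_eq)
 also have "... = 1 + X ^ (3 * k)" using k(1) by (simp add: power_mult)
 also have "1 + X ^ 3 = (1 + X) * U" by (simp add: U_def algebra_simps power3_eq_cube power2_eq_square)
 finally have UW: "(1 + X) * (U * W) = 1 + X ^ (3 * k)" by (simp only: mult.assoc)
 \<comment> \<open>On the image of \<open>U * W - 1\<close> the map \<open>f\<close> acts as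
   inversion. As its \<open>p\<close>-th power is the identity and \<open>p\<close> is odd, every
   point of the image is 2-torsion, and the image is trivial.\<close>
 have unit: "poly_act f (U * W) y = y" if y: "y : carrier A" for y
 proof -
  let ?d = "poly_act f (U * W - 1)"
  have "?d z [^] (2::int) = \<one>" if z: "z : carrier A" for z
  proof -
   have e: "(1 + X) * (U * W - 1) = X ^ (3 * k) - X" using UW by (simp add: algebra_simps)
   have fz: "(f ^^ (3 * k)) z = f z" using flp[OF f.hom_closed[OF z]] by (simp add: k(2) funpow_swap1)
   have "poly_act f ((1 + X) * (U * W - 1)) z = \<one>" unfolding e using z fz by (simp add: act(3,5,6))
   hence dz: "?d z \<otimes> f (?d z) = \<one>" using z by (simp add: act(1,2,4,5) cl)
   have dc: "?d z : carrier A" using z by (rule cl)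
   have fd: "f (?d z) = inv (?d z)" using dz dc by (metis f.hom_closed inv_equality m_comm)
   have "(f ^^ i) (?d z) = (if even i then ?d z else inv (?d z))" for i
    by (induction i) (use fd dc in auto)
   hence "?d z = inv (?d z)" using fp[OF dc] p(1) by metis
   hence "?d z \<otimes> ?d z = \<one>" using r_inv[OF dc] by simp
   moreover have "?d z [^] (2::int) = ?d z [^] (2::nat)" by (metis int_pow_int of_nat_numeral)
   ultimately show ?thesis using dc by (simp add: numeral_2_eq_2)
  qed
  hence "?d y = \<one>" by (intro torsion_endomorphism[OF am ah _ _ y, of 2]) auto
  hence "poly_act f (U * W) y \<otimes> inv y = \<one>" using y by (simp only: act(3,4))
  thus ?thesis using inv_solve_right[of \<one> "poly_act f (U * W) y" y] y cl by simp
 qed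
 have "EX m>0. ALL x:carrier A. (poly_act f U ^^ m) x = x"
 proof (rule finite_order[OF fin am ah am])
  show "poly_act f U (poly_act f W y) = y" "poly_act f W (poly_act f U y) = y" if "y : carrier A" for y
   using unit[OF that] act_mult[OF f(2) that, of U W] act_mult[OF f(2) that, of W U] by (simp_all add: mult.commute[of W])
 qed
 then obtain m where m: "m > 0" "ALL x:carrier A. (poly_act f U ^^ m) x = x" by blast
 \<comment> \<open>Its roots are the \<open>p\<close>-th roots of unity other than 1. There
   \<open>U\<close> has absolute value different from 1, so \<open>U ^ m - 1\<close> and
   \<open>?Ph\<close> have no common root.\<close>
 let ?Ph = "SUM i<p. X ^ i"
 have XPh: "X ^ p - 1 = ?Ph * (X - 1)"
  using power_diff_1_eq[of X p] by (simp only: mult.commute)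
 have evX: "evc X z = z" "evc 1 z = 1" for z by (simp_all add: X_def evc_pCons one_pCons)
 have evPh: "z ^ p = 1 & z ~= 1" if Ph: "evc ?Ph z = 0" for z
 proof -
  have "evc (SUM i<n. X ^ i) z = (SUM i<n. z ^ i)" for n
   by (induction n) (simp_all add: evc_add evc_power evX)
  hence s: "(SUM i<p. z ^ i) = 0" using Ph by simp
  have "p > 0" using p(1) by (rule odd_pos)
  thus ?thesis using s power_diff_1_eq[of z p] by auto
 qed
 have "?Ph ~= 0" using evPh[of 1] by auto
 moreover have False if z: "evc (U ^ m - 1) z = 0" "evc ?Ph z = 0" for z
 proof -
  have "evc U z = evc (U + X) z - z" by (simp add: evc_add evX)
  also have "... = 1 - z + z\<^sup>2" by (simp add: U_def evc_add evc_power evX)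
  finally have eU: "evc U z = 1 - z + z\<^sup>2" .
  have "evc (U ^ m) z = 1" using z(1) evc_add[of "U ^ m - 1" 1 z] by (simp add: evX)
  hence "norm (1 - z + z\<^sup>2) ^ m = 1 ^ m" using norm_power[of "1 - z + z\<^sup>2" m] by (simp add: evc_power eU)
  hence "norm (1 - z + z\<^sup>2) = 1" using m(1) power_eq_imp_eq_base[of "norm (1 - z + z\<^sup>2)" m 1] by simp
  thus False using root_of_unity_norm evPh[OF z(2)] p(1) by blast
 qed
 ultimately obtain s t N where N: "N ~= 0" "s * (U ^ m - 1) + t * ?Ph = [:N:]" using coprime_int_polys by blast
 let ?g = "poly_act f (X - 1)"
 \<comment> \<open>On the image of \<open>X - 1\<close> both \<open>U ^ m - 1\<close> and
   \<open>?Ph\<close> act as zero, hence so does their integer combination \<open>N\<close>.\<close>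
 have "?g y [^] N = \<one>" if y: "y : carrier A" for y
 proof -
  have gy: "?g y : carrier A" by (rule cl[OF y])
  have one: "poly_act f r \<one> = \<one>" for r by (rule hom_one[OF ah is_group is_group])
  have "poly_act f (U ^ m - 1) (?g y) = \<one>" using m(2) gy by (simp add: act(3,4,7))
  moreover have "poly_act f ?Ph (?g y) = \<one>"
   unfolding act_mult[OF f(2) y, symmetric] XPh[symmetric] using y fp[OF y] by (simp add: act(3,4,6))
  ultimately have "poly_act f [:N:] (?g y) = \<one>" unfolding N(2)[symmetric] using gy by (simp add: act(1,2) one)
  thus ?thesis using gy by (simp add: act_pCons[OF f(2)] act_0[OF f(2)])
 qed
 hence "?g x = \<one>" by (rule torsion_endomorphism[OF am ah N(1) _ x])
 hence "f x \<otimes> inv x = \<one>" using x by (simp only: act(3,4,5))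
 thus ?thesis using inv_solve_right[of \<one> "f x" x] x by simp
qed

text \<open>If \<open>p\<close> does not divide the order \<open>m\<close> of \<open>f\<close>, the point \<open>P\<close> lies in the image of \<open>1 + f + \<dots> + f\<^sup>m\<^sup>-\<^sup>1\<close>, where \<open>f\<close> is trivial.\<close>

theorem fixes_generic_torsion:
 assumes fin: "finite (Aut0 A)" and p: "prime p" "p >= 7"
  and P: "P : torsion_points A p" and Pgen: "!!B. abelian_subvariety B A ==> B ~= carrier A ==> P ~: B"
  and f: "morphism V V f" "morphism V V g" "f : hom A A"
  and gf: "!!x. x : carrier A ==> g (f x) = x" and fg: "!!x. x : carrier A ==> f (g x) = x"
  and fP: "f P = P" and x: "x : carrier A"
 shows "f x = x"
proof -
 let ?T = "%m. m > 0 & (ALL x:carrier A. (f ^^ m) x = x)"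
 define m where "m = (LEAST m. ?T m)"
 have m: "m > 0" "ALL x:carrier A. (f ^^ m) x = x"
  using LeastI_ex[of ?T] finite_order[OF fin f(1,3,2) gf fg] unfolding m_def by blast+
 let ?X = "[:0, 1:] :: int poly"
 have cp: "odd p" "~ 3 dvd p" using p prime_odd_nat[of p] primes_dvd_imp_eq[of 3 p] by auto
 \<comment> \<open>If \<open>m = d * p\<close>, the \<open>p\<close>-th power of
   \<open>f ^^ d\<close> is the identity, so \<open>f ^^ d\<close> itself is, against minimality of
   \<open>m\<close>.\<close>
 have "~ p dvd m"
 proof
  assume "p dvd m"
  then obtain d where d: "m = d * p" by (metis dvd_def mult.commute)
  let ?h = "poly_act f (?X ^ d)"
  have h: "?h y = (f ^^ d) y" if "y : carrier A" for y by (rule act_monomial[OF f(3) that])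
  have "(?h ^^ p) y = y" if y: "y : carrier A" for y
   using act_power[OF f(3) y, of "?X ^ d" p] act_monomial[OF f(3) y, of m] m(2) y by (simp add: d power_mult)
  hence "?h y = y" if "y : carrier A" for y
   using no_prime_order[OF fin act_morphism[OF f(3,1)] act_hom[OF f(3)] cp] that by blast
  hence "?T d" using h m(1) d by (cases d) auto
  hence "m <= d" unfolding m_def by (rule Least_le)
  thus False using d m(1) p(2) by simp
 qed
 hence mp: "coprime m p" using p(1) by (metis coprime_commute prime_imp_coprime)
 let ?n = "poly_act f (SUM i<m. ?X ^ i)"
 have P': "P : carrier A" "P [^] p = \<one>" using P by (auto simp: torsion_points_def)
 \<comment> \<open>All \<open>m\<close> summands act trivially on the fixed point. As
   \<open>m\<close> is prime to \<open>p\<close>, the point \<open>P\<close> itself is recovered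
   from this power.\<close>
 have nP: "?n P = P [^] m"
  using act_fixed[OF f(3) fP P'(1)] by (simp add: poly_sum poly_power int_pow_int)
 note nh = act_hom[OF f(3)] and nm = act_morphism[OF f(3,1)]
 interpret n: group_hom A A ?n by (intro group_hom.intro group_hom_axioms.intro is_group nh)
 have "abelian_subvariety (?n ` carrier A) A"
 proof (rule abelian_subvarietyI)
  show "subgroup (?n ` carrier A) A" by (rule n.img_is_subgroup)
  show "cls V (?n ` carrier A)" using image_closed[OF _ nm] coords unfolding carrier_points by blast
  show "irr (zariski V) (?n ` carrier A)" unfolding carrier_points
   by (rule irr_image[OF _ irr_topspace[OF irrV]]) (use nm in "simp add: morphism_def")
 qed
 moreover have "P : ?n ` carrier A"
  by (rule nat_pow_gcd_closed[OF n.img_is_subgroup P'(1) _ _ mp m(1)]) (use P' nP[symmetric] n.one_closed n.hom_one in \<open>auto simp: image_iff intro: bexI[of _ \<one>]\<close>)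
 ultimately have "?n ` carrier A = carrier A" using Pgen by blast
 then obtain y where y: "y : carrier A" "x = ?n y" using x by auto
 \<comment> \<open>The image of the norm is now everything, and \<open>f - 1\<close> kills it by the
   geometric sum.\<close>
 have e: "?X * (SUM i<m. ?X ^ i) - (SUM i<m. ?X ^ i) = ?X ^ m - 1"
  using power_diff_1_eq[of ?X m] by (simp only: left_diff_distrib mult_1_left)
 have "poly_act f (?X * (SUM i<m. ?X ^ i) - (SUM i<m. ?X ^ i)) y = \<one>"
  unfolding e using y m(2) by (simp add: act_diff[OF f(3)] act_monomial[OF f(3)] act_1[OF f(3)])
 moreover have "poly_act f ?X z = f z" if "z : carrier A" for z using act_monomial[OF f(3) that, of 1] by simp
 ultimately have "f x \<otimes> inv x = \<one>" using y x by (simp only: act_diff[OF f(3)] act_mult[OF f(3)])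
 moreover have "f x : carrier A" using morphism_carrier[OF f(1)] x unfolding carrier_points .
 ultimately show ?thesis using x inv_solve_right[of \<one> "f x" x] by simp
qed

end

subsection \<open>Powers of the variables and Koszul relations\<close>


text \<open>Division of \<open>G\<close> by the power \<open>x_i ^ N\<close>, with the monomials not
  divisible by it discarded.\<close>

definition quo :: "nat => nat => cpoly => cpoly" where
 "quo i N G = (SUM m:{m:keys G. N <= lk m i}. sg (m - sg i N) (lk G m))"

lemma X_power: "Xv i ^ N = sg (sg i N) 1"
 by (rule eval_inject) simp

lemma split_exponent: "N <= lk m i ==> sg i N + (m - sg i N) = (m :: nat \<Rightarrow>\<^sub>0 nat)"
 by (rule poly_mapping_eqI) (auto simp: lookup_add lookup_minus lookup_single when_def)

lemma quo_select: "Xv i ^ N * quo i N G = select (%m. N <= lk m i) G"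
 unfolding quo_def select_def X_power sum_distrib_left
 by (rule sum.cong) (auto simp: mult_single split_exponent)

lemma lookup_X_mult: "lk (Xv i ^ N * A) m = (if N <= lk m i then lk A (m - sg i N) else 0)"
proof (induction A rule: cpoly_induct)
 case (single m' c)
 have "sg i N + m' = m \<longleftrightarrow> N <= lk m i & m' = m - sg i N"
  using split_exponent[of N m i] by (auto simp: lookup_add lookup_single)
 thus ?case by (auto simp: X_power mult_single lookup_single when_def)
qed (auto simp: distrib_left lookup_add)

lemma lookup_quo: "lk (quo i N G) m = lk G (m + sg i N)"
proof -
 have "lk (Xv i ^ N * quo i N G) (m + sg i N) = lk (quo i N G) m"
  unfolding lookup_X_mult by (simp add: lookup_add)
 thus ?thesis unfolding quo_select by (simp add: lookup_select lookup_add)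
qed

lemma quo_uminus: "quo i N (- G) = - quo i N G"
 by (rule poly_mapping_eqI) (simp add: lookup_quo)

lemma quo_form: "form n d G ==> form n (d - N) (quo i N G)"
 unfolding form_iff
proof
 fix m assume G: "ALL m:keys G. keys m <= {..n} & mdeg m = d" and "m : keys (quo i N G)"
 hence "m + sg i N : keys G" by (simp add: in_keys_iff lookup_quo)
 with G have "keys (m + sg i N) <= {..n}" "mdeg (m + sg i N) = d" by auto
 thus "keys m <= {..n} & mdeg m = d - N" by (auto simp: keys_add_nat mdeg_add)
qed

text \<open>The ideal generated by \<open>x\<^sub>0\<^sup>N, \<dots>, x\<^sub>k\<^sub>-\<^sub>1\<^sup>N\<close>.\<close>

definition XI :: "nat => nat => cpoly set" where
 "XI N k = {G. ALL m:keys G. EX i<k. N <= lk m i}"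

lemma XI_0: "G : XI N 0 \<longleftrightarrow> G = 0"
 by (simp add: XI_def keys_eq_empty[symmetric] del: keys_eq_empty)

lemma XI_zero: "0 : XI N k"
 by (simp add: XI_def)

lemma XI_add: "F : XI N k ==> G : XI N k ==> F + G : XI N k"
 unfolding XI_def using Poly_Mapping.keys_add[of F G] by blast

lemma XI_uminus: "F : XI N k ==> - F : XI N k"
 by (simp add: XI_def)

lemma XI_diff: "F : XI N k ==> G : XI N k ==> F - G : XI N k"
 using XI_add[OF _ XI_uminus, of F N k G] by simp

lemma XI_mult: "F : XI N k ==> G * F : XI N k"
 unfolding XI_def
proof (intro CollectI ballI)
 fix m assume F: "F : {G. ALL m:keys G. EX i<k. N <= lk m i}" and "m : keys (G * F)"
 then obtain a b where ab: "b : keys F" "m = a + b" using keys_mult[of G F] by blast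
 then obtain i where "i < k" "N <= lk b i" using F by blast
 thus "EX i<k. N <= lk m i" by (intro exI[of _ i]) (auto simp: ab lookup_add)
qed

lemma XI_sum: "(!!x. x : A ==> f x : XI N k) ==> sum f A : XI N k"
 by (induction A rule: infinite_finite_induct) (auto intro: XI_add XI_zero)

lemma XI_Suc: "G : XI N (Suc k) ==> G - Xv k ^ N * quo k N G : XI N k"
 by (auto simp: XI_def quo_select in_keys_iff lookup_minus lookup_select less_Suc_eq split: if_splits)

lemma XI_mono: "F : XI N k ==> F : XI N (Suc k)"
 by (auto simp: XI_def less_Suc_eq)

lemma XI_X: "Xv k ^ N * A : XI N (Suc k)"
 by (auto simp: XI_def in_keys_iff lookup_X_mult split: if_splits)

text \<open>Regularity of the sequence of powers: \<open>x_k ^ N\<close> does not affect the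
  exponents of the earlier variables.\<close>

lemma XI_cancel: "Xv k ^ N * G : XI N k ==> G : XI N k"
 unfolding XI_def
proof (intro CollectI ballI)
 fix m assume XG: "Xv k ^ N * G : {G. ALL m:keys G. EX i<k. N <= lk m i}" and "m : keys G"
 hence "m + sg k N : keys (Xv k ^ N * G)" by (simp add: in_keys_iff lookup_X_mult lookup_add)
 then obtain i where "i < k" "N <= lk (m + sg k N) i" using XG by blast
 thus "EX i<k. N <= lk m i" by (intro exI[of _ i]) (auto simp: lookup_add lookup_single)
qed

text \<open>One function on index lists carries its values on lists of every length, so exterior
  powers of all degrees are treated without separate types. Adjacent transpositions generate all
  sign rules.\<close>

definition alternating :: "(nat list => cpoly) => bool" where
 "alternating w \<longleftrightarrow> (ALL us i j vs. w (us @ i # j # vs) = - w (us @ j # i # vs))"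

lemma alternatingD: "alternating w ==> w (us @ i # j # vs) = - w (us @ j # i # vs)"
 unfolding alternating_def by blast

lemma alternating_Cons: "alternating w ==> alternating (%xs. w (i # xs))"
 unfolding alternating_def by (metis append_Cons)

text \<open>Exterior multiplication by the 1-form \<open>c\<close>, expanded along the first
  index.\<close>

fun wedge :: "(nat => cpoly) => (nat list => cpoly) => nat list => cpoly" where
 "wedge c w [] = 0"
| "wedge c w (i # xs) = c i * w xs - wedge c (%ys. w (i # ys)) xs"

lemma wedge_uminus: "wedge c (%xs. - w xs) xs = - wedge c w xs"
 by (induction c w xs rule: wedge.induct) auto

lemma wedge_mult: "wedge c (%xs. f * w xs) xs = f * wedge c w xs"
 by (induction c w xs rule: wedge.induct) (auto simp: algebra_simps)

lemma wedge_sum: "wedge c (%xs. SUM l:L. w l xs) xs = (SUM l:L. wedge c (w l) xs)"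
 by (induction xs arbitrary: w) (auto simp: sum_distrib_left sum_subtractf)

lemma wedge_XI: "(!!ys. Suc (length ys) = length xs ==> set ys <= set xs ==> w ys : XI N k) ==> wedge c w xs : XI N k"
 by (induction xs arbitrary: w) (auto intro!: XI_diff XI_mult simp: XI_zero subset_insertI2)

lemma alternating_wedge: "alternating w ==> alternating (wedge c w)"
 unfolding alternating_def[of "wedge c w"]
proof (intro allI)
 fix us i j vs assume "alternating w"
 thus "wedge c w (us @ i # j # vs) = - wedge c w (us @ j # i # vs)"
 proof (induction us arbitrary: w)
  case Nil
  have "(%ys. w (i # j # ys)) = (%ys. - w (j # i # ys))"
   by (rule ext) (use alternatingD[OF Nil, of "[]" i j] in simp)
  thus ?case by (simp add: wedge_uminus)
 next
  case (Cons u us)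
  from Cons.IH[OF alternating_Cons[OF Cons.prems]] alternatingD[OF Cons.prems, of us i j vs] show ?case by simp
 qed
qed

lemma cpoly_neg_self: "x = - x ==> x = (0 :: cpoly)"
proof -
 assume "x = - x"
 hence "2 * x = 0" using add.right_inverse[of x] by (metis mult_2)
 thus ?thesis by simp
qed

lemma alternating_repeat:
 assumes w: "alternating w" and "~ distinct xs"
 shows "w xs = 0"
proof -
 obtain us x vs ws where "xs = us @ [x] @ vs @ [x] @ ws" using not_distinct_decomp[OF assms(2)] by blast
 moreover have "w (us @ x # vs @ x # ws) = 0"
 proof (induction vs arbitrary: us)
  case Nil
  show ?case using cpoly_neg_self[OF alternatingD[OF w, of us x x ws]] by simp
 next
  case (Cons v vs)
  show ?case using alternatingD[OF w, of us x v "vs @ x # ws"] Cons[of "us @ [v]"] by simp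
 qed
 ultimately show ?thesis by simp
qed

definition bdry :: "(nat => cpoly) => (nat list => cpoly) => nat list => cpoly" where
 "bdry F w xs = (SUM l<=3. F l * w (l # xs))"

text \<open>The homotopy formula of the Koszul complex: contraction with \<open>F\<close> is an
  antiderivation, and its value on \<open>c\<close> is the scalar sum.\<close>

lemma bdry_wedge: "bdry F (wedge c w) xs = (SUM l<=3. c l * F l) * w xs - wedge c (bdry F w) xs"
 unfolding bdry_def[of F "wedge c w"] bdry_def[of F w, abs_def] wedge_sum wedge_mult
 by (simp add: right_diff_distrib sum_subtractf sum_distrib_left mult_ac)

lemma alternating_bdry:
 assumes "alternating w"
 shows "alternating (bdry F w)"
 unfolding alternating_def bdry_def sum_negf[symmetric]
proof (intro allI sum.cong refl)
 show "F l * w (l # us @ i # j # vs) = - (F l * w (l # us @ j # i # vs))" for l us i j vs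
  using alternatingD[OF assms, of "l # us" i j vs] by simp
qed

lemma bdry_bdry: "alternating w ==> bdry F (bdry F w) xs = 0"
proof -
 assume w: "alternating w"
 let ?S = "SUM l<=3. SUM k<=3. F l * F k * w (k # l # xs)"
 have "?S = (SUM l<=3. SUM k<=3. - (F k * F l * w (l # k # xs)))"
 proof (intro sum.cong refl)
  show "F l * F k * w (k # l # xs) = - (F k * F l * w (l # k # xs))" for k l
   using alternatingD[OF w, of "[]" k l xs] by simp
 qed
 also have "... = - ?S" by (subst sum.swap) (simp add: sum_negf)
 finally have "?S = 0" by (rule cpoly_neg_self)
 thus ?thesis unfolding bdry_def by (simp add: sum_distrib_left mult.assoc)
qed

text \<open>Exactness of the Koszul complex of \<open>F\<close>: modulo the first \<open>k\<close> of the powers \<open>x\<^sub>i\<^sup>N\<close>, wedging with \<open>c k\<close>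
 is a null-homotopy of the multiplication by the regular element \<open>x\<^sub>k\<^sup>N\<close>.\<close>

lemma koszul:
 assumes c: "!!i. i <= 3 ==> Xv i ^ N = (SUM l<=3. c i l * F l)" and k: "k <= 4"
  and w: "alternating w" "!!xs. length xs = k ==> set xs <= {..3} ==> bdry F w xs : XI N k"
 shows "EX e. alternating e & (ALL xs. length xs = Suc k --> set xs <= {..3} --> w xs - bdry F e xs : XI N k)"
 using k w
proof (induction "4 - k" arbitrary: k w)
 case 0
 \<comment> \<open>Here \<open>k = 4\<close>: five indices among four variables repeat.\<close>
 have "w xs = 0" if "length xs = Suc k" "set xs <= {..3}" for xs
 proof (rule alternating_repeat[OF 0(3)])
  have "card (set xs) <= 4" using card_mono[OF _ that(2)] by simp
  thus "~ distinct xs" using distinct_card[of xs] that(1) 0(1) by auto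
 qed
 thus ?case by (intro exI[of _ "%_. 0"]) (auto simp: alternating_def bdry_def XI_zero)
next
 case (Suc d)
 hence k3: "k <= 3" by simp
 let ?x = "Xv k ^ N" and ?w = "wedge (c k) w"
 have b: "?x * w xs - bdry F ?w xs : XI N k" if xs: "length xs = Suc k" "set xs <= {..3}" for xs
 proof -
  have "wedge (c k) (bdry F w) xs : XI N k"
   by (rule wedge_XI) (use Suc.prems(3) xs in auto)
  thus ?thesis unfolding bdry_wedge c[OF k3] by simp
 qed
 \<comment> \<open>Modulo one more power, \<open>?w\<close> is a cycle, because its boundary is
   \<open>?x * w\<close> up to the ideal; so the induction hypothesis, one degree higher, applies to
   \<open>?w\<close>.\<close>
 have "EX e. alternating e & (ALL xs. length xs = Suc (Suc k) --> set xs <= {..3} --> ?w xs - bdry F e xs : XI N (Suc k))"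
 proof (rule Suc.hyps(1)[OF _ _ alternating_wedge[OF Suc.prems(2)]])
  fix xs :: "nat list" assume xs: "length xs = Suc k" "set xs <= {..3}"
  show "bdry F ?w xs : XI N (Suc k)"
   using XI_diff[OF XI_X[of k N "w xs"] XI_mono[OF b[OF xs]]] by simp
 qed (use Suc.hyps(2) k3 in auto)
 then obtain e where e: "alternating e"
  "!!xs. length xs = Suc (Suc k) ==> set xs <= {..3} ==> ?w xs - bdry F e xs : XI N (Suc k)" by blast
 let ?r = "%xs. ?w xs - bdry F e xs"
 \<comment> \<open>The defect \<open>?r\<close> lies in the larger ideal; its part divisible by the
   new power \<open>?x\<close>, divided by \<open>?x\<close>, gives the primitive of
   \<open>w\<close>.\<close>
 let ?b = "%xs. quo k N (?r xs)"
 have alt: "alternating ?b"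
  unfolding alternating_def
 proof (intro allI)
  fix us i j vs
  have "?r (us @ i # j # vs) = - ?r (us @ j # i # vs)"
   using alternatingD[OF alternating_wedge[OF Suc.prems(2)], of "c k" us i j vs] alternatingD[OF alternating_bdry[OF e(1)], of F us i j vs]
   by simp
  thus "?b (us @ i # j # vs) = - ?b (us @ j # i # vs)" by (simp only: quo_uminus)
 qed
 have "w xs - bdry F ?b xs : XI N k" if xs: "length xs = Suc k" "set xs <= {..3}" for xs
 proof (rule XI_cancel)
  have "(SUM l<=3. F l * (?r (l # xs) - ?x * ?b (l # xs))) : XI N k"
  proof (intro XI_sum XI_mult XI_Suc)
   show "?r (l # xs) : XI N (Suc k)" if "l : {..3}" for l by (rule e(2)) (use xs that in auto)
  qed
  also have "(SUM l<=3. F l * (?r (l # xs) - ?x * ?b (l # xs))) = bdry F ?w xs - bdry F (bdry F e) xs - ?x * bdry F ?b xs"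
   unfolding bdry_def[of F _ xs] right_diff_distrib sum_subtractf sum_distrib_left by (simp add: mult.left_commute)
  finally have "bdry F ?w xs - ?x * bdry F ?b xs : XI N k" by (simp add: bdry_bdry[OF e(1)])
  from XI_add[OF b[OF xs] this] show "?x * (w xs - bdry F ?b xs) : XI N k" by (simp add: algebra_simps)
 qed
 with alt show ?case by blast
qed

text \<open>By exactness every syzygy is a combination of the Koszul ones, whose entries are
  multiples of the \<open>F k\<close> and so have degree at least \<open>q\<close>.\<close>

lemma low_degree_syzygy:
 fixes F c v
 assumes F: "!!l::nat. l <= 3 ==> form 3 q (F l)" and c: "!!i. i <= 3 ==> Xv i ^ N = (SUM l<=3. c i l * F l)"
  and v: "!!l. l <= 3 ==> form 3 d (v l)" "d < q" and rel: "(SUM l<=3. F l * v l) = 0" and l: "l <= 3"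
 shows "v l = 0"
proof -
 let ?w = "%xs :: nat list. case xs of [l] => v l | _ => 0"
 have "alternating ?w" unfolding alternating_def by (auto split: list.splits simp: append_eq_Cons_conv Cons_eq_append_conv)
 moreover have "bdry F ?w xs : XI N 0" if "length xs = 0" for xs using that rel by (simp add: bdry_def XI_zero)
 ultimately have "EX e. alternating e & (ALL xs. length xs = Suc 0 --> set xs <= {..3} --> ?w xs - bdry F e xs : XI N 0)"
  by (intro koszul[of N c F]) (auto intro: c)
 then obtain e where e: "ALL xs. length xs = Suc 0 --> set xs <= {..3} --> ?w xs - bdry F e xs : XI N 0" by (elim exE conjE)
 have vl: "v l = (SUM k<=3. F k * e [k, l])" using e[rule_format, of "[l]"] l by (simp add: XI_0 bdry_def)
 have "q <= mdeg m" if m: "m : keys (SUM k<=3. F k * e [k, l])" for m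
 proof -
  obtain k where k: "k <= 3" "m : keys (F k * e [k, l])" 
   using subsetD[OF keys_sum m] by auto
  then obtain a b where "a : keys (F k)" "m = a + b" using keys_mult[of "F k" "e [k, l]"] by blast
  thus ?thesis using F[OF k(1)] by (auto simp: form_iff mdeg_add)
 qed
 hence "keys (v l) = {}" using v(1)[OF l] v(2) unfolding vl[symmetric] form_iff by force
 thus ?thesis by simp
qed

subsection \<open>Polynomials vanishing on a smooth hypersurface\<close>

text \<open>Polynomials in four variables as iterated univariate ones: a type with unique
  factorisation.\<close>

type_synonym upoly = "complex poly poly poly poly"

definition ev4 :: "upoly => (nat => complex) => complex" where
 "ev4 q v = poly (poly (poly (poly q [:[:[:v 3:]:]:]) [:[:v 2:]:]) [:v 1:]) (v 0)"

definition trunc :: "(nat => complex) => nat => complex" where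
 "trunc v i = (if i <= 3 then v i else 0)"

definition Yv :: "nat => upoly" where
 "Yv i = (if i = 0 then [:[:[:[:0, 1:]:]:]:] else if i = 1 then [:[:[:0, 1:]:]:] else if i = 2 then [:[:0, 1:]:]
  else if i = 3 then [:0, 1:] else 0)"

definition emb :: "cpoly => upoly" where
 "emb G = (SUM m:keys G. [:[:[:[:lk G m:]:]:]:] * (PROD j:keys m. Yv j ^ lk m j))"

lemma ev4_simps [simp]: "ev4 (a + b) v = ev4 a v + ev4 b v" "ev4 (a * b) v = ev4 a v * ev4 b v" "ev4 0 v = 0" "ev4 1 v = 1"
 "ev4 [:[:[:[:c:]:]:]:] v = c" "ev4 (Yv i) v = trunc v i"
proof -
 have "i <= 3 \<longleftrightarrow> i = 0 \<or> i = 1 \<or> i = 2 \<or> i = 3" by auto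
 thus "ev4 (Yv i) v = trunc v i" unfolding Yv_def trunc_def by (auto simp: ev4_def)
qed (auto simp: ev4_def)

lemma ev4_sum [simp]: "ev4 (sum f A) v = (SUM x:A. ev4 (f x) v)"
 by (induction A rule: infinite_finite_induct) auto

lemma ev4_prod [simp]: "ev4 (prod f A) v = (PROD x:A. ev4 (f x) v)"
 by (induction A rule: infinite_finite_induct) auto

lemma ev4_power [simp]: "ev4 (a ^ k) v = ev4 a v ^ k"
 by (induction k) auto

lemma ev4_emb [simp]: "ev4 (emb G) v = ev G (trunc v)"
 by (simp add: emb_def eval_poly_def del: mult_pCons_left)

lemma poly_zeroI:
 fixes q :: "'a::idom poly" and h :: "complex => 'a"
 assumes "inj h" "!!c. poly q (h c) = 0"
 shows "q = 0"
proof (rule ccontr)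
 assume "q ~= 0"
 hence "finite {x. poly q x = 0}" by (rule poly_roots_finite)
 moreover have "range h <= {x. poly q x = 0}" using assms(2) by auto
 ultimately have "finite (range h)" by (rule rev_finite_subset)
 thus False using finite_imageD[OF _ assms(1)] infinite_UNIV_char_0 by blast
qed

lemma ev4_inject:
 assumes "!!v. ev4 q v = ev4 r v"
 shows "q = r"
proof -
 have z: "poly (poly (poly (poly (q - r) [:[:[:a:]:]:]) [:[:b:]:]) [:c:]) d = 0" for a b c d
  using assms[of "%i. if i = 3 then a else if i = 2 then b else if i = 1 then c else d"] by (simp add: ev4_def)
 have "q - r = 0"
  by (rule poly_zeroI[of "%a. [:[:[:a:]:]:]"], simp add: inj_def, rule poly_zeroI[of "%b. [:[:b:]:]"], simp add: inj_def,
   rule poly_zeroI[of "%c. [:c:]"], simp add: inj_def, rule poly_zeroI[of "%d. d"], simp, rule z)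
 thus ?thesis by simp
qed

lemma ev4_polynomial: "EX G. ALL v. ev G v = ev4 q v"
proof -
 have 1: "EX G. ALL v. ev G v = poly a (v 0)" for a
 proof (induction a)
  case (pCons c a)
  then obtain G where "ALL v. ev G v = poly a (v 0)" by blast
  thus ?case by (intro exI[of _ "const_poly c + Xv 0 * G"]) simp
 qed (auto intro: exI[of _ 0])
 have 2: "EX G. ALL v. ev G v = poly (poly a [:v 1:]) (v 0)" for a
 proof (induction a)
  case (pCons c a)
  then obtain G where "ALL v. ev G v = poly (poly a [:v 1:]) (v 0)" by blast
  moreover obtain H where "ALL v. ev H v = poly c (v 0)" using 1 by blast
  ultimately show ?case by (intro exI[of _ "H + Xv 1 * G"]) simp
 qed (auto intro: exI[of _ 0])
 have 3: "EX G. ALL v. ev G v = poly (poly (poly a [:[:v 2:]:]) [:v 1:]) (v 0)" for a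
 proof (induction a)
  case (pCons c a)
  then obtain G where "ALL v. ev G v = poly (poly (poly a [:[:v 2:]:]) [:v 1:]) (v 0)" by blast
  moreover obtain H where "ALL v. ev H v = poly (poly c [:v 1:]) (v 0)" using 2 by blast
  ultimately show ?case by (intro exI[of _ "H + Xv 2 * G"]) simp
 qed (auto intro: exI[of _ 0])
 show ?thesis
  unfolding ev4_def
 proof (induction q)
  case (pCons c a)
  then obtain G where "ALL v. ev G v = poly (poly (poly (poly a [:[:[:v 3:]:]:]) [:[:v 2:]:]) [:v 1:]) (v 0)" by blast
  moreover obtain H where "ALL v. ev H v = poly (poly (poly c [:[:v 2:]:]) [:v 1:]) (v 0)" using 3 by blast
  ultimately show ?case by (intro exI[of _ "H + Xv 3 * G"]) simp
 qed (auto intro: exI[of _ 0])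
qed

text \<open>Each prime occurs in \<open>q\<close> at most once, and it occurs in \<open>x\<close> as
  soon as it occurs in a power of \<open>x\<close>.\<close>

lemma squarefree_dvd:
 fixes q :: "'a::factorial_semiring"
 assumes sq: "!!a. a * a dvd q ==> a dvd 1" and q: "q ~= 0" and dvd: "q dvd x ^ n"
 shows "q dvd x"
proof (cases "x = 0")
 case False
 show ?thesis
 proof (rule multiplicity_le_imp_dvd[OF q])
  fix r :: 'a assume r: "prime r"
  show "multiplicity r q <= multiplicity r x"
  proof (cases "r dvd q")
   case True
   hence "r dvd x" using prime_dvd_power[OF r] dvd dvd_trans by blast
   hence "1 <= multiplicity r x" using r False by (intro multiplicity_geI) auto
   moreover have "multiplicity r q < 2"
   proof (rule multiplicity_lessI)
    show "~ r ^ 2 dvd q" using sq[of r] r by (auto simp: power2_eq_square)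
   qed (use q r in auto)
   ultimately show ?thesis by simp
  qed (simp add: not_dvd_imp_multiplicity_0)
 qed
qed simp

lemma coprime_Y: "q dvd Yv 2 ^ N ==> q dvd Yv 3 ^ N ==> q dvd 1"
proof -
 have "coprime (Yv 2) (Yv 3)"
 proof (rule coprimeI)
  fix d assume "d dvd Yv 2" "d dvd Yv 3"
  then obtain a b where a: "Yv 2 = d * a" and b: "Yv 3 = d * b" by (elim dvdE)
  have "degree (d * a) = 0" "d * a ~= 0" by (simp_all flip: a add: Yv_def)
  hence "degree d = 0" by (auto simp: degree_mult_eq)
  then obtain c where c: "d = [:c:]" by (metis degree_eq_zeroE)
  have "coeff (Yv 3) 1 = c * coeff b 1" unfolding b c by simp
  hence "1 = c * coeff b 1" by (simp add: Yv_def)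
  hence "c dvd 1" by (rule dvdI)
  thus "d dvd 1" by (simp add: c is_unit_const_poly_iff)
 qed
 hence "coprime (Yv 2 ^ N) (Yv 3 ^ N)" by simp
 thus "q dvd Yv 2 ^ N ==> q dvd Yv 3 ^ N ==> q dvd 1" by (rule coprime_common_divisor)
qed

lemma X_power_nonzero: "Xv i ^ K ~= 0"
proof
 assume 0: "Xv i ^ K = 0"
 have "ev (Xv i ^ K) (%_. 1) = 1" by simp
 thus False unfolding 0 by simp
qed

text \<open>From \<open>Xv j ^ K * A = Xv i ^ K * B\<close> the power of \<open>x_i\<close> divides
  \<open>A\<close> and can be cancelled. In this way divisibility known on two charts becomes
  divisibility of polynomials.\<close>

lemma depth_two:
 assumes F: "(F :: cpoly) ~= 0" and ij: "i ~= j" and A: "Xv i ^ K * z = F * A" and B: "Xv j ^ K * z = F * B"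
 shows "F dvd z"
proof -
 note X0 = X_power_nonzero[of i K]
 have "F * (Xv j ^ K * A) = F * (Xv i ^ K * B)"
  unfolding mult.left_commute[of F] A[symmetric] B[symmetric] by (rule mult.left_commute)
 hence AB: "Xv j ^ K * A = Xv i ^ K * B" using F by simp
 have "K <= lk m i" if m: "m : keys A" for m
 proof -
  let ?m = "m + sg j K"
  have "lk (Xv j ^ K * A) ?m ~= 0" using m by (simp add: lookup_X_mult lookup_add in_keys_iff)
  hence "K <= lk ?m i" unfolding AB lookup_X_mult by presburger
  thus ?thesis using ij by (simp add: lookup_add lookup_single)
 qed
 hence "A = Xv i ^ K * quo i K A" unfolding quo_select by (rule select_id[symmetric])
 hence "Xv i ^ K * z = F * (Xv i ^ K * quo i K A)" using A by simp
 hence "z = F * quo i K A" unfolding mult.left_commute[of F] using mult_left_cancel[OF X0] by blast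
 thus ?thesis by simp
qed

abbreviation "PP == subspace_of (projective_space 3) (ppoints 3)"

lemma PP: "proj_coords 3 PP rep" "points PP = ppoints 3"
proof -
 have "cls (projective_space 3) (ppoints 3)" using points_projective[of 3] by (metis closedin_topspace)
 thus "proj_coords 3 PP rep" by (rule proj_coords_closed)
qed (simp add: points_projective)

lemma form_eqI:
 assumes A: "form 3 d A" and B: "form 3 d B" and eq: "!!v. v : homog_coords 3 ==> ev A v = ev B v"
 shows "A = B"
proof (rule eval_inject)
 fix v
 show "ev A v = ev B v"
 proof (cases "EX i<=3. v i ~= 0")
  case True
  hence "trunc v : homog_coords 3" by (auto simp: homog_coords_def trunc_def fun_eq_iff)
  from eq[OF this] show ?thesis
   using form_eval_cong[OF A, of v "trunc v"] form_eval_cong[OF B, of v "trunc v"] by (simp add: trunc_def)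
 next
  case False
  let ?w = "%i::nat. if i = 0 then 1 else 0 :: complex"
  have "?w : homog_coords 3" by (auto simp: homog_coords_def fun_eq_iff)
  from eq[OF this] show ?thesis
   using form_eval_cong[OF A, of v "%i. 0 * ?w i"] form_eval_cong[OF B, of v "%i. 0 * ?w i"] False
    form_scale[OF A, of 0 ?w] form_scale[OF B, of 0 ?w] by simp
 qed
qed

lemma hideal_form: "(d, G) : hideal n J ==> (!!d F. (d, F) : J ==> form n d F) ==> form n d G"
 by (induction rule: hideal.induct) (auto intro!: form_add form_mult')

text \<open>The projective Nullstellensatz on all of projective space, where equality at every point
  is equality of forms. The bound \<open>D0\<close> leaves room to enlarge the exponent
  later.\<close>

lemma hideal_powers:
 assumes J: "!!d F. (d, F) : J ==> form 3 d F" and nz: "!!v. v : homog_coords 3 ==> EX (d, F):J. ev F v ~= 0"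
 shows "EX D0. ALL D>=D0. ALL i<=3. (D, Xv i ^ D) : hideal 3 J"
proof -
 have "EX D. ALL E. form 3 D E --> (EX G. (D, G) : hideal 3 J & (ALL x:points PP. ev E (rep x) = ev G (rep x)))"
  by (rule proj_nullstellensatz[OF PP(1) J nz]) (auto intro: pc_homog[OF PP(1)])
 then obtain D where D: "!!E. form 3 D E ==> EX G. (D, G) : hideal 3 J & (ALL x:points PP. ev E (rep x) = ev G (rep x))"
  by blast
 have XD: "(D, Xv i ^ D) : hideal 3 J" if i: "i <= 3" for i
 proof -
  have X: "form 3 D (Xv i ^ D)" using form_power[OF form_X[OF i], of D] by simp
  from D[OF X] obtain G where G: "(D, G) : hideal 3 J" "ALL x:points PP. ev (Xv i ^ D) (rep x) = ev G (rep x)" by blast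
  have "Xv i ^ D = G"
  proof (rule form_eqI[OF X])
   show fG: "form 3 D G" by (rule hideal_form[OF G(1) J])
   fix v assume v: "v : homog_coords 3"
   hence x: "proj_point v : points PP" using ppoints_def[of 3] PP(2) by blast
   obtain c where "c ~= 0" "rep (proj_point v) = (%i. c * v i)" using rep_scale by blast
   thus "ev (Xv i ^ D) v = ev G v"
    using G(2)[rule_format, OF x] form_scale[OF X, of c v] form_scale[OF fG, of c v] by simp
  qed
  thus ?thesis using G(1) by simp
 qed
 have "(E, Xv i ^ E) : hideal 3 J" if "D <= E" "i <= 3" for E i
  using hideal_mult[OF XD[OF that(2)] form_power[OF form_X[OF that(2)], of "E - D"]] that(1) by (simp add: power_add[symmetric])
 thus ?thesis by blast
qed

locale surface =
 fixes F :: cpoly and p :: nat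
 assumes F: "form 3 p F" and p: "p > 0"
  and smooth: "!!v. v : homog_coords 3 ==> ev F v = 0 ==> EX i<=3. ev (pd i F) v ~= 0"
begin

definition cone :: "(nat => complex) set" where
 "cone = {v : homog_coords 3. ev F v = 0}"

text \<open>By the relation of Euler a common zero of the partial derivatives is a zero of
  \<open>F\<close>, hence a singular point; so the partial derivatives have no common zero at
  all.\<close>

lemma jacobian: "EX N c. ALL i<=3. Xv i ^ N = (SUM l<=3. c i l * pd l F)"
proof -
 let ?J = "(%l. (p - 1, pd l F)) ` {..3}"
 have "EX D0. ALL D>=D0. ALL i<=3. (D, Xv i ^ D) : hideal 3 ?J"
 proof (rule hideal_powers)
  show "form 3 d G" if "(d, G) : ?J" for d G using that form_pd[OF F] by auto
  show "EX (d, G):?J. ev G v ~= 0" if v: "v : homog_coords 3" for v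
  proof (rule ccontr)
   assume no: "~ ?thesis"
   hence "of_nat p * ev F v = 0" unfolding euler_eval[OF F, symmetric] by (intro sum.neutral) auto
   thus False using smooth[OF v] no p by auto
  qed
 qed
 then obtain D where D: "!!i. i <= 3 ==> (D, Xv i ^ D) : hideal 3 ?J" by blast
 have "EX c. G = (SUM l<=3. c l * pd l F)" if "(d, G) : hideal 3 ?J" for d G
  using that
 proof induction
  case (hid_0 D)
  show ?case by (auto intro: exI[of _ "%_. 0"])
 next
  case (hid_add D G d H e Q)
  then obtain c l where c: "G = (SUM l<=3. c l * pd l F)" "l <= 3" "H = pd l F" by auto
  have "(SUM k<=3. (c k + (if k = l then Q else 0)) * pd k F) = (SUM k<=3. c k * pd k F + (if k = l then pd l F * Q else 0))"
   by (rule sum.cong) (auto simp: algebra_simps)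
  hence "G + H * Q = (SUM k<=3. (c k + (if k = l then Q else 0)) * pd k F)" using c by (simp add: sum.distrib)
  thus ?case by (rule exI[of _ "%k. c k + (if k = l then Q else 0)"])
 qed
 with D have "ALL i. EX c. i <= 3 --> Xv i ^ D = (SUM l<=3. c l * pd l F)" by blast
 thus ?thesis unfolding choice_iff by blast
qed

lemma F_nonzero: "F ~= 0"
proof
 assume "F = 0"
 moreover have "(%i::nat. if i = 0 then 1 else 0) : homog_coords 3" by (auto simp: homog_coords_def fun_eq_iff)
 ultimately show False using smooth by force
qed

text \<open>A double factor divides all partial derivatives, hence by \<open>jacobian\<close> powers
  of all four variables, and is a unit.\<close>

lemma emb_squarefree:
 assumes "q * q dvd emb F"
 shows "q dvd 1"
proof -
 obtain r where r: "emb F = q * q * r" using assms by (elim dvdE)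
 obtain Q where Q: "ALL v. ev Q v = ev4 q v" using ev4_polynomial by blast
 obtain R where R: "ALL v. ev R v = ev4 r v" using ev4_polynomial by blast
 have FQ: "F = Q * Q * R"
 proof (rule eval_inject)
  fix v
  have "ev F v = ev4 (emb F) v" using form_eval_cong[OF F, of v "trunc v"] by (simp add: trunc_def)
  thus "ev F v = ev (Q * Q * R) v" by (simp add: r Q R)
 qed
 obtain N c where c: "ALL i<=3. Xv i ^ N = (SUM l<=3. c i l * pd l F)" using jacobian by blast
 have "q dvd Yv i ^ N" if i: "i <= 3" for i
 proof -
  let ?W = "SUM l<=3. c i l * (2 * pd l Q * R + Q * pd l R)"
  have X: "Xv i ^ N = Q * ?W"
   unfolding c[rule_format, OF i] sum_distrib_left by (rule sum.cong) (simp_all add: FQ pd_mult algebra_simps)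
  have "Yv i ^ N = q * emb ?W"
  proof (rule ev4_inject)
   fix v
   have "ev4 q v = ev Q (trunc v)" using Q by (simp add: ev4_def trunc_def)
   thus "ev4 (Yv i ^ N) v = ev4 (q * emb ?W) v"
    using arg_cong[OF X, of "%G. ev G (trunc v)"] by (simp del: eval_sum)
  qed
  thus ?thesis by simp
 qed
 from coprime_Y[OF this this] show ?thesis by simp
qed

text \<open>The radical Nullstellensatz on charts shows that \<open>F\<close> divides a power of
  \<open>g\<close> times a power of \<open>x_j\<close>. Two charts remove the variable, and
  squarefreeness of \<open>F\<close> removes the exponent of \<open>g\<close>.\<close>

theorem vanishing_multiple:
 assumes g: "form 3 d g" and van: "!!v. v : cone ==> ev g v = 0"
 shows "EX Q. g = F * Q & form 3 (d - p) Q & (d < p --> Q = 0)"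
proof -
 have chart: "EX n M Q. Xv j ^ M * g ^ n = F * Q" if j: "j <= 3" for j
 proof -
  let ?L = "Xv j" and ?U = "Dset PP rep (Xv j)" and ?O = "chart_alg 3 PP rep (Xv j)"
  have L: "form 3 1 ?L" by (rule form_X[OF j])
  have Lp: "form 3 k (?L ^ k)" for k using form_power[OF L, of k] by simp
  note alg = fun_alg_chart[OF L, of PP rep]
  let ?g = "%x. ev g (rep x) / ev ?L (rep x) ^ d" and ?f = "%x. ev F (rep x) / ev ?L (rep x) ^ p"
  have "EX n m s f. (ALL k<(m::nat). s k : {?f} & f k : ?O) & (ALL x:?U. ?g x ^ n = (SUM k<m. s k x * f k x))"
  proof (rule radical_nullstellensatz[OF affine_chart[OF PP(1) L]])
   show "?g : ?O" by (rule chart_algI[OF g refl])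
   have "?f : ?O" by (rule chart_algI[OF F refl])
   thus "{?f} <= ?O" by blast
   fix x assume x: "x : ?U" and "ALL f:{?f}. f x = 0"
   hence "rep x : cone" using pc_homog[OF PP(1), of x] by (auto simp: cone_def Dset_def)
   thus "?g x = 0" using van by simp
  qed
  then obtain n m s f where f: "!!k. k < (m::nat) ==> s k = ?f" "!!k. k < m ==> f k : ?O"
   "!!x. x : ?U ==> ?g x ^ n = (SUM k<m. s k x * f k x)" by blast
  have "(%x. SUM k<m. f k x) : ?O" using f(2) by (intro fun_alg_sum[OF alg]) auto
  then obtain e Q where Q: "form 3 e Q" "ALL x:?U. (SUM k<m. f k x) = ev Q (rep x) / ev ?L (rep x) ^ e"
   by (elim chart_algE)
  \<comment> \<open>The summands 1 in the exponents let both sides vanish where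
    \<open>x_j = 0\<close>, so the identity of forms need only be checked on the chart.\<close>
  have "?L ^ (p + e + 1) * g ^ n = F * (?L ^ (d * n + 1) * Q)"
  proof (rule form_eqI)
   show "form 3 (p + e + 1 + n * d) (?L ^ (p + e + 1) * g ^ n)" by (rule form_mult[OF Lp form_power[OF g]])
   show "form 3 (p + e + 1 + n * d) (F * (?L ^ (d * n + 1) * Q))"
    by (rule form_mult'[OF F form_mult[OF Lp Q(1)]]) simp
   fix v assume v: "v : homog_coords 3"
   show "ev (?L ^ (p + e + 1) * g ^ n) v = ev (F * (?L ^ (d * n + 1) * Q)) v"
   proof (cases "v j = 0")
    case False
    let ?x = "proj_point v"
    obtain c where c: "c ~= 0" "rep ?x = (%i. c * v i)" using rep_scale by blast
    have "?x : points PP" using v ppoints_def[of 3] PP(2) by blast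
    hence x: "?x : ?U" using False c by (simp add: Dset_def)
    have gv: "ev g (rep ?x) = c ^ d * ev g v" and Fv: "ev F (rep ?x) = c ^ p * ev F v"
     and Qv: "ev Q (rep ?x) = c ^ e * ev Q v" unfolding c(2) by (rule form_scale[OF g] form_scale[OF F] form_scale[OF Q(1)])+
    have "?g ?x ^ n = ?f ?x * (SUM k<m. f k ?x)" using f(3)[OF x] f(1) by (simp add: sum_distrib_left)
    hence "(ev g v / v j ^ d) ^ n = (ev F v / v j ^ p) * (ev Q v / v j ^ e)"
     using c(1) Q(2) x by (simp add: gv Fv Qv) (simp add: c(2) power_mult_distrib)
    thus ?thesis using False by (simp add: power_divide power_mult[symmetric] field_simps power_add)
   qed simp
  qed
  thus ?thesis by blast
 qed
 obtain n0 M0 Q0 where 0: "Xv 0 ^ M0 * g ^ n0 = F * Q0" using chart[of 0] by auto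
 obtain n1 M1 Q1 where 1: "Xv 1 ^ M1 * g ^ n1 = F * Q1" using chart[of 1] by auto
 have "F dvd g ^ (n0 + n1)"
 proof (rule depth_two[OF F_nonzero, of 0 1])
  show "Xv 0 ^ (M0 + M1) * g ^ (n0 + n1) = F * (Q0 * Xv 0 ^ M1 * g ^ n1)" using 0 by (simp add: power_add)
  show "Xv 1 ^ (M0 + M1) * g ^ (n0 + n1) = F * (Q1 * Xv 1 ^ M0 * g ^ n0)" using 1 by (simp add: power_add)
 qed simp
 then obtain C where C: "g ^ (n0 + n1) = F * C" by (elim dvdE)
 have "emb g ^ (n0 + n1) = emb F * emb C"
  by (rule ev4_inject) (use arg_cong[OF C, of "%G. ev G (trunc _)"] in simp)
 hence "emb F dvd emb g ^ (n0 + n1)" by simp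
 moreover have "emb F ~= 0"
 proof
  assume "emb F = 0"
  have "F = 0"
  proof (rule eval_inject)
   fix v show "ev F v = ev 0 v"
    using ev4_emb[of F v] form_eval_cong[OF F, of v "trunc v"] \<open>emb F = 0\<close> by (simp add: trunc_def)
  qed
  thus False using F_nonzero by simp
 qed
 ultimately have "emb F dvd emb g" using squarefree_dvd emb_squarefree by blast
 then obtain r where r: "emb g = emb F * r" by (elim dvdE)
 obtain R where R: "ALL v. ev R v = ev4 r v" using ev4_polynomial by blast
 have "g = F * R"
 proof (rule eval_inject)
  fix v show "ev g v = ev (F * R) v"
   using ev4_emb[of F v] ev4_emb[of g v] form_eval_cong[OF F, of v "trunc v"] form_eval_cong[OF g, of v "trunc v"]
   by (simp add: trunc_def r R)
 qed
 from form_divide[OF F g this] show ?thesis .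
qed

lemma XI_2: "G : XI N 2 ==> G = Xv 0 ^ N * quo 0 N (G - Xv 1 ^ N * quo 1 N G) + Xv 1 ^ N * quo 1 N G"
 using XI_Suc[of "G - Xv 1 ^ N * quo 1 N G" N 0] XI_Suc[of G N 1] by (simp add: XI_0 numeral_2_eq_2 algebra_simps)

text \<open>Global sections of \<open>O(n)\<close> on the surface are forms, because the depth at the vertex of the cone is \<open>3\<close>.\<close>

theorem global_form:
 assumes loc: "!!v. v : cone ==> EX d N M. form 3 (n + d) N & form 3 d M & ev M v ~= 0 &
  (ALL w:cone. ev M w ~= 0 --> ev M w * \<eta> w = ev N w)"
 shows "EX G. form 3 n G & (ALL v:cone. \<eta> v = ev G v)"
proof -
 \<comment> \<open>\<open>M\<close> is admissible if it turns \<open>\<eta>\<close> into a form on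
   the whole cone.\<close>
 let ?P = "%d M. EX N. form 3 (n + d) N & (ALL w:cone. ev M w * \<eta> w = ev N w)"
 let ?J = "{(d, M). form 3 d M & ?P d M}"
 have "EX D0. ALL D>=D0. ALL i<=3. (D, Xv i ^ D) : hideal 3 ?J"
 proof (rule hideal_powers)
  fix v assume v: "v : homog_coords 3"
  show "EX (d, M):?J. ev M v ~= 0"
  proof (cases "ev F v = 0")
   case True
   then obtain d N M where M: "form 3 (n + d) N" "form 3 d M" "ev M v ~= 0"
    "ALL w:cone. ev M w ~= 0 --> ev M w * \<eta> w = ev N w"
    using loc[of v] v unfolding cone_def by auto
   have "form 3 (d + d) (M * M)" "form 3 (n + (d + d)) (M * N)" using M by (auto intro: form_mult' )
   moreover have "ALL w:cone. ev (M * M) w * \<eta> w = ev (M * N) w" using M(4) by (auto simp: mult.assoc)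
   ultimately have "(d + d, M * M) : ?J" by blast
   thus ?thesis by (rule bexI[rotated]) (simp add: M)
  next
   case False
   \<comment> \<open>Off the cone \<open>F\<close> itself is an admissible denominator, with
     numerator 0; so the admissible forms have no common zero in the whole projective space.\<close>
   have "(p, F) : ?J" using F by (auto intro!: exI[of _ 0] simp: cone_def)
   thus ?thesis by (rule bexI[rotated]) (simp add: False)
  qed
 qed auto
 \<comment> \<open>The bound \<open>p <= D\<close> keeps \<open>n + D - p\<close> from being
   truncated when a form of that degree is multiplied by \<open>F\<close>.\<close>
 then obtain D where D: "p <= D" "!!i. i <= 3 ==> (D, Xv i ^ D) : hideal 3 ?J" by (meson nle_le)
 have hid: "?P d M" if "(d, M) : hideal 3 ?J" for d M
  using that
 proof induction
  case (hid_0 D)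
  show ?case by (auto intro: exI[of _ 0])
 next
  case (hid_add D G d H e Q)
  then obtain N N' where N: "form 3 (n + D) N" "ALL w:cone. ev G w * \<eta> w = ev N w"
   "form 3 (n + d) N'" "ALL w:cone. ev H w * \<eta> w = ev N' w" by blast
  have "form 3 (n + D) (N + N' * Q)" 
   using form_mult[OF N(3) hid_add.hyps(3)] hid_add.hyps(4) by (intro form_add N(1)) (simp add: add.assoc)
  moreover have "ALL w:cone. ev (G + H * Q) w * \<eta> w = ev (N + N' * Q) w"
   using N by (simp add: algebra_simps)
  ultimately show ?case by blast
 qed
 from hid[OF D(2)] have "ALL i. EX G. i <= 3 --> form 3 (n + D) G & (ALL w:cone. ev (Xv i ^ D) w * \<eta> w = ev G w)" by blast
 then obtain G where G: "!!i. i <= 3 ==> form 3 (n + D) (G i)" "!!i w. i <= 3 ==> w : cone ==> w i ^ D * \<eta> w = ev (G i) w"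
  unfolding choice_iff by auto
 let ?X = "%i. Xv i ^ D"
 have X: "form 3 D (?X i)" if "i <= 3" for i using form_power[OF form_X[OF that], of D] by simp
 have "EX Q. ?X i * G j - ?X j * G i = F * Q & form 3 (D + (n + D) - p) Q & (D + (n + D) < p --> Q = 0)" if ij: "i <= 3" "j <= 3" for i j
 proof (rule vanishing_multiple)
  show "form 3 (D + (n + D)) (?X i * G j - ?X j * G i)" using ij by (intro form_diff form_mult X G(1))
  show "ev (?X i * G j - ?X j * G i) v = 0" if "v : cone" for v
   using G(2)[OF ij(1) that] G(2)[OF ij(2) that] by (simp flip: G(2)[OF ij(1) that] G(2)[OF ij(2) that])
 qed
 hence "ALL i. EX q. ALL j. i <= 3 --> j <= 3 --> ?X i * G j - ?X j * G i = F * q j & form 3 (D + (n + D) - p) (q j)" by metis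
 then obtain Q where Q: "!!i j. i <= 3 ==> j <= 3 ==> ?X i * G j - ?X j * G i = F * Q i j"
  "!!i j. i <= 3 ==> j <= 3 ==> form 3 (D + (n + D) - p) (Q i j)" unfolding choice_iff by blast
 \<comment> \<open>The cocycle relation among the \<open>Q i j\<close>, where a third variable is
   needed: it puts \<open>Q 0 1\<close> into the ideal of the powers of \<open>x_0\<close> and
   \<open>x_1\<close>.\<close>
 have "F * (?X 2 * Q 0 1) = F * (?X 1 * Q 0 2 - ?X 0 * Q 1 2)"
  using Q(1)[of 0 1] Q(1)[of 0 2] Q(1)[of 1 2] by (simp add: right_diff_distrib mult.left_commute[of F] flip: Q(1))
 hence "?X 2 * Q 0 1 = ?X 1 * Q 0 2 - ?X 0 * Q 1 2" using F_nonzero by simp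
 also have "... : XI D 2"
  using XI_X[of 1 D "Q 0 2"] XI_mono[OF XI_X[of 0 D "Q 1 2"]] by (simp add: XI_diff numeral_2_eq_2)
 finally have "Q 0 1 : XI D 2" by (rule XI_cancel)
 hence Q01: "Q 0 1 = ?X 0 * quo 0 D (Q 0 1 - ?X 1 * quo 1 D (Q 0 1)) + ?X 1 * quo 1 D (Q 0 1)" by (rule XI_2)
 \<comment> \<open>With \<open>Q 0 1 = ?X 0 * T1 - ?X 1 * T0\<close>, subtracting
   \<open>F * T0\<close> and \<open>F * T1\<close> turns agreement of the local sections on the cone
   into an identity of polynomials.\<close>
 define T0 T1 where "T0 = - quo 1 D (Q 0 1)" and "T1 = quo 0 D (Q 0 1 - ?X 1 * quo 1 D (Q 0 1))"
 have T0: "form 3 (n + D - p) T0"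
  unfolding T0_def using quo_form[OF Q(2)[of 0 1], of D 1] by (auto intro!: form_uminus simp: algebra_simps)
 define E where "E = quo 0 D (G 0 - F * T0)"
 have xy: "?X 0 * (G 1 - F * T1) = ?X 1 * (G 0 - F * T0)"
 proof -
  have "Q 0 1 = ?X 0 * T1 - ?X 1 * T0" using Q01 unfolding T0_def T1_def mult_minus_right diff_minus_eq_add .
  hence "?X 0 * G 1 - ?X 1 * G 0 = F * (?X 0 * T1 - ?X 1 * T0)" using Q(1)[of 0 1] by simp
  moreover have "?X 0 * (G 1 - F * T1) - ?X 1 * (G 0 - F * T0) = (?X 0 * G 1 - ?X 1 * G 0) - F * (?X 0 * T1 - ?X 1 * T0)"
   by (simp add: algebra_simps)
  ultimately show ?thesis by simp
 qed
 have "?X 1 * (G 0 - F * T0) : XI D 1" unfolding xy[symmetric] using XI_X[of 0 D] by simp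
 hence "G 0 - F * T0 : XI D 1" by (rule XI_cancel)
 hence E0: "G 0 - F * T0 = ?X 0 * E" using XI_Suc[of "G 0 - F * T0" D 0] by (simp add: XI_0 E_def)
 have X0: "?X 0 ~= 0" by (rule X_power_nonzero)
 have "?X 0 * (G 1 - F * T1) = ?X 0 * (?X 1 * E)" unfolding xy E0 by (simp add: mult.left_commute)
 hence E1: "G 1 - F * T1 = ?X 1 * E" by (rule mult_left_cancel[OF X0, THEN iffD1])
 \<comment> \<open>For the remaining charts agreement modulo \<open>F\<close> is enough, and it is
   tested after multiplication by powers of \<open>x_0\<close> and of \<open>x_1\<close>.\<close>
 have Ek: "F dvd G k - ?X k * E" if k: "k <= 3" for k
 proof (rule depth_two[OF F_nonzero, of 0 1])
  have "?X 0 * (G k - ?X k * E) = ?X 0 * G k - ?X k * (?X 0 * E)" by (simp add: algebra_simps)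
  also have "... = F * (Q 0 k + ?X k * T0)"
   unfolding E0[symmetric] using Q(1)[of 0 k] k by (simp add: algebra_simps)
  finally show "?X 0 * (G k - ?X k * E) = F * (Q 0 k + ?X k * T0)" .
  have "?X 1 * (G k - ?X k * E) = ?X 1 * G k - ?X k * (?X 1 * E)" by (simp add: algebra_simps)
  also have "... = F * (Q 1 k + ?X k * T1)"
   unfolding E1[symmetric] using Q(1)[of 1 k] k by (simp add: algebra_simps)
  finally show "?X 1 * (G k - ?X k * E) = F * (Q 1 k + ?X k * T1)" .
 qed simp
 have "form 3 (n + D) (G 0 - F * T0)" using D(1) by (intro form_diff G(1) form_mult'[OF F T0]) auto
 hence "form 3 n E" unfolding E_def using quo_form[of 3 "n + D" _ D 0] by simp
 moreover have "\<eta> v = ev E v" if v: "v : cone" for v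
 proof -
  obtain k where k: "k <= 3" "v k ~= 0" using v homog_nonzero unfolding cone_def by blast
  obtain R where R: "G k - ?X k * E = F * R" using Ek[OF k(1)] by (elim dvdE)
  have "v k ^ D * \<eta> v = v k ^ D * ev E v"
   using arg_cong[OF R, of "%G. ev G v"] G(2)[OF k(1) v] v by (simp add: cone_def)
  thus ?thesis using k(2) by simp
 qed
 ultimately show ?thesis by blast
qed

end

subsection \<open>Differentials on a smooth hypersurface\<close>


lemma pd_const [simp]: "pd a (const_poly c) = 0"
 by (simp add: const_poly_def pd_single)

context surface
begin

text \<open>The fraction \<open>N / M\<close> of degree zero represents \<open>h\<close> on the
  neighbourhood of \<open>v\<close> in the cone where \<open>E\<close> is nonzero; the relation is
  cleared of denominators.\<close>

definition germ :: "((nat => complex) => complex) => (nat => complex) => nat => cpoly => cpoly => bool" where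
 "germ h v d N M \<longleftrightarrow> form 3 d N & form 3 d M & ev M v ~= 0 &
  (EX e E. form 3 e E & ev E v ~= 0 & (ALL w:cone. ev E w ~= 0 --> ev M w * h w = ev N w))"

lemma germI: "form 3 d N ==> form 3 d M ==> ev M v ~= 0 ==> form 3 e E ==> ev E v ~= 0 ==>
  (!!w. w : cone ==> ev E w ~= 0 ==> ev M w * h w = ev N w) ==> germ h v d N M"
 unfolding germ_def by blast

lemma germE:
 assumes "germ h v d N M"
 obtains e E where "form 3 d N" "form 3 d M" "ev M v ~= 0" "form 3 e E" "ev E v ~= 0"
  "!!w. w : cone ==> ev E w ~= 0 ==> ev M w * h w = ev N w"
 using assms unfolding germ_def by blast

text \<open>\<open>G * E\<close> is a multiple \<open>F * Q\<close>. Since \<open>F\<close> and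
  \<open>G\<close> vanish at \<open>v\<close>, differentiation leaves E dG = Q dF.\<close>

lemma vanishing_gradient:
 assumes v: "v : cone" and G: "form 3 d G" "form 3 e E" "ev E v ~= 0"
  and van: "!!w. w : cone ==> ev E w ~= 0 ==> ev G w = 0"
 shows "EX k. ALL a. ev (pd a G) v = k * ev (pd a F) v"
proof -
 have "EX Q. G * E = F * Q & form 3 (d + e - p) Q & (d + e < p --> Q = 0)"
  by (rule vanishing_multiple[OF form_mult[OF G(1,2)]]) (use van in auto)
 then obtain Q where Q: "G * E = F * Q" by blast
 have "ev E v * ev (pd a G) v = ev Q v * ev (pd a F) v" for a
  using arg_cong[OF Q, of "%P. ev (pd a P) v"] van[OF v G(3)] v by (simp add: pd_mult cone_def mult.commute)
 thus ?thesis using G(3) by (intro exI[of _ "ev Q v / ev E v"]) (simp add: field_simps)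
qed

text \<open>The differential of \<open>h\<close> at \<open>v\<close> modulo dF is independent of the
  fraction, because \<open>N * M' - M * N'\<close> vanishes on the cone near
  \<open>v\<close>.\<close>

lemma germ_gradient:
 assumes v: "v : cone" and g: "germ h v d N M" "germ h v d' N' M'"
 shows "EX k. ALL a. ev M' v * (ev (pd a N) v - h v * ev (pd a M) v) - ev M v * (ev (pd a N') v - h v * ev (pd a M') v) = k * ev (pd a F) v"
proof -
 obtain e E where 1: "form 3 d N" "form 3 d M" "ev M v ~= 0" "form 3 e E" "ev E v ~= 0"
  "!!w. w : cone ==> ev E w ~= 0 ==> ev M w * h w = ev N w" using germE[OF g(1)] by blast
 obtain e' E' where 2: "form 3 d' N'" "form 3 d' M'" "ev M' v ~= 0" "form 3 e' E'" "ev E' v ~= 0"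
  "!!w. w : cone ==> ev E' w ~= 0 ==> ev M' w * h w = ev N' w" using germE[OF g(2)] by blast
 have "EX k. ALL a. ev (pd a (N * M' - M * N')) v = k * ev (pd a F) v"
 proof (rule vanishing_gradient[OF v form_diff form_mult[OF 1(4) 2(4)]])
  show "form 3 (d + d') (N * M')" "form 3 (d + d') (M * N')" using 1 2 by (auto intro: form_mult)
  show "ev (E * E') v ~= 0" using 1 2 by simp
  show "ev (N * M' - M * N') w = 0" if "w : cone" "ev (E * E') w ~= 0" for w
  proof -
   have "ev N w = ev M w * h w" "ev N' w = ev M' w * h w" using 1(6)[OF that(1)] 2(6)[OF that(1)] that(2) by auto
   thus ?thesis by simp
  qed
 qed
 then obtain k where k: "!!a. ev (pd a (N * M' - M * N')) v = k * ev (pd a F) v" by blast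
 have "ev (pd a (N * M' - M * N')) v = ev M' v * (ev (pd a N) v - h v * ev (pd a M) v) - ev M v * (ev (pd a N') v - h v * ev (pd a M') v)" for a
  unfolding pd_diff pd_mult using 1(6)[OF v 1(5)] 2(6)[OF v 2(5)] by (simp add: algebra_simps flip: 1(6)[OF v 1(5)] 2(6)[OF v 2(5)])
 with k show ?thesis by auto
qed

text \<open>The differential of \<open>h\<close> on the surface vanishes at \<open>v\<close>: up to
  the factor \<open>M\<close>, its gradient is a multiple of the normal vector dF.\<close>

definition flat :: "((nat => complex) => complex) => (nat => complex) => bool" where
 "flat h v \<longleftrightarrow> (EX d N M k. germ h v d N M & (ALL a<=3. ev (pd a N) v - h v * ev (pd a M) v = k * ev (pd a F) v))"

lemma flat_germ:
 assumes v: "v : cone" and h: "flat h v" and g: "germ h v d N M"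
 shows "EX k. ALL a<=3. ev (pd a N) v - h v * ev (pd a M) v = k * ev (pd a F) v"
proof -
 obtain d' N' M' k where f: "germ h v d' N' M'" "ALL a<=3. ev (pd a N') v - h v * ev (pd a M') v = k * ev (pd a F) v"
  using h unfolding flat_def by blast
 obtain l where l: "ALL a. ev M' v * (ev (pd a N) v - h v * ev (pd a M) v) - ev M v * (ev (pd a N') v - h v * ev (pd a M') v) = l * ev (pd a F) v"
  using germ_gradient[OF v g f(1)] by blast
 have M': "ev M' v ~= 0" using f(1) by (simp add: germ_def)
 have "ev (pd a N) v - h v * ev (pd a M) v = ((l + ev M v * k) / ev M' v) * ev (pd a F) v" if "a <= 3" for a
  using l[rule_format, of a] f(2) that M' by (simp add: field_simps)
 thus ?thesis by blast
qed

lemma germ_cong: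
 assumes g: "germ h v d N M" and E: "form 3 e E" "ev E v ~= 0" "!!w. w : cone ==> ev E w ~= 0 ==> h' w = h w"
 shows "germ h' v d N M"
proof -
 obtain e' E' where 1: "form 3 d N" "form 3 d M" "ev M v ~= 0" "form 3 e' E'" "ev E' v ~= 0"
  "!!w. w : cone ==> ev E' w ~= 0 ==> ev M w * h w = ev N w" using germE[OF g(1)] by blast
 show ?thesis by (rule germI[OF 1(1-3) form_mult[OF 1(4) E(1)]]) (use 1 E in auto)
qed

lemma flat_cong:
 assumes "flat h v" "v : cone" "form 3 e E" "ev E v ~= 0" "!!w. w : cone ==> ev E w ~= 0 ==> h' w = h w"
 shows "flat h' v"
proof -
 obtain d N M k where f: "germ h v d N M" "ALL a<=3. ev (pd a N) v - h v * ev (pd a M) v = k * ev (pd a F) v"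
  using assms(1) unfolding flat_def by blast
 thus ?thesis unfolding flat_def using germ_cong[OF f(1) assms(3-5)] assms(5)[OF assms(2,4)] by (intro exI conjI) auto
qed

lemma flat_const: "flat (%_. c) v"
proof -
 have "germ (%_. c) v 0 (const_poly c) (const_poly 1)"
  by (rule germI[where E = 1, OF form_const form_const _ form_1]) auto
 thus ?thesis unfolding flat_def by (intro exI[of _ 0] exI conjI) auto
qed

lemma flat_add:
 assumes v: "v : cone" and h: "flat h v" "flat g v"
 shows "flat (%w. h w + g w) v"
proof -
 obtain d N M k where f: "germ h v d N M" "ALL a<=3. ev (pd a N) v - h v * ev (pd a M) v = k * ev (pd a F) v"
  using h(1) unfolding flat_def by blast
 obtain d' N' M' k' where f': "germ g v d' N' M'" "ALL a<=3. ev (pd a N') v - g v * ev (pd a M') v = k' * ev (pd a F) v"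
  using h(2) unfolding flat_def by blast
 obtain e E where 1: "form 3 d N" "form 3 d M" "ev M v ~= 0" "form 3 e E" "ev E v ~= 0"
  "!!w. w : cone ==> ev E w ~= 0 ==> ev M w * h w = ev N w" using germE[OF f(1)] by blast
 obtain e' E' where 2: "form 3 d' N'" "form 3 d' M'" "ev M' v ~= 0" "form 3 e' E'" "ev E' v ~= 0"
  "!!w. w : cone ==> ev E' w ~= 0 ==> ev M' w * g w = ev N' w" using germE[OF f'(1)] by blast
 have "germ (%w. h w + g w) v (d + d') (N * M' + M * N') (M * M')"
 proof (rule germI[OF _ _ _ form_mult[OF 1(4) 2(4)]])
  show "ev (M * M') w * (h w + g w) = ev (N * M' + M * N') w" if "w : cone" "ev (E * E') w ~= 0" for w
   using 1(6)[of w] 2(6)[of w] that by (simp add: algebra_simps flip: 1(6) 2(6))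
 qed (use 1 2 in "auto intro!: form_add form_mult")
 moreover have "ev (pd a (N * M' + M * N')) v - (h v + g v) * ev (pd a (M * M')) v = (ev M' v * k + ev M v * k') * ev (pd a F) v" if "a <= 3" for a
 proof -
  have "ev (pd a N) v = h v * ev (pd a M) v + k * ev (pd a F) v" "ev (pd a N') v = g v * ev (pd a M') v + k' * ev (pd a F) v"
   using f(2) f'(2) that by (auto simp: algebra_simps)
  moreover have "ev N v = ev M v * h v" "ev N' v = ev M' v * g v" using 1(6)[OF v 1(5)] 2(6)[OF v 2(5)] by auto
  ultimately show ?thesis by (simp add: pd_add pd_mult algebra_simps)
 qed
 ultimately show ?thesis unfolding flat_def by blast
qed

lemma flat_mult:
 assumes v: "v : cone" and h: "flat h v" "h v = 0" and g: "germ g v d' N' M'"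
 shows "flat (%w. h w * g w) v"
proof -
 obtain d N M k where f: "germ h v d N M" "ALL a<=3. ev (pd a N) v - h v * ev (pd a M) v = k * ev (pd a F) v"
  using h(1) unfolding flat_def by blast
 obtain e E where 1: "form 3 d N" "form 3 d M" "ev M v ~= 0" "form 3 e E" "ev E v ~= 0"
  "!!w. w : cone ==> ev E w ~= 0 ==> ev M w * h w = ev N w" using germE[OF f(1)] by blast
 obtain e' E' where 2: "form 3 d' N'" "form 3 d' M'" "ev M' v ~= 0" "form 3 e' E'" "ev E' v ~= 0"
  "!!w. w : cone ==> ev E' w ~= 0 ==> ev M' w * g w = ev N' w" using germE[OF g] by blast
 have "germ (%w. h w * g w) v (d + d') (N * N') (M * M')"
 proof (rule germI[OF _ _ _ form_mult[OF 1(4) 2(4)]])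
  show "ev (M * M') w * (h w * g w) = ev (N * N') w" if "w : cone" "ev (E * E') w ~= 0" for w
   using 1(6)[of w] 2(6)[of w] that by (simp add: mult_ac flip: 1(6) 2(6))
 qed (use 1 2 in "auto intro!: form_mult")
 moreover have "ev (pd a (N * N')) v - h v * g v * ev (pd a (M * M')) v = (ev N' v * k) * ev (pd a F) v" if "a <= 3" for a
  using f(2) that h(2) 1(6)[OF v 1(5)] by (simp add: pd_mult mult_ac)
 ultimately show ?thesis unfolding flat_def by blast
qed

text \<open>There are no nonzero \<open>1\<close>-forms: the \<open>2 \<times> 2\<close> minors \<open>\<eta>\<close> of \<open>(dh, dF)\<close> are forms of degree \<open>p - 2\<close>,
  and both they and the quotients of \<open>dF \<and> \<eta>\<close> by \<open>F\<close> are syzygies of degree less than \<open>p - 1\<close>.\<close>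

theorem no_differentials:
 assumes p2: "3 <= p" and h0: "!!v. v : cone ==> h v v = 0"
  and loc: "!!v0. v0 : cone ==> EX d P B e E. 0 < d & (ALL a<=3. form 3 (d - 1) (P a)) & form 3 d B & ev B v0 ~= 0 &
   form 3 e E & ev E v0 ~= 0 & (ALL v:cone. ev (B * E) v ~= 0 --> (EX d N M. germ (h v) v d N M &
    ev M v = ev B v & (ALL a<=3. ev (pd a N) v = ev (P a) v)))"
  and v: "v : cone"
 shows "flat (h v) v"
proof -
 have "ALL v. EX d. EX N. EX M. v : cone --> germ (h v) v d N M"
 proof
  fix v
  show "EX d. EX N. EX M. v : cone --> germ (h v) v d N M"
  proof (cases "v : cone")
   case True
   from loc[OF this] obtain d N M where "germ (h v) v d N M" using True by auto
   thus ?thesis by blast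
  qed simp
 qed
 then obtain dd NN MM where g: "!!v. v : cone ==> germ (h v) v (dd v) (NN v) (MM v)" unfolding choice_iff by blast
 \<comment> \<open>Since \<open>h v v = 0\<close>, the derivative of the denominator drops out and
   dN / M is the gradient of \<open>h v\<close> at \<open>v\<close>, up to multiples of dF.\<close>
 define \<delta> where "\<delta> a v = ev (pd a (NN v)) v / ev (MM v) v" for a v
 define \<eta> where "\<eta> a b v = \<delta> a v * ev (pd b F) v - \<delta> b v * ev (pd a F) v" for a b v
 have Mv: "ev (MM v) v ~= 0" if "v : cone" for v using g[OF that] by (simp add: germ_def)
 \<comment> \<open>The minors do not see multiples of dF, so the uniform fractions from
   \<open>loc\<close> compute them. The degree is (d - 1) + (p - 1) + e minus that of the
   denominator, d + e.\<close>
 have "EX G. form 3 (p - 2) G & (ALL v:cone. \<eta> a b v = ev G v)" if ab: "a <= 3" "b <= 3" for a b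
 proof (rule global_form)
  fix v0 assume "v0 : cone"
  from loc[OF this] obtain d P B e E where 1: "0 < d" "ALL a<=3. form 3 (d - 1) (P a)" "form 3 d B" "ev B v0 ~= 0"
   "form 3 e E" "ev E v0 ~= 0" "ALL v:cone. ev (B * E) v ~= 0 --> (EX d N M. germ (h v) v d N M &
    ev M v = ev B v & (ALL a<=3. ev (pd a N) v = ev (P a) v))" by (elim exE conjE)
  let ?N = "(P a * pd b F - P b * pd a F) * E"
  have "form 3 (p - 2 + (d + e)) ?N"
   using 1(2)[rule_format, OF ab(1)] 1(2)[rule_format, OF ab(2)] form_pd[OF F] 1(1,5) p2
   by (intro form_mult'[of 3 "d - 1 + (p - 1)" _ e] form_diff form_mult) auto
  moreover have "ev (B * E) w * \<eta> a b w = ev ?N w" if w: "w : cone" "ev (B * E) w ~= 0" for w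
  proof -
   obtain d' N M where N: "germ (h w) w d' N M" "ev M w = ev B w" "ALL a<=3. ev (pd a N) w = ev (P a) w" using 1(7) w by blast
   obtain k where k: "ALL a. ev (MM w) w * ev (pd a N) w - ev M w * ev (pd a (NN w)) w = k * ev (pd a F) w"
    using germ_gradient[OF w(1) N(1) g[OF w(1)]] h0[OF w(1)] by auto
   have B: "ev B w * \<delta> c w = ev (P c) w - k / ev (MM w) w * ev (pd c F) w" if "c <= 3" for c
    using k[rule_format, of c] N(2,3) that Mv[OF w(1)] by (simp add: \<delta>_def field_simps)
   have "ev B w * \<eta> a b w = (ev B w * \<delta> a w) * ev (pd b F) w - (ev B w * \<delta> b w) * ev (pd a F) w"
    by (simp add: \<eta>_def algebra_simps)
   also have "... = ev (P a * pd b F - P b * pd a F) w" unfolding B[OF ab(1)] B[OF ab(2)] by (simp add: algebra_simps)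
   finally have R: "ev B w * \<eta> a b w = ev (P a * pd b F - P b * pd a F) w" .
   have "ev (B * E) w * \<eta> a b w = (ev B w * \<eta> a b w) * ev E w" by simp
   thus ?thesis unfolding R by (simp only: eval_mult)
  qed
  ultimately show "EX d N M. form 3 (p - 2 + d) N & form 3 d M & ev M v0 ~= 0 & (ALL w:cone. ev M w ~= 0 --> ev M w * \<eta> a b w = ev N w)"
   using form_mult[OF 1(3,5)] 1(4,6) by (intro exI[of _ "d + e"] exI[of _ ?N] exI[of _ "B * E"]) auto
 qed
 hence "ALL a. ALL b. EX G. a <= 3 --> b <= 3 --> form 3 (p - 2) G & (ALL v:cone. \<eta> a b v = ev G v)" by blast
 then obtain E where E': "!!a b. a <= 3 ==> b <= 3 ==> form 3 (p - 2) (E a b) & (ALL v:cone. \<eta> a b v = ev (E a b) v)"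
  unfolding choice_iff by blast
 have E: "a <= 3 ==> b <= 3 ==> form 3 (p - 2) (E a b)" "a <= 3 ==> b <= 3 ==> v : cone ==> ev (E a b) v = \<eta> a b v" for a b v
  using E'[of a b] by auto
 let ?F = "%l. pd l F"
 have F': "form 3 (p - 1) (?F l)" for l by (rule form_pd[OF F])
 obtain n co where co: "!!i. i <= 3 ==> Xv i ^ n = (SUM l<=3. co i l * ?F l)" using jacobian by blast
 have small: "v l = 0" if "!!l. l <= 3 ==> form 3 d (v l)" "d < p - 1" "(SUM l<=3. ?F l * v l) = 0" "l <= 3" for v d l
  by (rule low_degree_syzygy[where F = ?F and q = "p - 1" and N = n and c = co and d = d])
   (rule F', rule co, assumption, rule that(1), assumption, rule that(2), rule that(3), rule that(4))
 have sum4: "(SUM l<=3. f l) = f 0 + f 1 + f 2 + f (3::nat)" for f :: "nat => cpoly" by (simp add: eval_nat_numeral)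
 \<comment> \<open>A 3 by 3 determinant with two rows dF, hence zero on the cone; only its quotient
   by \<open>F\<close> can survive.\<close>
 have "EX \<theta>. ?F c * E a b + ?F a * E b c - ?F b * E a c = F * \<theta> & form 3 (p - 3) \<theta>" if abc: "a <= 3" "b <= 3" "c <= 3" for a b c
 proof -
  let ?K = "?F c * E a b + ?F a * E b c - ?F b * E a c"
  have fK: "form 3 (p - 1 + (p - 2)) ?K" using abc by (intro form_diff form_add form_mult F' E(1))
  have "EX Q. ?K = F * Q & form 3 (p - 1 + (p - 2) - p) Q & (p - 1 + (p - 2) < p --> Q = 0)"
   by (rule vanishing_multiple[OF fK]) (use abc in \<open>simp add: E(2) \<eta>_def algebra_simps\<close>)
  moreover have "p - 1 + (p - 2) - p = p - 3" using p2 by simp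
  ultimately show ?thesis by auto
 qed
 hence "ALL a. ALL b. ALL c. EX \<theta>. a <= 3 --> b <= 3 --> c <= 3 --> ?F c * E a b + ?F a * E b c - ?F b * E a c = F * \<theta> & form 3 (p - 3) \<theta>" by blast
 then obtain \<theta> where th: "!!a b c. a <= 3 ==> b <= 3 ==> c <= 3 ==> ?F c * E a b + ?F a * E b c - ?F b * E a c = F * \<theta> a b c"
  "!!a b c. a <= 3 ==> b <= 3 ==> c <= 3 ==> form 3 (p - 3) (\<theta> a b c)" unfolding choice_iff by (auto simp: choice_iff)
 \<comment> \<open>The components of \<theta> with the signs of dF \<and> \<theta>. Times
   \<open>F\<close> this is dF \<and> dF \<and> \<eta>, which is zero.\<close>
 let ?v = "%l::nat. if l = 0 then - \<theta> 1 2 3 else if l = 1 then \<theta> 0 2 3 else if l = 2 then - \<theta> 0 1 3 else \<theta> 0 1 2"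
 have "F * (SUM l<=3. ?F l * ?v l) = ?F 3 * (F * \<theta> 0 1 2) - ?F 2 * (F * \<theta> 0 1 3) + ?F 1 * (F * \<theta> 0 2 3) - ?F 0 * (F * \<theta> 1 2 3)"
  unfolding sum4 by (simp add: algebra_simps)
 also have "... = 0"
  using th(1)[of 0 1 2] th(1)[of 0 1 3] th(1)[of 0 2 3] th(1)[of 1 2 3] by (simp flip: th(1)) (simp add: algebra_simps)
 finally have syz: "(SUM l<=3. ?F l * ?v l) = 0" using F_nonzero by simp
 have v0: "?v l = 0" if "l <= 3" for l
 proof (rule small[OF _ _ syz that])
  show "form 3 (p - 3) (?v l)" if "l <= 3" for l using th(2) by (auto intro: form_uminus)
 qed (use p2 in simp)
 have th0: "\<theta> 0 1 2 = 0" "\<theta> 0 1 3 = 0" "\<theta> 0 2 3 = 0" using v0[of 3] v0[of 2] v0[of 1] by simp_all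
 \<comment> \<open>Once \<theta> vanishes, the determinant identity is itself a syzygy, now in
   degree \<open>p - 2\<close>.\<close>
 have syz2: "E a b = 0 & E b c = 0 & E a c = 0" if abc: "a < b" "b < c" "c <= 3" and t: "\<theta> a b c = 0" for a b c
 proof -
  let ?w = "%l. if l = c then E a b else if l = a then E b c else if l = b then - E a c else 0"
  have K: "?F c * E a b + ?F a * E b c - ?F b * E a c = 0" using th(1)[of a b c] abc t by simp
  have "(SUM l<=3. ?F l * ?w l) = (SUM l:{a, b, c}. ?F l * ?w l)"
   using abc by (intro sum.mono_neutral_right) auto
  also have "... = 0" using abc K by (simp add: algebra_simps)
  finally have s: "(SUM l<=3. ?F l * ?w l) = 0" .
  have "?w l = 0" if "l <= 3" for l
  proof (rule small[OF _ _ s that])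
   show "form 3 (p - 2) (?w l)" if "l <= 3" for l using E(1) abc by (auto intro: form_uminus)
  qed (use p2 in simp)
  from this[of a] this[of b] this[of c] show ?thesis using abc by auto
 qed
 have E0: "E 0 1 = 0" "E 1 2 = 0" "E 0 2 = 0" "E 1 3 = 0" "E 0 3 = 0" "E 2 3 = 0"
  using syz2[of 0 1 2] syz2[of 0 1 3] syz2[of 0 2 3] th0 by auto
 have sym: "\<eta> b a v = - \<eta> a b v" for a b v by (simp add: \<eta>_def)
 have "\<eta> a b v = 0" if "a <= 3" "b <= 3" for a b
 proof -
  have less: "\<eta> a b v = 0" if "a < b" "b <= 3" for a b
  proof -
   have "a = 0 & b = 1 \<or> a = 0 & b = 2 \<or> a = 0 & b = 3 \<or> a = 1 & b = 2 \<or> a = 1 & b = 3 \<or> a = 2 & b = 3" using that by auto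
   hence "E a b = 0" using E0 by auto
   thus ?thesis using E(2)[of a b v] v that by simp
  qed
  show ?thesis using less[of a b] less[of b a] sym[of a b v] that by (cases a b rule: linorder_cases) (auto simp: \<eta>_def)
 qed
 moreover obtain b where b: "b <= 3" "ev (pd b F) v ~= 0" using smooth[of v] v by (auto simp: cone_def)
 ultimately have "\<delta> a v * ev (pd b F) v = \<delta> b v * ev (pd a F) v" if "a <= 3" for a using that by (simp add: \<eta>_def)
 hence "ev (pd a (NN v)) v = (\<delta> b v * ev (MM v) v / ev (pd b F) v) * ev (pd a F) v" if "a <= 3" for a
  using that b(2) Mv[OF v] by (simp add: \<delta>_def field_simps)
 hence "ALL a<=3. ev (pd a (NN v)) v - h v v * ev (pd a (MM v)) v = (\<delta> b v * ev (MM v) v / ev (pd b F) v) * ev (pd a F) v"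
  using h0[OF v] by simp
 with g[OF v] show ?thesis unfolding flat_def by (intro exI conjI)
qed

end

subsection \<open>Functions with zero differential\<close>

lemma pd_power: "ev (pd a (N ^ e)) v = of_nat e * ev N v ^ (e - 1) * ev (pd a N) v"
proof (induction e)
 case 0
 show ?case using pd_const[of a 1] by (simp add: const_poly_def del: pd_const)
next
 case (Suc e)
 have "of_nat e * (ev N v * ev N v ^ (e - 1)) = of_nat e * ev N v ^ e" by (cases e) auto
 thus ?case by (simp add: pd_mult Suc) (auto simp: algebra_simps)
qed

context surface
begin

text \<open>A dimension count for algebraic dependence: on the cone, \<open>N / M\<close> is
  algebraic over the polynomials in the three variables other than \<open>x_l0\<close>.\<close>

lemma exists_relation:
 assumes l0: "l0 <= 3" and N: "form 3 d N" and M: "form 3 d M"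
 shows "EX r k A. (ALL e<=k. form 3 r (A e) & (ALL m:keys (A e). lk m l0 = 0)) & (EX e<=k. A e ~= 0) &
  (ALL w:cone. (SUM e<=k. ev (A e) w * ev N w ^ e * ev M w ^ (k - e)) = 0)"
proof -
 have "l0 = 0 \<or> l0 = 1 \<or> l0 = 2 \<or> l0 = 3" using l0 by auto
 hence "EX a b c. {..3::nat} = {l0, a, b, c} & distinct [l0, a, b, c]" (is ?G)
 proof (elim disjE)
  show "l0 = 0 ==> ?G" by (rule exI[of _ 1], rule exI[of _ 2], rule exI[of _ 3]) auto
  show "l0 = 1 ==> ?G" by (rule exI[of _ 0], rule exI[of _ 2], rule exI[of _ 3]) auto
  show "l0 = 2 ==> ?G" by (rule exI[of _ 0], rule exI[of _ 1], rule exI[of _ 3]) auto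
  show "l0 = 3 ==> ?G" by (rule exI[of _ 0], rule exI[of _ 1], rule exI[of _ 2]) auto
 qed
 then obtain a b c where abc: "{..3::nat} = {l0, a, b, c}" "distinct [l0, a, b, c]" by blast
 define T where "T j = {m. keys m <= {a, b, c} & mdeg m = j}" for j
 have Tmon: "m : monomials 3 j" "lk m l0 = 0" if "m : T j" for m j
  using that abc by (auto simp: T_def monomials_def in_keys_iff)
 have fT: "finite (T j)" for j using Tmon(1) finite_subset[OF _ finite_monomials, of "T j" 3 j] by blast
 have dT: "mdeg m = lk m a + lk m b + lk m c" if "m : T j" for m j
  using mdeg_superset[of "{a, b, c}" m] that abc(2) by (auto simp: T_def)
 have upper: "card (T j) <= (j + 1) ^ 2" for j
 proof -
  have "inj_on (%m. (lk m a, lk m b)) (T j)"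
  proof (rule inj_onI, rule poly_mapping_eqI)
   fix m m' k assume m: "m : T j" "m' : T j" "(lk m a, lk m b) = (lk m' a, lk m' b)"
   hence "lk m c = lk m' c" using dT[OF m(1)] dT[OF m(2)] by (simp add: T_def)
   moreover have "lk m k = 0" "lk m' k = 0" if "k ~: {a, b, c}"
    using that m(1,2) unfolding T_def by (auto simp flip: not_in_keys_iff_lookup_eq_zero)
   ultimately show "lk m k = lk m' k" using m(3) by (cases "k : {a, b, c}") auto
  qed
  moreover have "(%m. (lk m a, lk m b)) ` T j <= {..j} \<times> {..j}" using dT by (auto simp: T_def)
  ultimately show ?thesis using card_inj_on_le[of _ "T j" "{..j} \<times> {..j}"] by (simp add: power2_eq_square)
 qed
 have lower: "(j + 1) ^ 2 <= card (T (2 * j))" for j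
 proof -
  let ?f = "%(s, t). sg a s + sg b t + sg c (2 * j - s - t)"
  have "inj_on ?f ({..j} \<times> {..j})"
  proof (rule inj_onI, clarify)
   fix s t s' t' assume eq: "sg a s + sg b t + sg c (2 * j - s - t) =
    sg a s' + sg b t' + sg c (2 * j - s' - t')"
   show "s = s' & t = t'"
    using arg_cong[OF eq, of "%m. lk m a"] arg_cong[OF eq, of "%m. lk m b"] abc(2) by (auto simp: lookup_add lookup_single)
  qed
  moreover have "?f ` ({..j} \<times> {..j}) <= T (2 * j)"
   by (auto simp: T_def keys_add_nat mdeg_add split: if_splits)
  ultimately show ?thesis using card_inj_on_le[of ?f "{..j} \<times> {..j}" "T (2 * j)"] fT by (simp add: power2_eq_square)
 qed
 have mono: "card (T i) <= card (T j)" if "i <= j" for i j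
 proof (rule card_inj_on_le[OF _ _ fT])
  show "inj_on (%m. m + sg a (j - i)) (T i)" by (rule inj_onI) simp
  show "(%m. m + sg a (j - i)) ` T i <= T j" using that by (auto simp: T_def keys_add_nat mdeg_add split: if_splits)
 qed
 \<comment> \<open>Here n = 3kd. Forms of degree \<open>n\<close> modulo multiples of
   \<open>F\<close> number at most p(3kd + 1)^2, which is at most 9p(kd + 1)^2, while the unknown
   coefficients number at least (k + 1)(kd + 1)^2; so k = 9p suffices.\<close>
 define k r n where "k = 9 * p" and "r = 2 * (k * d)" and "n = r + k * d"
 define B where "B = (if p <= n then monomials 3 (n - p) else {})"
 have fB: "finite B" by (simp add: B_def finite_monomials)
 let ?x = "%j m. sg l0 j + m"
 \<comment> \<open>Monomials are sorted by the exponent of \<open>x_l0\<close>: those divisible by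
   its \<open>p\<close>-th power are as many as the multiples of \<open>F\<close>, the others form
   at most \<open>p\<close> layers in three variables.\<close>
 have "monomials 3 n <= ?x p ` B Un (\<Union>j\<in>{j. j < p & j <= n}. ?x j ` T (n - j))"
 proof
  fix m assume m: "m : monomials 3 n"
  let ?j = "min p (lk m l0)" and ?m = "m - sg l0 (min p (lk m l0))"
  have s: "m = ?x ?j ?m" using split_exponent[of ?j m l0] by simp
  have km: "keys ?m <= {..3}" "?j + mdeg ?m = n"
   using m arg_cong[OF s, of mdeg] arg_cong[OF s, of keys] unfolding monomials_def by (auto simp: mdeg_add keys_add_nat)
  show "m : ?x p ` B Un (\<Union>j\<in>{j. j < p & j <= n}. ?x j ` T (n - j))"
  proof (cases "p <= lk m l0")
   case True
   hence "?m : B" using km by (auto simp: B_def monomials_def)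
   hence "m : ?x ?j ` B" using s by (rule image_eqI[rotated])
   thus ?thesis using True by simp
  next
   case False
   hence "lk ?m l0 = 0" by (simp add: lookup_minus)
   hence "l0 ~: keys ?m" by (simp add: in_keys_iff)
   hence "?m : T (n - ?j)" using km abc(1) by (auto simp: T_def)
   hence "m : ?x ?j ` T (n - ?j)" using s by (rule image_eqI[rotated])
   thus ?thesis using False km(2) by (intro UnI2 UN_I[of ?j]) auto
  qed
 qed
 hence "card (monomials 3 n) <= card (?x p ` B Un (\<Union>j\<in>{j. j < p & j <= n}. ?x j ` T (n - j)))"
  using fB fT by (intro card_mono) auto
 also have "... <= card B + (SUM j:{j. j < p & j <= n}. card (T n))"
 proof -
  have "card (?x j ` T (n - j)) <= card (T n)" for j using card_image_le[OF fT, of "?x j" "n - j"] mono[of "n - j" n] by simp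
  hence "card (\<Union>j\<in>{j. j < p & j <= n}. ?x j ` T (n - j)) <= (SUM j:{j. j < p & j <= n}. card (T n))"
   by (intro order.trans[OF card_UN_le] sum_mono) auto
  thus ?thesis using card_image_le[OF fB, of "?x p"] by (intro order.trans[OF card_Un_le]) simp
 qed
 also have "... <= card B + p * card (T n)"
  using card_mono[of "{..<p}" "{j. j < p & j <= n}"] by auto
 also have "... < card B + (k + 1) * card (T r)"
 proof -
  have "p * card (T n) <= p * (3 * (k * d) + 1) ^ 2" using upper[of n] by (simp add: n_def r_def mult.commute[of k d])
  also have "... <= p * (3 * (k * d + 1)) ^ 2" by (intro mult_left_mono power_mono) auto
  also have "... = k * (k * d + 1) ^ 2" unfolding power_mult_distrib by (simp add: k_def)
  also have "... < (k + 1) * (k * d + 1) ^ 2" by simp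
  also have "... <= (k + 1) * card (T r)" using mult_le_mono2[OF lower[of "k * d"], of "k + 1"] by (simp only: r_def)
  finally show ?thesis by simp
 qed
 finally have count: "card (monomials 3 n) < card B + (k + 1) * card (T r)" .
 \<comment> \<open>The unknowns: the coefficients of the \<open>A e\<close>, and those of a multiple
   of \<open>F\<close>.\<close>
 let ?K = "Inl ` ({..k} \<times> T r) Un Inr ` B"
 let ?P = "case_sum (%(e, m). sg m 1 * (N ^ e * M ^ (k - e))) (%m. F * sg m 1)"
 have sumK: "(SUM q:?K. g q) = (SUM e<=k. SUM m:T r. g (Inl (e, m))) + (SUM m:B. g (Inr m))" for g :: "_ => cpoly"
 proof -
  have "(SUM q:?K. g q) = (SUM q:Inl ` ({..k} \<times> T r). g q) + (SUM q:Inr ` B. g q)"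
   using fB fT by (intro sum.union_disjoint) auto
  thus ?thesis by (simp add: sum.reindex sum.cartesian_product case_prod_unfold)
 qed
 have "card ?K = (k + 1) * card (T r) + card B"
  by (subst card_Un_disjoint) (use fB fT in "auto simp: card_image card_cartesian_product")
 hence "card (monomials 3 n) < card ?K" using count by simp
 moreover have "finite ?K" using fB fT by simp
 ultimately obtain z where z: "EX q:?K. z q ~= 0" "ALL j:monomials 3 n. (SUM q:?K. z q * lk (?P q) j) = 0"
  using linear_dependence[OF finite_monomials[of 3 n], of ?K "%q. lk (?P q)"] by blast
 have fP: "form 3 n (?P q)" if q: "q : ?K" for q
  using q
 proof
  assume "q : Inl ` ({..k} \<times> T r)"
  then obtain e m where em: "q = Inl (e, m)" "e <= k" "m : T r" by auto
  have "form 3 r (sg m 1)" using Tmon(1)[OF em(3)] by (intro form_single) (auto simp: monomials_def)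
  moreover have "form 3 (e * d + (k - e) * d) (N ^ e * M ^ (k - e))" by (intro form_mult form_power N M)
  moreover have "e * d + (k - e) * d = k * d" using em(2) by (simp flip: add_mult_distrib)
  ultimately show ?thesis using form_mult em(1) by (simp add: n_def)
 next
  assume "q : Inr ` B"
  then obtain m where m: "q = Inr m" "m : B" by auto
  hence "p <= n" "m : monomials 3 (n - p)" by (auto simp: B_def split: if_splits)
  thus ?thesis using m(1) by (auto intro!: form_mult'[OF F form_single] simp: monomials_def)
 qed
 have zero: "(SUM q:?K. const_poly (z q) * ?P q) = 0"
 proof (rule poly_mapping_eqI)
  fix j
  have lkc: "lk (const_poly x * G) j = x * lk G j" for x G
   by (induction G rule: cpoly_induct) (auto simp: const_poly_mult_single lookup_single when_def distrib_left lookup_add)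
  have "lk (SUM q:?K. const_poly (z q) * ?P q) j = (SUM q:?K. z q * lk (?P q) j)" by (simp add: lookup_sum lkc)
  also have "... = 0"
  proof (cases "j : monomials 3 n")
   case False
   hence "lk (?P q) j = 0" if "q : ?K" for q using fP[OF that] by (auto simp: form_iff monomials_def in_keys_iff)
   thus ?thesis by (intro sum.neutral) simp
  qed (use z(2) in blast)
  finally show "lk (SUM q:?K. const_poly (z q) * ?P q) j = lk 0 j" by simp
 qed
 define A where "A e = (SUM m:T r. sg m (z (Inl (e, m))))" for e
 define Q where "Q = (SUM m:B. sg m (z (Inr m)))"
 have zero': "(SUM e<=k. A e * (N ^ e * M ^ (k - e))) + F * Q = 0"
 proof -
  have s: "const_poly x * sg m 1 = sg m x" for x m by (simp add: const_poly_mult_single)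
  have "A e * G = (SUM m:T r. const_poly (z (Inl (e, m))) * (sg m 1 * G))" for e G
   unfolding A_def sum_distrib_right by (simp only: mult.assoc[symmetric] s)
  moreover have "F * Q = (SUM m:B. const_poly (z (Inr m)) * (F * sg m 1))"
   unfolding Q_def sum_distrib_left by (simp only: mult.left_commute[of _ F] s)
  ultimately show ?thesis using zero unfolding sumK by simp
 qed
 have lkA: "lk (SUM m:Y. sg m (f m)) m = f m" if "finite Y" "m : Y" for Y m and f :: "_ => complex"
  using that by (simp add: lookup_sum lookup_single when_def)
 show ?thesis
 proof (rule exI[of _ r], rule exI[of _ k], rule exI[of _ A], intro conjI allI impI ballI)
  show "form 3 r (A e)" for e
   unfolding A_def using Tmon(1) by (intro form_sum form_single) (auto simp: monomials_def)
  show "lk m l0 = 0" if "m : keys (A e)" for m e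
  proof -
   have "m : T r" using subsetD[OF keys_sum that[unfolded A_def]] by (auto split: if_splits)
   thus ?thesis by (rule Tmon(2))
  qed
  show "EX e<=k. A e ~= 0"
  proof (rule ccontr)
   assume "~ ?thesis"
   hence A0: "A e = 0" if "e <= k" for e using that by blast
   hence "F * Q = 0" using zero' by simp
   hence "Q = 0" using F_nonzero by simp
   hence "z (Inr m) = 0" if "m : B" for m using lkA[OF fB that, of "%m. z (Inr m)"] by (simp add: Q_def)
   moreover have "z (Inl (e, m)) = 0" if "e <= k" "m : T r" for e m
    using lkA[OF fT that(2), of "%m. z (Inl (e, m))"] A0[OF that(1)] by (simp add: A_def)
   ultimately show False using z(1) by auto
  qed
  show "(SUM e<=k. ev (A e) w * ev N w ^ e * ev M w ^ (k - e)) = 0" if "w : cone" for w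
   using arg_cong[OF zero', of "%G. ev G w"] that by (simp add: cone_def mult.assoc)
 qed
qed

text \<open>Take a relation for \<open>h\<close> whose coefficients have least degree. As dh = 0,
  applying a derivation to the coefficients alone gives a relation of lower degree; so the
  coefficients are constants and \<open>h\<close> takes values among the roots of one
  polynomial.\<close>

theorem flat_finite_valued:
 assumes l0: "l0 <= 3" and N: "form 3 d N" and M: "form 3 d M" and E: "form 3 e E"
  and U: "!!w. w : cone ==> ev E w ~= 0 ==> ev M w ~= 0 & ev (pd l0 F) w ~= 0 & ev M w * h w = ev N w & flat h w"
 shows "finite (h ` {w:cone. ev E w ~= 0})"
proof -
 define R where "R r k A \<longleftrightarrow> (ALL e<=k. form 3 r (A e) & (ALL m:keys (A e). lk m l0 = 0)) & (EX e<=k. A e ~= 0) &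
  (ALL w:cone. ev E w ~= 0 --> (SUM e<=k. ev (A e) w * h w ^ e) = 0)" for r and k :: nat and A :: "nat => cpoly"
 have NM: "ev N w ^ i * ev M w ^ (k - i) = ev M w ^ k * h w ^ i" if "w : cone" "ev E w ~= 0" "i <= k" for w i k
 proof -
  have "ev M w ^ k = ev M w ^ i * ev M w ^ (k - i)" using that(3) by (simp flip: power_add)
  thus ?thesis using U[OF that(1,2)] by (simp add: power_mult_distrib mult_ac flip: conjunct1[OF conjunct2[OF conjunct2[OF U[OF that(1,2)]]]])
 qed
 from exists_relation[OF l0 N M] obtain r0 k0 A0 where "(ALL e<=k0. form 3 r0 (A0 e) & (ALL m:keys (A0 e). lk m l0 = 0)) & (EX e<=k0. A0 e ~= 0) &
  (ALL w:cone. (SUM e<=k0. ev (A0 e) w * ev N w ^ e * ev M w ^ (k0 - e)) = 0)" by (elim exE)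
 note 0 = this[THEN conjunct1] this[THEN conjunct2, THEN conjunct1] this[THEN conjunct2, THEN conjunct2]
 have "R r0 k0 A0" unfolding R_def
 proof (intro conjI 0(1,2) ballI impI)
  fix w assume w: "w : cone" "ev E w ~= 0"
  have "ev M w ^ k0 * (SUM e<=k0. ev (A0 e) w * h w ^ e) = (SUM e<=k0. ev (A0 e) w * ev N w ^ e * ev M w ^ (k0 - e))"
   unfolding sum_distrib_left using NM[OF w] by (intro sum.cong) (auto simp: mult_ac)
  thus "(SUM e<=k0. ev (A0 e) w * h w ^ e) = 0" using 0(3) w(1) U[OF w] by simp
 qed
 hence ex: "EX r k A. R r k A" by blast
 define r where "r = (LEAST r. EX k A. R r k A)"
 have "EX k A. R r k A" unfolding r_def by (rule LeastI_ex[OF ex])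
 then obtain k A where A: "R r k A" by blast
 have least: "~ R s k B" if "s < r" for s k B using not_less_Least[OF that[unfolded r_def]] by blast
 have fA: "form 3 r (A i)" and lA: "m : keys (A i) ==> lk m l0 = 0" if "i <= k" for i m using A that unfolding R_def by blast+
 have rel: "(SUM i<=k. ev (A i) w * h w ^ i) = 0" if "w : cone" "ev E w ~= 0" for w using A that unfolding R_def by blast
 have r0: "r = 0"
 proof (rule ccontr)
  assume r: "r ~= 0"
  have der: "(SUM i<=k. ev (pd a (A i)) w * h w ^ i) = 0" if w: "w : cone" "ev E w ~= 0" and a: "a <= 3" for w a
  proof -
   note u = U[OF w]
   let ?G = "SUM i<=k. A i * (N ^ i * M ^ (k - i))"
   have G: "form 3 (r + k * d) ?G"
   proof (rule form_sum)
    fix i assume "i : {..k}"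
    hence "i <= k" "i * d + (k - i) * d = k * d" by (auto simp flip: add_mult_distrib)
    thus "form 3 (r + k * d) (A i * (N ^ i * M ^ (k - i)))"
     using form_mult[OF fA form_mult[OF form_power[OF N] form_power[OF M]], of i i "k - i"] by simp
   qed
   have "EX ka. ALL a. ev (pd a ?G) w = ka * ev (pd a F) w"
   proof (rule vanishing_gradient[OF w(1) G E w(2)])
    fix y assume y: "y : cone" "ev E y ~= 0"
    have "ev ?G y = ev M y ^ k * (SUM i<=k. ev (A i) y * h y ^ i)"
     unfolding sum_distrib_left eval_sum using NM[OF y] by (intro sum.cong) (auto simp: mult_ac)
    thus "ev ?G y = 0" using rel[OF y] by simp
   qed
   then obtain ka where ka: "!!a. ev (pd a ?G) w = ka * ev (pd a F) w" by blast
   have "germ h w d N M" by (rule germI[OF N M _ E w(2)]) (use U u in auto)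
   then obtain l where l: "ALL a<=3. ev (pd a N) w - h w * ev (pd a M) w = l * ev (pd a F) w" using flat_germ[OF w(1)] u by blast
   let ?H = "SUM i<=k. ev (A i) w * (of_nat i * h w ^ (i - 1))"
   have trm: "ev M w * ev (pd a (A i * (N ^ i * M ^ (k - i)))) w =
     ev M w ^ (k + 1) * (ev (pd a (A i)) w * h w ^ i) + (of_nat k * ev M w ^ k * ev (pd a M) w) * (ev (A i) w * h w ^ i) +
     (ev M w ^ k * l * ev (pd a F) w) * (ev (A i) w * (of_nat i * h w ^ (i - 1)))" if i: "i <= k" and a: "a <= 3" for i a
   proof -
    have dN: "ev (pd a N) w = h w * ev (pd a M) w + l * ev (pd a F) w" using l a by (simp add: algebra_simps)
    have Nw: "ev N w = ev M w * h w" using u by simp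
    have 1: "of_nat i * (ev N w ^ (i - 1) * ev M w ^ (k - i) * ev M w) = of_nat i * (ev M w ^ k * h w ^ (i - 1))"
    proof (cases i)
     case (Suc j)
     have "k = j + Suc (k - i)" using Suc i by simp
     hence "ev M w ^ k = ev M w ^ j * (ev M w ^ (k - i) * ev M w)" by (metis power_add power_Suc2)
     thus ?thesis unfolding Nw power_mult_distrib by (simp add: Suc)
    qed simp
    have 2: "of_nat (k - i) * (ev M w ^ (k - i - 1) * ev M w) = of_nat (k - i) * ev M w ^ (k - i)"
     by (cases "k - i") auto
    have 3: "of_nat i * (h w ^ (i - 1) * h w) = of_nat i * h w ^ i" by (cases i) auto
    have ki: "(of_nat k :: complex) = of_nat i + of_nat (k - i)" using i by (simp flip: of_nat_add)
    have "ev M w * ev (pd a (N ^ i * M ^ (k - i))) w =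
     (of_nat i * (ev N w ^ (i - 1) * ev M w ^ (k - i) * ev M w)) * ev (pd a N) w +
     ev N w ^ i * (of_nat (k - i) * (ev M w ^ (k - i - 1) * ev M w)) * ev (pd a M) w"
     by (simp add: pd_mult pd_power algebra_simps)
    also have "... = ev M w ^ k * (of_nat i * (h w ^ (i - 1) * h w)) * ev (pd a M) w + ev M w ^ k * l * ev (pd a F) w * (of_nat i * h w ^ (i - 1)) +
     of_nat (k - i) * (ev N w ^ i * ev M w ^ (k - i)) * ev (pd a M) w"
     unfolding 1 2 dN by (simp add: algebra_simps)
    also have "... = of_nat k * ev M w ^ k * ev (pd a M) w * h w ^ i + ev M w ^ k * l * ev (pd a F) w * (of_nat i * h w ^ (i - 1))"
     unfolding 3 NM[OF w i] ki by (simp add: algebra_simps)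
    finally have d: "ev M w * ev (pd a (N ^ i * M ^ (k - i))) w = ..." .
    have "ev M w * ev (pd a (A i * (N ^ i * M ^ (k - i)))) w = ev M w * ev (pd a (A i)) w * (ev N w ^ i * ev M w ^ (k - i)) +
     ev (A i) w * (ev M w * ev (pd a (N ^ i * M ^ (k - i))) w)"
     unfolding pd_mult[of a "A i"] by (simp add: algebra_simps)
    thus ?thesis unfolding d NM[OF w i] by (simp add: algebra_simps)
   qed
   have main: "ev M w ^ (k + 1) * (SUM i<=k. ev (pd a (A i)) w * h w ^ i) = (ev M w * ka - ev M w ^ k * l * ?H) * ev (pd a F) w" if a: "a <= 3" for a
   proof -
    have "ev M w * ev (pd a ?G) w = ev M w ^ (k + 1) * (SUM i<=k. ev (pd a (A i)) w * h w ^ i) +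
      (of_nat k * ev M w ^ k * ev (pd a M) w) * (SUM i<=k. ev (A i) w * h w ^ i) + (ev M w ^ k * l * ev (pd a F) w) * ?H"
     unfolding pd_sum eval_sum sum_distrib_left sum.distrib[symmetric] by (rule sum.cong[OF refl]) (rule trm[OF _ a], simp)
    thus ?thesis unfolding ka rel[OF w] by (simp add: algebra_simps)
   qed
   \<comment> \<open>The differentiated relation is a multiple of dF. Its component at
     \<open>l0\<close> is zero, as the coefficients do not involve \<open>x_l0\<close>, whereas that
     of dF is not; so the multiple is zero.\<close>
   have "pd l0 (A i) = 0" if "i <= k" for i
    unfolding pd_def using lA[OF that] by (intro sum.neutral) auto
   hence "(ev M w * ka - ev M w ^ k * l * ?H) * ev (pd l0 F) w = 0" using main[OF l0] by simp
   hence "ev M w * ka - ev M w ^ k * l * ?H = 0" using u by simp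
   hence "ev M w ^ (k + 1) * (SUM i<=k. ev (pd a (A i)) w * h w ^ i) = 0" using main[OF a] by simp
   thus ?thesis using u by simp
  qed
  have pd0: "pd a (A i) = 0" if a: "a <= 3" and i: "i <= k" for a i
  proof (rule ccontr)
   assume nz: "pd a (A i) ~= 0"
   have "R (r - 1) k (%i. pd a (A i))"
    unfolding R_def
   proof (intro conjI allI impI ballI)
    show "form 3 (r - 1) (pd a (A i))" if "i <= k" for i by (rule form_pd[OF fA[OF that]])
    show "EX i<=k. pd a (A i) ~= 0" using nz i by blast
    show "(SUM i<=k. ev (pd a (A i)) w * h w ^ i) = 0" if "w : cone" "ev E w ~= 0" for w by (rule der[OF that a])
    fix i m assume i: "i <= k" and m: "m : keys (pd a (A i))"
    obtain m' where "m' : keys (A i)" "m = m' - sg a 1"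
     using subsetD[OF keys_sum m[unfolded pd_def]] by (auto split: if_splits)
    thus "lk m l0 = 0" using lA[OF i] by (simp add: lookup_minus)
   qed
   thus False using least[of "r - 1"] r by simp
  qed
  \<comment> \<open>All partial derivatives vanish, so by Euler a form of positive degree
    does.\<close>
  have "A i = 0" if "i <= k" for i
  proof -
   have "of_nat r * A i = 0" using euler[OF fA[OF that]] pd0 that by simp
   thus ?thesis using r by simp
  qed
  thus False using A unfolding R_def by blast
 qed
 define q where "q = Poly (map (%i. ev (A i) (%_. 0)) [0..<Suc k])"
 have cq: "coeff q i = (if i <= k then ev (A i) (%_. 0) else 0)" for i
  by (simp add: q_def coeff_Poly_eq nth_default_def del: upt_Suc)
 have Ac: "ev (A i) w = ev (A i) (%_. 0)" if "i <= k" for i w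
  using form_scale[OF fA[OF that], of 0 w] r0 by simp
 obtain i where i: "i <= k" "A i ~= 0" using A unfolding R_def by blast
 have "q ~= 0"
 proof
  assume "q = 0"
  hence "ev (A i) w = ev 0 w" for w using cq[of i] Ac[OF i(1), of w] i(1) by simp
  thus False using eval_inject[of "A i" 0] i(2) by blast
 qed
 have "poly q x = (SUM i<=k. ev (A i) (%_. 0) * x ^ i)" for x
 proof -
  have "degree q <= k" by (rule degree_le) (simp add: cq)
  hence "poly q x = (SUM i<=k. coeff q i * x ^ i)"
   unfolding poly_altdef by (intro sum.mono_neutral_left) (auto simp: coeff_eq_0)
  thus ?thesis by (simp add: cq)
 qed
 hence "poly q (h w) = 0" if "w : cone" "ev E w ~= 0" for w
  using rel[OF that] Ac[of _ w] by simp
 hence "h ` {w:cone. ev E w ~= 0} <= {x. poly q x = 0}" by auto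
 thus ?thesis using poly_roots_finite[OF \<open>q ~= 0\<close>] finite_subset by blast
qed

end

subsection \<open>Morphisms from a smooth surface to an abelian variety\<close>

lemma chart_alg_raise:
 assumes L: "form n 1 L" and h: "h : chart_alg n X rh L"
 shows "EX e. ALL D>=e. EX G. form n D G & (ALL x:Dset X rh L. h x = ev G (rh x) / ev L (rh x) ^ D)"
proof -
 obtain e G where G: "form n e G" "ALL x:Dset X rh L. h x = ev G (rh x) / ev L (rh x) ^ e" using h by (elim chart_algE)
 have "EX G. form n D G & (ALL x:Dset X rh L. h x = ev G (rh x) / ev L (rh x) ^ D)" if D: "D >= e" for D
 proof (intro exI[of _ "G * L ^ (D - e)"] conjI ballI)
  show "form n D (G * L ^ (D - e))" using form_mult[OF G(1) form_power[OF L, of "D - e"]] D by simp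
  fix x assume x: "x : Dset X rh L"
  hence "ev L (rh x) ^ D = ev L (rh x) ^ e * ev L (rh x) ^ (D - e)" "ev L (rh x) ~= 0" using D by (auto simp flip: power_add simp: Dset_def)
  thus "h x = ev (G * L ^ (D - e)) (rh x) / ev L (rh x) ^ D" using G(2) x by simp
 qed
 thus ?thesis by blast
qed

text \<open>A common degree \<open>D\<close> in both variables for all summands, and for every large
  \<open>D\<close>, lets numerator and denominator of a fraction be given the same degree.\<close>

lemma tens_biform:
 assumes L: "form n 1 L" and h: "h : tens (chart_alg n X rh L) (chart_alg n X rh L)"
 shows "EX e. ALL D>=e. EX m A B. (ALL k<(m::nat). form n D (A k) & form n D (B k)) &
  (ALL x:Dset X rh L. ALL y:Dset X rh L. h (x, y) = (SUM k<m. ev (A k) (rh x) * ev (B k) (rh y)) / (ev L (rh x) ^ D * ev L (rh y) ^ D))"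
proof -
 let ?O = "chart_alg n X rh L" and ?U = "Dset X rh L"
 obtain m a b where h: "!!k. k < (m::nat) ==> a k : ?O & b k : ?O" "h = (%(x, y). SUM k<m. a k x * b k y)"
  using tens_sum_repr[OF h] by blast
 have "ALL k. EX e. k < m --> (ALL D>=e. EX G H. form n D G & form n D H & (ALL x:?U. a k x = ev G (rh x) / ev L (rh x) ^ D) &
   (ALL x:?U. b k x = ev H (rh x) / ev L (rh x) ^ D))"
 proof
  fix k
  show "EX e. k < m --> (ALL D>=e. EX G H. form n D G & form n D H & (ALL x:?U. a k x = ev G (rh x) / ev L (rh x) ^ D) &
   (ALL x:?U. b k x = ev H (rh x) / ev L (rh x) ^ D))"
  proof (cases "k < m")
   case True
   obtain e where e: "!!D. D >= e ==> EX G. form n D G & (ALL x:?U. a k x = ev G (rh x) / ev L (rh x) ^ D)"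
    using chart_alg_raise[OF L] h(1)[OF True] by blast
   obtain e' where e': "!!D. D >= e' ==> EX G. form n D G & (ALL x:?U. b k x = ev G (rh x) / ev L (rh x) ^ D)"
    using chart_alg_raise[OF L] h(1)[OF True] by blast
   show ?thesis using e e' by (intro exI[of _ "e + e'"] impI allI) (meson add_leD1 add_leD2)
  qed simp
 qed
 then obtain e where e: "!!k D. k < m ==> D >= e k ==> EX G H. form n D G & form n D H & (ALL x:?U. a k x = ev G (rh x) / ev L (rh x) ^ D) &
   (ALL x:?U. b k x = ev H (rh x) / ev L (rh x) ^ D)" unfolding choice_iff by blast
 show ?thesis
 proof (rule exI[of _ "SUM k<m. e k"], intro allI impI)
  fix D assume D: "(SUM k<m. e k) <= D"
  have "ALL k. EX G. EX H. k < m --> form n D G & form n D H & (ALL x:?U. a k x = ev G (rh x) / ev L (rh x) ^ D) &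
   (ALL x:?U. b k x = ev H (rh x) / ev L (rh x) ^ D)"
  proof
   fix k
   have "e k <= D" if "k < m" using D member_le_sum[of k "{..<m}" e] that by auto
   thus "EX G. EX H. k < m --> form n D G & form n D H & (ALL x:?U. a k x = ev G (rh x) / ev L (rh x) ^ D) &
    (ALL x:?U. b k x = ev H (rh x) / ev L (rh x) ^ D)" using e[of k D] by blast
  qed
  then obtain A B where AB: "!!k. k < m ==> form n D (A k) & form n D (B k) & (ALL x:?U. a k x = ev (A k) (rh x) / ev L (rh x) ^ D) &
   (ALL x:?U. b k x = ev (B k) (rh x) / ev L (rh x) ^ D)" unfolding choice_iff by blast
  show "EX m A B. (ALL k<(m::nat). form n D (A k) & form n D (B k)) &
   (ALL x:?U. ALL y:?U. h (x, y) = (SUM k<m. ev (A k) (rh x) * ev (B k) (rh y)) / (ev L (rh x) ^ D * ev L (rh y) ^ D))"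
  proof (rule exI[of _ m], rule exI[of _ A], rule exI[of _ B], intro conjI ballI)
   show "ALL k<m. form n D (A k) & form n D (B k)" using AB by blast
   show "h (x, y) = (SUM k<m. ev (A k) (rh x) * ev (B k) (rh y)) / (ev L (rh x) ^ D * ev L (rh y) ^ D)" if "x : ?U" "y : ?U" for x y
    unfolding h(2) prod.case sum_divide_distrib using AB that by (intro sum.cong) auto
  qed
 qed
qed

context surface
begin

definition S :: "(nat => complex) set set" where "S = proj_point ` cone"
definition SS :: "(nat => complex) set fspace" where "SS = subspace_of (projective_space 3) S"

lemma S_rep: "x : S ==> rep x : cone & x = proj_point (rep x)"
proof -
 assume "x : S"
 then obtain v where v: "v : cone" "x = proj_point v" unfolding S_def by blast
 obtain c where c: "c ~= 0" "rep x = (%i. c * v i)" using rep_scale v(2) by blast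
 thus ?thesis using v form_scale[OF F, of c v] homog_scale[of v 3 c] by (auto simp: cone_def proj_point_scale)
qed

lemma SS: "proj_coords 3 SS rep" "points SS = S"
proof -
 have Sp: "S <= ppoints 3" unfolding S_def cone_def ppoints_def by blast
 have "S = points PP - Dset PP rep F"
 proof (intro equalityI subsetI)
  fix x assume "x : S"
  thus "x : points PP - Dset PP rep F" using S_rep[of x] Sp PP(2) by (auto simp: cone_def Dset_def)
 next
  fix x assume "x : points PP - Dset PP rep F"
  hence x: "x : ppoints 3" "ev F (rep x) = 0" using PP(2) by (auto simp: Dset_def)
  hence "rep x : cone" "x = proj_point (rep x)" using ppoints_rep[OF x(1)] by (auto simp: cone_def)
  thus "x : S" unfolding S_def by blast
 qed
 hence "cls PP S" using pc_open[OF PP(1) F] by (metis closedin_diff closedin_topspace)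
 hence cl: "cls (projective_space 3) S"
  using closedin_trans_full[of _ "ppoints 3"] points_projective[of 3] by (metis closedin_topspace zariski_subspace)
 thus "proj_coords 3 SS rep" unfolding SS_def by (rule proj_coords_closed)
 show "points SS = S" using closedin_subset[OF cl] by (auto simp: SS_def)
qed

lemma fsS: "fspace SS" by (rule pc_fspace[OF SS(1)])

lemma cone_point: "v : cone ==> proj_point v : points SS & (EX c. c ~= 0 & rep (proj_point v) = (%i. c * v i))"
 using rep_scale SS(2) by (auto simp: S_def)

lemma local_ratio:
 assumes U: "opn SS U" and f: "f : regular SS U" and v: "v : cone" "proj_point v : U"
 shows "EX d N M e E. form 3 d N & form 3 d M & form 3 e E & ev E v ~= 0 &
  (ALL w:cone. ev E w ~= 0 --> proj_point w : U & ev M w ~= 0 & ev M w * f (proj_point w) = ev N w)"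
proof -
 obtain d N M where N: "form 3 d N" "form 3 d M" "ev M (rep (proj_point v)) ~= 0"
  "ALL y:U. ev M (rep y) ~= 0 --> f y = ev N (rep y) / ev M (rep y)"
  using f v(2) unfolding pc_regular[OF SS(1) U] ratio_at_def by blast
 obtain e E where E: "form 3 e E" "proj_point v : Dset SS rep E" "Dset SS rep E <= U" using pc_basis[OF SS(1) U v(2)] by blast
 have sc: "EX c. c ~= 0 & (ALL d G. form 3 d G --> ev G (rep (proj_point w)) = c ^ d * ev G w)" if w: "w : cone" for w
 proof -
  obtain c where "c ~= 0" "rep (proj_point w) = (%i. c * w i)" using cone_point[OF w] by blast
  thus ?thesis using form_scale by auto
 qed
 have "ev (E * M) v ~= 0" using sc[OF v(1)] E(1,2) N(2,3) by (auto simp: Dset_def)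
 moreover have "proj_point w : U & ev M w ~= 0 & ev M w * f (proj_point w) = ev N w" if w: "w : cone" "ev (E * M) w ~= 0" for w
 proof -
  obtain c where c: "c ~= 0" "!!d G. form 3 d G ==> ev G (rep (proj_point w)) = c ^ d * ev G w" using sc[OF w(1)] by blast
  have "proj_point w : U" using E(1,3) c w cone_point[OF w(1)] by (auto simp: Dset_def)
  thus ?thesis using N(4) c N(1,2) w(2) by simp
 qed
 ultimately show ?thesis using N(1,2) form_mult[OF E(1) N(2)] by blast
qed

text \<open>The indicator function of a clopen set is locally a quotient of forms of degree zero,
  hence a global form of degree 0, which is a constant.\<close>

lemma connected: "connected_space (zariski SS)"
 unfolding connected_space_clopen_in
proof (intro allI impI)
 fix T assume T: "opn SS T & cls SS T"
 let ?\<eta> = "%w. if proj_point w : T then 1 else 0 :: complex"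
 have "EX G. form 3 0 G & (ALL v:cone. ?\<eta> v = ev G v)"
 proof (rule global_form)
  fix v assume v: "v : cone"
  have loc: "EX d N M. form 3 (0 + d) N & form 3 d M & ev M v ~= 0 & (ALL w:cone. ev M w ~= 0 --> ev M w * ?\<eta> w = ev N w)"
   if U: "opn SS U" "proj_point v : U" and c: "ALL x:U. (if x : T then 1 else 0) = (c :: complex)" for U c
  proof -
   obtain d N M e E where E: "form 3 e E" "ev E v ~= 0"
    "ALL w:cone. ev E w ~= 0 --> proj_point w : U & ev M w ~= 0 & ev M w * (%_. 0) (proj_point w) = ev N w"
    using local_ratio[OF U(1) fs_const[OF fsS U(1)] v U(2)] by blast
   show ?thesis
    by (rule exI[of _ e], rule exI[of _ "const_poly c * E"], rule exI[of _ E]) (use E c form_cmult[OF E(1)] in auto)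
  qed
  show "EX d N M. form 3 (0 + d) N & form 3 d M & ev M v ~= 0 & (ALL w:cone. ev M w ~= 0 --> ev M w * ?\<eta> w = ev N w)"
  proof (cases "proj_point v : T")
   case True
   thus ?thesis using loc[of T 1] T by auto
  next
   case False
   have "opn SS (points SS - T)" "proj_point v : points SS - T" using T False cone_point[OF v] by auto
   thus ?thesis by (rule loc[of _ 0]) auto
  qed
 qed
 then obtain G where G: "form 3 0 G" "!!v. v : cone ==> ?\<eta> v = ev G v" by blast
 have c: "ev G v = ev G (%_. 0)" for v using form_scale[OF G(1), of 0 v] by simp
 have "x : T \<longleftrightarrow> y : T" if "x : S" "y : S" for x y
  using G(2)[of "rep x"] G(2)[of "rep y"] S_rep[OF that(1)] S_rep[OF that(2)] c[of "rep x"] c[of "rep y"] by (auto split: if_splits)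
 moreover have "T <= S" using T openin_subset SS(2) by metis
 ultimately show "T = {} \<or> T = points SS" unfolding SS(2) by blast
qed

lemma flat_sum: "finite I ==> v : cone ==> (!!i. i : I ==> flat (f i) v) ==> flat (%w. SUM i:I. f i w) v"
 by (induction I rule: finite_induct) (auto intro: flat_const flat_add)

text \<open>For fixed \<open>y\<close> the functions \<open>x \<mapsto> t\<^sub>l (c x / c y)\<close> have zero differential at \<open>y\<close>; translating in \<open>A\<close>,
  the functions \<open>x \<mapsto> t\<^sub>l (c x / c x\<^sub>0)\<close> have zero differential everywhere, so they take finitely many values.\<close>

theorem morphism_to_abelian:
 assumes A: "abelian_variety A" and p3: "3 <= p" and c: "morphism SS (variety A) c" and xy: "x : S" "y : S"
 shows "c x = c y"
proof -
 interpret A: abvar A by (rule abvarI[OF A])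
 let ?V = "variety A" and ?one = "\<one>\<^bsub>A\<^esub>"
 obtain n rh where co: "proj_coords n ?V rh" using A.coords by blast
 have one: "?one : points ?V" using A.carrier_points by blast
 obtain j where j: "j <= n" "rh ?one j ~= 0" using homog_nonzero[OF pc_homog[OF co one]] by blast
 let ?L = "Xv j"
 have L: "form n 1 ?L" by (rule form_X[OF j(1)])
 let ?D = "Dset ?V rh ?L" and ?O = "chart_alg n ?V rh ?L"
 have oneD: "?one : ?D" using one j by (simp add: Dset_def)
 define t where "t = (%i x. rh x i / ev ?L (rh x) - rh ?one i / ev ?L (rh ?one))"
 note alg = fun_alg_chart[OF L, of ?V rh]
 have oD: "opn ?V ?D" and Oreg: "?O <= regular ?V ?D" using chart_proj[OF co L] by (auto simp: chart_def)
 have tO: "t i : ?O" if "i <= n" for i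
  unfolding t_def using fun_alg_diff[OF alg chart_gen[OF that] fun_alg_const[OF alg]] by simp
 have t1: "t i ?one = 0" for i by (simp add: t_def)
 have sep: "z = ?one" if z: "z : ?D" "ALL i<=n. t i z = 0" for z
 proof -
  have zp: "z : points ?V" "rh z j ~= 0" using z(1) by (auto simp: Dset_def)
  have "EX d. d ~= 0 & rh z = (%i. d * rh ?one i)"
  proof (rule proportional[OF pc_homog[OF co one] pc_homog[OF co zp(1)] j(2)])
   fix i assume "i <= n"
   hence "rh z i / rh z j = rh ?one i / rh ?one j" using z(2) by (simp add: t_def)
   thus "rh ?one j * rh z i = rh ?one i * rh z j" using zp(2) j(2) by (simp add: field_simps)
  qed
  thus ?thesis using pc_inj[OF co one zp(1)] by blast
 qed
 have cc: "c x : carrier A" if "x : S" for x using A.morphism_carrier[OF c] that SS(2) by metis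
 let ?q = "%x y. c x \<otimes>\<^bsub>A\<^esub> inv\<^bsub>A\<^esub> (c y)"
 have mq: "morphism SS ?V (%x. ?q x y)" if "y : S" for y
  by (intro A.mult_morphism[OF fsS c] A.const_morphism[OF fsS] A.inv_closed cc that)
 \<comment> \<open>The coordinates of c(w) / c(v), which is the neutral element on the diagonal:
   differentials at any point are transported to the neutral element by translation.\<close>
 define h where "h l v w = t l (?q (proj_point w) (proj_point v))" for l v w
 have ppS: "proj_point v : S" if "v : cone" for v using that by (simp add: S_def)
 have h0: "h l v v = 0" if "v : cone" for l v using cc[OF ppS[OF that]] by (simp add: h_def t1)
 have hflat: "flat (h l v) v" if l: "l <= n" and v: "v : cone" for l v
 proof (rule no_differentials[OF p3 h0 _ v])
  fix v0 assume v0: "v0 : cone"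
  then obtain i0 where i0: "i0 <= 3" "v0 i0 ~= 0" using homog_nonzero[of v0 3] by (auto simp: cone_def)
  let ?M = "Xv i0"
  have M: "form 3 1 ?M" by (rule form_X[OF i0(1)])
  let ?U = "Dset SS rep ?M" and ?P = "chart_alg 3 SS rep ?M"
  let ?x0 = "proj_point v0"
  have inU: "proj_point w : ?U" if "w : cone" "w i0 ~= 0" for w using cone_point[OF that(1)] that(2) by (auto simp: Dset_def)
  note pr = fspace_prod[OF fsS fsS] and ch = chart_proj[OF SS(1) M]
  have mqq: "morphism (SS \<times>\<^sub>v SS) ?V (%z. ?q (fst z) (snd z))"
   by (intro A.mult_morphism[OF pr] A.inv_morphism morphism_comp[OF _ c] morphism_fst[OF fsS fsS] morphism_snd[OF fsS fsS])
  let ?W = "{z : points (SS \<times>\<^sub>v SS). ?q (fst z) (snd z) : ?D}"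
  have W: "opn (SS \<times>\<^sub>v SS) ?W" by (rule morphism_open[OF mqq oD])
  have reg: "(%z. t l (?q (fst z) (snd z))) : regular (SS \<times>\<^sub>v SS) ?W"
   by (rule morphism_pull[OF mqq oD]) (use Oreg tO[OF l] in blast)
  have x0: "(?x0, ?x0) : ?U \<times> ?U" "(?x0, ?x0) : ?W"
   using inU[OF v0 i0(2)] oneD cc[OF ppS[OF v0]] ppS[OF v0] by (auto simp: points_prod[OF fsS fsS] SS(2))
  obtain a b where ab: "a : tens ?P ?P" "b : tens ?P ?P" "b (?x0, ?x0) ~= 0"
   "ALL z:?U \<times> ?U. b z ~= 0 --> z : ?W & t l (?q (fst z) (snd z)) = a z / b z"
   using chartD[OF chart_prod[OF fsS fsS ch ch] x0(1) W x0(2) reg] by blast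
  obtain ea where ea: "!!D. D >= ea ==> EX m A B. (ALL k<(m::nat). form 3 D (A k) & form 3 D (B k)) &
   (ALL x:?U. ALL y:?U. a (x, y) = (SUM k<m. ev (A k) (rep x) * ev (B k) (rep y)) / (ev ?M (rep x) ^ D * ev ?M (rep y) ^ D))"
   using tens_biform[OF M ab(1)] by blast
  obtain eb where eb: "!!D. D >= eb ==> EX m A B. (ALL k<(m::nat). form 3 D (A k) & form 3 D (B k)) &
   (ALL x:?U. ALL y:?U. b (x, y) = (SUM k<m. ev (A k) (rep x) * ev (B k) (rep y)) / (ev ?M (rep x) ^ D * ev ?M (rep y) ^ D))"
   using tens_biform[OF M ab(2)] by blast
  \<comment> \<open>Positive, so that a derivative has degree exactly \<open>?d - 1\<close>.\<close>
  let ?d = "Suc (ea + eb)"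
  obtain m A A' where a: "!!k. k < (m::nat) ==> form 3 ?d (A k) & form 3 ?d (A' k)"
   "ALL x:?U. ALL y:?U. a (x, y) = (SUM k<m. ev (A k) (rep x) * ev (A' k) (rep y)) / (ev ?M (rep x) ^ ?d * ev ?M (rep y) ^ ?d)"
   using ea[of ?d] by auto
  obtain m' B B' where b: "!!k. k < (m'::nat) ==> form 3 ?d (B k) & form 3 ?d (B' k)"
   "ALL x:?U. ALL y:?U. b (x, y) = (SUM k<m'. ev (B k) (rep x) * ev (B' k) (rep y)) / (ev ?M (rep x) ^ ?d * ev ?M (rep y) ^ ?d)"
   using eb[of ?d] by auto
  have bihom: "(SUM k<m. ev (A k) (rep (proj_point w)) * ev (B k) (rep (proj_point v))) / (ev ?M (rep (proj_point w)) ^ ?d * ev ?M (rep (proj_point v)) ^ ?d)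
    = (SUM k<m. ev (A k) w * ev (B k) v) / (w i0 ^ ?d * v i0 ^ ?d)"
   if A: "!!k. k < (m::nat) ==> form 3 ?d (A k) & form 3 ?d (B k)" and wv: "w : cone" "v : cone" for m A B v w
  proof -
   obtain s where s: "s ~= 0" "rep (proj_point w) = (%i. s * w i)" using cone_point[OF wv(1)] by blast
   obtain r where r: "r ~= 0" "rep (proj_point v) = (%i. r * v i)" using cone_point[OF wv(2)] by blast
   have 1: "(SUM k<m. ev (A k) (rep (proj_point w)) * ev (B k) (rep (proj_point v))) = s ^ ?d * r ^ ?d * (SUM k<m. ev (A k) w * ev (B k) v)"
    unfolding sum_distrib_left
   proof (rule sum.cong)
    fix k assume "k : {..<m}"
    hence "form 3 ?d (A k)" "form 3 ?d (B k)" using A by auto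
    thus "ev (A k) (rep (proj_point w)) * ev (B k) (rep (proj_point v)) = s ^ ?d * r ^ ?d * (ev (A k) w * ev (B k) v)"
     unfolding s(2) r(2) by (simp add: form_scale del: power_Suc)
   qed simp
   have 2: "ev ?M (rep (proj_point w)) ^ ?d * ev ?M (rep (proj_point v)) ^ ?d = s ^ ?d * r ^ ?d * (w i0 ^ ?d * v i0 ^ ?d)"
    unfolding s(2) r(2) by (simp add: power_mult_distrib)
   have "s ^ ?d * r ^ ?d ~= 0" using s(1) r(1) by simp
   thus ?thesis unfolding 1 2 by (rule mult_divide_mult_cancel_left)
  qed
  let ?B = "SUM k<m'. B' k * B k"
  \<comment> \<open>The derivative of the numerator in the first variable, restricted to the
    diagonal; this makes it a form in the moving point, as \<open>no_differentials\<close>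
    requires.\<close>
  let ?Pa = "%e. SUM k<m. A' k * pd e (A k)"
  have nzB: "ev ?B v0 ~= 0"
  proof -
   have "b (?x0, ?x0) = (SUM k<m'. ev (B k) v0 * ev (B' k) v0) / (v0 i0 ^ ?d * v0 i0 ^ ?d)"
    using b(2) inU[OF v0 i0(2)] bihom[OF b(1) v0 v0] by simp
   thus ?thesis using ab(3) by (auto simp: mult.commute)
  qed
  have germs: "EX d N M. germ (h l v) v d N M & ev M v = ev ?B v & (ALL a<=3. ev (pd a N) v = ev (?Pa a) v)"
   if v: "v : cone" "ev (?B * ?M) v ~= 0" for v
  proof (rule exI[of _ ?d], rule exI[of _ "SUM k<m. const_poly (ev (A' k) v) * A k"], rule exI[of _ "SUM k<m'. const_poly (ev (B' k) v) * B k"], intro conjI)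
   let ?N = "SUM k<m. const_poly (ev (A' k) v) * A k" and ?M' = "SUM k<m'. const_poly (ev (B' k) v) * B k"
   have fN: "form 3 ?d ?N" by (intro form_sum form_cmult) (use a in auto)
   have fM: "form 3 ?d ?M'" by (intro form_sum form_cmult) (use b in auto)
   have vi: "v i0 ~= 0" using v(2) by simp
   show "germ (h l v) v ?d ?N ?M'"
   proof (rule germI[OF fN fM _ form_mult[OF fM M]])
    show "ev ?M' v ~= 0" "ev (?M' * ?M) v ~= 0" using v(2) by auto
    fix w assume w: "w : cone" "ev (?M' * ?M) w ~= 0"
    hence wi: "w i0 ~= 0" and Mw: "ev ?M' w ~= 0" by auto
    note U = inU[OF w(1) wi] inU[OF v(1) vi]
    have "a (proj_point w, proj_point v) = ev ?N w / (w i0 ^ ?d * v i0 ^ ?d)"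
     using a(2) U bihom[OF a(1) w(1) v(1)] by (simp add: mult.commute)
    moreover have bw: "b (proj_point w, proj_point v) = ev ?M' w / (w i0 ^ ?d * v i0 ^ ?d)"
     using b(2) U bihom[OF b(1) w(1) v(1)] by (simp add: mult.commute)
    moreover have "b (proj_point w, proj_point v) ~= 0" unfolding bw using Mw wi vi by simp
    hence "h l v w = a (proj_point w, proj_point v) / b (proj_point w, proj_point v)"
     using ab(4) U by (force simp: h_def)
    ultimately show "ev ?M' w * h l v w = ev ?N w" using Mw wi vi by simp
   qed
   show "ev ?M' v = ev ?B v" by simp
   show "ALL a<=3. ev (pd a ?N) v = ev (?Pa a) v" by (simp add: pd_sum pd_mult)
  qed
  show "EX d P B e E. 0 < d & (ALL a<=3. form 3 (d - 1) (P a)) & form 3 d B & ev B v0 ~= 0 &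
   form 3 e E & ev E v0 ~= 0 & (ALL v:cone. ev (B * E) v ~= 0 --> (EX d N M. germ (h l v) v d N M &
    ev M v = ev B v & (ALL a<=3. ev (pd a N) v = ev (P a) v)))"
  proof (rule exI[of _ "?d + ?d"], rule exI[of _ ?Pa], rule exI[of _ ?B], rule exI[of _ 1], rule exI[of _ ?M], intro conjI allI impI ballI germs nzB M)
   show "form 3 (?d + ?d) ?B" by (intro form_sum form_mult) (use b in auto)
   show "form 3 (?d + ?d - 1) (?Pa e)" for e
    by (rule form_sum, rule form_mult'[of 3 ?d _ "?d - 1"]) (use a form_pd[of 3 ?d] in auto)
  qed (use i0 in auto)
 qed
 have fibre: "EX T. opn SS T & x0 : T & (ALL x:T. c x = c x0)" if x0: "x0 : S" for x0
 proof -
  let ?U0 = "{x : points SS. ?q x x0 : ?D}"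
  have oU0: "opn SS ?U0" by (rule morphism_open[OF mq[OF x0] oD])
  let ?W = "%l x. t l (?q x x0)"
  have rW: "?W l : regular SS ?U0" if "l <= n" for l
   by (rule morphism_pull[OF mq[OF x0] oD]) (use Oreg tO[OF that] in blast)
  have flatW: "flat (%w. ?W l (proj_point w)) v" if l: "l <= n" and v: "v : cone" "proj_point v : ?U0" for l v
  proof -
   let ?pv = "proj_point v" let ?y = "?q ?pv x0"
   have yD: "?y : ?D" using v(2) by blast
   have yc: "?y : carrier A" using cc[OF ppS[OF v(1)]] cc[OF x0] by simp
   have mt: "morphism ?V ?V (%u. u \<otimes>\<^bsub>A\<^esub> ?y)" by (rule A.mult_morphism[OF A.fsV morphism_id[OF A.fsV] A.const_morphism[OF A.fsV yc]])
   let ?Wt = "{u : points ?V. u \<otimes>\<^bsub>A\<^esub> ?y : ?D}"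
   have rt: "(%u. t l (u \<otimes>\<^bsub>A\<^esub> ?y)) : regular ?V ?Wt" by (rule morphism_pull[OF mt oD]) (use Oreg tO[OF l] in blast)
   have oneW: "?one : ?Wt" using one yD yc by simp
   obtain a b where ab: "a : ?O" "b : ?O" "b ?one ~= 0" "ALL u:?D. b u ~= 0 --> u : ?Wt & t l (u \<otimes>\<^bsub>A\<^esub> ?y) = a u / b u"
    using chartD[OF chart_proj[OF co L] oneD morphism_open[OF mt oD] oneW rt] by (elim bexE conjE)
   \<comment> \<open>The numerator of the change of \<open>t l\<close> under translation by
     \<open>?y\<close>. It vanishes at the neutral element, so it is a combination of the
     \<open>t i\<close>, whose pullbacks are flat at \<open>v\<close>.\<close>
   let ?f = "%u. a u - t l ?y * b u"
   have fO: "?f : ?O" by (intro fun_alg_diff[OF alg] fun_alg_cmult[OF alg] ab)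
   have f1: "?f ?one = 0" using ab(3,4) oneD yc by auto
   have "EX g. (ALL i<=n. g i : ?O) & (ALL u:?D. ?f u - ?f ?one = (SUM i<=n. t i u * g i u))" by (rule chart_ideal[OF L fO t_def oneD])
   then obtain g where g: "!!i. i <= n ==> g i : ?O" "ALL u:?D. ?f u - ?f ?one = (SUM i<=n. t i u * g i u)" by (elim exE conjE) blast
   let ?Db = "{u:?D. b u ~= 0}"
   have oDb: "opn ?V ?Db" by (rule fs_open[OF A.fsV oD]) (use ab Oreg in blast)
   let ?R = "{x : points SS. ?q x ?pv : ?Db}"
   note mv = mq[OF ppS[OF v(1)]]
   have oR: "opn SS ?R" by (rule morphism_open[OF mv oDb])
   have vR: "?pv : ?R" using oneD ab(3) cc[OF ppS[OF v(1)]] ppS[OF v(1)] SS(2) by simp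
   let ?G = "%i x. g i (?q x ?pv) / b (?q x ?pv)"
   have rG: "?G i : regular SS ?R" if i: "i <= n" for i
   proof (rule morphism_pull[OF mv oDb])
    have "g i : regular ?V ?Db" "b : regular ?V ?Db" using g(1)[OF i] ab(2) Oreg by (auto intro!: fs_restrict[OF A.fsV oD oDb])
    thus "(%u. g i u / b u) : regular ?V ?Db" by (rule fs_divide[OF A.fsV oDb]) simp
   qed
   have term': "flat (%w. h i v w * ?G i (proj_point w)) v" if i: "i <= n" for i
   proof -
    from local_ratio[OF oR rG[OF i] v(1) vR] obtain d N M e E where "form 3 d N" "form 3 d M" "form 3 e E" "ev E v ~= 0"
     "ALL w:cone. ev E w ~= 0 --> proj_point w : ?R & ev M w ~= 0 & ev M w * ?G i (proj_point w) = ev N w" by (elim exE conjE)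
    hence "germ (%w. ?G i (proj_point w)) v d N M" using v(1) by (intro germI) auto
    thus ?thesis by (rule flat_mult[OF v(1) hflat[OF i v(1)] h0[OF v(1)]])
   qed
   have fl: "flat (%w. t l ?y + (SUM i:{..n}. h i v w * ?G i (proj_point w))) v"
    by (intro flat_add[OF v(1) flat_const] flat_sum[OF _ v(1)] term') auto
   \<comment> \<open>Applied to the constant 0 only to obtain a form \<open>E\<close> that cuts out
     a neighbourhood inside \<open>?R\<close>.\<close>
   from local_ratio[OF oR fs_const[OF fsS oR] v(1) vR, of 0] obtain d N M e E where E: "form 3 e E" "ev E v ~= 0"
     "ALL w:cone. ev E w ~= 0 --> proj_point w : ?R & ev M w ~= 0 & ev M w * 0 = ev N w" by (elim exE conjE)
   show ?thesis
   proof (rule flat_cong[OF fl v(1) E(1,2)])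
    fix w assume w: "w : cone" "ev E w ~= 0"
    let ?u = "?q (proj_point w) ?pv"
    have u: "?u : ?D" "b ?u ~= 0" using E(3) w by auto
    have c3: "c (proj_point w) : carrier A" "c ?pv : carrier A" "c x0 : carrier A" using cc ppS w(1) v(1) x0 by auto
    have "?u \<otimes>\<^bsub>A\<^esub> ?y = c (proj_point w) \<otimes>\<^bsub>A\<^esub> (inv\<^bsub>A\<^esub> (c ?pv) \<otimes>\<^bsub>A\<^esub> c ?pv) \<otimes>\<^bsub>A\<^esub> inv\<^bsub>A\<^esub> (c x0)"
     using c3 by (simp only: A.m_assoc A.inv_closed A.m_closed)
    hence uy: "?q (proj_point w) x0 = ?u \<otimes>\<^bsub>A\<^esub> ?y" using c3 by simp
    have "t l (?u \<otimes>\<^bsub>A\<^esub> ?y) = a ?u / b ?u" using ab(4) u by blast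
    also have "... = t l ?y + ?f ?u / b ?u" using u(2) by (simp add: field_simps)
    also have "?f ?u = (SUM i<=n. t i ?u * g i ?u)" using g(2) u(1) f1 by simp
    finally show "?W l (proj_point w) = t l ?y + (SUM i:{..n}. h i v w * ?G i (proj_point w))"
     unfolding uy by (simp add: h_def sum_divide_distrib)
   qed
  qed
  let ?v0 = "rep x0"
  have v0: "?v0 : cone" "proj_point ?v0 = x0" using S_rep[OF x0] by auto
  obtain l0 where l0: "l0 <= 3" "ev (pd l0 F) ?v0 ~= 0" using smooth[of ?v0] v0 by (auto simp: cone_def)
  have x0U: "x0 : ?U0" using x0 oneD cc[OF x0] SS(2) by simp
  have "EX T. opn SS T & x0 : T & T <= ?U0 & (ALL x:T. ?W l x = 0)" if l: "l <= n" for l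
  proof -
   from local_ratio[OF oU0 rW[OF l] v0(1)] x0U v0(2) obtain d N M e E where N: "form 3 d N" "form 3 d M" "form 3 e E" "ev E ?v0 ~= 0"
    "ALL w:cone. ev E w ~= 0 --> proj_point w : ?U0 & ev M w ~= 0 & ev M w * ?W l (proj_point w) = ev N w" by auto
   \<comment> \<open>Shrinks to where the chosen partial derivative does not vanish, as the
     finiteness argument needs.\<close>
   let ?E = "E * pd l0 F"
   have fE: "form 3 (e + (p - 1)) ?E" by (rule form_mult[OF N(3) form_pd[OF F]])
   have fin: "finite ((%w. ?W l (proj_point w)) ` {w:cone. ev ?E w ~= 0})"
    by (rule flat_finite_valued[OF l0(1) N(1,2) fE]) (use N(5) flatW[OF l] in auto)
   let ?T = "Dset SS rep ?E" and ?vals = "(%w. ?W l (proj_point w)) ` {w:cone. ev ?E w ~= 0} - {0}"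
   have oT: "opn SS ?T" by (rule pc_open[OF SS(1) fE])
   have TU: "x : ?U0 & rep x : cone & proj_point (rep x) = x" if "x : ?T" for x
    using that S_rep[of x] N(5) SS(2) by (auto simp: Dset_def)
   \<comment> \<open>The finitely many nonzero values are excluded by open conditions; the value at
     \<open>x0\<close> is 0.\<close>
   let ?TT = "((\<Inter>k\<in>?vals. {x:?T. ?W l x ~= k}) Int points SS) Int ?T"
   have "opn SS {x:?T. ?W l x ~= k}" for k
    by (rule fs_eq_open[OF fsS oT fs_restrict[OF fsS oU0 oT _ rW[OF l]] fs_const[OF fsS oT]]) (use TU in blast)
   hence "opn SS ((\<Inter>k\<in>?vals. {x:?T. ?W l x ~= k}) Int points SS)" using fin by (intro openin_INT) auto
   hence "opn SS ?TT" using oT by (rule openin_Int)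
   moreover have W0: "?W l x0 = 0" using cc[OF x0] by (simp add: t1)
   have "x0 : ?TT" using W0 x0 SS(2) N(4) l0(2) by (auto simp: Dset_def)
   moreover have "?TT <= ?U0" using TU by blast
   moreover have "ALL x:?TT. ?W l x = 0"
   proof (rule ballI, rule ccontr)
    fix x assume x: "x : ?TT" and nz: "?W l x ~= 0"
    hence "x : ?T" by blast
    hence "?W l x : ?vals" using TU[of x] nz by (auto simp: Dset_def intro!: image_eqI[of _ _ "rep x"])
    thus False using x by blast
   qed
   ultimately show ?thesis by (intro exI[of _ ?TT] conjI)
  qed
  hence "ALL l. EX T. l <= n --> opn SS T & x0 : T & T <= ?U0 & (ALL x:T. ?W l x = 0)" by blast
  then obtain T where T: "!!l. l <= n ==> opn SS (T l) & x0 : T l & T l <= ?U0 & (ALL x:T l. ?W l x = 0)"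
   unfolding choice_iff by blast
  have "opn SS (\<Inter>l\<in>{..n}. T l)" by (rule openin_INT2) (use T in auto)
  moreover have "c x = c x0" if x: "x : (\<Inter>l\<in>{..n}. T l)" for x
  proof -
   have xU: "x : ?U0" using x T[of 0] by auto
   have "?q x x0 = ?one" by (rule sep) (use xU x T in auto)
   moreover have "c x : carrier A" "c x0 : carrier A" using xU cc x0 SS(2) by auto
   ultimately show ?thesis using A.inv_solve_right[of ?one "c x" "c x0"] by simp
  qed
  moreover have "x0 : (\<Inter>l\<in>{..n}. T l)" using T by blast
  ultimately show ?thesis by blast
 qed
 have "{z : points SS. c z = c x} = points SS"
 proof (rule connected_clopen[OF connected])
  show "opn SS {z : points SS. c z = c x}"
   unfolding openin_subopen[of "zariski SS" "{z : points SS. c z = c x}"]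
  proof
   fix z assume z: "z : {z : points SS. c z = c x}"
   obtain T where T: "opn SS T" "z : T" "ALL x:T. c x = c z" using fibre[of z] z SS(2) by auto
   thus "EX T. opn SS T & z : T & T <= {z : points SS. c z = c x}"
   proof (intro exI[of _ T] conjI subsetI)
    fix w assume w: "w : T"
    hence "w : points SS" using openin_subset[OF T(1)] by blast
    thus "w : {z : points SS. c z = c x}" using T(3) w z by simp
   qed (rule T(1), rule T(2))
  qed
  have "cls SS {z : points SS. c z : {c x}}" by (rule morphism_closed[OF c A.point_closed[OF cc[OF xy(1)]]])
  thus "cls SS {z : points SS. c z = c x}" by simp
  show "{z : points SS. c z = c x} ~= {}" using xy SS(2) by blast
 qed
 moreover have "y : points SS" using xy(2) SS(2) by simp
 ultimately have "y : {z : points SS. c z = c x}" by (rule ssubst)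
 thus ?thesis by simp
qed

end

section \<open>Functions separating finitely many points\<close>

lemma avoiding_linear_form:
 assumes "finite E" "E <= homog_coords n"
 shows "EX L. form n 1 L & (ALL v:E. ev L v ~= 0)"
 using assms
proof induction
 case empty
 thus ?case using form_0 by blast
next
 case (insert v E)
 then obtain L where L: "form n 1 L" "ALL v:E. ev L v ~= 0" by auto
 obtain j where j: "j <= n" "v j ~= 0" using homog_nonzero[of v n] insert by auto
 have "finite (insert (- (ev L v / v j)) ((%w. - (ev L w / w j)) ` E))" using insert by simp
 \<comment> \<open>Each point excludes at most one value of the coefficient of
   \<open>x_j\<close>.\<close>
 then obtain c where c: "c ~: insert (- (ev L v / v j)) ((%w. - (ev L w / w j)) ` E)"
  using ex_new_if_finite infinite_UNIV_char_0 by blast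
 let ?L = "L + const_poly c * Xv j"
 have "ev ?L w ~= 0" if "w : insert v E" for w
 proof (cases "w j = 0")
  case True
  thus ?thesis using that L(2) j(2) by auto
 next
  case False
  have "c ~= - (ev L w / w j)" using c that by blast
  moreover have "c = - (ev L w / w j)" if "ev L w + c * w j = 0"
   using that False minus_unique[OF that] by (metis minus_divide_left nonzero_mult_div_cancel_right)
  ultimately show ?thesis by auto
 qed
 thus ?case using form_add[OF L(1) form_cmult[OF form_X[OF j(1)]]] by blast
qed

lemma chart_separates:
 assumes c: "proj_coords n X rh" and xy: "x : Dset X rh L" "y : Dset X rh L" "x ~= y"
 shows "EX i<=n. rh x i / ev L (rh x) ~= rh y i / ev L (rh y)"
proof (rule ccontr)
 assume no: "~ ?thesis"
 have p: "x : points X" "y : points X" "ev L (rh x) ~= 0" "ev L (rh y) ~= 0" using xy by (auto simp: Dset_def)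
 have "rh y i = ev L (rh y) / ev L (rh x) * rh x i" for i
 proof (cases "i <= n")
  case True
  thus ?thesis using no p by (auto simp: field_simps)
 next
  case False
  thus ?thesis using pc_homog[OF c p(1)] pc_homog[OF c p(2)] by (simp add: homog_coords_def)
 qed
 thus False using pc_inj[OF c p(1,2), of "ev L (rh y) / ev L (rh x)"] p xy(3) by auto
qed

text \<open>Lagrange interpolation in one chart containing all the points, with a coordinate ratio
  separating \<open>e\<close> from each of the others.\<close>

lemma separating_function:
 assumes c: "proj_coords n X rh" and E: "finite E" "E <= points X" "e : E"
 shows "EX L ep. form n 1 L & E <= Dset X rh L & ep : chart_alg n X rh L & ep e = 1 & (ALL x:E - {e}. ep x = 0)"
proof -
 have "rh ` E <= homog_coords n" using pc_homog[OF c] E(2) by auto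
 then obtain L where L: "form n 1 L" "ALL v:rh ` E. ev L v ~= 0"
  using avoiding_linear_form[OF finite_imageI[OF E(1)]] by blast
 hence ED: "E <= Dset X rh L" using E(2) by (auto simp: Dset_def)
 let ?t = "%i x. rh x i / ev L (rh x)"
 have "ALL x:E - {e}. EX i. i <= n & ?t i x ~= ?t i e"
  using chart_separates[OF c] ED E(3) by (auto simp: subset_iff)
 then obtain i where i: "ALL x:E - {e}. i x <= n & ?t (i x) x ~= ?t (i x) e" unfolding bchoice_iff by blast
 define ep where "ep = (%z. PROD x:E - {e}. 1 / (?t (i x) e - ?t (i x) x) * (?t (i x) z - ?t (i x) x))"
 note al = fun_alg_chart[OF L(1), of X rh]
 have "ep : chart_alg n X rh L" unfolding ep_def
  by (intro fun_alg_prod[OF al] fun_alg_cmult[OF al] fun_alg_diff[OF al] fun_alg_const[OF al] chart_gen) (use i in blast)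
 moreover have "ep e = 1" unfolding ep_def using i by (intro prod.neutral ballI) (metis (no_types, lifting) nonzero_divide_mult_cancel_left nonzero_eq_divide_eq times_divide_eq_left mult_1 right_minus_eq)
 moreover have "ep x = 0" if "x : E - {e}" for x unfolding ep_def
  using E(1) that by (intro prod_zero) auto
 ultimately show ?thesis using L(1) ED by blast
qed

lemma chart_open_subset:
 assumes X: "fspace X" and ch: "chart X U \<O>" and W: "opn X W" "W <= U"
 shows "chart X W \<O>"
proof -
 have "opn X U" "\<O> <= regular X U" "fun_alg \<O>" using ch by (auto simp: chart_def)
 hence "\<O> <= regular X W" using fs_restrict[OF X _ W] by blast
 moreover have "EX a:\<O>. EX b:\<O>. b x ~= 0 & (ALL y:W. b y ~= 0 --> y : S & f y = a y / b y)"
  if x: "x : W" "opn X S" "x : S" "f : regular X S" for x S f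
  using chartD[OF ch subsetD[OF W(2) x(1)] x(2-)] W(2) by (meson subsetD)
 ultimately show ?thesis using \<open>fun_alg \<O>\<close> W(1) unfolding chart_def by blast
qed

lemma proj_chart_at: "proj_coords n X rh ==> x : points X ==> EX U \<O>. chart X U \<O> & x : U"
 using separating_function[of n X rh "{x}" x] chart_proj by (metis empty_subsetI finite.simps insertI1 insert_subset)

section \<open>The group of automorphisms\<close>

lemma Aut_one: "\<one>\<^bsub>Aut X\<^esub> = (\<lambda>x\<in>points X. x)" and Aut_mult:
 "f : carrier (Aut X) ==> g : carrier (Aut X) ==> f \<otimes>\<^bsub>Aut X\<^esub> g = compose (points X) f g"
 by (simp_all add: Aut_def BijGroup_def)

lemma Aut_ext: "f : carrier (Aut X) ==> f : extensional (points X)"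
 by (simp add: carrier_Aut Bij_def)

lemma Aut_eqI: "f : carrier (Aut X) ==> g : carrier (Aut X) ==> (!!x. x : points X ==> f x = g x) ==> f = g"
 by (rule extensionalityI[OF Aut_ext Aut_ext])

lemma Aut_in: "f : carrier (Aut X) ==> x : points X ==> f x : points X"
 by (erule AutE) (rule morphism_in)

lemma Aut_apply: "f : carrier (Aut X) ==> g : carrier (Aut X) ==> x : points X ==> (f \<otimes>\<^bsub>Aut X\<^esub> g) x = f (g x)"
 by (simp add: Aut_mult compose_def)

lemma group_Aut:
 assumes X: "fspace X"
 shows "group (Aut X)"
proof (rule groupI)
 show one: "\<one>\<^bsub>Aut X\<^esub> : carrier (Aut X)"
  unfolding Aut_one using AutI[OF X morphism_id[OF X] morphism_id[OF X]] by (simp add: restrict_def)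
 fix f assume f: "f : carrier (Aut X)"
 obtain f' where f': "morphism X X f" "morphism X X f'" "!!x. x : points X ==> f' (f x) = x" "!!x. x : points X ==> f (f' x) = x"
  using AutE[OF f] by metis
 have r: "restrict f' (points X) : carrier (Aut X)" by (rule AutI[OF X f'(2,1,4,3)])
 have cl: "f \<otimes>\<^bsub>Aut X\<^esub> g : carrier (Aut X)" if f: "f : carrier (Aut X)" and g: "g : carrier (Aut X)" for f g
 proof -
  obtain f' where f': "morphism X X f" "morphism X X f'" "!!x. x : points X ==> f' (f x) = x" "!!x. x : points X ==> f (f' x) = x"
   using AutE[OF f] by metis
  obtain g' where g': "morphism X X g" "morphism X X g'" "!!x. x : points X ==> g' (g x) = x" "!!x. x : points X ==> g (g' x) = x"
   using AutE[OF g] by metis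
  show ?thesis unfolding Aut_mult[OF f g] compose_def
   by (rule AutI[OF X morphism_comp[OF g'(1) f'(1)] morphism_comp[OF f'(2) g'(2)]])
    (simp_all add: f' g' morphism_in[OF f'(2)] morphism_in[OF g'(1)])
 qed
 show "f \<otimes>\<^bsub>Aut X\<^esub> g : carrier (Aut X)" if "g : carrier (Aut X)" for g by (rule cl[OF f that])
 show "\<one>\<^bsub>Aut X\<^esub> \<otimes>\<^bsub>Aut X\<^esub> f = f"
  by (rule Aut_eqI[OF cl[OF one f] f]) (simp only: Aut_apply[OF one f], simp add: Aut_one Aut_in[OF f])
 show "EX g:carrier (Aut X). g \<otimes>\<^bsub>Aut X\<^esub> f = \<one>\<^bsub>Aut X\<^esub>"
  by (rule bexI[OF _ r], rule Aut_eqI[OF cl[OF r f] one]) (simp only: Aut_apply[OF r f], simp add: Aut_one Aut_in[OF f] f')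
 show "f \<otimes>\<^bsub>Aut X\<^esub> g \<otimes>\<^bsub>Aut X\<^esub> k = f \<otimes>\<^bsub>Aut X\<^esub> (g \<otimes>\<^bsub>Aut X\<^esub> k)" if "g : carrier (Aut X)" "k : carrier (Aut X)" for g k
  by (rule Aut_eqI[OF cl[OF cl[OF f that(1)] that(2)] cl[OF f cl[OF that]]]) (simp add: Aut_apply cl f that Aut_in)
qed

subsection \<open>Quotients by finite groups\<close>

locale finite_action = group G for G :: "'g monoid" (structure) +
 fixes X :: "'x fspace" and act :: "'g => 'x => 'x"
 assumes finG: "finite (carrier G)" and fsX: "fspace X" and act: "g : carrier G ==> morphism X X (act g)"
  and act_mult: "g : carrier G ==> k : carrier G ==> x : points X ==> act g (act k x) = act (g \<otimes> k) x"
  and act_one: "x : points X ==> act \<one> x = x"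
begin

abbreviation "\<pi> x == orbit G act x"
abbreviation "Q == orbits G (points X) act"
abbreviation "Y == quotient_fspace X Q"
abbreviation "invt U == ALL g:carrier G. ALL x:U. act g x : U"

lemma act_in: "g : carrier G ==> x : points X ==> act g x : points X"
 by (rule morphism_in[OF act])

lemma orbit_self: "x : points X ==> x : \<pi> x"
 unfolding orbit_def using act_one[of x] one_closed by force

lemma orbit_act:
 assumes g: "g : carrier G" and x: "x : points X"
 shows "\<pi> (act g x) = \<pi> x"
proof (intro equalityI subsetI)
 fix y assume "y : \<pi> (act g x)"
 then obtain k where "k : carrier G" "y = act k (act g x)" by (auto simp: orbit_def)
 thus "y : \<pi> x" using act_mult[OF _ g x] m_closed[OF _ g] by (auto simp: orbit_def)
next
 fix y assume "y : \<pi> x"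
 then obtain k where k: "k : carrier G" "y = act k x" by (auto simp: orbit_def)
 have "y = act (k \<otimes> inv g) (act g x)" using k g x by (simp add: act_mult m_assoc)
 thus "y : \<pi> (act g x)" using k g by (auto simp: orbit_def)
qed

lemma orbit_eq: "y : \<pi> x ==> x : points X ==> \<pi> y = \<pi> x"
proof -
 assume "y : \<pi> x" and x: "x : points X"
 then obtain g where "g : carrier G" "y = act g x" by (auto simp: orbit_def)
 thus ?thesis using orbit_act x by blast
qed

lemma partition: "partition_on (points X) Q"
proof (rule partition_onI)
 show "\<Union>Q = points X" using orbit_self act_in by (auto simp: orbits_def) (auto simp: orbit_def)
 show "{} ~: Q" using orbit_self by (auto simp: orbits_def)
 show "disjnt B C" if "B : Q" "C : Q" "B ~= C" for B C
  using that orbit_eq unfolding orbits_def disjnt_def by blast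
qed

lemmas points_Y = points_quotient[OF partition]
lemmas fsY = fspace_quotient[OF fsX partition]

lemma pi_in: "x : points X ==> \<pi> x : points Y"
 unfolding points_Y by (auto simp: orbits_def)

lemma pointE: "y : points Y ==> (!!x. x : points X ==> y = \<pi> x ==> thesis) ==> thesis"
 unfolding points_Y by (auto simp: orbits_def)

lemma pi_eqD: "\<pi> x = \<pi> y ==> y : points X ==> EX g:carrier G. y = act g x"
 using orbit_self[of y] by (auto simp: orbit_def)

lemma pi_morphism: "morphism X Y (orbit G act)"
 by (rule quotient_projection[OF fsX partition]) (auto simp: orbits_def orbit_self)

lemma universal:
 assumes f: "morphism X Z f" and F: "!!x. x : points X ==> F (\<pi> x) = f x"
 shows "morphism Y Z F"
proof (rule quotient_universal[OF fsX partition f])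
 fix B x assume B: "B : Q" "x : B"
 then obtain y where y: "y : points X" "B = \<pi> y" by (auto simp: orbits_def)
 hence "x : points X" using B act_in by (auto simp: orbit_def)
 thus "F B = f x" using F orbit_eq[of x y] y B by metis
qed

lemma stable_image:
 assumes U: "opn X U" "invt U"
 shows "\<Union>(orbit G act ` U) = U" "opn Y (orbit G act ` U)" "x : points X ==> \<pi> x : orbit G act ` U \<longleftrightarrow> x : U"
proof -
 have UX: "U <= points X" using U(1) by (rule openin_subset)
 show un: "\<Union>(orbit G act ` U) = U" 
 proof (intro equalityI subsetI)
  show "x : \<Union>(orbit G act ` U)" if "x : U" for x using orbit_self[of x] that UX by blast
 qed (use U(2) in "auto simp: orbit_def")
 show "opn Y (orbit G act ` U)" unfolding openin_quotient[OF partition] un using U UX by (auto simp: orbits_def)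
 show "\<pi> x : orbit G act ` U \<longleftrightarrow> x : U" if "x : points X" using un orbit_self[OF that] by blast
qed

lemma act_sum: "g : carrier G ==> x : points X ==> (SUM k:carrier G. e (act k (act g x))) = (SUM k:carrier G. e (act k x))"
 by (rule sum.reindex_bij_witness[where i = "%k. k \<otimes> inv g" and j = "%k. k \<otimes> g"]) (simp_all add: act_mult m_assoc)

text \<open>Sums over orbits are invariant, so they descend to the quotient; multiplication by a
  function that separates an orbit lets them recover individual values.\<close>

lemma average:
 assumes U: "opn X U" "invt U" and e: "e : regular X U"
 shows "EX e':regular Y (orbit G act ` U). ALL x:U. e' (\<pi> x) = (SUM g:carrier G. e (act g x))"
proof -
 let ?s = "%x. SUM g:carrier G. e (act g x)"
 have UX: "U <= points X" using U(1) by (rule openin_subset)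
 define e' where "e' = (%B. ?s (SOME x. x : B))"
 have e': "e' (\<pi> x) = ?s x" if x: "x : points X" for x
 proof -
  have "(SOME y. y : \<pi> x) : \<pi> x" by (rule someI[of _ x]) (rule orbit_self[OF x])
  then obtain g where "g : carrier G" "(SOME y. y : \<pi> x) = act g x" by (auto simp: orbit_def)
  thus ?thesis unfolding e'_def using act_sum[OF _ x] by simp
 qed
 have "?s : regular X U"
 proof (rule fun_alg_sum[OF fs_alg[OF fsX U(1)]])
  fix g assume g: "g : carrier G"
  show "(%x. e (act g x)) : regular X U"
   by (rule fs_restrict[OF fsX morphism_open[OF act[OF g] U(1)] U(1) _ morphism_pull[OF act[OF g] U(1) e]]) (use UX U(2) g in auto)
 qed
 hence "e' : regular Y (orbit G act ` U)" unfolding regular_quotient stable_image(1)[OF U]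
 proof (rule bexI[rotated], safe)
  fix x y assume "x : U" "y : \<pi> x"
  then obtain g where "g : carrier G" "y = act g x" "x : points X" using UX by (auto simp: orbit_def)
  thus "?s y = e' (\<pi> x)" by (simp only: e' act_sum)
 qed
 thus ?thesis using e' UX by blast
qed

text \<open>\<open>ep\<close> is 1 at the chosen lift and 0 at its other translates, so the average
  of \<open>h * ep\<close> on the orbit is the value of \<open>h\<close> at the lift. Thus
  coordinates of the lift are functions of the orbit.\<close>

lemma lift_morphism:
 assumes T: "fspace T" and x: "!!t. t : points T ==> x t : points X" and j: "morphism T Y (%t. \<pi> (x t))"
  and sep: "!!t. t : points T ==> EX U \<O> ep. chart X U \<O> & x t : U & invt U & ep : regular X U &
   (ALL u:points T. x u : U --> ep (x u) = 1 & (ALL g:carrier G. g ~= \<one> --> ep (act g (x u)) = 0))"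
 shows "morphism T X x"
proof (rule morphism_localI[OF T x _ fsX])
 fix W f t assume W: "opn X W" "f : regular X W" "t : points T" "x t : W"
 obtain U \<O> ep where U: "chart X U \<O>" "x t : U" "invt U" "ep : regular X U"
   "ALL u:points T. x u : U --> ep (x u) = 1 & (ALL g:carrier G. g ~= \<one> --> ep (act g (x u)) = 0)"
  using sep[OF W(3)] by (elim exE conjE)
 have oU: "opn X U" and OU: "\<O> <= regular X U" using U(1) by (auto simp: chart_def)
 obtain a b where ab: "a : \<O>" "b : \<O>" "b (x t) ~= 0" "ALL y:U. b y ~= 0 --> y : W & f y = a y / b y"
  using chartD[OF U(1,2) W(1,4,2)] by blast
 define T0 where "T0 = {u : points T. x u : U}"
 have T0: "T0 = {u : points T. \<pi> (x u) : orbit G act ` U}" unfolding T0_def using stable_image(3)[OF oU U(3)] x by blast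
 have oT: "opn T T0" unfolding T0 by (rule morphism_open[OF j stable_image(2)[OF oU U(3)]])
 have reg: "(%u. h (x u)) : regular T T0" if h: "h : \<O>" for h
 proof -
  have "(%y. h y * ep y) : regular X U" using fs_mult[OF fsX oU _ U(4)] OU h by blast
  then obtain e where e: "e : regular Y (orbit G act ` U)" "ALL x:U. e (\<pi> x) = (SUM g:carrier G. h (act g x) * ep (act g x))"
   using average[OF oU U(3)] by blast
  show ?thesis
  proof (rule fs_cong[OF T oT morphism_pull[OF j stable_image(2)[OF oU U(3)] e(1), folded T0]])
   fix u assume u: "u : T0"
   have "e (\<pi> (x u)) = (SUM g:carrier G. if g = \<one> then h (x u) else 0)"
    using u U(5) x e(2) unfolding T0_def by (auto intro!: sum.cong simp: act_one)
   thus "h (x u) = e (\<pi> (x u))" using finG by simp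
  qed
 qed
 let ?U = "{u : T0. b (x u) ~= 0}"
 have oU': "opn T ?U" by (rule fs_open[OF T oT reg[OF ab(2)]])
 have "(%u. a (x u) / b (x u)) : regular T ?U"
  by (rule fs_divide[OF T oU']) (auto intro!: fs_restrict[OF T oT oU'] reg ab)
 hence "(%u. f (x u)) : regular T ?U"
  by (rule fs_cong[OF T oU']) (use ab(4) in "auto simp: T0_def")
 moreover have "x ` ?U <= W" "t : ?U" using ab(3,4) W(3) U(2) by (auto simp: T0_def)
 ultimately show "EX U. opn T U & t : U & x ` U <= W & (%u. f (x u)) : regular T U"
  using oU' by blast
qed

lemma average_tens:
 assumes U: "opn X U" "invt U" and ep: "ep : regular X U" and e: "e : tens R (regular X U)"
  and R: "fun_alg R"
 shows "EX e':tens R (regular Y (orbit G act ` U)). ALL z. ALL x:U. e' (z, \<pi> x) = (SUM g:carrier G. e (z, act g x) * ep (act g x))"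
proof -
 obtain m a b where ab: "ALL k<(m::nat). a k : R & b k : regular X U" "e = (%(x, y). SUM k<m. a k x * b k y)"
  using tens_sum_repr[OF e] by blast
 have "ALL k:{..<m}. EX e'. e' : regular Y (orbit G act ` U) & (ALL x:U. e' (\<pi> x) = (SUM g:carrier G. b k (act g x) * ep (act g x)))"
  using average[OF U fs_mult[OF fsX U(1) _ ep]] ab(1) by blast
 then obtain b' where b': "ALL k:{..<m}. b' k : regular Y (orbit G act ` U) & (ALL x:U. b' k (\<pi> x) = (SUM g:carrier G. b k (act g x) * ep (act g x)))"
  unfolding bchoice_iff by (elim exE)
 have "(%(x, y). SUM k<m. a k x * b' k y) : tens R (regular Y (orbit G act ` U))"
  by (rule tens_sum[OF R fs_alg[OF fsY stable_image(2)[OF U]]]) (use ab(1) b' in simp)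
 thus ?thesis
 proof (rule bexI[rotated], intro allI ballI)
  fix z x assume x: "x : U"
  have "(SUM k<m. a k z * b' k (\<pi> x)) = (SUM k<m. SUM g:carrier G. a k z * (b k (act g x) * ep (act g x)))"
   using b' x by (simp add: sum_distrib_left)
  also have "... = (SUM g:carrier G. SUM k<m. a k z * (b k (act g x) * ep (act g x)))" by (rule sum.swap)
  finally show "(case (z, \<pi> x) of (x, y) => SUM k<m. a k x * b' k y) = (SUM g:carrier G. e (z, act g x) * ep (act g x))"
   unfolding ab(2) by (simp add: sum_distrib_right mult.assoc)
 qed
qed

text \<open>If \<open>a / b\<close> is an invariant function, averaging \<open>a b ep\<close> and \<open>b\<^sup>2 ep\<close> makes numerator and denominator
  invariant as well; \<open>ep\<close> keeps the average of \<open>b\<^sup>2 ep\<close> from vanishing.\<close>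

lemma prod_universal:
 assumes Z: "fspace Z" "!!z. z : points Z ==> EX U \<O>. chart Z U \<O> & z : U" and W: "fspace W"
  and f: "morphism (Z \<times>\<^sub>v X) W f" and F: "!!z x. z : points Z ==> x : points X ==> F (z, \<pi> x) = f (z, x)"
  and sep: "!!x. x : points X ==> EX U \<O> ep. chart X U \<O> & x : U & invt U & ep : regular X U &
   ep x = 1 & (ALL g:carrier G. g ~= \<one> --> ep (act g x) = 0)"
 shows "morphism (Z \<times>\<^sub>v Y) W F"
proof (rule morphism_localI[OF fspace_prod[OF Z(1) fsY] _ _ W])
 note pZX = points_prod[OF Z(1) fsX] and pZY = points_prod[OF Z(1) fsY]
 show "F q : points W" if "q : points (Z \<times>\<^sub>v Y)" for q
  using that morphism_in[OF f] F unfolding pZX pZY by (auto elim!: pointE)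
 fix S h q assume S: "opn W S" "h : regular W S" "q : points (Z \<times>\<^sub>v Y)" "F q : S"
 obtain z y where q: "q = (z, y)" "z : points Z" "y : points Y" using S(3) unfolding pZY by auto
 obtain x where x: "x : points X" "y = \<pi> x" using q(3) by (rule pointE)
 obtain U \<O> ep where U: "chart X U \<O>" "x : U" "invt U" "ep : regular X U"
   "ep x = 1" "ALL g:carrier G. g ~= \<one> --> ep (act g x) = 0"
  using sep[OF x(1)] by (elim exE conjE)
 obtain D \<P> where D: "chart Z D \<P>" "z : D" using Z(2)[OF q(2)] by blast
 have oU: "opn X U" and OU: "\<O> <= regular X U" using U(1) by (auto simp: chart_def)
 have oD: "opn Z D" and OD: "\<P> <= regular Z D" using D(1) by (auto simp: chart_def)
 have UX: "U <= points X" "D <= points Z" using oU oD by (auto dest: openin_subset)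
 define N where "N = {w : points (Z \<times>\<^sub>v X). f w : S}"
 have N: "opn (Z \<times>\<^sub>v X) N" "(z, x) : N" "(%w. h (f w)) : regular (Z \<times>\<^sub>v X) N"
  unfolding N_def using morphism_open[OF f S(1)] morphism_pull[OF f S(1,2)] pZX q x F S(4) by auto
 have inv: "f (w, act g v) = f (w, v)" if "w : D" "v : U" "g : carrier G" for w v g
  using F[of w v] F[of w "act g v"] that UX U(3) orbit_act[of g v] by (metis subsetD)
 have "EX a:tens \<P> \<O>. EX b:tens \<P> \<O>. b (z, x) ~= 0 & (ALL w:D \<times> U. b w ~= 0 --> w : N & h (f w) = a w / b w)"
  by (rule chartD[OF chart_prod[OF Z(1) fsX D(1) U(1)] _ N]) (use D U in simp)
 then obtain a b where ab: "a : tens \<P> \<O>" "b : tens \<P> \<O>" "b (z, x) ~= 0"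
  "!!w. w : D \<times> U ==> b w ~= 0 ==> w : N & h (f w) = a w / b w" by blast
 let ?R = "regular Z D" and ?V = "orbit G act ` U"
 note RD = fs_alg[OF Z(1) oD] and RU = fs_alg[OF fsX oU] and oV = stable_image(2)[OF oU U(3)]
 have ab': "a : tens ?R (regular X U)" "b : tens ?R (regular X U)" using ab(1,2) tens_mono[OF OD OU] by auto
 note al = fun_alg_mult[OF fun_alg_tens[OF RD RU]]
 obtain \<alpha> where \<alpha>: "\<alpha> : tens ?R (regular Y ?V)" "ALL w. ALL v:U. \<alpha> (w, \<pi> v) = (SUM g:carrier G. a (w, act g v) * b (w, act g v) * ep (act g v))"
  using average_tens[OF oU U(3,4) al[OF ab'] RD] by blast
 obtain \<beta> where \<beta>: "\<beta> : tens ?R (regular Y ?V)" "ALL w. ALL v:U. \<beta> (w, \<pi> v) = (SUM g:carrier G. b (w, act g v) * b (w, act g v) * ep (act g v))"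
  using average_tens[OF oU U(3,4) al[OF ab'(2,2)] RD] by blast
 note rg = regular_tens[OF Z(1) fsY oD oV] and oDV = openin_times[OF Z(1) fsY oD oV] and fZY = fspace_prod[OF Z(1) fsY]
 let ?M = "{w : D \<times> ?V. \<beta> w ~= 0}"
 have oM: "opn (Z \<times>\<^sub>v Y) ?M" by (rule fs_open[OF fZY oDV rg[OF \<beta>(1)]])
 have key: "F w : S & h (F w) = \<alpha> w / \<beta> w" if "w : ?M" for w
 proof -
  obtain d v where w: "w = (d, \<pi> v)" "d : D" "v : U" "\<beta> (d, \<pi> v) ~= 0" using \<open>w : ?M\<close> by auto
  have fF: "F (d, \<pi> v) = f (d, v)" using F w UX by blast
  have "EX g:carrier G. b (d, act g v) ~= 0"
   using w(3,4) \<beta>(2) by (metis (no_types, lifting) mult_zero_left sum.neutral)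
  then obtain g where g: "g : carrier G" "b (d, act g v) ~= 0" by blast
  have "f (d, v) : S" using ab(4)[of "(d, act g v)"] g w U(3) inv unfolding N_def by auto
  moreover have "\<alpha> (d, \<pi> v) = h (f (d, v)) * \<beta> (d, \<pi> v)"
  proof -
   have "a (d, act g v) * b (d, act g v) * ep (act g v) = h (f (d, v)) * (b (d, act g v) * b (d, act g v) * ep (act g v))"
    if g: "g : carrier G" for g
    using ab(4)[of "(d, act g v)"] w U(3) inv[OF w(2,3) g] g by (cases "b (d, act g v) = 0") auto
   thus ?thesis unfolding \<alpha>(2)[rule_format, OF w(3)] \<beta>(2)[rule_format, OF w(3)] sum_distrib_left by (rule sum.cong[OF refl])
  qed
  ultimately show ?thesis using w(1,4) fF by simp
 qed
 have "(%w. \<alpha> w / \<beta> w) : regular (Z \<times>\<^sub>v Y) ?M"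
  by (rule fs_divide[OF fZY oM]) (auto intro!: fs_restrict[OF fZY oDV oM] rg \<alpha> \<beta>)
 hence "(%w. h (F w)) : regular (Z \<times>\<^sub>v Y) ?M"
  by (rule fs_cong[OF fZY oM]) (use key in blast)
 moreover have "q : ?M"
 proof -
  have "\<beta> (z, \<pi> x) = (SUM g:carrier G. if g = \<one> then b (z, x) * b (z, x) else 0)"
   using \<beta>(2) U(2,5,6) act_one[OF x(1)] by (auto intro!: sum.cong)
  thus ?thesis using q x D U(2) ab(3) finG by simp
 qed
 ultimately show "EX U. opn (Z \<times>\<^sub>v Y) U & q : U & F ` U <= S & (%w. h (F w)) : regular (Z \<times>\<^sub>v Y) U"
  using oM key by blast
qed

end

lemma Aut_inverse: "f : carrier (Aut X) ==> EX g. morphism X X f & morphism X X g & (ALL x:points X. g (f x) = x) & (ALL x:points X. f (g x) = x)"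
 by (erule AutE) blast

section \<open>The quotient of the product of the surface and the abelian variety\<close>

locale twist = surface F p + abvar A for F p and A :: "'a group_variety" (structure) +
 fixes ka :: "((nat => complex) set => (nat => complex) set) => int" and P :: 'a
 assumes prime: "prime p" and p3: "3 <= p" and chi: "ka : iso (Aut SS) (integer_mod_group p)"
  and free: "!!g s. g : carrier (Aut SS) ==> g ~= \<one>\<^bsub>Aut SS\<^esub> ==> s : S ==> g s ~= s"
  and P: "P : carrier A" "P [^] p = \<one>" "P ~= \<one>"
  and rigid: "!!f g x. morphism V V f ==> morphism V V g ==> f : hom A A ==> (!!x. x : carrier A ==> g (f x) = x) ==>
   (!!x. x : carrier A ==> f (g x) = x) ==> f P = P ==> x : carrier A ==> f x = x"
begin

abbreviation "GG == Aut SS"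
abbreviation "X == SS \<times>\<^sub>v V"
abbreviation (input) "act == %g (s, a). (g s, a \<otimes> P [^] ka g)"

lemma groupG: "group GG" by (rule group_Aut[OF fsS])

lemma chi_range: "g : carrier GG ==> ka g : {0..<int p}"
 using chi p by (auto simp: iso_def hom_def carrier_integer_mod_group)

lemma P_mod: "P [^] (k mod int p) = P [^] k"
proof -
 have "P [^] (int p * (k div int p) + k mod int p) = P [^] (k mod int p)"
  unfolding int_pow_mult[OF P(1)] int_pow_pow[OF P(1), symmetric] int_pow_int P(2) using P(1) by simp
 thus ?thesis by (simp only: mult_div_mod_eq)
qed

lemma P_mult: "g : carrier GG ==> k : carrier GG ==> P [^] ka (g \<otimes>\<^bsub>GG\<^esub> k) = P [^] ka g \<otimes> P [^] ka k"
 using chi P by (simp add: iso_def hom_def P_mod int_pow_mult)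

lemma chi_one: "ka \<one>\<^bsub>GG\<^esub> = 0"
 using hom_one[of ka GG "integer_mod_group p"] chi groupG by (simp add: iso_def)

lemma P_trivial:
 assumes g: "g : carrier GG" and 1: "P [^] ka g = \<one>"
 shows "g = \<one>\<^bsub>GG\<^esub>"
proof -
 have "ka g = 0"
 proof (rule ccontr)
  assume "ka g ~= 0"
  then obtain d where d: "ka g = int d" "0 < d" "d < p" using chi_range[OF g] by (cases "ka g") auto
  hence "coprime d p" using prime by (metis coprime_commute nat_dvd_not_less prime_imp_coprime)
  hence "P : {\<one>}" using nat_pow_gcd_closed[OF triv_subgroup P(1), of d p] P(2) 1 d by (simp add: int_pow_int)
  thus False using P(3) by simp
 qed
 thus ?thesis using chi g group.is_monoid[OF groupG] chi_one unfolding iso_def bij_betw_def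
  by (auto dest: inj_onD[of _ _ g "\<one>\<^bsub>GG\<^esub>"])
qed

lemma P_generator: "EX g:carrier GG. P [^] ka g = P"
proof -
 have "1 : carrier (integer_mod_group p)" using p3 by simp
 hence "1 : ka ` carrier GG" using chi unfolding iso_def bij_betw_def by blast
 then obtain g where "g : carrier GG" "ka g = 1" by auto
 thus ?thesis using P by force
qed

lemma points_X: "points X = S \<times> carrier A"
 using points_prod[OF fsS fsV] SS(2) carrier_points by simp

lemma G_in: "g : carrier GG ==> s : S ==> g s : S"
 using Aut_in[of g SS s] SS(2) by simp

lemma action: "finite_action GG X act"
proof -
 have f: "finite (carrier GG)"
 proof (rule finite_imageD[of ka])
  show "finite (ka ` carrier GG)" by (rule finite_subset[OF image_subsetI[OF chi_range]]) simp_all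
  show "inj_on ka (carrier GG)" using chi by (simp add: iso_def bij_betw_def)
 qed
 have fsX: "fspace X" by (rule fspace_prod[OF fsS fsV])
 have m: "morphism X X (act g)" if g: "g : carrier GG" for g
 proof -
  have "morphism SS SS g" using g by (rule AutE)
  note m = morphism_comp[OF morphism_fst[OF fsS fsV] this]
  show ?thesis unfolding case_prod_unfold
   by (rule morphism_pair[OF fsX fsS fsV m mult_morphism[OF fsX morphism_snd[OF fsS fsV] const_morphism[OF fsX]]]) (use P in simp)
 qed
 have mu: "act g (act k x) = act (g \<otimes>\<^bsub>GG\<^esub> k) x" if gk: "g : carrier GG" "k : carrier GG" and x: "x : points X" for g k x
 proof -
  obtain s a where x: "x = (s, a)" "s : S" "a : carrier A" using x by (auto simp: points_X)
  have "P [^] ka g : carrier A" "P [^] ka k : carrier A" using P by auto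
  thus ?thesis using SS(2) x m_comm[of "P [^] ka g"] by (simp add: P_mult[OF gk] Aut_apply[OF gk] m_assoc)
 qed
 have o: "act \<one>\<^bsub>GG\<^esub> x = x" if x: "x : points X" for x
 proof -
  obtain s a where x: "x = (s, a)" "s : points SS" "a : carrier A" using x SS(2) by (auto simp: points_X)
  thus ?thesis by (simp only: prod.case chi_one) (simp add: Aut_one)
 qed
 show ?thesis
  by (rule finite_action.intro[OF groupG], rule finite_action_axioms.intro, rule f, rule fsX, rule m, assumption, rule mu, assumption+, rule o)
qed

sublocale Q: finite_action GG X act by (rule action)

lemma S_nonempty: "S ~= {}"
proof
 assume "S = {}"
 hence "g = \<one>\<^bsub>GG\<^esub>" if "g : carrier GG" for g
  using Aut_eqI[OF that monoid.one_closed[OF group.is_monoid[OF groupG]]] SS(2) by simp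
 thus False using P_generator chi_one P by fastforce
qed

definition pt where "pt s a = Q.\<pi> (s, a)"

lemma pi_act: "g : carrier GG ==> s : S ==> a : carrier A ==> pt (g s) (a \<otimes> P [^] ka g) = pt s a"
 using Q.orbit_act[of g "(s, a)"] by (simp add: points_X pt_def)

lemma pi_eqE:
 assumes "pt s a = pt r b" "r : S" "b : carrier A"
 obtains g where "g : carrier GG" "r = g s" "b = a \<otimes> P [^] ka g"
 using Q.pi_eqD[OF assms(1)[unfolded pt_def]] assms(2,3) by (auto simp: points_X)

text \<open>Free action on the surface: once the point of \<open>S\<close> is fixed, an orbit
  determines the point of \<open>A\<close>. \<open>pi_fst\<close> is the counterpart, resting on
  \<open>P\<close> having order \<open>p\<close>.\<close>

lemma pi_snd:
 assumes "pt s a = pt s b" "s : S" "a : carrier A" "b : carrier A"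
 shows "a = b"
proof -
 obtain g where g: "g : carrier GG" "s = g s" "b = a \<otimes> P [^] ka g" using pi_eqE[OF assms(1,2,4)] .
 hence "g = \<one>\<^bsub>GG\<^esub>" using free[OF g(1) _ assms(2)] by metis
 thus ?thesis using g assms by (simp add: chi_one)
qed

lemma pi_fst:
 assumes "pt s a = pt r a" "s : S" "r : S" "a : carrier A"
 shows "s = r"
proof -
 obtain g where g: "g : carrier GG" "r = g s" "a = a \<otimes> P [^] ka g" using pi_eqE[OF assms(1,3,4)] .
 hence "P [^] ka g = \<one>" using l_cancel_one'[OF assms(4) int_pow_closed[OF P(1)]] by blast
 hence "g = \<one>\<^bsub>GG\<^esub>" by (rule P_trivial[OF g(1)])
 thus ?thesis using g assms SS(2) by (simp add: Aut_one)
qed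

lemma Y_pointE: "y : points Q.Y ==> (!!s a. s : S ==> a : carrier A ==> y = pt s a ==> thesis) ==> thesis"
 by (elim Q.pointE) (auto simp: points_X pt_def)

lemma pt_in: "s : S ==> a : carrier A ==> pt s a : points Q.Y"
 unfolding pt_def by (rule Q.pi_in) (simp add: points_X)

text \<open>Two separating functions on one stable chart: \<open>ep\<close> depends on the surface
  coordinate only and serves lifts with fixed \<open>s\<close>, \<open>\<delta>\<close> depends on
  the other coordinate and serves lifts with fixed \<open>a\<close>.\<close>

lemma good_chart:
 assumes s: "s : S" and a: "a : carrier A"
 shows "EX U \<O> ep \<delta>. chart X U \<O> & (s, a) : U & Q.invt U & ep : regular X U & \<delta> : regular X U &
  (ALL b. ep (s, b) = 1 & (ALL g:carrier GG. g ~= \<one>\<^bsub>GG\<^esub> --> ep (act g (s, b)) = 0)) &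
  (ALL r. \<delta> (r, a) = 1 & (ALL g:carrier GG. g ~= \<one>\<^bsub>GG\<^esub> --> \<delta> (act g (r, a)) = 0))"
proof -
 let ?E = "(%g. g s) ` carrier GG" and ?E' = "(%g. a \<otimes> P [^] ka g) ` carrier GG"
 have one: "\<one>\<^bsub>GG\<^esub> : carrier GG" by (rule Q.one_closed)
 have "s : ?E" by (rule image_eqI[OF _ one]) (use s SS(2) in "simp add: Aut_one")
 moreover have "?E <= points SS" using G_in[OF _ s] SS(2) by auto
 ultimately obtain L ep where L: "form 3 1 L" "?E <= Dset SS rep L" "ep : chart_alg 3 SS rep L" "ep s = 1" "ALL x:?E - {s}. ep x = 0"
  using separating_function[OF SS(1) finite_imageI[OF Q.finG]] by metis
 obtain n rh where c: "proj_coords n V rh" using coords by blast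
 have "a : ?E'" by (rule image_eqI[OF _ one]) (use a in "simp add: chi_one")
 moreover have "?E' <= points V" using a P carrier_points by auto
 ultimately obtain M \<delta> where M: "form n 1 M" "?E' <= Dset V rh M" "\<delta> : chart_alg n V rh M" "\<delta> a = 1" "ALL x:?E' - {a}. \<delta> x = 0"
  using separating_function[OF c finite_imageI[OF Q.finG]] by metis
 let ?D = "Dset SS rep L" and ?D' = "Dset V rh M"
 note ch = chart_proj[OF SS(1) L(1)] chart_proj[OF c M(1)]
 note chX = chart_prod[OF fsS fsV ch]
 have oD: "opn X (?D \<times> ?D')" "opn SS ?D" "opn V ?D'"
  and e: "ep : regular SS ?D" "\<delta> : regular V ?D'"
  using chX ch L(3) M(3) by (auto simp: chart_def)
 \<comment> \<open>The intersection of all translates, which is the stable part of the product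
   chart.\<close>
 define U where "U = (\<Inter>g\<in>carrier GG. {x : points X. act g x : ?D \<times> ?D'})"
 have oU: "opn X U" unfolding U_def
  by (intro openin_Inter) (use Q.finG one morphism_open[OF Q.act oD(1)] in auto)
 have UD: "U <= ?D \<times> ?D'" 
 proof
  fix x assume "x : U"
  hence "x : points X" "act \<one>\<^bsub>GG\<^esub> x : ?D \<times> ?D'" using one unfolding U_def by blast+
  thus "x : ?D \<times> ?D'" using Q.act_one[of x] by simp
 qed
 have "(s, a) : U" unfolding U_def using s a L(2) M(2) by (auto simp: points_X)
 moreover have "Q.invt U"
 proof (intro ballI)
  fix g x assume g: "g : carrier GG" and x: "x : U"
  hence xX: "x : points X" using one unfolding U_def by blast
  show "act g x : U" unfolding U_def
  proof (intro INT_I CollectI conjI)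
   show "act g x : points X" by (rule Q.act_in[OF g xX])
   fix k assume k: "k : carrier GG"
   show "act k (act g x) : ?D \<times> ?D'" unfolding Q.act_mult[OF k g xX]
    using x Q.m_closed[OF k g] unfolding U_def by blast
  qed
 qed
 moreover have "chart X U (tens (chart_alg 3 SS rep L) (chart_alg n V rh M))"
  by (rule chart_open_subset[OF Q.fsX chX oU UD])
 moreover have "(%z. ep (fst z)) : regular X U"
  by (rule fs_restrict[OF Q.fsX _ oU _ morphism_pull[OF morphism_fst[OF fsS fsV] oD(2) e(1)]])
   (use UD oU morphism_open[OF morphism_fst[OF fsS fsV] oD(2)] in "auto dest: openin_subset")
 moreover have "(%z. \<delta> (snd z)) : regular X U"
  by (rule fs_restrict[OF Q.fsX _ oU _ morphism_pull[OF morphism_snd[OF fsS fsV] oD(3) e(2)]])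
   (use UD oU morphism_open[OF morphism_snd[OF fsS fsV] oD(3)] in "auto dest: openin_subset")
 moreover have "ep (g s) = 0" if "g : carrier GG" "g ~= \<one>\<^bsub>GG\<^esub>" for g using L(5) free[OF that s] that by blast
 moreover have "\<delta> (a \<otimes> P [^] ka g) = 0" if g: "g : carrier GG" "g ~= \<one>\<^bsub>GG\<^esub>" for g
 proof -
  have "a \<otimes> P [^] ka g ~= a" using P_trivial[OF g(1)] g(2) l_cancel_one[OF a int_pow_closed[OF P(1)]] by blast
  thus ?thesis using M(5) g(1) by blast
 qed
 ultimately show ?thesis using L(4) M(4)
  by (intro exI[of _ U] exI[of _ "tens (chart_alg 3 SS rep L) (chart_alg n V rh M)"] exI[of _ "%z. ep (fst z)"] exI[of _ "%z. \<delta> (snd z)"]) auto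
qed

lemma lift_snd:
 assumes T: "fspace T" and s: "s : S" and b: "!!t. t : points T ==> b t : carrier A" and j: "morphism T Q.Y (%t. pt s (b t))"
 shows "morphism T V b"
proof -
 have "morphism T X (%t. (s, b t))"
 proof (rule Q.lift_morphism[OF T _ j[unfolded pt_def]])
  fix t assume t: "t : points T"
  show "(s, b t) : points X" using s b[OF t] by (simp add: points_X)
  show "EX U \<O> ep. chart X U \<O> & (s, b t) : U & Q.invt U & ep : regular X U &
   (ALL u:points T. (s, b u) : U --> ep (s, b u) = 1 & (ALL g:carrier GG. g ~= \<one>\<^bsub>GG\<^esub> --> ep (act g (s, b u)) = 0))"
   using good_chart[OF s b[OF t]] by (elim exE conjE) (rule exI, rule exI, rule exI, intro conjI, assumption+, blast)
 qed
 thus ?thesis using morphism_comp[OF _ morphism_snd[OF fsS fsV]] by fastforce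
qed

lemma lift_fst:
 assumes T: "fspace T" and a: "a : carrier A" and r: "!!t. t : points T ==> r t : S" and j: "morphism T Q.Y (%t. pt (r t) a)"
 shows "morphism T SS r"
proof -
 have "morphism T X (%t. (r t, a))"
 proof (rule Q.lift_morphism[OF T _ j[unfolded pt_def]])
  fix t assume t: "t : points T"
  show "(r t, a) : points X" using a r[OF t] by (simp add: points_X)
  show "EX U \<O> ep. chart X U \<O> & (r t, a) : U & Q.invt U & ep : regular X U &
   (ALL u:points T. (r u, a) : U --> ep (r u, a) = 1 & (ALL g:carrier GG. g ~= \<one>\<^bsub>GG\<^esub> --> ep (act g (r u, a)) = 0))"
   using good_chart[OF r[OF t] a] by (elim exE conjE) (rule exI, rule exI, rule exI, intro conjI, assumption+, blast)
 qed
 thus ?thesis using morphism_comp[OF _ morphism_fst[OF fsS fsV]] by fastforce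
qed

lemma slice_morphism: "a : carrier A ==> morphism SS Q.Y (%s. pt s a)"
 "s : S ==> morphism V Q.Y (%a. pt s a)"
 using morphism_comp[OF morphism_pair[OF fsS fsS fsV morphism_id[OF fsS] const_morphism[OF fsS]] Q.pi_morphism]
  morphism_comp[OF morphism_pair[OF fsV fsS fsV morphism_const[OF fsV] morphism_id[OF fsV]] Q.pi_morphism] SS(2) unfolding pt_def by auto

lemma pow_p: "x : carrier A ==> (x \<otimes> P [^] (k::int)) [^] p = x [^] p"
proof -
 assume x: "x : carrier A"
 have "(P [^] k) [^] int p = (P [^] int p) [^] k" using P by (simp add: int_pow_pow mult.commute)
 thus ?thesis using x P by (simp add: pow_mult_distrib[OF m_comm] int_pow_int)
qed

text \<open>Multiples of \<open>P\<close> die under the \<open>p\<close>-th power, so it does not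
  depend on the representative of the orbit.\<close>

lemma power_map: "EX q. morphism Q.Y V q & (ALL s:S. ALL x:carrier A. q (pt s x) = x [^] p)"
proof -
 define q where "q y = snd (SOME z. z : y) [^] p" for y :: "((nat => complex) set \<times> 'a) set"
 have q: "q (Q.\<pi> z) = snd z [^] p" if z: "z : points X" for z
 proof -
  have "(SOME w. w : Q.\<pi> z) : Q.\<pi> z" by (rule someI) (rule Q.orbit_self[OF z])
  then obtain g where "(SOME w. w : Q.\<pi> z) = act g z" by (auto simp: orbit_def)
  thus ?thesis unfolding q_def using z by (auto simp: points_X pow_p split: prod.split)
 qed
 have "morphism Q.Y V q"
  by (rule Q.universal[OF pow_morphism[OF Q.fsX morphism_snd[OF fsS fsV]] q])
 thus ?thesis using q by (auto simp: points_X pt_def)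
qed

text \<open>The image of a sheet has constant \<open>p\<close>-th power, so its points lie on sheets
  differing by torsion. The sets of \<open>s\<close> landing on a given sheet are open, and two of
  them coincide or are disjoint; connectedness leaves one.\<close>

lemma fibre_preserved:
 assumes f: "morphism Q.Y Q.Y f" and a: "a : carrier A"
 shows "EX b:carrier A. ALL s:S. EX r:S. f (pt s a) = pt r b"
proof -
 obtain q where q: "morphism Q.Y V q" "!!s x. s : S ==> x : carrier A ==> q (pt s x) = x [^] p"
  using power_map by blast
 define j where "j s = f (pt s a)" for s
 have j: "morphism SS Q.Y j" unfolding j_def by (rule morphism_comp[OF slice_morphism(1)[OF a] f])
 have jr: "EX r:S. EX c:carrier A. j s = pt r c" if "s : S" for s
 proof -
  have "j s : points Q.Y" using morphism_in[OF j] SS(2) that by simp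
  thus ?thesis by (rule Y_pointE) blast
 qed
 have const: "q (j s) = q (j r)" if "s : S" "r : S" for s r
  by (rule morphism_to_abelian[OF av p3 morphism_comp[OF j q(1)] that])
 define E where "E c = {s : S. EX r:S. j s = pt r c}" for c
 obtain U where U: "opn V U" "\<one> : U" "ALL x:U. x [^] p = \<one> --> x = \<one>"
  using torsion_isolated[OF p] by blast
 have oE: "opn SS (E c)" if c: "c : carrier A" "t : E c" for c t
 proof -
  let ?m = "%g z. snd (act g z) \<otimes> inv c"
  \<comment> \<open>Points having a translate close to \<open>c\<close> in \<open>A\<close>. With
    the \<open>p\<close>-th power fixed, close to \<open>c\<close> means equal to
    \<open>c\<close>.\<close>
  define D where "D = (\<Union>g\<in>carrier GG. {z : points X. ?m g z : U})"
  have "morphism X V (?m g)" if "g : carrier GG" for g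
   by (rule mult_morphism[OF Q.fsX morphism_comp[OF Q.act[OF that] morphism_snd[OF fsS fsV]] const_morphism[OF Q.fsX]]) (use c in simp)
  hence D: "opn X D" unfolding D_def using morphism_open[OF _ U(1)] by blast
  have "Q.invt D"
  proof (intro ballI)
   fix g z assume g: "g : carrier GG" and "z : D"
   then obtain k where k: "k : carrier GG" "z : points X" "?m k z : U" unfolding D_def by blast
   have kg: "k \<otimes>\<^bsub>GG\<^esub> inv\<^bsub>GG\<^esub> g : carrier GG" using g k by simp
   have "act (k \<otimes>\<^bsub>GG\<^esub> inv\<^bsub>GG\<^esub> g) (act g z) = act k z"
    unfolding Q.act_mult[OF kg g k(2)] using g k by (simp add: Q.m_assoc)
   hence "?m (k \<otimes>\<^bsub>GG\<^esub> inv\<^bsub>GG\<^esub> g) (act g z) : U" using k(3) by simp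
   thus "act g z : D" unfolding D_def using kg Q.act_in[OF g k(2)] by blast
  qed
  note st = Q.stable_image[OF D this]
  have "E c = {s : points SS. j s : orbit GG act ` D}"
  proof (intro equalityI subsetI)
   fix s assume "s : E c"
   then obtain r where r: "s : S" "r : S" "j s = pt r c" by (auto simp: E_def)
   have "(r, c) : D" unfolding D_def
    by (rule UN_I[OF Q.one_closed]) (use r c U(2) in "simp add: points_X chi_one")
   thus "s : {s : points SS. j s : orbit GG act ` D}" using r SS(2) by (auto simp: pt_def)
  next
   fix s assume "s : {s : points SS. j s : orbit GG act ` D}"
   then obtain z where z: "s : S" "z : D" "j s = Q.\<pi> z" using SS(2) by auto
   obtain g where g: "g : carrier GG" "z : points X" "?m g z : U" using z(2) unfolding D_def by blast
   obtain r x where zx: "z = (r, x)" "r : S" "x : carrier A" using g(2) by (auto simp: points_X)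
   let ?x = "x \<otimes> P [^] ka g"
   have cl: "?x : carrier A" "x [^] p : carrier A" using zx P by auto
   have jx: "j s = pt r x" using z(3) zx(1) by (simp add: pt_def)
   have "q (j s) = c [^] p" using c(2) const[OF z(1), of t] q(2)[OF _ c(1)] by (auto simp: E_def)
   hence "x [^] p = c [^] p" using jx zx q(2) by simp
   hence "(?x \<otimes> inv c) [^] p = \<one>"
    using pow_p[OF zx(3)] c(1) cl by (simp add: pow_mult_distrib[OF m_comm] nat_pow_inv)
   hence "?x \<otimes> inv c = \<one>" using U(3) g(3) zx by simp
   hence "?x = c" using cl c(1) inv_solve_right[of \<one> ?x c] by simp
   hence "j s = pt (g r) c" using jx pi_act[OF g(1) zx(2,3)] by simp
   thus "s : E c" unfolding E_def using z(1) G_in[OF g(1) zx(2)] by blast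
  qed
  thus ?thesis using morphism_open[OF j st(2)] by simp
 qed
 obtain s0 where s0: "s0 : S" using S_nonempty by blast
 obtain r b where b: "b : carrier A" "s0 : E b" using jr[OF s0] s0 by (auto simp: E_def)
 have "E b = points SS"
 proof (rule connected_clopen[OF connected oE[OF b]])
  show "cls SS (E b)" unfolding closedin_def
  proof
   show "E b <= points SS" by (auto simp: E_def SS(2))
   show "opn SS (points SS - E b)" unfolding openin_subopen[of _ "points SS - E b"]
   proof
    fix s assume s: "s : points SS - E b"
    then obtain r c where c: "c : carrier A" "s : E c" using jr[of s] SS(2) by (auto simp: E_def)
    have "E c Int E b = {}"
    proof (rule ccontr)
     assume "E c Int E b ~= {}"
     then obtain t r r' where t: "r : S" "r' : S" "pt r c = pt r' b" by (auto simp: E_def)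
     obtain g where g: "g : carrier GG" "b = c \<otimes> P [^] ka g" using pi_eqE[OF t(3,2) b(1)] .
     obtain u where u: "s : S" "u : S" "j s = pt u c" using c(2) by (auto simp: E_def)
     have "j s = pt (g u) b" using pi_act[OF g(1) u(2) c(1), folded g(2)] u(3) by simp
     hence "s : E b" using u(1) G_in[OF g(1) u(2)] unfolding E_def by blast
     thus False using s by blast
    qed
    hence "opn SS (E c) & s : E c & E c <= points SS - E b" using oE[OF c] c(2) openin_subset by blast
    thus "EX T. opn SS T & s : T & T <= points SS - E b" by blast
   qed
  qed
  show "E b ~= {}" using b by blast
 qed
 thus ?thesis using b(1) SS(2) unfolding E_def j_def by blast
qed

text \<open>Between two sheets, both copies of \<open>S\<close>, the map is an automorphism of
  \<open>S\<close>, hence an element of the group; moving along the orbit trades it for a shift by a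
  multiple of \<open>P\<close>.\<close>

lemma sheet_preserved:
 assumes f: "morphism Q.Y Q.Y f" "morphism Q.Y Q.Y f'" and inv: "!!y. y : points Q.Y ==> f' (f y) = y" "!!y. y : points Q.Y ==> f (f' y) = y"
  and a: "a : carrier A"
 shows "EX c:carrier A. ALL s:S. f (pt s a) = pt s c"
proof -
 obtain s0 where s0: "s0 : S" using S_nonempty by blast
 obtain b where b: "b : carrier A" "ALL s:S. EX r:S. f (pt s a) = pt r b" using fibre_preserved[OF f(1) a] by blast
 then obtain r where r: "ALL s:S. r s : S & f (pt s a) = pt (r s) b" by metis
 obtain d where d: "d : carrier A" "ALL s:S. EX r:S. f' (pt s b) = pt r d" using fibre_preserved[OF f(2) b(1)] by blast
 have "EX t:S. f' (pt (r s0) b) = pt t d" using d(2) r s0 by blast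
 then obtain t where t: "t : S" "pt t d = pt s0 a" using inv(1)[OF pt_in[OF s0 a]] r s0 by metis
 \<comment> \<open>The inverse leads from sheet \<open>b\<close> back to a sheet \<open>d\<close>
   that meets the orbit of sheet \<open>a\<close>; a group element identifies \<open>d\<close> with
   \<open>a\<close>.\<close>
 obtain g where g: "g : carrier GG" "a = d \<otimes> P [^] ka g" using pi_eqE[OF t(2) s0 a] .
 have "ALL s:S. EX r:S. f' (pt s b) = pt r a"
  using d pi_act[OF g(1) _ d(1), folded g(2)] G_in[OF g(1)] by metis
 then obtain r' where r': "ALL s:S. r' s : S & f' (pt s b) = pt (r' s) a" by metis
 have "morphism SS SS r"
  by (rule lift_fst[OF fsS b(1) _ morphism_cong[OF fsS morphism_comp[OF slice_morphism(1)[OF a] f(1)]]]) (use r SS(2) in auto)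
 moreover have "morphism SS SS r'"
  by (rule lift_fst[OF fsS a _ morphism_cong[OF fsS morphism_comp[OF slice_morphism(1)[OF b(1)] f(2)]]]) (use r' SS(2) in auto)
 moreover have "r' (r s) = s" if s: "s : S" for s
  using inv(1)[OF pt_in[OF s a]] r r' s a by (metis pi_fst)
 moreover have "r (r' s) = s" if s: "s : S" for s
  using inv(2)[OF pt_in[OF s b(1)]] r r' s b(1) by (metis pi_fst)
 ultimately have k: "restrict r S : carrier GG" using AutI[OF fsS, of r r'] SS(2) by simp
 let ?k = "P [^] ka (restrict r S)"
 have kc: "?k : carrier A" using P by simp
 show ?thesis
 proof (rule bexI[of _ "b \<otimes> inv ?k"], intro ballI)
  fix s assume s: "s : S"
  have "pt (r s) b = pt s (b \<otimes> inv ?k)" using pi_act[OF k s, of "b \<otimes> inv ?k"] s b kc by (simp add: m_assoc)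
  thus "f (pt s a) = pt s (b \<otimes> inv ?k)" using r s by simp
 qed (use b kc in simp)
qed

theorem automorphism_is_translation:
 assumes "f : carrier (Aut Q.Y)"
 shows "EX b:carrier A. ALL s:S. ALL x:carrier A. f (pt s x) = pt s (x \<otimes> b)"
proof -
 obtain f' where f': "morphism Q.Y Q.Y f" "morphism Q.Y Q.Y f'" "ALL y:points Q.Y. f' (f y) = y" "ALL y:points Q.Y. f (f' y) = y"
  using Aut_inverse[OF assms] by (elim exE conjE) (rule that)
 note f = f'(1,2) f'(3,4)[rule_format]
 obtain s0 where s0: "s0 : S" using S_nonempty by blast
 obtain t where t: "!!x. x : carrier A ==> t x : carrier A" "!!x s. x : carrier A ==> s : S ==> f (pt s x) = pt s (t x)"
  using sheet_preserved[OF f] by metis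
 obtain t' where t': "!!x. x : carrier A ==> t' x : carrier A" "!!x s. x : carrier A ==> s : S ==> f' (pt s x) = pt s (t' x)"
  using sheet_preserved[OF f(2,1,4,3)] by metis
 have m: "morphism V V t"
  by (rule lift_snd[OF fsV s0 _ morphism_cong[OF fsV morphism_comp[OF slice_morphism(2)[OF s0] f(1)]]]) (use t s0 carrier_points in auto)
 have m': "morphism V V t'"
  by (rule lift_snd[OF fsV s0 _ morphism_cong[OF fsV morphism_comp[OF slice_morphism(2)[OF s0] f(2)]]]) (use t' s0 carrier_points in auto)
 have t't: "t' (t x) = x" if x: "x : carrier A" for x
  using f(3)[OF pt_in[OF s0 x]] t t' s0 x by (metis pi_snd)
 have tt': "t (t' x) = x" if x: "x : carrier A" for x
  using f(4)[OF pt_in[OF s0 x]] t t' s0 x by (metis pi_snd)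
 obtain g where g: "g : carrier GG" "P [^] ka g = P" using P_generator by blast
 \<comment> \<open>The generator \<open>g\<close> that shifts by \<open>P\<close> links the sheets
   of \<open>P\<close> and of the neutral element over \<open>g s0\<close> and
   \<open>s0\<close>.\<close>
 have "t P = t \<one> \<otimes> P"
 proof (rule pi_snd[OF _ G_in[OF g(1) s0]])
  have "pt (g s0) P = pt s0 \<one>" using pi_act[OF g(1) s0 one_closed] g(2) P by simp
  hence "pt (g s0) (t P) = pt s0 (t \<one>)" using t(2) G_in[OF g(1) s0] s0 P by (metis one_closed)
  thus "pt (g s0) (t P) = pt (g s0) (t \<one> \<otimes> P)" using pi_act[OF g(1) s0 t(1)[OF one_closed]] g(2) by simp
 qed (use t P in auto)
 \<comment> \<open>Normalised to preserve the neutral element, so that it is a homomorphism; it then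
   fixes \<open>P\<close>.\<close>
 let ?f = "%x. t x \<otimes> inv (t \<one>)" and ?g = "%x. t' (x \<otimes> t \<one>)"
 have f1: "morphism V V ?f" by (rule mult_morphism[OF fsV m const_morphism[OF fsV]]) (use t in simp)
 have "?f x = x" if x: "x : carrier A" for x
 proof (rule rigid[OF f1 _ _ _ _ _ x])
  show "morphism V V ?g" by (rule morphism_comp[OF mult_morphism[OF fsV morphism_id[OF fsV] const_morphism[OF fsV]] m']) (use t in simp)
  show "?f : hom A A" by (rule morphism_hom[OF av av f1]) (use t in simp)
  show "?f P = P" using \<open>t P = t \<one> \<otimes> P\<close> t(1)[OF one_closed] P by (simp add: m_comm[of "t \<one>"] m_assoc)
 qed (use t t' t't tt' in "simp_all add: m_assoc")
 hence tx: "t x = x \<otimes> t \<one>" if "x : carrier A" for x using that t(1) inv_solve_right[of x "t x" "t \<one>"] by simp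
 have "ALL s:S. ALL x:carrier A. f (pt s x) = pt s (x \<otimes> t \<one>)" using t(2) tx by metis
 thus ?thesis using t(1)[OF one_closed] by blast
qed

abbreviation (input) "tr a == %(s, x). (s, x \<otimes> a)"

text \<open>Translation is applied to an orbit as a set; it commutes with the group action since
  \<open>A\<close> is commutative, so the result is again an orbit.\<close>

definition \<Phi> where "\<Phi> a = (\<lambda>y\<in>points Q.Y. tr a ` y)"

lemma Phi_pt:
 assumes s: "s : S" and x: "x : carrier A" and a: "a : carrier A"
 shows "\<Phi> a (pt s x) = pt s (x \<otimes> a)"
proof -
 have "tr a (act g (s, x)) = act g (s, x \<otimes> a)" if "g : carrier GG" for g
  using x a P by (simp add: m_assoc m_comm[of a])
 hence "tr a ` pt s x = pt s (x \<otimes> a)"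
  unfolding pt_def orbit_def by (auto simp: image_iff) force+
 thus ?thesis using pt_in[OF s x] by (simp add: \<Phi>_def)
qed

lemma pt_eqI: "f : extensional (points Q.Y) ==> g : extensional (points Q.Y) ==>
  (!!s x. s : S ==> x : carrier A ==> f (pt s x) = g (pt s x)) ==> f = g"
 by (rule extensionalityI) (auto elim!: Y_pointE)

lemma Phi_Aut:
 assumes a: "a : carrier A"
 shows "\<Phi> a : carrier (Aut Q.Y)"
proof -
 have m: "morphism Q.Y Q.Y (\<Phi> a)" if a: "a : carrier A" for a
 proof (rule Q.universal)
  show "morphism X Q.Y (%z. pt (fst z) (snd z \<otimes> a))" unfolding pt_def
   by (rule morphism_comp[OF morphism_pair[OF Q.fsX fsS fsV morphism_fst[OF fsS fsV]
    mult_morphism[OF Q.fsX morphism_snd[OF fsS fsV] const_morphism[OF Q.fsX a]]] Q.pi_morphism])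
  show "\<Phi> a (Q.\<pi> x) = pt (fst x) (snd x \<otimes> a)" if "x : points X" for x
   using Phi_pt[OF _ _ a] that unfolding pt_def by (auto simp: points_X)
 qed
 have "restrict (\<Phi> a) (points Q.Y) : carrier (Aut Q.Y)"
  by (rule AutI[OF Q.fsY m[OF a] m[of "inv a"]]) (use a in "auto elim!: Y_pointE simp: Phi_pt m_assoc")
 thus ?thesis by (simp add: \<Phi>_def)
qed

lemma Phi_iso: "\<Phi> : iso A (Aut Q.Y)"
proof -
 note gY = group_Aut[OF Q.fsY]
 have "\<Phi> : hom A (Aut Q.Y)"
 proof (rule homI)
  fix a b assume ab: "a : carrier A" "b : carrier A"
  note c = Phi_Aut[OF ab(1)] Phi_Aut[OF ab(2)]
  show "\<Phi> (a \<otimes> b) = \<Phi> a \<otimes>\<^bsub>Aut Q.Y\<^esub> \<Phi> b"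
  proof (rule pt_eqI[OF Aut_ext Aut_ext])
   show "\<Phi> a \<otimes>\<^bsub>Aut Q.Y\<^esub> \<Phi> b : carrier (Aut Q.Y)" by (rule monoid.m_closed[OF group.is_monoid[OF gY] c])
   show "\<Phi> (a \<otimes> b) (pt s x) = (\<Phi> a \<otimes>\<^bsub>Aut Q.Y\<^esub> \<Phi> b) (pt s x)" if "s : S" "x : carrier A" for s x
    unfolding Aut_apply[OF c pt_in[OF that]] using that ab by (simp add: Phi_pt m_assoc m_comm[of b])
  qed (use Phi_Aut ab in simp)
 qed (rule Phi_Aut)
 moreover have "inj_on \<Phi> (carrier A)"
 proof (rule inj_onI)
  fix a b assume ab: "a : carrier A" "b : carrier A" "\<Phi> a = \<Phi> b"
  obtain s where s: "s : S" using S_nonempty by blast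
  have "pt s a = pt s b" using Phi_pt[OF s one_closed, of a] Phi_pt[OF s one_closed, of b] ab by simp
  thus "a = b" using pi_snd s ab by blast
 qed
 moreover have "f : \<Phi> ` carrier A" if f: "f : carrier (Aut Q.Y)" for f
 proof -
  obtain b where b: "b : carrier A" "ALL s:S. ALL x:carrier A. f (pt s x) = pt s (x \<otimes> b)"
   using automorphism_is_translation[OF f] by blast
  have "f = \<Phi> b" by (rule pt_eqI[OF Aut_ext[OF f] Aut_ext[OF Phi_Aut[OF b(1)]]]) (use b in "simp add: Phi_pt")
  thus ?thesis using b(1) by blast
 qed
 ultimately show ?thesis using Phi_Aut unfolding iso_def bij_betw_def by blast
qed

lemma Phi_morphism: "morphism (V \<times>\<^sub>v Q.Y) Q.Y (%(a, y). \<Phi> a y)"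
proof (rule Q.prod_universal[OF fsV _ Q.fsY])
 note fs3 = fspace_prod[OF fsV Q.fsX]
 note sx = morphism_snd[OF fsV Q.fsX]
 show "EX U \<O>. chart V U \<O> & z : U" if "z : points V" for z using coords proj_chart_at[OF _ that] by blast
 show "morphism (V \<times>\<^sub>v X) Q.Y (%w. pt (fst (snd w)) (snd (snd w) \<otimes> fst w))" unfolding pt_def
  by (rule morphism_comp[OF morphism_pair[OF fs3 fsS fsV morphism_comp[OF sx morphism_fst[OF fsS fsV]]
   mult_morphism[OF fs3 morphism_comp[OF sx morphism_snd[OF fsS fsV]] morphism_fst[OF fsV Q.fsX]]] Q.pi_morphism])
 show "(case (z, Q.\<pi> x) of (a, y) => \<Phi> a y) = pt (fst (snd (z, x))) (snd (snd (z, x)) \<otimes> fst (z, x))"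
  if "z : points V" "x : points X" for z x
  using that Phi_pt carrier_points by (auto simp: points_X pt_def[symmetric])
 show "EX U \<O> ep. chart X U \<O> & x : U & Q.invt U & ep : regular X U & ep x = 1 &
   (ALL g:carrier GG. g ~= \<one>\<^bsub>GG\<^esub> --> ep (act g x) = 0)" if x: "x : points X" for x
 proof -
  obtain s a where sa: "x = (s, a)" "s : S" "a : carrier A" using x by (auto simp: points_X)
  show ?thesis unfolding sa(1) using good_chart[OF sa(2,3)]
   by (elim exE conjE) (rule exI, rule exI, rule exI, intro conjI, assumption+, blast, blast)
 qed
qed

text \<open>The translation amount at \<open>t\<close> is read off from the image of the single
  point \<open>pt s \<one>\<close>, and \<open>lift_snd\<close> lifts this path in the quotient to
  \<open>A\<close>.\<close>

lemma Phi_family: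
 assumes T: "fspace T" and \<Psi>: "\<Psi> : carrier (Aut (T \<times>\<^sub>v Q.Y))" and fst: "!!t y. t : points T ==> y : points Q.Y ==> fst (\<Psi> (t, y)) = t"
 shows "morphism T V (%t. inv_into (carrier A) \<Phi> (\<lambda>y\<in>points Q.Y. snd (\<Psi> (t, y))))"
proof -
 let ?X = "T \<times>\<^sub>v Q.Y"
 obtain \<Psi>' where p: "morphism ?X ?X \<Psi>" "morphism ?X ?X \<Psi>'" "ALL x:points ?X. \<Psi>' (\<Psi> x) = x" "ALL x:points ?X. \<Psi> (\<Psi>' x) = x"
  using Aut_inverse[OF \<Psi>] by (elim exE conjE) (rule that)
 note ptX = points_prod[OF T Q.fsY] and sn = morphism_snd[OF T Q.fsY]
 have fst': "fst (\<Psi>' (t, y)) = t" if t: "t : points T" "y : points Q.Y" for t y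
 proof -
  have "\<Psi>' (t, y) : points ?X" by (rule morphism_in[OF p(2)]) (use t ptX in simp)
  hence "fst (\<Psi> (\<Psi>' (t, y))) = fst (\<Psi>' (t, y))" using fst[of "fst (\<Psi>' (t, y))" "snd (\<Psi>' (t, y))"] ptX by auto
  thus ?thesis using p(4)[rule_format, of "(t, y)"] t ptX by simp
 qed
 let ?f = "%t. \<lambda>y\<in>points Q.Y. snd (\<Psi> (t, y))"
 have slice: "morphism Q.Y Q.Y (%y. snd (\<Theta> (t, y)))" if "t : points T" "morphism ?X ?X \<Theta>" for t \<Theta>
  by (rule morphism_comp[OF morphism_comp[OF morphism_pair[OF Q.fsY T Q.fsY morphism_const[OF Q.fsY that(1)] morphism_id[OF Q.fsY]] that(2)] sn])
 have f: "?f t : carrier (Aut Q.Y)" if t: "t : points T" for t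
 proof -
  have "restrict (%y. snd (\<Psi> (t, y))) (points Q.Y) : carrier (Aut Q.Y)"
  proof (rule AutI[OF Q.fsY slice[OF t p(1)] slice[OF t p(2)]])
   fix y assume y: "y : points Q.Y"
   show "snd (\<Psi>' (t, snd (\<Psi> (t, y)))) = y" 
    using p(3)[rule_format, of "(t, y)"] fst[OF t y] t y ptX by (cases "\<Psi> (t, y)") simp
   show "snd (\<Psi> (t, snd (\<Psi>' (t, y)))) = y" 
    using p(4)[rule_format, of "(t, y)"] fst'[OF t y] t y ptX by (cases "\<Psi>' (t, y)") simp
  qed
  thus ?thesis .
 qed
 let ?a = "%t. inv_into (carrier A) \<Phi> (?f t)"
 have im: "?f t : \<Phi> ` carrier A" if "t : points T" for t using f[OF that] Phi_iso unfolding iso_def bij_betw_def by blast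
 have a: "?a t : carrier A" "\<Phi> (?a t) = ?f t" if "t : points T" for t
  using inv_into_into[OF im[OF that]] f_inv_into_f[OF im[OF that]] by auto
 obtain s where s: "s : S" using S_nonempty by blast
 note o = pt_in[OF s one_closed]
 show ?thesis
 proof (rule lift_snd[OF T s a(1)])
  show "morphism T Q.Y (%t. pt s (?a t))"
  proof (rule morphism_cong[OF T morphism_comp[OF morphism_comp[OF morphism_pair[OF T T Q.fsY morphism_id[OF T] morphism_const[OF T o]] p(1)] sn]])
   fix t assume t: "t : points T"
   have "pt s (?a t) = \<Phi> (?a t) (pt s \<one>)" using Phi_pt[OF s one_closed a(1)[OF t]] a(1)[OF t] by simp
   also have "... = snd (\<Psi> (t, pt s \<one>))" unfolding a(2)[OF t] using o by simp
   finally show "pt s (?a t) = snd (\<Psi> (t, pt s \<one>))" .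
  qed
 qed
qed

theorem Aut_quotient:
 shows "Aut_isomorphic_to Q.Y A"
 unfolding Aut_isomorphic_to_def
proof (intro bexI[OF _ Phi_iso] conjI allI impI Phi_morphism)
 fix n Z T \<Psi>
 assume Z: "cls (affine_space n) Z" and T: "T = subspace_of (affine_space n) Z"
  and \<Psi>: "\<Psi> : carrier (Aut (T \<times>\<^sub>v Q.Y))" and fst: "ALL t:Z. ALL y:points Q.Y. fst (\<Psi> (t, y)) = t"
 have "gen_family {({v. ALL i>=n. v i = 0}, ev F) | F. True}"
  unfolding gen_family_def
 proof (intro allI impI conjI; clarify)
  fix F G c
  show "EX H. ({v. ALL i>=n. v i = 0}, %_. c) = ({v. ALL i>=n. v i = (0::complex)}, ev H) & True"
   by (rule exI[of _ "const_poly c"]) auto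
  show "EX H. ({v. ALL i>=n. v i = 0} Int {v. ALL i>=n. v i = 0}, %x. ev F x + ev G x) = ({v. ALL i>=n. v i = (0::complex)}, ev H) & True"
   by (rule exI[of _ "F + G"]) auto
  show "EX H. ({v. ALL i>=n. v i = 0} Int {v. ALL i>=n. v i = 0}, %x. ev F x * ev G x) = ({v. ALL i>=n. v i = (0::complex)}, ev H) & True"
   by (rule exI[of _ "F * G"]) auto
 qed
 hence "fspace (affine_space n)" unfolding affine_space_def by (rule fspace_generated)
 hence fT: "fspace T" unfolding T by (rule fspace_subspace)
 have "points T <= Z" unfolding T by auto
 thus "morphism T V (%t. inv_into (carrier A) \<Phi> (\<lambda>y\<in>points Q.Y. snd (\<Psi> (t, y))))"
  using Phi_family[OF fT \<Psi>] fst by blast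
qed

end

text \<open>With no factors all generators are constants given by natural numbers, so locally only
  rational constants are regular; the constant \<open>\<i>\<close> on \<open>Y\<close> has no
  regular pullback.\<close>

lemma empty_product_morphism:
 fixes X :: "'a => 'b fspace"
 assumes Y: "fspace Y" and f: "morphism (Prod_fspace {} X) Y f"
 shows False
proof -
 define \<F> :: "(('a => 'b) set \<times> (('a => 'b) => complex)) set" where
  "\<F> = {(Pi\<^sub>E {} U, %x. SUM k<m. PROD i:{}. g k i (x i)) | U m g.
    ALL i:{}. opn (X i) (U i) & (ALL k<(m::nat). g k i : regular (X i) (U i))}"
 have P: "Prod_fspace {} X = generated_fspace \<F>" unfolding Prod_fspace_def \<F>_def ..
 let ?x = "(%_. undefined) :: 'a => 'b"
 have mem: "(Pi\<^sub>E {} U, %x. SUM k<m. PROD i:{}. g k i (x i)) : \<F>" for U :: "'a => 'b set" and m :: nat and g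
  unfolding \<F>_def by (rule CollectI, rule exI, rule exI, rule exI, rule conjI[OF refl]) simp
 have val: "EX k::nat. h = (%_. of_nat k)" if "(W, h) : \<F>" for W h
  using that unfolding \<F>_def by auto
 have "{x : {?x}. (1::complex) ~= 0} : {{x:W. h x ~= 0} | W h. (W, h) : \<F>}"
  using mem[of _ _ "Suc 0"] by (intro CollectI exI[of _ "{?x}"] exI[of _ "%_. 1"]) simp
 hence x: "?x : points (generated_fspace \<F>)"
  unfolding generated_fspace_def by (simp only: topology_generated_by_topspace fspace.select_convs) (rule UnionI, assumption, simp)
 have "(%_. \<i>) \<circ> f : regular (generated_fspace \<F>) {x : points (generated_fspace \<F>). f x : points Y}"
  using f fs_const[OF Y points_open] unfolding P morphism_def by blast
 moreover have "?x : {x : points (generated_fspace \<F>). f x : points Y}" using x morphism_in[OF f[unfolded P] x] by simp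
 ultimately obtain W a b where ab: "(W, a) : \<F>" "(W, b) : \<F>" "?x : W" "b ?x ~= 0"
  "ALL y:{x : points (generated_fspace \<F>). f x : points Y} Int W. b y ~= 0 --> ((%_. \<i>) \<circ> f) y = a y / b y"
  unfolding regular_generated by blast
 have "\<i> = a ?x / b ?x" using ab(3,4,5) x morphism_in[OF f[unfolded P] x] by simp
 moreover obtain m n :: nat where "a = (%_. of_nat m)" "b = (%_. of_nat n)" using val[OF ab(1)] val[OF ab(2)] by blast
 ultimately have "Im \<i> = Im (of_nat m / of_nat n)" by simp
 thus False by (simp add: Im_divide)
qed

theorem theorem3p9:
  fixes A :: "'a group_variety"
    and h N p :: nat
    and Ai :: "nat \<Rightarrow> 'a set"
    and \<sigma> :: "(nat \<Rightarrow> 'a) \<Rightarrow> 'a"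
    and S :: "(nat \<Rightarrow> complex) set set"
    and G :: "((nat \<Rightarrow> complex) set \<Rightarrow> (nat \<Rightarrow> complex) set) monoid"
    and chi :: "((nat \<Rightarrow> complex) set \<Rightarrow> (nat \<Rightarrow> complex) set) \<Rightarrow> int"
    and P :: 'a
    and Y :: "((nat \<Rightarrow> complex) set \<times> 'a) set fspace"
  assumes "abelian_variety A"
    and "finite (Aut0 A)"
    and "\<forall>i\<in>{1..h}. abelian_subvariety (Ai i) A \<and> simple_abelian_variety (sub_gv A (Ai i))"
    and "\<sigma> = (\<lambda>a. finprod A a {1..h})"
    and "isogeny (product_gv {1..h} (\<lambda>i. sub_gv A (Ai i))) A \<sigma>"
    and "N = card (kernel (product_gv {1..h} (\<lambda>i. sub_gv A (Ai i))) A \<sigma>)"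
    and "prime p" and "p \<ge> 7"
    and "\<forall>i\<in>{1..h}. \<forall>H. subgroup H (sub_gv A (Ai i)) \<longrightarrow> H \<subseteq> torsion_points A N \<longrightarrow>
           (\<forall>\<phi> \<in> Aut0 (quotient_gv (sub_gv A (Ai i)) H).
              \<phi> \<noteq> restrict id (carrier (quotient_gv (sub_gv A (Ai i)) H)) \<longrightarrow>
              finite {x \<in> carrier (quotient_gv (sub_gv A (Ai i)) H). \<phi> x = x} \<and>
              card {x \<in> carrier (quotient_gv (sub_gv A (Ai i)) H). \<phi> x = x} < p)"
    and "smooth_hypersurface 3 p S"
    and "G = Aut (subspace_of (projective_space 3) S)"
    and "chi \<in> iso G (integer_mod_group p)"
    and "\<forall>g\<in>carrier G. g \<noteq> \<one>\<^bsub>G\<^esub> \<longrightarrow> (\<forall>s\<in>S. g s \<noteq> s)"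
    and "P \<in> torsion_points A p"
    and "\<forall>B. abelian_subvariety B A \<longrightarrow> B \<noteq> carrier A \<longrightarrow> P \<notin> B"
    and "Y = quotient_fspace (subspace_of (projective_space 3) S \<times>\<^sub>v variety A)
               (orbits G (S \<times> carrier A) (\<lambda>g (s, a). (g s, a \<otimes>\<^bsub>A\<^esub> (P [^]\<^bsub>A\<^esub> chi g))))"
  shows "Aut_isomorphic_to Y A"
proof -
 note A = assms(1) and fin = assms(2) and Ai = assms(3)[rule_format] and iso = assms(5)[unfolded assms(4)]
  and p = assms(7,8) and G = assms(11) and free = assms(13)[rule_format] and P = assms(14) and Pgen = assms(15)[rule_format] and Y = assms(16)
 interpret abvar A by (rule abvarI[OF A])
 \<comment> \<open>A positive number of simple factors makes \<open>A\<close> nontrivial, which is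
   what keeps \<open>P\<close> from being neutral.\<close>
 have "h > 0"
 proof (rule ccontr)
  assume "~ h > 0"
  hence "morphism (Prod_fspace {} (%i. variety (sub_gv A (Ai i)))) V (%a. finprod A a {1..h})"
   using iso unfolding isogeny_def product_gv_def by (simp add: monoid.defs)
  thus False by (rule empty_product_morphism[OF fsV])
 qed
 obtain F where F: "form 3 p F" "S = {proj_point v | v. v : homog_coords 3 & ev F v = 0}"
   "ALL v:homog_coords 3. ev F v = 0 --> (EX i<=3. eval_partial i F v ~= 0)"
  using assms(10) unfolding smooth_hypersurface_def by blast
 interpret s: surface F p
  by unfold_locales (use F p in "auto simp: eval_pd")
 have S: "S = s.S" unfolding F(2) s.S_def s.cone_def by blast
 have G': "G = Aut s.SS" unfolding G s.SS_def S ..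
 have P': "P : carrier A" "P [^]\<^bsub>A\<^esub> p = \<one>\<^bsub>A\<^esub>" using P by (auto simp: torsion_points_def)
 \<comment> \<open>Otherwise \<open>P\<close> would lie in the trivial subvariety, which by
   genericity would be all of \<open>A\<close>, although \<open>A\<close> contains a simple abelian
   variety.\<close>
 have "P ~= \<one>\<^bsub>A\<^esub>"
 proof
  assume "P = \<one>\<^bsub>A\<^esub>"
  hence "carrier A = {\<one>\<^bsub>A\<^esub>}" using Pgen[OF trivial_subvariety] by blast
  moreover have "simple_abelian_variety (sub_gv A (Ai 1))" "Ai 1 <= carrier A" "\<one>\<^bsub>A\<^esub> : Ai 1"
   using Ai[of 1] \<open>h > 0\<close> by (auto simp: abelian_subvariety_def dest: subgroup.subset subgroup.one_closed)
  ultimately show False unfolding simple_abelian_variety_def by auto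
 qed
 interpret t: twist F p A chi P
 proof unfold_locales
  show "f x = x" if "morphism V V f" "morphism V V g" "f : hom A A" "!!x. x : carrier A ==> g (f x) = x"
   "!!x. x : carrier A ==> f (g x) = x" "f P = P" "x : carrier A" for f g x
   by (rule fixes_generic_torsion[OF fin p P Pgen that])
  show "g s ~= s" if "g : carrier (Aut s.SS)" "g ~= \<one>\<^bsub>Aut s.SS\<^esub>" "s : s.S" for g s
   using free[of g s] that unfolding G' S by blast
 qed (use p assms(12) P' \<open>P ~= \<one>\<^bsub>A\<^esub>\<close> in "simp_all add: G'")
 show ?thesis
  using t.Aut_quotient[unfolded t.points_X] unfolding Y G' S s.SS_def .
qed

end
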